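(* Let $u_0\in L^3(\mathbb{R}^3)$ be a divergence-free vector field and let $\theta_0\in L^1(\mathbb{R}^3)$. Then there exist $T>0$ and a unique mild solution $(u,\theta)\in X\times Y$ of the Boussinesq system with data $(u_0,\theta_0)$, where $X$ and $Y$ are the function spaces on $[0,T]$ defined in the context.
   Context: The unknowns are a velocity field $u$ with values in $\mathbb{R}^3$ and a scalar temperature $\theta$, functions of $x\in\mathbb{R}^3$ and time $t$. Let $e_3=(0,0,1)$ and let $\mathbb{P}$ denote the Leray projector onto divergence-free vector fields on $\mathbb{R}^3$; $e^{t\Delta}$ is the heat semigroup; $\|\cdot\|_p$ is the $L^p(\mathbb{R}^3)$-norm. A mild solution of the Boussinesq system with data $(u_0,\theta_0)$ is a pair $(u,\theta)$ satisfying the integral system $$\theta(t)=e^{t\Delta}\theta_0-\int_0^t e^{(t-s)\Delta}\nabla\cdot(\theta u)(s)\,ds,$$ $$u(t)=e^{t\Delta}u_0-\int_0^t e^{(t-s)\Delta}\mathbb{P}\nabla\cdot(u\otimes u)(s)\,ds+\int_0^t e^{(t-s)\Delta}\mathbb{P}\,\theta(s)e_3\,ds,\qquad \nabla\cdot u_0=0.$$ $X$ is the space of all divergence-free vector fields $u\in C([0,T],L^3(\mathbb{R}^3))$ such that $$\|u\|_X=\sup_{t\in[0,T]}\|u(t)\|_3+\sup_{0<t\le T}\sqrt t\,\|u(t)\|_\infty<\infty\quad\text{and}\quad\lim_{t\to0}\sqrt t\,\|u(t)\|_\infty=0.$$ $Y$ is the space of all functions $\theta\in C([0,T],L^1(\mathbb{R}^3))$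 such that $$\|\theta\|_Y=\sup_{t\in[0,T]}\|\theta(t)\|_1+\sup_{0<t\le T}t^{3/2}\|\theta(t)\|_\infty<\infty\quad\text{and}\quad\lim_{t\to0}t^{3/2}\|\theta(t)\|_\infty=0.$$ *)

theory Defs
  imports "HOL-Probability.Probability"
begin

text \<open>
  Elements of \<open>L\<^sup>p(\<real>\<^sup>3)\<close> are represented by Borel functions, identified up to Lebesgue-null sets;
  vector fields are functions \<^typ>\<open>real^3 \<Rightarrow> real^3\<close>. Time-dependent fields are
  functions of \<open>t\<close> whose values are such representatives.
\<close>

definition Lp_norm :: "real \<Rightarrow> (real^3 \<Rightarrow> 'b::euclidean_space) \<Rightarrow> ennreal" where
  "Lp_norm p f =
     (let I = (\<integral>\<^sup>+ x. ennreal (norm (f x) powr p) \<partial>lborel)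
      in if I = \<infinity> then \<infinity> else ennreal (enn2real I powr (1 / p)))"

definition Linf_norm :: "(real^3 \<Rightarrow> 'b::euclidean_space) \<Rightarrow> ennreal" where
  "Linf_norm f = esssup lborel (\<lambda>x. ennreal (norm (f x)))"

definition Lp_space :: "real \<Rightarrow> (real^3 \<Rightarrow> 'b::euclidean_space) set" where
  "Lp_space p = {f \<in> borel_measurable lborel. Lp_norm p f < \<infinity>}"

definition C_Lp :: "real \<Rightarrow> real \<Rightarrow> (real \<Rightarrow> real^3 \<Rightarrow> 'b::euclidean_space) set" where
  "C_Lp p T = {f. (\<forall>t\<in>{0..T}. f t \<in> Lp_space p) \<and>
     (\<forall>t\<in>{0..T}. ((\<lambda>s. Lp_norm p (\<lambda>x. f s x - f t x)) \<longlongrightarrow> 0) (at t within {0..T}))}"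

definition partial_deriv :: "3 \<Rightarrow> (real^3 \<Rightarrow> real) \<Rightarrow> real^3 \<Rightarrow> real" where
  "partial_deriv k f x = frechet_derivative f (at x) (axis k 1)"

definition grad :: "(real^3 \<Rightarrow> real) \<Rightarrow> real^3 \<Rightarrow> real^3" where
  "grad f x = (\<chi> k. partial_deriv k f x)"

primrec Ck :: "nat \<Rightarrow> (real^3 \<Rightarrow> real) \<Rightarrow> bool" where
  "Ck 0 f \<longleftrightarrow> continuous_on UNIV f"
| "Ck (Suc n) f \<longleftrightarrow> (\<forall>x. f differentiable at x) \<and> (\<forall>k. Ck n (partial_deriv k f))"

definition test_function :: "(real^3 \<Rightarrow> real) \<Rightarrow> bool" where
  "test_function \<phi> \<longleftrightarrow> (\<forall>n. Ck n \<phi>) \<and> compact (closure {x. \<phi> x \<noteq> 0})"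

text \<open>
  Divergence-free in the sense of distributions. This is only used for members of some
  \<open>L\<^sup>p\<close>, \<open>p \<ge> 1\<close>, for which the integrals below converge.
\<close>

definition div_free :: "(real^3 \<Rightarrow> real^3) \<Rightarrow> bool" where
  "div_free u \<longleftrightarrow> (\<forall>\<phi>. test_function \<phi> \<longrightarrow> (\<integral>x. u x \<bullet> grad \<phi> x \<partial>lborel) = 0)"

text \<open>
  The Leray projector as the orthogonal projector of \<open>L\<^sup>2(\<real>\<^sup>3)\<^sup>3\<close> onto its closed subspace of
  divergence-free fields. It determines its value up to null sets, and the choice of the
  representative is immaterial since \<open>leray f\<close> occurs below only under integrals over space.
  The domain \<open>L\<^sup>2\<close> suffices: for \<open>(u, \<theta>) \<in> X \<times> Y\<close> and \<open>0 < s \<le> T\<close> both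
  \<open>u(s) \<otimes> u(s) \<in> L\<^sup>3\<^sup>/\<^sup>2 \<inter> L\<^sup>\<infinity>\<close> and \<open>\<theta>(s) \<in> L\<^sup>1 \<inter> L\<^sup>\<infinity>\<close> lie in \<open>L\<^sup>2\<close>.
\<close>

definition is_leray_projection :: "(real^3 \<Rightarrow> real^3) \<Rightarrow> (real^3 \<Rightarrow> real^3) \<Rightarrow> bool" where
  "is_leray_projection f g \<longleftrightarrow> g \<in> Lp_space 2 \<and> div_free g \<and>
     (\<forall>h\<in>Lp_space 2. div_free h \<longrightarrow> (\<integral>x. (f x - g x) \<bullet> h x \<partial>lborel) = 0)"

definition leray :: "(real^3 \<Rightarrow> real^3) \<Rightarrow> real^3 \<Rightarrow> real^3" where
  "leray f = (SOME g. is_leray_projection f g)"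

definition heat_kernel :: "real \<Rightarrow> real^3 \<Rightarrow> real" where
  "heat_kernel t x = (4 * pi * t) powr (- 3 / 2) * exp (- (norm x)\<^sup>2 / (4 * t))"

definition heat :: "real \<Rightarrow> (real^3 \<Rightarrow> 'b::euclidean_space) \<Rightarrow> real^3 \<Rightarrow> 'b" where
  "heat t f x = (if t = 0 then f x else (\<integral>y. heat_kernel t (x - y) *\<^sub>R f y \<partial>lborel))"

text \<open>
  \<open>e\<^sup>t\<^sup>\<Delta> \<nabla>\<cdot>F\<close> for \<open>t > 0\<close>: the heat kernel \<open>G\<^sub>t\<close> convolved with the distribution \<open>\<nabla>\<cdot>F\<close>, i.e.
  \<open>\<Sum>\<^sub>k (\<partial>\<^sub>k G\<^sub>t) * F\<^sub>k\<close>.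
\<close>

definition heat_div :: "real \<Rightarrow> (real^3 \<Rightarrow> real^3) \<Rightarrow> real^3 \<Rightarrow> real" where
  "heat_div t F x = (\<integral>y. grad (heat_kernel t) (x - y) \<bullet> F y \<partial>lborel)"

definition tensor :: "real^3 \<Rightarrow> real^3 \<Rightarrow> real^3^3" where
  "tensor a b = (\<chi> k j. a $ k * b $ j)"

text \<open>
  \<open>e\<^sup>t\<^sup>\<Delta> P \<nabla>\<cdot>F\<close> for \<open>t > 0\<close>, where \<open>(\<nabla>\<cdot>F)\<^sub>j = \<Sum>\<^sub>k \<partial>\<^sub>k F\<^sub>k\<^sub>j\<close>. As a translation-invariant operator \<open>P\<close>
  extends to distributional derivatives of \<open>L\<^sup>2\<close> fields by \<open>P \<partial>\<^sub>k f = \<partial>\<^sub>k P f\<close>, so that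
  \<open>P \<nabla>\<cdot>F = \<Sum>\<^sub>k \<partial>\<^sub>k P F\<^sub>k\<close> with \<open>F\<^sub>k\<close> the \<open>k\<close>-th row of \<open>F\<close>.
\<close>

definition heat_leray_div :: "real \<Rightarrow> (real^3 \<Rightarrow> real^3^3) \<Rightarrow> real^3 \<Rightarrow> real^3" where
  "heat_leray_div t F x =
     (\<Sum>k\<in>UNIV. \<integral>y. partial_deriv k (heat_kernel t) (x - y) *\<^sub>R leray (\<lambda>z. F z $ k) y \<partial>lborel)"

definition e3 :: "real^3" where
  "e3 = axis 3 1"

text \<open>
  The integrals over \<open>(0, t)\<close> are taken at (almost) every point \<open>x\<close> and are required to converge
  absolutely; the identities hold for every \<open>t \<in> [0, T]\<close> as identities of classes of functions
  of \<open>x\<close>.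
\<close>

definition mild_solution ::
  "real \<Rightarrow> (real^3 \<Rightarrow> real^3) \<Rightarrow> (real^3 \<Rightarrow> real) \<Rightarrow>
   (real \<Rightarrow> real^3 \<Rightarrow> real^3) \<Rightarrow> (real \<Rightarrow> real^3 \<Rightarrow> real) \<Rightarrow> bool" where
  "mild_solution T u0 \<theta>0 u \<theta> \<longleftrightarrow> div_free u0 \<and>
     (\<forall>t\<in>{0..T}. AE x in lborel.
        set_integrable lborel {0<..<t} (\<lambda>s. heat_div (t - s) (\<lambda>y. \<theta> s y *\<^sub>R u s y) x) \<and>
        \<theta> t x = heat t \<theta>0 x
          - (LBINT s:{0<..<t}. heat_div (t - s) (\<lambda>y. \<theta> s y *\<^sub>R u s y) x)) \<and>
     (\<forall>t\<in>{0..T}. AE x in lborel.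
        set_integrable lborel {0<..<t} (\<lambda>s. heat_leray_div (t - s) (\<lambda>y. tensor (u s y) (u s y)) x) \<and>
        set_integrable lborel {0<..<t} (\<lambda>s. heat (t - s) (leray (\<lambda>y. \<theta> s y *\<^sub>R e3)) x) \<and>
        u t x = heat t u0 x
          - (LBINT s:{0<..<t}. heat_leray_div (t - s) (\<lambda>y. tensor (u s y) (u s y)) x)
          + (LBINT s:{0<..<t}. heat (t - s) (leray (\<lambda>y. \<theta> s y *\<^sub>R e3)) x))"

definition X_norm :: "real \<Rightarrow> (real \<Rightarrow> real^3 \<Rightarrow> real^3) \<Rightarrow> ennreal" where
  "X_norm T u = (SUP t\<in>{0..T}. Lp_norm 3 (u t))
     + (SUP t\<in>{0<..T}. ennreal (sqrt t) * Linf_norm (u t))"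

definition X_space :: "real \<Rightarrow> (real \<Rightarrow> real^3 \<Rightarrow> real^3) set" where
  "X_space T = {u \<in> C_Lp 3 T. (\<forall>t\<in>{0..T}. div_free (u t)) \<and> X_norm T u < \<infinity> \<and>
     ((\<lambda>t. ennreal (sqrt t) * Linf_norm (u t)) \<longlongrightarrow> 0) (at_right 0)}"

definition Y_norm :: "real \<Rightarrow> (real \<Rightarrow> real^3 \<Rightarrow> real) \<Rightarrow> ennreal" where
  "Y_norm T \<theta> = (SUP t\<in>{0..T}. Lp_norm 1 (\<theta> t))
     + (SUP t\<in>{0<..T}. ennreal (t powr (3 / 2)) * Linf_norm (\<theta> t))"

definition Y_space :: "real \<Rightarrow> (real \<Rightarrow> real^3 \<Rightarrow> real) set" where
  "Y_space T = {\<theta> \<in> C_Lp 1 T. Y_norm T \<theta> < \<infinity> \<and>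
     ((\<lambda>t. ennreal (t powr (3 / 2)) * Linf_norm (\<theta> t)) \<longlongrightarrow> 0) (at_right 0)}"

end

theory Submission
  imports Defs
begin

text \<open>
  The solution is the fixed point of the Duhamel map in the scale-invariant norms
  \<open>sup t\<^sup>1\<^sup>/\<^sup>8 \<parallel>u(t)\<parallel>\<^sub>4\<close> and \<open>sup t\<^sup>3\<^sup>/\<^sup>4 \<parallel>\<theta>(t)\<parallel>\<^sub>2\<close>. For these exponents \<open>u \<otimes> u\<close> and \<open>\<theta> e\<^sub>3\<close> lie in
  \<open>L\<^sup>2\<close>, where the Leray projector is a contraction, so only \<open>L\<^sup>p\<close>-\<open>L\<^sup>q\<close> bounds of the scalar heat
  kernel are needed. The linear evolution is small in these norms for short times by density, hence
  the Picard iterates starting from \<open>0\<close> stay small and converge geometrically. The remaining bounds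
  (\<open>L\<^sup>\<infinity>\<close> with weights, \<open>L\<^sup>1\<close> for \<open>\<theta>\<close>) are uniform along the iteration and proportional to the
  smallness of the linear part, which may be taken arbitrarily small as \<open>t \<rightarrow> 0\<close>; this
  gives the limits at \<open>0\<close> and continuity there. Interpolation puts any solution in \<open>X \<times> Y\<close> into the
  same framework; two solutions agree for short times by contraction, and their agreement
  extends past any \<open>r > 0\<close> since the kernels of the Duhamel integrals over \<open>(r, t)\<close> are small.
\<close>

text \<open>The cost of controlling the Leray projector in L^2 alone shows at the endpoint. A
  derivative of the heat kernel maps L^2 to L^4 with (t - s)^(-7/8), which is integrable, but L^2 to
  L^\<infinity> with (t - s)^(-5/4), which is not; therefore a spatial Lipschitz bound of u in L^4
  is carried through the iteration. A second obstacle is buoyancy: it is linear in \<theta>, with a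
  constant of size 1024 that no short time reduces, so smallness of the data part alone gives no
  contraction. Velocity differences are therefore allowed to be 30000 times larger than temperature
  differences. The Picard iterates depend neither on the smallness parameter nor on the time
  interval. One and the same limit thus satisfies the a priori bounds for every parameter \<beta> on
  a corresponding interval (0, \<tau>], and letting \<beta> tend to 0 gives the behaviour at time
  zero. All time singularities that are finally integrated have exponents at most 7/8, so a single
  number, 32, bounds every beta integral; the large constants are products of such numbers.\<close>

text \<open>A relation with an explicit real constant replaces the norm: no infinite value has to be
  excluded, no root is taken, and measurability travels along with the bound.\<close>

definition Lp_bound :: "real \<Rightarrow> ('a::euclidean_space \<Rightarrow> 'b::euclidean_space) \<Rightarrow> real \<Rightarrow> bool" where
  "Lp_bound p f K \<longleftrightarrow> f \<in> borel_measurable borel \<and> 0 \<le> K \<and>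
     (\<integral>\<^sup>+x. ennreal (norm (f x) powr p) \<partial>lborel) \<le> ennreal (K powr p)"

lemma Lp_boundD:
  assumes "Lp_bound p f K"
  shows "f \<in> borel_measurable borel" "0 \<le> K"
    "(\<integral>\<^sup>+x. ennreal (norm (f x) powr p) \<partial>lborel) \<le> ennreal (K powr p)"
  using assms by (auto simp: Lp_bound_def)

lemma Lp_bound_mono:
  assumes "Lp_bound p f K" "K \<le> L" "0 \<le> p"
  shows "Lp_bound p f L"
proof -
  have "K powr p \<le> L powr p"
    using assms by (intro powr_mono2) (auto simp: Lp_bound_def)
  then show ?thesis
    using assms by (auto simp: Lp_bound_def intro: order_trans[OF _ ennreal_leI])
qed

lemma Lp_bound_scaled_AE:
  assumes g: "Lp_bound p g N" and h: "h \<in> borel_measurable borel" and c: "0 \<le> c"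
    and le: "AE x in lborel. norm (h x) \<le> c * norm (g x)" and p: "0 \<le> p"
  shows "Lp_bound p h (c * N)"
proof -
  have [measurable]: "g \<in> borel_measurable borel"
    using g by (auto dest: Lp_boundD)
  have "(\<integral>\<^sup>+x. ennreal (norm (h x) powr p) \<partial>lborel)
      \<le> (\<integral>\<^sup>+x. ennreal (c powr p) * ennreal (norm (g x) powr p) \<partial>lborel)"
    using le
    by (intro nn_integral_mono_AE)
      (auto simp flip: ennreal_mult powr_mult intro!: ennreal_leI powr_mono2 p elim!: eventually_mono)
  also have "\<dots> = ennreal (c powr p) * (\<integral>\<^sup>+x. ennreal (norm (g x) powr p) \<partial>lborel)"
    by (intro nn_integral_cmult) auto
  also have "\<dots> \<le> ennreal (c powr p) * ennreal (N powr p)"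
    using g by (intro mult_left_mono) (auto dest: Lp_boundD)
  also have "\<dots> = ennreal ((c * N) powr p)"
    using c g by (auto simp flip: ennreal_mult simp: powr_mult dest: Lp_boundD)
  finally show ?thesis
    using h c g by (auto simp: Lp_bound_def)
qed

lemma Lp_bound_mono_AE:
  assumes "Lp_bound p g N" "h \<in> borel_measurable borel"
    and "AE x in lborel. norm (h x) \<le> norm (g x)" "0 \<le> p"
  shows "Lp_bound p h N"
  using Lp_bound_scaled_AE[of p g N h 1] assms by simp

lemma Lp_bound_cong_AE:
  assumes "Lp_bound p g N" "h \<in> borel_measurable borel"
    and "AE x in lborel. h x = g x" "0 \<le> p"
  shows "Lp_bound p h N"
  using assms(3) by (intro Lp_bound_mono_AE[OF assms(1,2) _ assms(4)]) (auto elim: eventually_mono)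

lemma Lp_bound_zero: "0 \<le> K \<Longrightarrow> Lp_bound p (\<lambda>x. 0) K"
  by (auto simp: Lp_bound_def)

lemma Lp_bound_0_AE:
  assumes "Lp_bound p f 0"
  shows "AE x in lborel. f x = 0"
proof -
  have [measurable]: "f \<in> borel_measurable borel"
    using assms by (auto dest: Lp_boundD)
  have "(\<integral>\<^sup>+x. ennreal (norm (f x) powr p) \<partial>lborel) = 0"
    using assms by (auto dest: Lp_boundD)
  then have "AE x in lborel. ennreal (norm (f x) powr p) = 0"
    by (subst (asm) nn_integral_0_iff_AE) auto
  then show ?thesis
    by eventually_elim (auto simp: powr_def split: if_splits)
qed

lemma Lp_bound_scaleR:
  assumes "Lp_bound p f K" "0 \<le> p"
  shows "Lp_bound p (\<lambda>x. c *\<^sub>R f x) (\<bar>c\<bar> * K)"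
  using Lp_boundD[OF assms(1)] by (intro Lp_bound_scaled_AE[OF assms(1)]) (auto simp: assms)

section \<open>Hoelder's inequality and interpolation with the sup norm\<close>

text \<open>Young's inequality for \<open>f x / A\<close> and \<open>g x / B\<close>, integrated;
  the constants recombine to \<open>A * B * (1 / p + 1 / q)\<close>. A zero bound cannot be divided
  by, but it makes the product vanish almost everywhere.\<close>

lemma nn_integral_Holder:
  fixes f g :: "'a \<Rightarrow> real"
  assumes [measurable]: "f \<in> borel_measurable M" "g \<in> borel_measurable M"
    and nonneg: "\<And>x. 0 \<le> f x" "\<And>x. 0 \<le> g x" "0 \<le> A" "0 \<le> B"
    and pq: "p > 1" "q > 1" "1 / p + 1 / q = 1"
    and A: "(\<integral>\<^sup>+x. ennreal (f x powr p) \<partial>M) \<le> ennreal (A powr p)"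
    and B: "(\<integral>\<^sup>+x. ennreal (g x powr q) \<partial>M) \<le> ennreal (B powr q)"
  shows "(\<integral>\<^sup>+x. ennreal (f x * g x) \<partial>M) \<le> ennreal (A * B)"
proof -
  have zero: "(\<integral>\<^sup>+x. ennreal (f x * g x) \<partial>M) = 0"
    if "(\<integral>\<^sup>+x. ennreal (h x powr r) \<partial>M) \<le> 0" "\<And>x. h x = 0 \<Longrightarrow> f x * g x = 0"
      and [measurable]: "h \<in> borel_measurable M" for h r
  proof -
    have "AE x in M. ennreal (h x powr r) = 0"
      using that by (subst (asm) le_zero_eq, subst (asm) nn_integral_0_iff_AE) auto
    then have "AE x in M. f x * g x = 0"
      by eventually_elim (rule that(2), auto simp: powr_def split: if_splits)
    then show ?thesis
      by (subst nn_integral_0_iff_AE) (auto elim: eventually_mono)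
  qed
  consider "A = 0" | "B = 0" | "A > 0" "B > 0"
    using nonneg by linarith
  then show ?thesis
  proof cases
    case 1
    then show ?thesis using zero[of f p] A pq by auto
  next
    case 2
    then show ?thesis using zero[of g q] B pq by auto
  next
    case 3
    define C where "C = A * B / p / A powr p"
    define D where "D = A * B / q / B powr q"
    have C: "0 \<le> C" and D: "0 \<le> D"
      using 3 pq by (auto simp: C_def D_def)
    have ptw: "f x * g x \<le> C * f x powr p + D * g x powr q" for x
    proof -
      have "(f x / A) * (g x / B) \<le> (f x / A) powr p / p + (g x / B) powr q / q"
        using 3 nonneg pq by (intro Youngs_inequality) auto
      then have "A * B * ((f x / A) * (g x / B)) \<le> A * B * ((f x / A) powr p / p + (g x / B) powr q / q)"
        using 3 by (intro mult_left_mono) auto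
      then show ?thesis
        using 3 nonneg by (simp add: C_def D_def powr_divide algebra_simps)
    qed
    have "(\<integral>\<^sup>+x. ennreal (f x * g x) \<partial>M)
       \<le> (\<integral>\<^sup>+x. ennreal (C) * ennreal (f x powr p)
              + ennreal (D) * ennreal (g x powr q) \<partial>M)"
    proof (rule nn_integral_mono)
      fix x
      have "ennreal (f x * g x) \<le> ennreal (C * f x powr p + D * g x powr q)"
        by (rule ennreal_leI[OF ptw])
      also have "\<dots> = ennreal (C) * ennreal (f x powr p)
              + ennreal (D) * ennreal (g x powr q)"
        by (simp add: C D ennreal_mult)
      finally show "ennreal (f x * g x) \<le> ennreal (C) * ennreal (f x powr p)
              + ennreal (D) * ennreal (g x powr q)" .
    qed
    also have "\<dots> = ennreal (C) * (\<integral>\<^sup>+x. ennreal (f x powr p) \<partial>M)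
              + ennreal (D) * (\<integral>\<^sup>+x. ennreal (g x powr q) \<partial>M)"
      by (subst nn_integral_add) (auto simp: nn_integral_cmult)
    also have "\<dots> \<le> ennreal (C) * ennreal (A powr p)
              + ennreal (D) * ennreal (B powr q)"
      by (intro add_mono mult_left_mono A B) auto
    also have "\<dots> = ennreal (C * A powr p + D * B powr q)"
      using C D by (simp flip: ennreal_mult ennreal_plus)
    also have "C * A powr p + D * B powr q = A * B * (1/p + 1/q)"
      using 3 by (simp add: C_def D_def field_simps)
    finally show ?thesis using pq by simp
  qed
qed

text \<open>Hoelder for \<open>norm (f x) powr r\<close> and \<open>norm (g x) powr r\<close> with
  exponents \<open>p / r\<close> and \<open>q / r\<close>, whose inverses sum to one. Admitting any
  \<open>h\<close> dominated by the product of the norms covers inner products and the bilinear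
  source terms alike.\<close>

lemma Lp_bound_Holder:
  assumes f: "Lp_bound p f A" and g: "Lp_bound q g B" and h: "h \<in> borel_measurable borel"
    and le: "\<And>x. norm (h x) \<le> norm (f x) * norm (g x)"
    and pqr: "0 < p" "0 < q" "0 < r" "1 / p + 1 / q = 1 / r"
  shows "Lp_bound r h (A * B)"
proof -
  have [measurable]: "f \<in> borel_measurable borel" "g \<in> borel_measurable borel"
    using f g by (auto dest: Lp_boundD)
  have nn: "0 \<le> A" "0 \<le> B"
    using f g by (auto dest: Lp_boundD)
  have less: "r < p" "r < q"
  proof -
    have "1 / p < 1 / r" "1 / q < 1 / r"
      using pqr by (auto simp flip: pqr(4))
    then show "r < p" "r < q"
      using pqr by (auto simp: field_simps)
  qed
  have 1: "r / p + r / q = 1"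
  proof -
    have "r / p + r / q = r * (1 / p + 1 / q)" by (simp add: algebra_simps)
    then show ?thesis using pqr by simp
  qed
  have "(\<integral>\<^sup>+x. ennreal (norm (h x) powr r) \<partial>lborel)
     \<le> (\<integral>\<^sup>+x. ennreal (norm (f x) powr r * norm (g x) powr r) \<partial>lborel)"
    using pqr by (intro nn_integral_mono ennreal_leI) (auto simp flip: powr_mult intro!: powr_mono2 le)
  also have "\<dots> \<le> ennreal (A powr r * B powr r)"
  proof (rule nn_integral_Holder[where p = "p / r" and q = "q / r"])
    show "(\<integral>\<^sup>+x. ennreal ((norm (f x) powr r) powr (p / r)) \<partial>lborel) \<le> ennreal ((A powr r) powr (p / r))"
      "(\<integral>\<^sup>+x. ennreal ((norm (g x) powr r) powr (q / r)) \<partial>lborel) \<le> ennreal ((B powr r) powr (q / r))"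
      using f g pqr by (simp_all add: powr_powr Lp_boundD)
  qed (use pqr less 1 in auto)
  also have "A powr r * B powr r = (A * B) powr r"
    using nn by (simp add: powr_mult)
  finally show ?thesis
    using h nn by (auto simp: Lp_bound_def)
qed

text \<open>Pointwise, |f|^q is at most K^(q - p) |f|^p. Interpolation always takes this form below,
  with the sup norm as one endpoint.\<close>

lemma Lp_bound_interpolate:
  assumes f: "Lp_bound p f N" and K: "AE x in lborel. norm (f x) \<le> K"
    and pq: "0 < p" "p \<le> q" and "0 \<le> K"
  shows "Lp_bound q f (K powr (1 - p / q) * N powr (p / q))"
proof -
  have [measurable]: "f \<in> borel_measurable borel"
    using f by (auto dest: Lp_boundD)
  have ptw: "norm (f x) powr q \<le> K powr (q - p) * norm (f x) powr p" if "norm (f x) \<le> K" for x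
  proof (cases "f x = 0")
    case False
    have "norm (f x) powr q = norm (f x) powr (q - p) * norm (f x) powr p"
      by (simp flip: powr_add)
    also have "\<dots> \<le> K powr (q - p) * norm (f x) powr p"
      using that pq by (intro mult_right_mono powr_mono2) auto
    finally show ?thesis .
  qed auto
  have "(\<integral>\<^sup>+x. ennreal (norm (f x) powr q) \<partial>lborel)
     \<le> (\<integral>\<^sup>+x. ennreal (K powr (q - p)) * ennreal (norm (f x) powr p) \<partial>lborel)"
    using K by (intro nn_integral_mono_AE)
      (auto simp flip: ennreal_mult intro!: ennreal_leI ptw elim!: eventually_mono)
  also have "\<dots> = ennreal (K powr (q - p)) * (\<integral>\<^sup>+x. ennreal (norm (f x) powr p) \<partial>lborel)"
    by (intro nn_integral_cmult) auto
  also have "\<dots> \<le> ennreal (K powr (q - p)) * ennreal (N powr p)"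
    using f by (intro mult_left_mono) (auto dest: Lp_boundD)
  also have "\<dots> = ennreal ((K powr (1 - p / q) * N powr (p / q)) powr q)"
  proof -
    have "(1 - p / q) * q = q - p"
      using pq by (simp add: field_simps)
    then show ?thesis
      using pq by (simp flip: ennreal_mult add: powr_mult powr_powr)
  qed
  finally show ?thesis by (auto simp: Lp_bound_def)
qed

lemma Lp_bound_translate:
  assumes "Lp_bound p f K"
  shows "Lp_bound p (\<lambda>x. f (x + a)) K"
proof -
  have [measurable]: "f \<in> borel_measurable borel"
    using assms by (auto dest: Lp_boundD)
  have "(\<integral>\<^sup>+x. ennreal (norm (f (x + a)) powr p) \<partial>lborel)
      = (\<integral>\<^sup>+x. ennreal (norm (f x) powr p) \<partial>distr lborel borel (\<lambda>x. a + x))"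
    by (subst nn_integral_distr) (auto simp: add.commute)
  then show ?thesis
    using assms by (auto simp: Lp_bound_def lborel_distr_plus)
qed

section \<open>Minkowski's integral inequality\<close>

text \<open>
  Hoelder's inequality with the weight \<open>a s powr (1 - p)\<close> reduces the claim to Tonelli's theorem;
  the parameters with \<open>a s = 0\<close> carry no mass and are treated separately.
\<close>

lemma Minkowski_nn:
  fixes h :: "'s \<Rightarrow> 'a::euclidean_space \<Rightarrow> 'b::euclidean_space"
  assumes M: "sigma_finite_measure M"
    and h[measurable]: "(\<lambda>(s, x). h s x) \<in> borel_measurable (M \<Otimes>\<^sub>M lborel)"
    and a[measurable]: "a \<in> borel_measurable M"
    and bound: "\<And>s. s \<in> space M \<Longrightarrow> Lp_bound p (h s) (a s)"
    and A: "(\<integral>\<^sup>+s. ennreal (a s) \<partial>M) \<le> ennreal A" "0 \<le> A" and p: "1 \<le> p"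
  shows "AE x in lborel. (\<integral>\<^sup>+s. ennreal (norm (h s x)) \<partial>M) < \<infinity>"
    and "Lp_bound p (\<lambda>x. enn2real (\<integral>\<^sup>+s. ennreal (norm (h s x)) \<partial>M)) A"
proof -
  interpret sigma_finite_measure M by fact
  interpret P: pair_sigma_finite M "lborel :: 'a measure" ..
  define N where "N x = (\<integral>\<^sup>+s. ennreal (norm (h s x)) \<partial>M)" for x
  have h'[measurable]: "(\<lambda>(x, s). h s x) \<in> borel_measurable (lborel \<Otimes>\<^sub>M M)"
    using measurable_pair_swap[OF h] by (simp add: case_prod_unfold)
  have [measurable]: "N \<in> borel_measurable lborel"
    unfolding N_def by measurable
  have a0: "0 \<le> a s" if "s \<in> space M" for s
    using Lp_boundD(2)[OF bound[OF that]] .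
  have hs[measurable]: "(\<lambda>s. h s x) \<in> borel_measurable M" for x
    using measurable_compose_Pair1[of x lborel "\<lambda>(x, s). h s x" M borel] by simp
  obtain c where c: "c \<in> borel_measurable lborel" "\<And>x. 0 \<le> c x"
    "AE x in lborel. N x \<le> ennreal (c x)"
    "(\<integral>\<^sup>+x. ennreal (c x powr p) \<partial>lborel) \<le> ennreal (A powr p)"
  proof (cases "p = 1")
    case True
    have "(\<integral>\<^sup>+x. N x \<partial>lborel) = (\<integral>\<^sup>+s. \<integral>\<^sup>+x. ennreal (norm (h s x)) \<partial>lborel \<partial>M)"
      unfolding N_def by (rule P.Fubini') measurable
    also have "\<dots> \<le> (\<integral>\<^sup>+s. ennreal (a s) \<partial>M)"
    proof (rule nn_integral_mono)
      fix s assume s: "s \<in> space M"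
      show "(\<integral>\<^sup>+x. ennreal (norm (h s x)) \<partial>lborel) \<le> ennreal (a s)"
        using Lp_boundD(3)[OF bound[OF s]] a0[OF s] by (simp add: True)
    qed
    finally have le: "(\<integral>\<^sup>+x. N x \<partial>lborel) \<le> ennreal A"
      using A by auto
    then have "AE x in lborel. N x \<noteq> \<infinity>"
      by (intro nn_integral_PInf_AE) (auto simp: top_unique)
    then have fin: "AE x in lborel. N x = ennreal (enn2real (N x))"
      by eventually_elim (auto simp: ennreal_enn2real less_top)
    show ?thesis
    proof (rule that[of "\<lambda>x. enn2real (N x)"])
      have "(\<integral>\<^sup>+x. ennreal (enn2real (N x) powr p) \<partial>lborel) = (\<integral>\<^sup>+x. N x \<partial>lborel)"
        using fin True by (intro nn_integral_cong_AE) (auto elim!: eventually_mono)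
      then show "(\<integral>\<^sup>+x. ennreal (enn2real (N x) powr p) \<partial>lborel) \<le> ennreal (A powr p)"
        using le True A by simp
    qed (use fin in \<open>auto elim!: eventually_mono\<close>)
  next
    case False
    then have p1: "p > 1" using p by simp
    define V where "V x = (\<integral>\<^sup>+s. ennreal (norm (h s x) powr p * a s powr (1 - p)) \<partial>M)" for x
    \<comment> \<open>Because \<open>0 powr c = 0\<close>, the product
      \<open>a s powr ((1 - p) / p) * a s powr ((p - 1) / p)\<close> is 1 only where
      \<open>a s\<close> is nonzero. \<open>Z\<close> collects what is lost elsewhere and vanishes
      almost everywhere.\<close>
    define Z where "Z x = (\<integral>\<^sup>+s. ennreal (norm (h s x)) * indicator {s \<in> space M. a s = 0} s \<partial>M)" for x
    have [measurable]: "V \<in> borel_measurable lborel" "Z \<in> borel_measurable lborel"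
      unfolding V_def Z_def by measurable
    have "(\<integral>\<^sup>+x. V x \<partial>lborel)
       = (\<integral>\<^sup>+s. \<integral>\<^sup>+x. ennreal (norm (h s x) powr p * a s powr (1 - p)) \<partial>lborel \<partial>M)"
      unfolding V_def by (rule P.Fubini') measurable
    also have "\<dots> \<le> (\<integral>\<^sup>+s. ennreal (a s) \<partial>M)"
    proof (rule nn_integral_mono)
      fix s assume s: "s \<in> space M"
      have [measurable]: "h s \<in> borel_measurable borel"
        using bound[OF s] by (auto dest: Lp_boundD)
      have "(\<integral>\<^sup>+x. ennreal (norm (h s x) powr p * a s powr (1 - p)) \<partial>lborel)
         = (\<integral>\<^sup>+x. ennreal (norm (h s x) powr p) \<partial>lborel) * ennreal (a s powr (1 - p))"
        by (subst nn_integral_multc[symmetric]) (auto simp: ennreal_mult)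
      also have "\<dots> \<le> ennreal (a s powr p) * ennreal (a s powr (1 - p))"
        using bound[OF s] by (intro mult_right_mono) (auto dest: Lp_boundD)
      also have "\<dots> = ennreal (a s)"
        using a0[OF s] by (auto simp flip: ennreal_mult powr_add)
      finally show "(\<integral>\<^sup>+x. ennreal (norm (h s x) powr p * a s powr (1 - p)) \<partial>lborel) \<le> ennreal (a s)" .
    qed
    also have "\<dots> \<le> ennreal A" by fact
    finally have V: "(\<integral>\<^sup>+x. V x \<partial>lborel) \<le> ennreal A" .
    then have "AE x in lborel. V x \<noteq> \<infinity>"
      by (intro nn_integral_PInf_AE) (auto simp: top_unique)
    then have Vfin: "AE x in lborel. V x = ennreal (enn2real (V x))"
      by eventually_elim (auto simp: ennreal_enn2real less_top)
    have "(\<integral>\<^sup>+x. Z x \<partial>lborel)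
       = (\<integral>\<^sup>+s. \<integral>\<^sup>+x. ennreal (norm (h s x)) * indicator {s \<in> space M. a s = 0} s \<partial>lborel \<partial>M)"
      unfolding Z_def by (rule P.Fubini') measurable
    also have "\<dots> = (\<integral>\<^sup>+s. 0 \<partial>M)"
    proof (rule nn_integral_cong)
      fix s assume s: "s \<in> space M"
      show "(\<integral>\<^sup>+x. ennreal (norm (h s x)) * indicator {s \<in> space M. a s = 0} s \<partial>lborel) = 0"
      proof (cases "a s = 0")
        case True
        then have "AE x in lborel. h s x = 0"
          using bound[OF s] by (auto dest: Lp_bound_0_AE)
        then have "(\<integral>\<^sup>+x. ennreal (norm (h s x)) * indicator {s \<in> space M. a s = 0} s \<partial>lborel)
           = (\<integral>\<^sup>+x. 0 \<partial>(lborel :: 'a measure))"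
          by (intro nn_integral_cong_AE) (auto elim!: eventually_mono)
        then show ?thesis by simp
      qed auto
    qed
    also have "\<dots> = 0"
      by simp
    finally have Z0: "(\<integral>\<^sup>+x. Z x \<partial>lborel) = 0" .
    have "AE x in lborel. Z x = 0"
      by (rule nn_integral_0_iff_AE[THEN iffD1, OF _ Z0]) measurable
    then have main: "AE x in lborel. N x \<le> ennreal (enn2real (V x) powr (1 / p) * A powr ((p - 1) / p))"
      using Vfin
    proof eventually_elim
      case (elim x)
      have "N x = (\<integral>\<^sup>+s. ennreal (norm (h s x)) * indicator {s \<in> space M. a s = 0} s
           + ennreal (norm (h s x) * a s powr ((1 - p) / p) * a s powr ((p - 1) / p)) \<partial>M)"
        unfolding N_def using p1
        by (intro nn_integral_cong)
           (auto simp: indicator_def mult.assoc simp flip: powr_add add_divide_distrib)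
      also have "\<dots> = Z x + (\<integral>\<^sup>+s. ennreal (norm (h s x) * a s powr ((1 - p) / p) * a s powr ((p - 1) / p)) \<partial>M)"
        unfolding Z_def by (rule nn_integral_add) measurable
      also have "\<dots> = (\<integral>\<^sup>+s. ennreal (norm (h s x) * a s powr ((1 - p) / p) * a s powr ((p - 1) / p)) \<partial>M)"
        using elim by simp
      also have "\<dots> \<le> ennreal (enn2real (V x) powr (1 / p) * A powr ((p - 1) / p))"
      proof (rule nn_integral_Holder[where p = p and q = "p / (p - 1)"])
        have "(\<integral>\<^sup>+s. ennreal ((norm (h s x) * a s powr ((1 - p) / p)) powr p) \<partial>M) = V x"
          unfolding V_def using p1 by (simp add: powr_mult powr_powr)
        then show "(\<integral>\<^sup>+s. ennreal ((norm (h s x) * a s powr ((1 - p) / p)) powr p) \<partial>M)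
           \<le> ennreal ((enn2real (V x) powr (1 / p)) powr p)"
          using elim p1 by (simp add: powr_powr)
        have "(\<integral>\<^sup>+s. ennreal ((a s powr ((p - 1) / p)) powr (p / (p - 1))) \<partial>M)
           = (\<integral>\<^sup>+s. ennreal (a s) \<partial>M)"
          using p1 a0 by (intro nn_integral_cong) (simp add: powr_powr)
        then show "(\<integral>\<^sup>+s. ennreal ((a s powr ((p - 1) / p)) powr (p / (p - 1))) \<partial>M)
            \<le> ennreal ((A powr ((p - 1) / p)) powr (p / (p - 1)))"
          using A p1 by (simp add: powr_powr)
      qed (use p1 in \<open>auto simp: field_simps\<close>)
      finally show ?case .
    qed
    show ?thesis
    proof (rule that[OF _ _ main])
      have "(\<integral>\<^sup>+x. ennreal ((enn2real (V x) powr (1 / p) * A powr ((p - 1) / p)) powr p) \<partial>lborel)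
         = (\<integral>\<^sup>+x. V x * ennreal (A powr (p - 1)) \<partial>lborel)"
        using Vfin p1
        by (intro nn_integral_cong_AE)
           (auto simp: powr_mult powr_powr ennreal_mult elim!: eventually_mono)
      also have "\<dots> = (\<integral>\<^sup>+x. V x \<partial>lborel) * ennreal (A powr (p - 1))"
        by (rule nn_integral_multc) auto
      also have "\<dots> \<le> ennreal A * ennreal (A powr (p - 1))"
        by (intro mult_right_mono V) auto
      also have "\<dots> = ennreal (A powr p)"
      proof (cases "A = 0")
        case False
        then have "A * A powr (p - 1) = A powr 1 * A powr (p - 1)"
          using A by simp
        also have "\<dots> = A powr p"
          by (subst powr_add[symmetric]) simp
        finally show ?thesis
          using A by (simp flip: ennreal_mult)
      qed (use p1 in auto)
      finally show "(\<integral>\<^sup>+x. ennreal ((enn2real (V x) powr (1 / p) * A powr ((p - 1) / p)) powr p) \<partial>lborel)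
        \<le> ennreal (A powr p)" .
    qed auto
  qed
  show "AE x in lborel. (\<integral>\<^sup>+s. ennreal (norm (h s x)) \<partial>M) < \<infinity>"
    using c(3) unfolding N_def[symmetric] by eventually_elim (auto simp: le_less_trans)
  have "AE x in lborel. norm (enn2real (N x)) \<le> norm (c x)"
    using c(3)
  proof eventually_elim
    case (elim x)
    then have "enn2real (N x) \<le> enn2real (ennreal (c x))"
      by (intro enn2real_mono) auto
    then show ?case using c(2)[of x] by simp
  qed
  moreover have "Lp_bound p c A"
    using c A by (auto simp: Lp_bound_def)
  ultimately show "Lp_bound p (\<lambda>x. enn2real (\<integral>\<^sup>+s. ennreal (norm (h s x)) \<partial>M)) A"
    unfolding N_def[symmetric] using p by (auto intro: Lp_bound_mono_AE[of p c A])
qed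

text \<open>Finiteness of the integral of the norms is Bochner integrability in \<open>s\<close> for
  almost every \<open>x\<close>. The parameter space is general on purpose: it is time for Duhamel
  integrals, space for convolutions, and a count space for sums and series.\<close>

lemma Minkowski_integral:
  fixes h :: "'s \<Rightarrow> 'a::euclidean_space \<Rightarrow> 'b::euclidean_space"
  assumes M: "sigma_finite_measure M"
    and h[measurable]: "(\<lambda>(s, x). h s x) \<in> borel_measurable (M \<Otimes>\<^sub>M lborel)"
    and a[measurable]: "a \<in> borel_measurable M"
    and bound: "\<And>s. s \<in> space M \<Longrightarrow> Lp_bound p (h s) (a s)"
    and A: "(\<integral>\<^sup>+s. ennreal (a s) \<partial>M) \<le> ennreal A" "0 \<le> A" and p: "1 \<le> p"
  shows "AE x in lborel. integrable M (\<lambda>s. h s x)"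
    and "Lp_bound p (\<lambda>x. \<integral>s. h s x \<partial>M) A"
proof -
  interpret sigma_finite_measure M by fact
  have mn: "AE x in lborel. (\<integral>\<^sup>+s. ennreal (norm (h s x)) \<partial>M) < \<infinity>"
    "Lp_bound p (\<lambda>x. enn2real (\<integral>\<^sup>+s. ennreal (norm (h s x)) \<partial>M)) A"
    using Minkowski_nn[OF M h a _ A p] bound by blast+
  have h'[measurable]: "(\<lambda>(x, s). h s x) \<in> borel_measurable (lborel \<Otimes>\<^sub>M M)"
    using measurable_pair_swap[OF h] by (simp add: case_prod_unfold)
  have hs[measurable]: "(\<lambda>s. h s x) \<in> borel_measurable M" for x
    using measurable_compose_Pair1[of x lborel "\<lambda>(x, s). h s x" M borel] by simp
  show int: "AE x in lborel. integrable M (\<lambda>s. h s x)"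
    using mn(1) by eventually_elim (auto simp: integrable_iff_bounded)
  have "AE x in lborel. norm (\<integral>s. h s x \<partial>M) \<le> norm (enn2real (\<integral>\<^sup>+s. ennreal (norm (h s x)) \<partial>M))"
    using mn(1)
  proof eventually_elim
    case (elim x)
    have "norm (\<integral>s. h s x \<partial>M) \<le> (\<integral>s. norm (h s x) \<partial>M)"
      by (rule integral_norm_bound)
    also have "\<dots> = enn2real (\<integral>\<^sup>+s. ennreal (norm (h s x)) \<partial>M)"
      by (rule integral_eq_nn_integral) auto
    finally show ?case by simp
  qed
  moreover have "(\<lambda>x. \<integral>s. h s x \<partial>M) \<in> borel_measurable borel"
    using borel_measurable_lebesgue_integral[OF h'] by simp
  ultimately show "Lp_bound p (\<lambda>x. \<integral>s. h s x \<partial>M) A"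
    using p by (auto intro: Lp_bound_mono_AE[OF mn(2)])
qed

section \<open>Triangle inequality, limits and completeness\<close>

text \<open>Minkowski's integral inequality over a two-point count space.\<close>

lemma Lp_bound_add:
  assumes f: "Lp_bound p f A" and g: "Lp_bound p g B" and p: "1 \<le> p"
  shows "Lp_bound p (\<lambda>x. f x + g x) (A + B)"
proof -
  let ?h = "\<lambda>b x. if b then f x else g x"
  let ?M = "count_space (UNIV :: bool set)"
  have nn: "0 \<le> A" "0 \<le> B"
    using f g by (auto dest: Lp_boundD)
  have [measurable]: "f \<in> borel_measurable borel" "g \<in> borel_measurable borel"
    using f g by (auto dest: Lp_boundD)
  have "Lp_bound p (\<lambda>x. \<integral>b. ?h b x \<partial>?M) (A + B)"
  proof (rule Minkowski_integral(2)[where a = "\<lambda>b. if b then A else B"])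
    show "sigma_finite_measure ?M"
      by (rule sigma_finite_measure_count_space_countable) simp
    show "(\<lambda>(s, x). ?h s x) \<in> borel_measurable (?M \<Otimes>\<^sub>M lborel)"
      by (rule measurable_pair_measure_countable1) auto
    show "(\<integral>\<^sup>+b. ennreal (if b then A else B) \<partial>?M) \<le> ennreal (A + B)"
      using nn by (simp add: nn_integral_count_space_finite UNIV_bool ennreal_plus)
  qed (use f g nn p in auto)
  then show ?thesis
    by (simp add: lebesgue_integral_count_space_finite UNIV_bool add.commute)
qed

lemma Lp_bound_diff:
  assumes "Lp_bound p f A" "Lp_bound p g B" "1 \<le> p"
  shows "Lp_bound p (\<lambda>x. f x - g x) (A + B)"
  using Lp_bound_add[OF assms(1) Lp_bound_scaleR[OF assms(2), of "-1"]] assms(3) by simp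

lemma Lp_bound_sum:
  assumes "finite I" "\<And>i. i \<in> I \<Longrightarrow> Lp_bound p (f i) (A i)" "1 \<le> p"
  shows "Lp_bound p (\<lambda>x. \<Sum>i\<in>I. f i x) (\<Sum>i\<in>I. A i)"
  using assms(1,2)
proof (induction I rule: finite_induct)
  case empty
  show ?case by (simp add: Lp_bound_zero)
next
  case (insert i I)
  then show ?case using assms(3) by (auto intro!: Lp_bound_add)
qed

lemma Lp_bound_LIMSEQ:
  assumes "\<And>n. Lp_bound p f (k n)" "k \<longlonglongrightarrow> K" "0 < p"
  shows "Lp_bound p f K"
proof -
  have "0 \<le> K"
    using assms(1) by (intro LIMSEQ_le_const[OF assms(2)]) (auto dest: Lp_boundD)
  moreover have "(\<lambda>n. ennreal (k n powr p)) \<longlonglongrightarrow> ennreal (K powr p)"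
    using assms \<open>0 \<le> K\<close>
    by (intro tendsto_ennrealI tendsto_powr'[OF assms(2) tendsto_const])
       (auto dest: Lp_boundD intro!: always_eventually)
  then have "(\<integral>\<^sup>+x. ennreal (norm (f x) powr p) \<partial>lborel) \<le> ennreal (K powr p)"
    using assms(1) by (intro LIMSEQ_le_const[of "\<lambda>n. ennreal (k n powr p)"]) (auto dest: Lp_boundD)
  ultimately show ?thesis
    using assms(1) by (auto simp: Lp_bound_def)
qed

text \<open>Carries the bounds of the Picard iterates over to their almost everywhere limit, also in
  norms in which convergence is not established.\<close>

lemma Lp_bound_Fatou:
  assumes f: "\<And>n. Lp_bound p (f n) K" and g[measurable]: "g \<in> borel_measurable borel"
    and lim: "AE x in lborel. (\<lambda>n. f n x) \<longlonglongrightarrow> g x" and p: "0 < p"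
  shows "Lp_bound p g K"
proof -
  have [measurable]: "f n \<in> borel_measurable borel" for n
    using f by (auto dest: Lp_boundD)
  have "(\<integral>\<^sup>+x. ennreal (norm (g x) powr p) \<partial>lborel)
      = (\<integral>\<^sup>+x. liminf (\<lambda>n. ennreal (norm (f n x) powr p)) \<partial>lborel)"
    using lim
  proof (intro nn_integral_cong_AE, eventually_elim)
    case (elim x)
    have "(\<lambda>n. ennreal (norm (f n x) powr p)) \<longlonglongrightarrow> ennreal (norm (g x) powr p)"
      using p by (intro tendsto_ennrealI tendsto_powr' tendsto_norm elim tendsto_const) auto
    then show ?case
      by (intro lim_imp_Liminf[symmetric]) auto
  qed
  also have "\<dots> \<le> liminf (\<lambda>n. \<integral>\<^sup>+x. ennreal (norm (f n x) powr p) \<partial>lborel)"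
    by (intro nn_integral_liminf) auto
  also have "\<dots> \<le> liminf (\<lambda>n. ennreal (K powr p))"
    using f by (intro Liminf_mono always_eventually) (auto dest: Lp_boundD)
  also have "\<dots> = ennreal (K powr p)"
    by (simp add: Liminf_const)
  finally show ?thesis
    using f[of 0] g by (auto simp: Lp_bound_def)
qed

text \<open>Minkowski's inequality over the natural numbers, applied to the increments from index
  \<open>n\<close> on: their bounds sum to \<open>2 * K / 2 ^ n\<close>. The telescoping series
  therefore converges almost everywhere, and the same sum is the rate of convergence.\<close>

lemma Riesz_Fischer:
  fixes f :: "nat \<Rightarrow> 'a::euclidean_space \<Rightarrow> 'b::euclidean_space"
  assumes f[measurable]: "\<And>n. f n \<in> borel_measurable borel"
    and d: "\<And>n. Lp_bound p (\<lambda>x. f (Suc n) x - f n x) (K / 2 ^ n)" and p: "1 \<le> p" and K: "0 \<le> K"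
  obtains g where "g \<in> borel_measurable borel"
    "AE x in lborel. (\<lambda>n. f n x) \<longlonglongrightarrow> g x"
    "\<And>n. Lp_bound p (\<lambda>x. g x - f n x) (2 * K / 2 ^ n)"
proof -
  let ?C = "count_space (UNIV :: nat set)"
  have *: "AE x in lborel. integrable ?C (\<lambda>k. f (Suc (k + n)) x - f (k + n) x)"
    "Lp_bound p (\<lambda>x. \<integral>k. f (Suc (k + n)) x - f (k + n) x \<partial>?C) (2 * K / 2 ^ n)" for n
  proof -
    have 1: "sigma_finite_measure ?C"
      by (rule sigma_finite_measure_count_space_countable) simp
    have 2: "(\<lambda>(k, x). f (Suc (k + n)) x - f (k + n) x) \<in> borel_measurable (?C \<Otimes>\<^sub>M lborel)"
      by (rule measurable_pair_measure_countable1) auto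
    have "(\<lambda>k. K / 2 ^ n * (1/2) ^ k) sums (K / 2 ^ n * (1 / (1 - 1/2)))"
      by (intro sums_mult geometric_sums) auto
    then have s: "(\<lambda>k. K / 2 ^ (k + n)) sums (2 * K / 2 ^ n)"
      by (simp add: power_add power_divide mult.commute)
    have 3: "(\<integral>\<^sup>+k. ennreal (K / 2 ^ (k + n)) \<partial>?C) \<le> ennreal (2 * K / 2 ^ n)"
      using K s by (simp add: nn_integral_count_space_nat suminf_ennreal_eq sums_unique[OF s, symmetric])
    show "AE x in lborel. integrable ?C (\<lambda>k. f (Suc (k + n)) x - f (k + n) x)"
      by (rule Minkowski_integral(1)[OF 1 2 _ d 3 _ p]) (use K in auto)
    show "Lp_bound p (\<lambda>x. \<integral>k. f (Suc (k + n)) x - f (k + n) x \<partial>?C) (2 * K / 2 ^ n)"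
      by (rule Minkowski_integral(2)[OF 1 2 _ d 3 _ p]) (use K in auto)
  qed
  define g where "g x = f 0 x + (\<integral>k. f (Suc k) x - f k x \<partial>?C)" for x
  have sums: "AE x in lborel. \<forall>n. (\<lambda>k. f (Suc (k + n)) x - f (k + n) x) sums (\<integral>k. f (Suc (k + n)) x - f (k + n) x \<partial>?C)"
    unfolding AE_all_countable
  proof
    fix n
    show "AE x in lborel. (\<lambda>k. f (Suc (k + n)) x - f (k + n) x) sums (\<integral>k. f (Suc (k + n)) x - f (k + n) x \<partial>?C)"
      using *(1)[of n] by eventually_elim (rule sums_integral_count_space_nat)
  qed
  show ?thesis
  proof (rule that[of g])
    show g[measurable]: "g \<in> borel_measurable borel"
      unfolding g_def using *(2)[of 0] by (auto dest: Lp_boundD)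
    show lim: "AE x in lborel. (\<lambda>n. f n x) \<longlonglongrightarrow> g x"
      using sums
    proof eventually_elim
      case (elim x)
      then have "(\<lambda>k. f (Suc k) x - f k x) sums (\<integral>k. f (Suc k) x - f k x \<partial>?C)"
        by (auto dest: spec[of _ 0])
      then have "(\<lambda>n. f n x - f 0 x) \<longlonglongrightarrow> (\<integral>k. f (Suc k) x - f k x \<partial>?C)"
        using sum_lessThan_telescope[of "\<lambda>k. f k x"] unfolding sums_def by simp
      from tendsto_add[OF this tendsto_const[of "f 0 x"]] show ?case
        by (simp add: g_def add.commute)
    qed
    fix n
    have "AE x in lborel. g x - f n x = (\<integral>k. f (Suc (k + n)) x - f (k + n) x \<partial>?C)"
      using sums lim
    proof eventually_elim
      case (elim x)
      have "(\<lambda>m. f (m + n) x - f n x) \<longlonglongrightarrow> (\<integral>k. f (Suc (k + n)) x - f (k + n) x \<partial>?C)"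
        using elim(1)[rule_format, of n] sum_lessThan_telescope[of "\<lambda>k. f (k + n) x"]
        unfolding sums_def by simp
      moreover have "(\<lambda>m. f (m + n) x - f n x) \<longlonglongrightarrow> g x - f n x"
        using elim(2) by (intro tendsto_diff tendsto_const LIMSEQ_ignore_initial_segment)
      ultimately show ?case using LIMSEQ_unique by blast
    qed
    then show "Lp_bound p (\<lambda>x. g x - f n x) (2 * K / 2 ^ n)"
      using p by (intro Lp_bound_cong_AE[OF *(2)[of n]]) auto
  qed
qed

text \<open>Truncation in value and in space at once: the result is bounded with bounded support,
  hence in every \<open>L^p\<close>.\<close>

definition cutoff :: "real \<Rightarrow> ('a::euclidean_space \<Rightarrow> 'b::euclidean_space) \<Rightarrow> 'a \<Rightarrow> 'b" where
  "cutoff R f x = (if norm (f x) \<le> R \<and> norm x \<le> R then f x else 0)"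

lemma measurable_cutoff[measurable]:
  assumes [measurable]: "f \<in> borel_measurable borel"
  shows "cutoff R f \<in> borel_measurable borel"
  unfolding cutoff_def by measurable

lemma norm_cutoff_le: "0 \<le> R \<Longrightarrow> norm (cutoff R f x) \<le> R"
  by (auto simp: cutoff_def)

lemma Lp_bound_cutoff_any:
  fixes f :: "'a::euclidean_space \<Rightarrow> 'b::euclidean_space"
  assumes [measurable]: "f \<in> borel_measurable borel" and p: "0 < p" and R: "0 \<le> R"
  shows "\<exists>N. Lp_bound p (cutoff R f) N"
proof -
  let ?m = "measure lborel (cball 0 R :: 'a set)"
  have m: "emeasure lborel (cball 0 R :: 'a set) = ennreal ?m"
    using emeasure_lborel_cball_finite[of "0 :: 'a" R] by (intro emeasure_eq_ennreal_measure) auto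
  have "(\<integral>\<^sup>+x. ennreal (norm (cutoff R f x) powr p) \<partial>lborel)
     \<le> (\<integral>\<^sup>+x. ennreal (R powr p) * indicator (cball (0 :: 'a) R) x \<partial>lborel)"
    using p by (intro nn_integral_mono) (auto simp: cutoff_def indicator_def intro!: ennreal_leI powr_mono2)
  also have "\<dots> = ennreal (R powr p * ?m)"
    by (subst nn_integral_cmult_indicator) (auto simp: m ennreal_mult)
  finally show ?thesis
    using p by (intro exI[of _ "(R powr p * ?m) powr (1 / p)"]) (auto simp: Lp_bound_def powr_powr)
qed

text \<open>At each point the remainder is zero for all large \<open>R\<close>, and it is dominated
  by \<open>f\<close>; dominated convergence finishes.\<close>

lemma Lp_bound_minus_cutoff:
  fixes f :: "'a::euclidean_space \<Rightarrow> 'b::euclidean_space"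
  assumes f: "Lp_bound p f N" and p: "0 < p" and e: "0 < e"
  obtains R where "0 \<le> R" "Lp_bound p (\<lambda>x. f x - cutoff R f x) e"
proof -
  have [measurable]: "f \<in> borel_measurable borel"
    using f by (auto dest: Lp_boundD)
  have fin: "(\<integral>\<^sup>+x. ennreal (norm (f x) powr p) \<partial>lborel) < \<infinity>"
    using Lp_boundD(3)[OF f] by (auto simp: le_less_trans)
  have "(\<lambda>n. \<integral>\<^sup>+x. ennreal (norm (f x - cutoff (real n) f x) powr p) \<partial>lborel)
     \<longlonglongrightarrow> (\<integral>\<^sup>+x. 0 \<partial>(lborel :: 'a measure))"
  proof (rule nn_integral_dominated_convergence[OF _ _ _ _ fin])
    show "AE x in lborel. (\<lambda>n. ennreal (norm (f x - cutoff (real n) f x) powr p)) \<longlonglongrightarrow> 0"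
    proof (intro AE_I2 tendsto_eventually)
      fix x :: 'a
      obtain n0 where n0: "max (norm (f x)) (norm x) \<le> real n0"
        using real_arch_simple by blast
      then show "\<forall>\<^sub>F n in sequentially. ennreal (norm (f x - cutoff (real n) f x) powr p) = 0"
        by (intro eventually_sequentiallyI[of n0]) (auto simp: cutoff_def)
    qed
  qed (use p in \<open>auto simp: cutoff_def\<close>)
  then have "\<forall>\<^sub>F n in sequentially. (\<integral>\<^sup>+x. ennreal (norm (f x - cutoff (real n) f x) powr p) \<partial>lborel) < ennreal (e powr p)"
    using e by (intro order_tendstoD(2)[of _ 0]) auto
  then obtain n where "(\<integral>\<^sup>+x. ennreal (norm (f x - cutoff (real n) f x) powr p) \<partial>lborel) < ennreal (e powr p)"
    by (auto simp: eventually_sequentially)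
  then show ?thesis
    using e by (intro that[of "real n"]) (auto simp: Lp_bound_def)
qed

section \<open>From bounds to the norms of the problem and back\<close>

lemma Lp_norm_leI:
  assumes "Lp_bound p f K" "0 < p"
  shows "Lp_norm p f \<le> ennreal K"
proof -
  let ?I = "\<integral>\<^sup>+x. ennreal (norm (f x) powr p) \<partial>lborel"
  have I: "?I \<le> ennreal (K powr p)" and K: "0 \<le> K"
    using assms by (auto dest: Lp_boundD)
  then have "enn2real ?I \<le> enn2real (ennreal (K powr p))"
    by (intro enn2real_mono) auto
  then have "enn2real ?I powr (1 / p) \<le> (K powr p) powr (1 / p)"
    using assms(2) by (intro powr_mono2) auto
  also have "\<dots> = K"
    using assms(2) K by (simp add: powr_powr)
  finally show ?thesis
    using I by (auto simp: Lp_norm_def Let_def top_unique intro!: ennreal_leI)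
qed

lemma Lp_bound_if_Lp_norm_le:
  assumes [measurable]: "f \<in> borel_measurable borel" and "Lp_norm p f \<le> ennreal K" "0 \<le> K" "0 < p"
  shows "Lp_bound p f K"
proof -
  let ?I = "\<integral>\<^sup>+x. ennreal (norm (f x) powr p) \<partial>lborel"
  have fin: "?I \<noteq> \<infinity>" and le: "enn2real ?I powr (1 / p) \<le> K"
    using assms by (auto simp: Lp_norm_def Let_def top_unique split: if_splits)
  have "?I = ennreal ((enn2real ?I powr (1 / p)) powr p)"
    using fin assms by (simp add: powr_powr less_top ennreal_enn2real)
  also have "\<dots> \<le> ennreal (K powr p)"
    using le assms by (intro ennreal_leI powr_mono2) auto
  finally show ?thesis
    using assms by (auto simp: Lp_bound_def)
qed

lemma Lp_space_iff:
  assumes "0 < p"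
  shows "f \<in> Lp_space p \<longleftrightarrow> (\<exists>K. Lp_bound p f K)"
proof
  assume f: "f \<in> Lp_space p"
  then obtain K where "Lp_norm p f = ennreal K" "0 \<le> K"
    by (auto simp: Lp_space_def less_top_ennreal)
  with f assms show "\<exists>K. Lp_bound p f K"
    by (intro exI[of _ K] Lp_bound_if_Lp_norm_le) (auto simp: Lp_space_def)
next
  assume "\<exists>K. Lp_bound p f K"
  then obtain K where K: "Lp_bound p f K" ..
  then show "f \<in> Lp_space p"
    using Lp_norm_leI[OF K assms] by (auto simp: Lp_space_def le_less_trans dest: Lp_boundD)
qed

lemma Linf_norm_leI:
  assumes "f \<in> borel_measurable borel" "AE x in lborel. norm (f x) \<le> K"
  shows "Linf_norm f \<le> ennreal K"
  unfolding Linf_norm_def using assms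
  by (intro esssup_I) (auto elim!: eventually_mono intro: ennreal_leI)

lemma AE_le_if_Linf_norm_le:
  assumes "Linf_norm f \<le> ennreal K" "0 \<le> K"
  shows "AE x in lborel. norm (f x) \<le> K"
  using esssup_AE[where M = lborel and f = "\<lambda>x. ennreal (norm (f x))"]
proof eventually_elim
  case (elim x)
  then have "ennreal (norm (f x)) \<le> ennreal K"
    using assms unfolding Linf_norm_def by (metis order_trans)
  then show ?case using assms by simp
qed

section \<open>Convolution\<close>

lemma lborel_distr_reflect: "distr lborel borel (\<lambda>y. x - y) = (lborel :: 'a::euclidean_space measure)"
  using lborel_affine[of "-1" x] by (simp add: density_1)

lemma nn_integral_reflect:
  fixes x :: "'a::euclidean_space"
  assumes [measurable]: "f \<in> borel_measurable borel"
  shows "(\<integral>\<^sup>+y. f (x - y) \<partial>lborel) = (\<integral>\<^sup>+y. f y \<partial>lborel)"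
proof -
  have "(\<integral>\<^sup>+y. f (x - y) \<partial>lborel) = (\<integral>\<^sup>+y. f y \<partial>distr lborel borel (\<lambda>y. x - y))"
    by (subst nn_integral_distr) auto
  then show ?thesis by (simp add: lborel_distr_reflect)
qed

lemma integral_reflect:
  fixes x :: "'a::euclidean_space" and f :: "'a \<Rightarrow> 'b::euclidean_space"
  assumes [measurable]: "f \<in> borel_measurable borel"
  shows "(\<integral>y. f (x - y) \<partial>lborel) = (\<integral>y. f y \<partial>lborel)"
proof -
  have "(\<integral>y. f (x - y) \<partial>lborel) = (\<integral>y. f y \<partial>distr lborel borel (\<lambda>y. x - y))"
    by (subst integral_distr) auto
  then show ?thesis by (simp add: lborel_distr_reflect)
qed

lemma nn_integral_translate:
  fixes a :: "'a::euclidean_space"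
  assumes [measurable]: "f \<in> borel_measurable borel"
  shows "(\<integral>\<^sup>+y. f (y + a) \<partial>lborel) = (\<integral>\<^sup>+y. f y \<partial>lborel)"
proof -
  have "(\<integral>\<^sup>+y. f (y + a) \<partial>lborel) = (\<integral>\<^sup>+y. f y \<partial>distr lborel borel (\<lambda>y. a + y))"
    by (subst nn_integral_distr) (auto simp: add.commute)
  then show ?thesis by (simp add: lborel_distr_plus)
qed

lemma integral_translate:
  fixes a :: "'a::euclidean_space" and f :: "'a \<Rightarrow> 'b::euclidean_space"
  assumes [measurable]: "f \<in> borel_measurable borel"
  shows "(\<integral>y. f (y + a) \<partial>lborel) = (\<integral>y. f y \<partial>lborel)"
proof -
  have "(\<integral>y. f (y + a) \<partial>lborel) = (\<integral>y. f y \<partial>distr lborel borel (\<lambda>y. a + y))"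
    by (subst integral_distr) (auto simp: add.commute)
  then show ?thesis by (simp add: lborel_distr_plus)
qed

definition conv :: "(real^3 \<Rightarrow> real) \<Rightarrow> (real^3 \<Rightarrow> 'b::euclidean_space) \<Rightarrow> real^3 \<Rightarrow> 'b" where
  "conv k f x = (\<integral>y. k (x - y) *\<^sub>R f y \<partial>lborel)"

text \<open>The mass and the height of a kernel at time scale \<sigma>, tied together by the scaling
  of the heat kernel in three dimensions. One constant \<kappa> then controls convolution from L^p
  to L^q for all \<open>1 \<le> p \<le> q\<close>.\<close>

definition kernel_bound :: "(real^3 \<Rightarrow> real) \<Rightarrow> real \<Rightarrow> real \<Rightarrow> bool" where
  "kernel_bound k \<kappa> \<sigma> \<longleftrightarrow> k \<in> borel_measurable borel \<and> 0 \<le> \<kappa> \<and> 0 < \<sigma> \<and>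
     (\<integral>\<^sup>+x. ennreal \<bar>k x\<bar> \<partial>lborel) \<le> ennreal \<kappa> \<and> (\<forall>x. \<bar>k x\<bar> \<le> \<kappa> * \<sigma> powr (- 3/2))"

lemma kernel_boundD:
  assumes "kernel_bound k \<kappa> \<sigma>"
  shows "k \<in> borel_measurable borel" "0 \<le> \<kappa>" "0 < \<sigma>"
    "(\<integral>\<^sup>+x. ennreal \<bar>k x\<bar> \<partial>lborel) \<le> ennreal \<kappa>" "\<bar>k x\<bar> \<le> \<kappa> * \<sigma> powr (- 3/2)"
  using assms by (auto simp: kernel_bound_def)

lemma kernel_bound_dominated:
  assumes g: "kernel_bound g \<kappa> \<sigma>" and k: "k \<in> borel_measurable borel" and c: "0 \<le> c"
    and le: "\<And>x. \<bar>k x\<bar> \<le> c * \<bar>g x\<bar>"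
  shows "kernel_bound k (c * \<kappa>) \<sigma>"
proof -
  have [measurable]: "g \<in> borel_measurable borel"
    using g by (auto dest: kernel_boundD)
  have "(\<integral>\<^sup>+x. ennreal \<bar>k x\<bar> \<partial>lborel) \<le> (\<integral>\<^sup>+x. ennreal c * ennreal \<bar>g x\<bar> \<partial>lborel)"
    using c by (intro nn_integral_mono) (auto simp flip: ennreal_mult intro!: ennreal_leI le)
  also have "\<dots> = ennreal c * (\<integral>\<^sup>+x. ennreal \<bar>g x\<bar> \<partial>lborel)"
    by (rule nn_integral_cmult) auto
  also have "\<dots> \<le> ennreal c * ennreal \<kappa>"
    by (intro mult_left_mono kernel_boundD(4)[OF g]) auto
  also have "\<dots> = ennreal (c * \<kappa>)"
    using c by (simp add: ennreal_mult')
  finally have 1: "(\<integral>\<^sup>+x. ennreal \<bar>k x\<bar> \<partial>lborel) \<le> ennreal (c * \<kappa>)" .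
  have 2: "\<bar>k x\<bar> \<le> c * \<kappa> * \<sigma> powr (- 3/2)" for x
    using order_trans[OF le mult_left_mono[OF kernel_boundD(5)[OF g] c]] by (simp add: mult.assoc)
  show ?thesis
    using 1 2 k c kernel_boundD(2,3)[OF g] by (auto simp: kernel_bound_def)
qed

lemma kernel_bound_mono:
  assumes k: "kernel_bound k \<kappa> \<sigma>" and "\<kappa> \<le> \<kappa>'" "\<sigma>' \<le> \<sigma>" "0 < \<sigma>'"
  shows "kernel_bound k \<kappa>' \<sigma>'"
proof -
  have "\<kappa> * \<sigma> powr (- 3/2) \<le> \<kappa>' * \<sigma>' powr (- 3/2)"
    using assms kernel_boundD(2)[OF k] by (intro mult_mono powr_mono2') auto
  then show ?thesis
    using assms by (auto simp: kernel_bound_def intro: order_trans[OF _ ennreal_leI] order_trans)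
qed

lemma kernel_bound_add:
  assumes k: "kernel_bound k \<kappa> \<sigma>" and l: "kernel_bound l \<kappa>' \<sigma>"
  shows "kernel_bound (\<lambda>x. k x + l x) (\<kappa> + \<kappa>') \<sigma>"
proof -
  have [measurable]: "k \<in> borel_measurable borel" "l \<in> borel_measurable borel"
    using k l by (auto dest: kernel_boundD)
  have "(\<integral>\<^sup>+x. ennreal \<bar>k x + l x\<bar> \<partial>lborel)
     \<le> (\<integral>\<^sup>+x. ennreal \<bar>k x\<bar> + ennreal \<bar>l x\<bar> \<partial>lborel)"
    by (intro nn_integral_mono) (auto simp flip: ennreal_plus intro!: ennreal_leI)
  also have "\<dots> = (\<integral>\<^sup>+x. ennreal \<bar>k x\<bar> \<partial>lborel) + (\<integral>\<^sup>+x. ennreal \<bar>l x\<bar> \<partial>lborel)"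
    by (rule nn_integral_add) auto
  also have "\<dots> \<le> ennreal \<kappa> + ennreal \<kappa>'"
    by (intro add_mono kernel_boundD(4)[OF k] kernel_boundD(4)[OF l])
  also have "\<dots> = ennreal (\<kappa> + \<kappa>')"
    using kernel_boundD(2)[OF k] kernel_boundD(2)[OF l] by (simp add: ennreal_plus)
  finally have 1: "(\<integral>\<^sup>+x. ennreal \<bar>k x + l x\<bar> \<partial>lborel) \<le> ennreal (\<kappa> + \<kappa>')" .
  have 2: "\<bar>k x + l x\<bar> \<le> (\<kappa> + \<kappa>') * \<sigma> powr (- 3/2)" for x
    using kernel_boundD(5)[OF k, of x] kernel_boundD(5)[OF l, of x] by (simp add: distrib_right)
  show ?thesis
    using 1 2 kernel_boundD(2,3)[OF k] kernel_boundD(2)[OF l] by (auto simp: kernel_bound_def)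
qed

lemma kernel_bound_translate:
  assumes k: "kernel_bound k \<kappa> \<sigma>"
  shows "kernel_bound (\<lambda>x. k (x + h)) \<kappa> \<sigma>"
proof -
  have [measurable]: "k \<in> borel_measurable borel"
    using k by (auto dest: kernel_boundD)
  show ?thesis
    using k nn_integral_translate[of "\<lambda>x. ennreal \<bar>k x\<bar>" h] by (auto simp: kernel_bound_def)
qed

text \<open>Split |k| = |k|^(1/q) |k|^(1/p) with \<open>q\<close> conjugate to \<open>p\<close> and
  apply Hoelder: the first factor is controlled by the mass of the kernel, the second, paired with
  |f|, by its height. This produces the power \<open>\<sigma> powr (- 3 / (2 * p))\<close>.\<close>

lemma conv_nn_le:
  fixes f :: "real^3 \<Rightarrow> 'b::euclidean_space"
  assumes k: "kernel_bound k \<kappa> \<sigma>" and f: "Lp_bound p f N" and p: "1 \<le> p"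
  shows "(\<integral>\<^sup>+y. ennreal (norm (k (x - y) *\<^sub>R f y)) \<partial>lborel) \<le> ennreal (\<kappa> * \<sigma> powr (- 3 / (2 * p)) * N)"
proof -
  have [measurable]: "k \<in> borel_measurable borel" "f \<in> borel_measurable borel"
    using k f by (auto dest: Lp_boundD kernel_boundD)
  have nn: "0 \<le> \<kappa>" "0 < \<sigma>" "0 \<le> N"
    using k f by (auto dest: Lp_boundD kernel_boundD)
  have B: "(\<integral>\<^sup>+y. ennreal (\<bar>k (x - y)\<bar> * norm (f y) powr p) \<partial>lborel) \<le> ennreal (\<kappa> * \<sigma> powr (- 3/2) * N powr p)"
  proof -
    have "(\<integral>\<^sup>+y. ennreal (\<bar>k (x - y)\<bar> * norm (f y) powr p) \<partial>lborel)
       \<le> (\<integral>\<^sup>+y. ennreal (\<kappa> * \<sigma> powr (- 3/2)) * ennreal (norm (f y) powr p) \<partial>lborel)"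
      using nn by (intro nn_integral_mono)
        (auto simp flip: ennreal_mult intro!: ennreal_leI mult_right_mono kernel_boundD(5)[OF k, simplified])
    also have "\<dots> = ennreal (\<kappa> * \<sigma> powr (- 3/2)) * (\<integral>\<^sup>+y. ennreal (norm (f y) powr p) \<partial>lborel)"
      by (rule nn_integral_cmult) auto
    also have "\<dots> \<le> ennreal (\<kappa> * \<sigma> powr (- 3/2)) * ennreal (N powr p)"
      by (intro mult_left_mono Lp_boundD(3)[OF f]) auto
    finally show ?thesis
      using nn by (simp add: ennreal_mult)
  qed
  show ?thesis
  proof (cases "p = 1")
    case True
    then show ?thesis using B nn by (simp add: mult.assoc)
  next
    case False
    then have p1: "p > 1" using p by simp
    define q where "q = p / (p - 1)"
    have q: "q > 1" "1 / q + 1 / p = 1" "q > 0" "q \<noteq> 0"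
      using p1 by (auto simp: q_def field_simps)
    have "(\<integral>\<^sup>+y. ennreal (norm (k (x - y) *\<^sub>R f y)) \<partial>lborel)
       = (\<integral>\<^sup>+y. ennreal (\<bar>k (x - y)\<bar> powr (1 / q) * (\<bar>k (x - y)\<bar> powr (1 / p) * norm (f y))) \<partial>lborel)"
      using q by (intro nn_integral_cong) (simp add: mult.assoc[symmetric] powr_add[symmetric])
    also have "\<dots> \<le> ennreal (\<kappa> powr (1 / q) * ((\<kappa> * \<sigma> powr (- 3/2)) powr (1 / p) * N))"
    proof (rule nn_integral_Holder[where p = q and q = p])
      show "(\<integral>\<^sup>+y. ennreal ((\<bar>k (x - y)\<bar> powr (1 / q)) powr q) \<partial>lborel) \<le> ennreal ((\<kappa> powr (1 / q)) powr q)"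
        using kernel_boundD(4)[OF k] q nn nn_integral_reflect[of "\<lambda>y. ennreal \<bar>k y\<bar>" x]
        by (simp add: powr_powr)
      show "(\<integral>\<^sup>+y. ennreal ((\<bar>k (x - y)\<bar> powr (1 / p) * norm (f y)) powr p) \<partial>lborel)
          \<le> ennreal (((\<kappa> * \<sigma> powr (- 3/2)) powr (1 / p) * N) powr p)"
        using B p1 nn by (simp add: powr_mult powr_powr)
    qed (use p1 q nn in auto)
    also have "\<kappa> powr (1 / q) * ((\<kappa> * \<sigma> powr (- 3/2)) powr (1 / p) * N)
       = \<kappa> powr (1 / q + 1 / p) * \<sigma> powr (- 3 / (2 * p)) * N"
      using nn by (simp add: powr_add powr_mult powr_powr algebra_simps)
    also have "\<dots> = \<kappa> * \<sigma> powr (- 3 / (2 * p)) * N"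
      using nn unfolding q(2) by simp
    finally show ?thesis .
  qed
qed

lemma conv_integrable:
  fixes f :: "real^3 \<Rightarrow> 'b::euclidean_space"
  assumes k: "kernel_bound k \<kappa> \<sigma>" and f: "Lp_bound p f N" and p: "1 \<le> p"
  shows "integrable lborel (\<lambda>y. k (x - y) *\<^sub>R f y)"
proof -
  have [measurable]: "k \<in> borel_measurable borel" "f \<in> borel_measurable borel"
    using k f by (auto dest: Lp_boundD kernel_boundD)
  show ?thesis
    using conv_nn_le[OF assms, of x] by (intro integrableI_bounded) (auto simp: le_less_trans)
qed

lemma norm_conv_le:
  fixes f :: "real^3 \<Rightarrow> 'b::euclidean_space"
  assumes k: "kernel_bound k \<kappa> \<sigma>" and f: "Lp_bound p f N" and p: "1 \<le> p"
  shows "norm (conv k f x) \<le> \<kappa> * \<sigma> powr (- 3 / (2 * p)) * N"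
proof -
  have nn: "0 \<le> \<kappa>" "0 \<le> N"
    using k f by (auto dest: Lp_boundD kernel_boundD)
  have "ennreal (norm (conv k f x)) \<le> (\<integral>\<^sup>+y. ennreal (norm (k (x - y) *\<^sub>R f y)) \<partial>lborel)"
    unfolding conv_def by (rule integral_norm_bound_ennreal[OF conv_integrable[OF assms]])
  also have "\<dots> \<le> ennreal (\<kappa> * \<sigma> powr (- 3 / (2 * p)) * N)"
    by (rule conv_nn_le[OF assms])
  finally show ?thesis using nn by simp
qed

lemma conv_reflect:
  assumes [measurable]: "k \<in> borel_measurable borel" "f \<in> borel_measurable borel"
  shows "conv k f x = (\<integral>z. k z *\<^sub>R f (x - z) \<partial>lborel)"
  using integral_reflect[of "\<lambda>z. k z *\<^sub>R f (x - z)" x] by (simp add: conv_def)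

text \<open>In reflected form the convolution superposes translates of \<open>f\<close>, all with
  the same bound; Minkowski's inequality leaves the mass of \<open>k\<close>.\<close>

lemma Lp_bound_conv_same:
  fixes f :: "real^3 \<Rightarrow> 'b::euclidean_space"
  assumes k: "kernel_bound k \<kappa> \<sigma>" and f: "Lp_bound p f N" and p: "1 \<le> p"
  shows "Lp_bound p (conv k f) (\<kappa> * N)"
proof -
  have [measurable]: "k \<in> borel_measurable borel" "f \<in> borel_measurable borel"
    using k f by (auto dest: Lp_boundD kernel_boundD)
  have nn: "0 \<le> \<kappa>" "0 \<le> N"
    using k f by (auto dest: Lp_boundD kernel_boundD)
  have "Lp_bound p (\<lambda>x. \<integral>z. k z *\<^sub>R f (x - z) \<partial>lborel) (\<kappa> * N)"
  proof (rule Minkowski_integral(2)[where a = "\<lambda>z. \<bar>k z\<bar> * N"])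
    show "sigma_finite_measure (lborel :: (real^3) measure)"
      by (rule lborel.sigma_finite_measure_axioms)
    show "Lp_bound p (\<lambda>x. k z *\<^sub>R f (x - z)) (\<bar>k z\<bar> * N)" for z
      using Lp_bound_scaleR[OF Lp_bound_translate[OF f, of "- z"], of "k z"] p by simp
    have "(\<integral>\<^sup>+z. ennreal (\<bar>k z\<bar> * N) \<partial>lborel) = (\<integral>\<^sup>+z. ennreal \<bar>k z\<bar> \<partial>lborel) * ennreal N"
      using nn by (subst nn_integral_multc[symmetric]) (auto simp: ennreal_mult)
    also have "\<dots> \<le> ennreal \<kappa> * ennreal N"
      by (intro mult_right_mono kernel_boundD(4)[OF k]) auto
    finally show "(\<integral>\<^sup>+z. ennreal (\<bar>k z\<bar> * N) \<partial>lborel) \<le> ennreal (\<kappa> * N)"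
      using nn by (simp add: ennreal_mult)
  qed (use nn p in auto)
  moreover have "conv k f = (\<lambda>x. \<integral>z. k z *\<^sub>R f (x - z) \<partial>lborel)"
    by (intro ext conv_reflect) auto
  ultimately show ?thesis
    by simp
qed

text \<open>Young's inequality, by interpolation between the bound into L^p and the pointwise
  bound.\<close>

lemma Lp_bound_conv:
  fixes f :: "real^3 \<Rightarrow> 'b::euclidean_space"
  assumes k: "kernel_bound k \<kappa> \<sigma>" and f: "Lp_bound p f N" and p: "1 \<le> p" "p \<le> q"
  shows "Lp_bound q (conv k f) (\<kappa> * \<sigma> powr (- 3/2 * (1 / p - 1 / q)) * N)"
proof -
  have nn: "0 \<le> \<kappa>" "0 \<le> N" "0 < \<sigma>"
    using k f by (auto dest: Lp_boundD kernel_boundD)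
  have expo: "- 3 / (2 * p) * (1 - p / q) = - 3/2 * (1 / p - 1 / q)"
    using p by (simp add: field_simps)
  have "(\<kappa> * \<sigma> powr a * N) powr b = (\<kappa> * N) powr b * \<sigma> powr (a * b)" for a b
    using nn by (simp add: powr_mult powr_powr)
  from this[of "- 3 / (2 * p)" "1 - p / q"] have "(\<kappa> * \<sigma> powr (- 3 / (2 * p)) * N) powr (1 - p / q) * (\<kappa> * N) powr (p / q)
      = (\<kappa> * N) powr (1 - p / q + p / q) * \<sigma> powr (- 3/2 * (1 / p - 1 / q))"
    unfolding powr_add expo by (simp only: mult_ac)
  also have "\<dots> = \<kappa> * \<sigma> powr (- 3/2 * (1 / p - 1 / q)) * N"
    using nn by simp
  finally have eq: "(\<kappa> * \<sigma> powr (- 3 / (2 * p)) * N) powr (1 - p / q) * (\<kappa> * N) powr (p / q)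
      = \<kappa> * \<sigma> powr (- 3/2 * (1 / p - 1 / q)) * N" .
  show ?thesis
    unfolding eq[symmetric] using nn norm_conv_le[OF k f p(1)] p
    by (intro Lp_bound_interpolate Lp_bound_conv_same[OF k f p(1)]) auto
qed

lemma conv_diff_right:
  fixes f g :: "real^3 \<Rightarrow> 'b::euclidean_space"
  assumes "kernel_bound k \<kappa> \<sigma>" "Lp_bound p f N" "Lp_bound p' g N'" "1 \<le> p" "1 \<le> p'"
  shows "conv k (\<lambda>y. f y - g y) x = conv k f x - conv k g x"
  unfolding conv_def scaleR_diff_right
  by (rule Bochner_Integration.integral_diff; rule conv_integrable; fact)

lemma conv_diff_left:
  fixes f :: "real^3 \<Rightarrow> 'b::euclidean_space"
  assumes "kernel_bound k \<kappa> \<sigma>" "kernel_bound l \<kappa>' \<sigma>'" "Lp_bound p f N" "1 \<le> p"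
  shows "conv (\<lambda>y. k y - l y) f x = conv k f x - conv l f x"
  unfolding conv_def scaleR_diff_left
  by (rule Bochner_Integration.integral_diff; rule conv_integrable; fact)

lemma conv_scaleR_left: "conv (\<lambda>y. c * k y) f x = c *\<^sub>R conv k f x"
  unfolding conv_def by (simp flip: scaleR_scaleR)

lemma conv_translate_left: "conv (\<lambda>y. k (y + h)) f x = conv k f (x + h)"
  unfolding conv_def by (simp add: algebra_simps)

lemma conv_translate_right:
  assumes [measurable]: "k \<in> borel_measurable borel" "f \<in> borel_measurable borel"
  shows "conv k (\<lambda>y. f (y + h)) x = conv k f (x + h)"
  unfolding conv_def
  using integral_translate[of "\<lambda>y. k (x + h - y) *\<^sub>R f y" h] by (simp add: algebra_simps)

section \<open>The heat kernel\<close>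

abbreviation (input) G :: "real \<Rightarrow> real^3 \<Rightarrow> real" where
  "G \<equiv> heat_kernel"

lemma heat_kernel_nonneg: "0 \<le> G t x"
  by (simp add: heat_kernel_def)

lemma heat_kernel_le:
  assumes "0 < t"
  shows "G t x \<le> t powr (- 3/2)"
proof -
  have "G t x \<le> (4 * pi * t) powr (- 3/2) * 1"
    unfolding heat_kernel_def using assms by (intro mult_left_mono) auto
  also have "(4 * pi * t) powr (- 3/2) \<le> t powr (- 3/2)"
    using assms pi_gt3 by (intro powr_mono2') auto
  finally show ?thesis by simp
qed

lemma measurable_heat_kernel[measurable]: "G t \<in> borel_measurable borel"
  unfolding heat_kernel_def by measurable

text \<open>The Gaussian factors over the coordinates into centred normal densities of variance
  \<open>2 * t\<close>.\<close>

lemma nn_integral_heat_kernel: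
  assumes t: "0 < t"
  shows "(\<integral>\<^sup>+x. ennreal (G t x) \<partial>lborel) = 1"
proof -
  have eq: "G t x = (\<Prod>b\<in>Basis. normal_density 0 (sqrt (2 * t)) (x \<bullet> b))" for x :: "real^3"
  proof -
    have "(\<Prod>b\<in>Basis. normal_density 0 (sqrt (2 * t)) (x \<bullet> b))
      = (\<Prod>b\<in>(Basis :: (real^3) set). 1 / sqrt (4 * pi * t)) * exp (\<Sum>b\<in>Basis. - (x \<bullet> b)\<^sup>2 / (4 * t))"
      unfolding normal_density_def prod.distrib exp_sum[OF finite_Basis] using t by (simp add: mult.assoc)
    also have "(\<Sum>b\<in>Basis. - (x \<bullet> b)\<^sup>2 / (4 * t)) = - (norm x)\<^sup>2 / (4 * t)"
      by (simp add: norm_eq_sqrt_inner[of x] euclidean_inner[of x x] power2_eq_square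
          sum_divide_distrib[symmetric] sum_negf sum_nonneg)
    also have "(\<Prod>b\<in>(Basis :: (real^3) set). 1 / sqrt (4 * pi * t)) = (4 * pi * t) powr (- 3/2)"
    proof -
      have "(1 / sqrt y) ^ 3 = y powr (- 3/2)" if "0 < y" for y :: real
      proof -
        have "1 / sqrt y = y powr (- 1/2)"
          using that by (simp add: powr_half_sqrt[symmetric] powr_minus_divide)
        then show ?thesis
          using that by (simp add: powr_power)
      qed
      from this[of "4 * pi * t"] show ?thesis
        using t by simp
    qed
    finally show ?thesis by (simp add: heat_kernel_def)
  qed
  have "(\<integral>\<^sup>+x. ennreal (G t x) \<partial>lborel)
     = (\<integral>\<^sup>+x. (\<Prod>b\<in>(Basis :: (real^3) set). ennreal (normal_density 0 (sqrt (2 * t)) (x \<bullet> b))) \<partial>lborel)"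
    unfolding eq by (simp add: prod_ennreal)
  also have "\<dots> = (\<Prod>b\<in>(Basis :: (real^3) set). (\<integral>\<^sup>+x. ennreal (normal_density 0 (sqrt (2 * t)) x) \<partial>lborel))"
    by (rule nn_integral_lborel_prod) auto
  also have "\<dots> = 1"
    using t by (simp add: nn_integral_eq_integral integrable_normal_density integral_normal_density)
  finally show ?thesis .
qed

lemma kernel_bound_heat_kernel: "0 < t \<Longrightarrow> kernel_bound (G t) 1 t"
  using heat_kernel_le[of t] by (simp add: kernel_bound_def nn_integral_heat_kernel heat_kernel_nonneg)

lemma has_derivative_heat_kernel:
  assumes "0 < t"
  shows "(G t has_derivative (\<lambda>v. - (x \<bullet> v) / (2 * t) * G t x)) (at x)"
proof -
  have "((\<lambda>x. (4 * pi * t) powr (- 3/2) * exp (- (x \<bullet> x) / (4 * t))) has_derivative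
     (\<lambda>v. - (x \<bullet> v) / (2 * t) * ((4 * pi * t) powr (- 3/2) * exp (- (x \<bullet> x) / (4 * t))))) (at x)"
    using assms by (auto intro!: derivative_eq_intros simp: inner_commute field_simps)
  then show ?thesis
    by (simp add: heat_kernel_def[abs_def] power2_norm_eq_inner)
qed

lemma partial_deriv_heat_kernel:
  assumes "0 < t"
  shows "partial_deriv k (G t) x = - (x $ k) / (2 * t) * G t x"
  unfolding partial_deriv_def frechet_derivative_at[OF has_derivative_heat_kernel[OF assms], symmetric]
  by (simp add: inner_axis)

section \<open>Gaussian bounds\<close>

text \<open>A common majorant, equal to \<open>8 * G (4 * t)\<close>. It is wide enough to absorb
  polynomial factors, times up to \<open>2 * t\<close> and shifts up to
  \<open>sqrt t\<close>.\<close>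

definition wide_gaussian :: "real \<Rightarrow> real^3 \<Rightarrow> real" where
  "wide_gaussian t x = (4 * pi * t) powr (- 3/2) * exp (- (norm x)\<^sup>2 / (16 * t))"

lemma wide_gaussian_nonneg: "0 \<le> wide_gaussian t x"
  by (simp add: wide_gaussian_def)

lemma kernel_bound_wide_gaussian:
  assumes t: "0 < t"
  shows "kernel_bound (wide_gaussian t) 8 t"
proof -
  have "(4::real) powr (3/2) = (2 powr 2) powr (3/2)"
    by simp
  also have "\<dots> = 8"
    by (simp only: powr_powr) simp
  finally have 4: "(4::real) powr (3/2) = 8" .
  have "wide_gaussian t x = 8 * G (4 * t) x" for x
  proof -
    have "(4 * pi * (4 * t)) powr (- 3/2) = (4 * (4 * pi * t)) powr (- 3/2)"
      by (simp add: mult_ac)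
    also have "\<dots> = 4 powr (- 3/2) * (4 * pi * t) powr (- 3/2)"
      by (rule powr_mult)
    finally show ?thesis
      using t by (simp add: wide_gaussian_def heat_kernel_def powr_minus 4)
  qed
  then have eq: "wide_gaussian t = (\<lambda>x. 8 * G (4 * t) x)"
    by auto
  have "kernel_bound (wide_gaussian t) (8 * 1) (4 * t)"
    using t unfolding eq
    by (intro kernel_bound_dominated[OF kernel_bound_heat_kernel]) (auto simp: abs_mult)
  then show ?thesis
    using t by (auto intro: kernel_bound_mono)
qed

lemma heat_kernel_eq: "G t x = (4 * pi * t) powr (- 3/2) * exp (- ((norm x)\<^sup>2 / (4 * t)))"
  by (simp add: heat_kernel_def)

text \<open>Half of the Gaussian exponent absorbs the factor \<open>c\<close>. The remaining half,
  |x|^2 / (8 s), is still at least the exponent of \<open>wide_gaussian t\<close> because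
  \<open>s \<le> 2 * t\<close>.\<close>

lemma gaussian_poly_le:
  assumes t: "0 < t" "t \<le> s" "s \<le> 2 * t" and c: "c \<le> K * exp ((norm x)\<^sup>2 / (4 * s) / 2)" and K: "0 \<le> K"
  shows "c * G s x \<le> K * wide_gaussian t x"
proof -
  let ?u = "(norm x)\<^sup>2 / (4 * s)"
  have "c * G s x \<le> K * exp (?u / 2) * G s x"
    by (intro mult_right_mono c heat_kernel_nonneg)
  also have "\<dots> = K * ((4 * pi * s) powr (- 3/2) * exp (- (?u / 2)))"
    by (simp add: heat_kernel_eq exp_minus[symmetric] exp_add[symmetric] mult_ac mult_exp_exp)
  also have "\<dots> \<le> K * wide_gaussian t x"
  proof -
    have "(norm x)\<^sup>2 / (16 * t) \<le> ?u / 2"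
      using t by (simp add: frac_le mult_left_mono)
    moreover have "(4 * pi * s) powr (- 3/2) \<le> (4 * pi * t) powr (- 3/2)"
      using t by (intro powr_mono2') auto
    ultimately show ?thesis
      unfolding wide_gaussian_def using K by (intro mult_left_mono mult_mono) auto
  qed
  finally show ?thesis .
qed

lemma exp_half_ge:
  assumes "0 \<le> (u::real)"
  shows "1 + u / 2 + u\<^sup>2/8 \<le> exp (u / 2)"
  using exp_lower_Taylor_quadratic[of "u / 2"] assms by (simp add: power2_eq_square)

lemma sqrt_le_half: "0 \<le> (u::real) \<Longrightarrow> sqrt u \<le> (1 + u) / 2"
  using arith_geo_mean_sqrt[of 1 u] by simp

text \<open>With \<open>u\<close> for |x|^2 / (4 t), these factors belong to the kernel, its space
  derivative, its time derivative, the time derivative of a space derivative, and a second space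
  derivative. Lower Taylor bounds of the exponential dominate each of them.\<close>

lemma gaussian_coeffs:
  assumes "0 \<le> (u::real)"
  shows "1 \<le> 4 * exp (u / 2)" "sqrt u \<le> 1 * exp (u / 2)" "u + 3/2 \<le> 4 * exp (u / 2)"
    "sqrt u * (u + 5/2) \<le> 4 * exp (u / 2)" "1/2 + u \<le> 2 * exp (u / 2)"
proof -
  note e = exp_half_ge[OF assms] and s = sqrt_le_half[OF assms]
  have sq: "0 \<le> u\<^sup>2" by simp
  show "1 \<le> 4 * exp (u / 2)"
    using e sq assms by linarith
  show "sqrt u \<le> 1 * exp (u / 2)"
  proof -
    have "(1 + u) / 2 \<le> 1 + u / 2"
      by (simp add: field_simps)
    also have "\<dots> \<le> exp (u / 2)"
      using e sq by linarith
    finally show ?thesis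
      using order_trans[OF s] by simp
  qed
  show "u + 3/2 \<le> 4 * exp (u / 2)"
    using e sq assms by linarith
  show "1/2 + u \<le> 2 * exp (u / 2)"
    using e sq assms by linarith
  have "sqrt u * (u + 5/2) \<le> (1 + u) / 2 * (u + 5/2)"
    using assms by (intro mult_right_mono s) auto
  also have "\<dots> = u\<^sup>2/2 + 7/4 * u + 5/4"
    by (simp add: power2_eq_square field_simps)
  also have "\<dots> \<le> 4 * exp (u / 2)"
    using e assms by linarith
  finally show "sqrt u * (u + 5/2) \<le> 4 * exp (u / 2)" .
qed

lemma abs_coord_le_sqrt:
  assumes t: "0 < t" and c: "\<bar>c\<bar> \<le> norm (x::real^3)"
  shows "\<bar>c / (2 * t)\<bar> \<le> t powr (- 1/2) * sqrt ((norm x)\<^sup>2 / (4 * t))"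
proof -
  have "sqrt ((norm x)\<^sup>2 / (4 * t)) = norm x / (2 * sqrt t)"
    using t by (simp add: real_sqrt_divide real_sqrt_mult)
  moreover have "t powr (- 1/2) = 1 / sqrt t"
    using t by (simp add: powr_half_sqrt[symmetric] powr_minus_divide)
  ultimately have "t powr (- 1/2) * sqrt ((norm x)\<^sup>2 / (4 * t)) = norm x / (2 * t)"
    using t by simp
  then show ?thesis
    using t c by (simp add: abs_divide divide_right_mono)
qed

lemma DERIV_heat_kernel_time:
  assumes t: "0 < t"
  shows "((\<lambda>t. G t x) has_field_derivative
     ((norm x)\<^sup>2 / (4 * t) - 3/2) / t * G t x) (at t)"
proof -
  have 1: "((\<lambda>t. (4 * pi * t) powr (- 3/2)) has_field_derivative
     (- 3/2) * (4 * pi * t) powr (- 3/2 - 1) * (4 * pi)) (at t)"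
    using t by (auto intro!: derivative_eq_intros)
  have "(4 * pi * t) powr (- 3/2) = (4 * pi * t) powr (- 3/2 - 1) * (4 * pi * t)"
    using t powr_add[of "4 * pi * t" "- 3/2 - 1" 1] by simp
  then have 2: "(- 3/2) * (4 * pi * t) powr (- 3/2 - 1) * (4 * pi) = - 3/2 / t * (4 * pi * t) powr (- 3/2)"
    using t by simp
  have 3: "((\<lambda>t. exp (- ((norm x)\<^sup>2 / (4 * t)))) has_field_derivative
     exp (- ((norm x)\<^sup>2 / (4 * t))) * ((norm x)\<^sup>2 / (4 * t) / t)) (at t)"
    using t by (auto intro!: derivative_eq_intros simp: field_simps power2_eq_square)
  show ?thesis
    unfolding heat_kernel_eq
    by (rule DERIV_cong[OF DERIV_mult[OF 1[unfolded 2] 3]]) (use t in \<open>simp add: field_simps\<close>)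
qed

lemma DERIV_heat_kernel_line:
  assumes t: "0 < t"
  shows "((\<lambda>r. G t (x + r *\<^sub>R h)) has_field_derivative
     - ((x + r *\<^sub>R h) \<bullet> h) / (2 * t) * G t (x + r *\<^sub>R h)) (at r)"
proof -
  have "((\<lambda>r. x + r *\<^sub>R h) has_derivative (\<lambda>r. r *\<^sub>R h)) (at r)"
    by (auto intro!: derivative_eq_intros)
  from has_derivative_compose[OF this has_derivative_heat_kernel[OF t]]
  show ?thesis
    by (rule has_derivative_imp_has_field_derivative) (simp add: mult_ac)
qed

text \<open>With \<open>y\<close> the shifted point, |x|^2 is at most 2 |y|^2 + 2 t. Comparing the
  exponents therefore loses only 1/8, and \<open>exp (1/8) \<le> 2\<close> is the extra
  factor.\<close>

lemma heat_kernel_shifted_le: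
  assumes t: "0 < t" and h: "norm h \<le> sqrt t" and r: "0 \<le> r" "r \<le> 1"
    and c: "c \<le> K * exp ((norm (x + r *\<^sub>R h))\<^sup>2 / (4 * t) / 2)" and K: "0 \<le> K"
  shows "c * G t (x + r *\<^sub>R h) \<le> 2 * K * wide_gaussian t x"
proof -
  define y where "y = x + r *\<^sub>R h"
  let ?u = "(norm y)\<^sup>2 / (4 * t)"
  have "norm x \<le> norm y + norm (r *\<^sub>R h)"
    using norm_triangle_ineq4[of "x + r *\<^sub>R h" "r *\<^sub>R h"] by (simp add: y_def)
  moreover have "norm (r *\<^sub>R h) \<le> sqrt t"
    using h r mult_mono[of r 1 "norm h" "sqrt t"] by simp
  ultimately have "norm x \<le> norm y + sqrt t" by linarith
  then have "(norm x)\<^sup>2 \<le> (norm y + sqrt t)\<^sup>2"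
    by (intro power_mono) auto
  also have "\<dots> \<le> 2 * (norm y)\<^sup>2 + 2 * t"
    using sum_squares_bound[of "norm y" "sqrt t"] t by (simp add: power2_sum)
  finally have nx: "(norm x)\<^sup>2 \<le> 2 * (norm y)\<^sup>2 + 2 * t" .
  have "(norm x)\<^sup>2 / (16 * t) \<le> (2 * (norm y)\<^sup>2 + 2 * t) / (16 * t)"
    using nx t by (intro divide_right_mono) auto
  also have "\<dots> = ?u / 2 + 1/8"
    using t by (simp add: field_simps)
  finally have "- (?u / 2) \<le> 1/8 + - (norm x)\<^sup>2 / (16 * t)"
    by simp
  then have "exp (- (?u / 2)) \<le> exp (1/8) * exp (- (norm x)\<^sup>2 / (16 * t))"
    by (simp flip: exp_add)
  also have "exp (1/8) \<le> (2 :: real)"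
    using exp_bound_half[of "1/8 :: real"] by simp
  finally have ex: "exp (- (?u / 2)) \<le> 2 * exp (- (norm x)\<^sup>2 / (16 * t))"
    by simp
  have "c * G t y \<le> K * exp (?u / 2) * G t y"
    using c unfolding y_def by (intro mult_right_mono heat_kernel_nonneg)
  also have "\<dots> = K * (4 * pi * t) powr (- 3/2) * exp (- (?u / 2))"
    by (simp add: heat_kernel_eq mult_ac mult_exp_exp)
  also have "\<dots> \<le> K * (4 * pi * t) powr (- 3/2) * (2 * exp (- (norm x)\<^sup>2 / (16 * t)))"
    using K by (intro mult_left_mono ex) auto
  finally show ?thesis
    by (simp add: y_def wide_gaussian_def mult_ac)
qed

text \<open>What the Duhamel estimates use of a kernel: its size, and its increments in time and
  space relative to the parabolic scales \<open>t\<close> and \<open>sqrt t\<close>. The order \<mu>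
  is 0 for the heat kernel and 1/2 for its space derivatives, so both are treated by the same
  lemmas.\<close>

definition heat_like :: "(real \<Rightarrow> real^3 \<Rightarrow> real) \<Rightarrow> real \<Rightarrow> real \<Rightarrow> bool" where
  "heat_like K \<mu> A \<longleftrightarrow> 0 \<le> \<mu> \<and> 0 \<le> A \<and>
     (\<forall>t>0. kernel_bound (K t) (A * t powr (- \<mu>)) t) \<and>
     (\<forall>t>0. \<forall>t'. t \<le> t' \<and> t' \<le> 2 * t \<longrightarrow>
        kernel_bound (\<lambda>x. K t' x - K t x) (A * ((t' - t) / t) * t powr (- \<mu>)) t) \<and>
     (\<forall>t>0. \<forall>h. norm h \<le> sqrt t \<longrightarrow>
        kernel_bound (\<lambda>x. K t (x + h) - K t x) (A * (norm h / sqrt t) * t powr (- \<mu>)) t)"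

text \<open>The increments come from the mean value theorem, in time and along the segment from
  \<open>x\<close> to \<open>x + h\<close>. The constant 32 is 4 * 8, the pointwise factor times the
  constant of \<open>kernel_bound_wide_gaussian\<close>.\<close>

lemma heat_likeI:
  assumes \<mu>: "0 \<le> \<mu>" and meas[measurable]: "\<And>t. 0 < t \<Longrightarrow> K t \<in> borel_measurable borel"
    and 1: "\<And>t x. 0 < t \<Longrightarrow> \<bar>K t x\<bar> \<le> 4 * t powr (- \<mu>) * wide_gaussian t x"
    and 2: "\<And>t s x. 0 < t \<Longrightarrow> t \<le> s \<Longrightarrow> s \<le> 2 * t \<Longrightarrow>
       \<exists>D. ((\<lambda>s. K s x) has_field_derivative D) (at s) \<and> \<bar>D\<bar> \<le> 4 / t * t powr (- \<mu>) * wide_gaussian t x"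
    and 3: "\<And>t x h r. 0 < t \<Longrightarrow> norm h \<le> sqrt t \<Longrightarrow> 0 \<le> r \<Longrightarrow> r \<le> 1 \<Longrightarrow>
       \<exists>D. ((\<lambda>r. K t (x + r *\<^sub>R h)) has_field_derivative D) (at r) \<and>
         \<bar>D\<bar> \<le> 4 * (norm h / sqrt t) * t powr (- \<mu>) * wide_gaussian t x"
  shows "heat_like K \<mu> 32"
proof -
  have MVT': "\<bar>f b - f a\<bar> \<le> (b - a) * B"
    if ab: "a \<le> b" "\<And>z. a \<le> z \<Longrightarrow> z \<le> b \<Longrightarrow> \<exists>D. (f has_field_derivative D) (at z) \<and> \<bar>D\<bar> \<le> B"
    for f :: "real \<Rightarrow> real" and a b B
  proof (cases "a = b")
    case False
    obtain f' where f': "\<And>z. a \<le> z \<Longrightarrow> z \<le> b \<Longrightarrow> (f has_field_derivative f' z) (at z) \<and> \<bar>f' z\<bar> \<le> B"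
      using ab(2) by metis
    from MVT2[of a b f f'] False ab(1) f' obtain z where z: "a < z" "z < b" "f b - f a = (b - a) * f' z"
      by (auto simp: less_le)
    then show ?thesis
      using f'[of z] ab(1) by (auto simp: abs_mult intro!: mult_left_mono)
  qed auto
  have dom: "kernel_bound k (32 * c) t"
    if "0 < t" "k \<in> borel_measurable borel" "0 \<le> c" "\<And>x. \<bar>k x\<bar> \<le> 4 * c * wide_gaussian t x" for k c t
    using kernel_bound_dominated[OF kernel_bound_wide_gaussian[OF that(1)], of k "4 * c"] that
    by (simp add: wide_gaussian_nonneg)
  show ?thesis
    unfolding heat_like_def
  proof (intro conjI allI impI \<mu>)
    fix t :: real assume t: "0 < t"
    show "kernel_bound (K t) (32 * t powr (- \<mu>)) t"
      using t 1 by (intro dom) auto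
  next
    fix t t' :: real assume t: "0 < t" and "t \<le> t' \<and> t' \<le> 2 * t"
    then have t': "t \<le> t'" "t' \<le> 2 * t" "0 < t'" by auto
    have "kernel_bound (\<lambda>x. K t' x - K t x) (32 * ((t' - t) / t * t powr (- \<mu>))) t"
    proof (rule dom)
      fix x
      have "\<bar>K t' x - K t x\<bar> \<le> (t' - t) * (4 / t * t powr (- \<mu>) * wide_gaussian t x)"
        using t t' by (intro MVT'[of t t' "\<lambda>s. K s x"] 2) auto
      then show "\<bar>K t' x - K t x\<bar> \<le> 4 * ((t' - t) / t * t powr (- \<mu>)) * wide_gaussian t x"
        by (simp add: mult_ac)
    qed (use t t' meas in auto)
    then show "kernel_bound (\<lambda>x. K t' x - K t x) (32 * ((t' - t) / t) * t powr (- \<mu>)) t"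
      by (simp only: mult.assoc)
  next
    fix t :: real and h :: "real^3" assume t: "0 < t" and h: "norm h \<le> sqrt t"
    have "kernel_bound (\<lambda>x. K t (x + h) - K t x) (32 * ((norm h / sqrt t) * t powr (- \<mu>))) t"
    proof (rule dom)
      fix x
      have "\<bar>K t (x + 1 *\<^sub>R h) - K t (x + 0 *\<^sub>R h)\<bar>
          \<le> (1 - 0) * (4 * (norm h / sqrt t) * t powr (- \<mu>) * wide_gaussian t x)"
        using t h by (intro MVT'[of 0 1 "\<lambda>r. K t (x + r *\<^sub>R h)"] 3) auto
      then show "\<bar>K t (x + h) - K t x\<bar> \<le> 4 * (norm h / sqrt t * t powr (- \<mu>)) * wide_gaussian t x"
        by (simp add: mult_ac)
    qed (use t meas in auto)
    then show "kernel_bound (\<lambda>x. K t (x + h) - K t x) (32 * (norm h / sqrt t) * t powr (- \<mu>)) t"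
      by (simp only: mult.assoc)
  qed auto
qed

lemma heat_kernel_line_derivative:
  assumes t: "0 < t" and h: "norm h \<le> sqrt t" and r: "0 \<le> r" "r \<le> 1"
  shows "\<exists>D. ((\<lambda>r. G t (x + r *\<^sub>R h)) has_field_derivative D) (at r) \<and>
         \<bar>D\<bar> \<le> 4 * (norm h / sqrt t) * wide_gaussian t x"
proof -
  let ?y = "x + r *\<^sub>R h"
  let ?u = "(norm ?y)\<^sup>2 / (4 * t)"
  have u: "0 \<le> ?u" using t by auto
  have "\<bar>- (?y \<bullet> h) / (2 * t)\<bar> \<le> norm h * \<bar>norm ?y / (2 * t)\<bar>"
    using t Cauchy_Schwarz_ineq2[of ?y h] by (simp add: divide_right_mono mult.commute)
  also have "\<dots> \<le> norm h * (t powr (- 1/2) * sqrt ?u)"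
    using t by (intro mult_left_mono abs_coord_le_sqrt) auto
  also have "\<dots> = norm h / sqrt t * sqrt ?u"
    using t by (simp add: powr_half_sqrt[symmetric] powr_minus_divide)
  finally have "\<bar>- (?y \<bullet> h) / (2 * t)\<bar> * G t ?y \<le> norm h / sqrt t * sqrt ?u * G t ?y"
    by (intro mult_right_mono heat_kernel_nonneg)
  also have "\<dots> = norm h / sqrt t * (sqrt ?u * G t ?y)"
    by (simp only: mult.assoc)
  also have "\<dots> \<le> norm h / sqrt t * (2 * 1 * wide_gaussian t x)"
    using t h r u by (intro mult_left_mono heat_kernel_shifted_le gaussian_coeffs) auto
  also have "\<dots> \<le> 4 * (norm h / sqrt t) * wide_gaussian t x"
    using t by (simp add: wide_gaussian_nonneg mult_right_mono divide_right_mono)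
  finally have "\<bar>- (?y \<bullet> h) / (2 * t) * G t ?y\<bar> \<le> 4 * (norm h / sqrt t) * wide_gaussian t x"
    by (simp add: abs_mult heat_kernel_nonneg)
  then show "\<exists>D. ((\<lambda>r. G t (x + r *\<^sub>R h)) has_field_derivative D) (at r) \<and>
         \<bar>D\<bar> \<le> 4 * (norm h / sqrt t) * wide_gaussian t x"
    using DERIV_heat_kernel_line[OF t, of x h r] by blast
qed

lemma heat_like_heat_kernel: "heat_like G 0 32"
proof (rule heat_likeI)
  fix t :: real and x :: "real^3" assume t: "0 < t"
  have "1 * G t x \<le> 4 * wide_gaussian t x"
    using t by (intro gaussian_poly_le gaussian_coeffs) auto
  then show "\<bar>G t x\<bar> \<le> 4 * t powr - 0 * wide_gaussian t x"
    using t by (simp add: heat_kernel_nonneg)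
next
  fix t s :: real and x :: "real^3" assume t: "0 < t" "t \<le> s" "s \<le> 2 * t"
  let ?u = "(norm x)\<^sup>2 / (4 * s)"
  have u: "0 \<le> ?u" using t by auto
  have "\<bar>?u - 3/2\<bar> * G s x \<le> (?u + 3/2) * G s x"
    using u by (intro mult_right_mono heat_kernel_nonneg) auto
  also have "\<dots> \<le> 4 * wide_gaussian t x"
    using t u by (intro gaussian_poly_le gaussian_coeffs) auto
  finally have "\<bar>?u - 3/2\<bar> * G s x / s \<le> 4 * wide_gaussian t x / t"
    using t by (intro frac_le) (auto simp: wide_gaussian_nonneg)
  then have "\<bar>(?u - 3/2) / s * G s x\<bar> \<le> 4 / t * t powr - 0 * wide_gaussian t x"
    using t by (simp add: abs_mult abs_divide heat_kernel_nonneg)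
  then show "\<exists>D. ((\<lambda>s. G s x) has_field_derivative D) (at s) \<and> \<bar>D\<bar> \<le> 4 / t * t powr - 0 * wide_gaussian t x"
    using DERIV_heat_kernel_time[of s x] t by auto
next
  fix t r :: real and x h :: "real^3" assume t: "0 < t" and h: "norm h \<le> sqrt t" and r: "0 \<le> r" "r \<le> 1"
  show "\<exists>D. ((\<lambda>r. G t (x + r *\<^sub>R h)) has_field_derivative D) (at r) \<and>
         \<bar>D\<bar> \<le> 4 * (norm h / sqrt t) * t powr - 0 * wide_gaussian t x"
    using heat_kernel_line_derivative[OF t h r, of x] t by simp
qed auto

lemma heat_like_partial_deriv: "heat_like (\<lambda>t. partial_deriv k (G t)) (1/2) 32"
proof (rule heat_likeI)
  fix t :: real assume "0 < t"
  then have "partial_deriv k (G t) = (\<lambda>x. - (x $ k) / (2 * t) * G t x)"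
    by (intro ext partial_deriv_heat_kernel)
  then show "partial_deriv k (G t) \<in> borel_measurable borel"
    by simp
next
  fix t :: real and x :: "real^3" assume t: "0 < t"
  let ?u = "(norm x)\<^sup>2 / (4 * t)"
  have u: "0 \<le> ?u" using t by auto
  have "\<bar>x $ k / (2 * t)\<bar> * G t x \<le> t powr (- 1/2) * sqrt ?u * G t x"
    using t by (intro mult_right_mono abs_coord_le_sqrt component_le_norm_cart heat_kernel_nonneg)
  also have "\<dots> = t powr (- 1/2) * (sqrt ?u * G t x)"
    by simp
  also have "\<dots> \<le> t powr (- 1/2) * (1 * wide_gaussian t x)"
    using t u by (intro mult_left_mono gaussian_poly_le gaussian_coeffs) auto
  also have "\<dots> \<le> 4 * t powr - (1/2) * wide_gaussian t x"
    using t by (simp add: wide_gaussian_nonneg)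
  finally show "\<bar>partial_deriv k (G t) x\<bar> \<le> 4 * t powr - (1/2) * wide_gaussian t x"
    using t by (simp add: partial_deriv_heat_kernel abs_mult abs_divide heat_kernel_nonneg)
next
  fix t s :: real and x :: "real^3" assume t: "0 < t" "t \<le> s" "s \<le> 2 * t"
  let ?u = "(norm x)\<^sup>2 / (4 * s)"
  have u: "0 \<le> ?u" and s: "0 < s" using t by auto
  \<comment> \<open>Here 5/2 is 3/2 + 1: the prefactor \<open>- (x $ k) / (2 * s)\<close>
    contributes one more \<open>1 / s\<close> to the time derivative.\<close>
  let ?D = "x $ k / (2 * s) * ((5/2 - ?u) / s * G s x)"
  have ev: "\<forall>\<^sub>F s in nhds s. partial_deriv k (G s) x = - (x $ k) / (2 * s) * G s x"
    using s by (auto intro: eventually_mono[OF eventually_nhds_in_open[of "{0<..}"]] simp: partial_deriv_heat_kernel)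
  have "((\<lambda>s. - (x $ k) / (2 * s)) has_field_derivative x $ k / (2 * s) / s) (at s)"
    using s by (auto intro!: derivative_eq_intros simp: field_simps)
  from DERIV_mult[OF this DERIV_heat_kernel_time[OF s, of x]]
  have "((\<lambda>s. - (x $ k) / (2 * s) * G s x) has_field_derivative ?D) (at s)"
    by (rule DERIV_cong) (use s in \<open>simp add: field_simps\<close>)
  then have D: "((\<lambda>s. partial_deriv k (G s) x) has_field_derivative ?D) (at s)"
    using DERIV_cong_ev[OF refl ev refl] by simp
  have abs_le: "\<bar>5/2 - ?u\<bar> \<le> ?u + 5/2"
    using u by linarith
  have "\<bar>?D\<bar> = \<bar>x $ k / (2 * s)\<bar> * (\<bar>5/2 - ?u\<bar> / s * G s x)"
    using s by (simp add: abs_mult abs_divide heat_kernel_nonneg)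
  also have "\<dots> \<le> s powr (- 1/2) * sqrt ?u * ((?u + 5/2) / s * G s x)"
    using s u
    by (intro mult_mono abs_coord_le_sqrt component_le_norm_cart divide_right_mono order_refl mult_nonneg_nonneg abs_le)
       (auto simp: heat_kernel_nonneg)
  also have "\<dots> = s powr (- 1/2) / s * (sqrt ?u * (?u + 5/2) * G s x)"
    by simp
  also have "\<dots> \<le> s powr (- 1/2) / s * (4 * wide_gaussian t x)"
    using t u s by (intro mult_left_mono gaussian_poly_le gaussian_coeffs) auto
  also have "\<dots> \<le> t powr (- 1/2) / t * (4 * wide_gaussian t x)"
    using t s by (intro mult_right_mono frac_le powr_mono2') (auto simp: wide_gaussian_nonneg)
  finally have "\<bar>?D\<bar> \<le> 4 / t * t powr - (1/2) * wide_gaussian t x"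
    by (simp add: mult_ac)
  with D show "\<exists>D. ((\<lambda>s. partial_deriv k (G s) x) has_field_derivative D) (at s) \<and>
     \<bar>D\<bar> \<le> 4 / t * t powr - (1/2) * wide_gaussian t x"
    by blast
next
  fix t r :: real and x h :: "real^3" assume t: "0 < t" and h: "norm h \<le> sqrt t" and r: "0 \<le> r" "r \<le> 1"
  let ?y = "x + r *\<^sub>R h"
  let ?u = "(norm ?y)\<^sup>2 / (4 * t)"
  have u: "0 \<le> ?u" using t by auto
  let ?D = "(?y $ k / (2 * t) * ((?y \<bullet> h) / (2 * t)) - h $ k / (2 * t)) * G t ?y"
  have "((\<lambda>r. - ((x + r *\<^sub>R h) $ k) / (2 * t)) has_field_derivative - (h $ k) / (2 * t)) (at r)"
    using t by (auto intro!: derivative_eq_intros simp: field_simps)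
  from DERIV_mult[OF this DERIV_heat_kernel_line[OF t, of x h r]]
  have D: "((\<lambda>r. partial_deriv k (G t) (x + r *\<^sub>R h)) has_field_derivative ?D) (at r)"
    unfolding partial_deriv_heat_kernel[OF t] by (rule DERIV_cong) (use t in \<open>simp add: field_simps\<close>)
  have "\<bar>?y $ k / (2 * t) * ((?y \<bullet> h) / (2 * t)) - h $ k / (2 * t)\<bar>
     \<le> \<bar>?y $ k / (2 * t)\<bar> * \<bar>(?y \<bullet> h) / (2 * t)\<bar> + \<bar>h $ k / (2 * t)\<bar>"
    by (simp only: abs_mult[symmetric] abs_triangle_ineq4)
  also have "\<dots> \<le> (norm ?y / (2 * t)) * (norm ?y * norm h / (2 * t)) + norm h / (2 * t)"
    using t component_le_norm_cart[of h k] component_le_norm_cart[of ?y k] Cauchy_Schwarz_ineq2[of ?y h]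
    by (intro add_mono mult_mono) (auto simp: abs_divide divide_right_mono)
  also have "\<dots> = norm h / t * (1/2 + ?u)"
    using t by (simp add: field_simps power2_eq_square)
  finally have coeff: "\<bar>?y $ k / (2 * t) * ((?y \<bullet> h) / (2 * t)) - h $ k / (2 * t)\<bar> \<le> norm h / t * (1/2 + ?u)" .
  have "\<bar>?D\<bar> \<le> norm h / t * (1/2 + ?u) * G t ?y"
    unfolding abs_mult[of _ "G t ?y"] abs_of_nonneg[OF heat_kernel_nonneg]
    by (rule mult_right_mono[OF coeff heat_kernel_nonneg])
  also have "\<dots> = norm h / t * ((1/2 + ?u) * G t ?y)"
    by simp
  also have "\<dots> \<le> norm h / t * (2 * 2 * wide_gaussian t x)"
    using t h r u by (intro mult_left_mono heat_kernel_shifted_le gaussian_coeffs) auto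
  also have "norm h / t = norm h / sqrt t * t powr - (1/2)"
    using t by (simp add: powr_half_sqrt[symmetric] powr_minus_divide powr_add[symmetric])
  finally have "\<bar>?D\<bar> \<le> 4 * (norm h / sqrt t) * t powr - (1/2) * wide_gaussian t x"
    by (simp add: mult_ac)
  with D show "\<exists>D. ((\<lambda>r. partial_deriv k (G t) (x + r *\<^sub>R h)) has_field_derivative D) (at r) \<and>
         \<bar>D\<bar> \<le> 4 * (norm h / sqrt t) * t powr - (1/2) * wide_gaussian t x"
    by blast
qed auto

section \<open>Duhamel integrals\<close>

text \<open>Sources are singular at time zero, so \<open>S\<close> is mostly \<open>{0<..T}\<close>;
  the continuity is then local, without uniformity as the time tends to zero.\<close>

definition Lp_cont :: "real \<Rightarrow> real set \<Rightarrow> (real \<Rightarrow> real^3 \<Rightarrow> 'b::euclidean_space) \<Rightarrow> bool" where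
  "Lp_cont p S f \<longleftrightarrow> (\<forall>t\<in>S. (\<exists>N. Lp_bound p (f t) N) \<and>
     (\<forall>e>0. \<exists>d>0. \<forall>s\<in>S. \<bar>s - t\<bar> < d \<longrightarrow> Lp_bound p (\<lambda>x. f s x - f t x) e))"

lemma Lp_cont_subset: "Lp_cont p S f \<Longrightarrow> T \<subseteq> S \<Longrightarrow> Lp_cont p T f"
  unfolding Lp_cont_def by (meson subsetD)

lemma Lp_contD:
  assumes "Lp_cont p S f" "t \<in> S"
  obtains N where "Lp_bound p (f t) N"
  using assms by (auto simp: Lp_cont_def)

lemma Lp_contE:
  assumes "Lp_cont p S f" "t \<in> S" "0 < e"
  obtains d where "0 < d" "\<And>s. s \<in> S \<Longrightarrow> \<bar>s - t\<bar> < d \<Longrightarrow> Lp_bound p (\<lambda>x. f s x - f t x) e"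
  using assms unfolding Lp_cont_def by meson

lemma heat_like_nonneg: "heat_like K \<mu> A \<Longrightarrow> 0 \<le> \<mu>" "heat_like K \<mu> A \<Longrightarrow> 0 \<le> A"
  by (auto simp: heat_like_def)

lemma heat_like_bound: "heat_like K \<mu> A \<Longrightarrow> 0 < t \<Longrightarrow> kernel_bound (K t) (A * t powr (- \<mu>)) t"
  by (auto simp: heat_like_def)

lemma heat_like_time:
  "heat_like K \<mu> A \<Longrightarrow> 0 < t \<Longrightarrow> t \<le> t' \<Longrightarrow> t' \<le> 2 * t \<Longrightarrow>
    kernel_bound (\<lambda>x. K t' x - K t x) (A * ((t' - t) / t) * t powr (- \<mu>)) t"
  by (auto simp: heat_like_def)

lemma heat_like_shift:
  "heat_like K \<mu> A \<Longrightarrow> 0 < t \<Longrightarrow> norm h \<le> sqrt t \<Longrightarrow>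
    kernel_bound (\<lambda>x. K t (x + h) - K t x) (A * (norm h / sqrt t) * t powr (- \<mu>)) t"
  by (auto simp: heat_like_def)

lemma heat_like_measurable: "heat_like K \<mu> A \<Longrightarrow> 0 < t \<Longrightarrow> K t \<in> borel_measurable borel"
  by (auto dest!: heat_like_bound kernel_boundD(1))

text \<open>The family \<open>f\<close> consists of L^p representatives chosen time by time, so no
  joint measurability in time and space is available. Convolution with the smooth kernel produces a
  jointly continuous integrand, which is what Minkowski and Fubini in time rest on. The increment is
  split into a change of \<open>f\<close>, of the kernel time, and of the point.\<close>

lemma conv_joint_continuous:
  fixes f :: "real \<Rightarrow> real^3 \<Rightarrow> 'b::euclidean_space"
  assumes K: "heat_like K \<mu> A" and f: "Lp_cont p {0<..<t} f" and p: "1 \<le> p"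
  shows "continuous_on ({0<..<t} \<times> UNIV) (\<lambda>(s, x). conv (K (t - s)) (f s) x)"
  unfolding continuous_on_iff
proof (intro ballI allI impI)
  fix z :: "real \<times> (real^3)" and e :: real
  assume z: "z \<in> {0<..<t} \<times> UNIV" and e: "0 < e"
  obtain s x where [simp]: "z = (s, x)" by force
  have s: "s \<in> {0<..<t}" using z by auto
  define \<tau> where "\<tau> = t - s"
  have \<tau>: "0 < \<tau>" using s by (simp add: \<tau>_def)
  obtain N where N: "Lp_bound p (f s) N"
    using Lp_contD[OF f s] .
  have N0: "0 \<le> N" using N by (rule Lp_boundD)
  have A0: "0 \<le> A" and \<mu>0: "0 \<le> \<mu>" using heat_like_nonneg[OF K] by auto
  define c where "c = (\<tau> / 2) powr (- \<mu>) * (\<tau> / 2) powr (- 3 / (2 * p))"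
  have c0: "0 \<le> c" by (simp add: c_def)
  have c: "m powr (- \<mu>) * m powr (- 3 / (2 * p)) \<le> c" if "\<tau> / 2 \<le> m" for m
    unfolding c_def using \<tau> that \<mu>0 p by (intro mult_mono powr_mono2') auto
  define e1 where "e1 = e / 3 / (A * c + 1)"
  have Ac: "0 < A * c + 1" using A0 c0 by (simp add: add_nonneg_pos)
  have e1: "0 < e1" using e Ac by (simp add: e1_def)
  obtain d1 where d1: "0 < d1" "\<And>s'. s' \<in> {0<..<t} \<Longrightarrow> \<bar>s' - s\<bar> < d1 \<Longrightarrow> Lp_bound p (\<lambda>x. f s' x - f s x) e1"
    using Lp_contE[OF f s e1] by blast
  define C2 where "C2 = A * c * (2 / \<tau>) * N"
  define C3 where "C3 = A * c / sqrt \<tau> * N"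
  have C2: "0 \<le> C2" and C3: "0 \<le> C3"
    using A0 c0 \<tau> N0 by (auto simp: C2_def C3_def)
  \<comment> \<open>\<open>\<tau> / 2\<close> keeps both kernel times above
    \<open>\<tau> / 2\<close> and within a factor two of each other, \<open>sqrt \<tau>\<close> is
    the admissible length of a spatial shift, and the other entries bring each of the three
    increments below \<open>e / 3\<close>.\<close>
  define d where "d = Min {d1, \<tau> / 2, sqrt \<tau>, e / (3 * (C2 + 1)), e / (3 * (C3 + 1))}"
  have "0 < d"
    using d1 \<tau> e C2 C3 by (auto simp: d_def intro!: divide_pos_pos)
  moreover have "dist (case z' of (s', x') \<Rightarrow> conv (K (t - s')) (f s') x') (case z of (s, x) \<Rightarrow> conv (K (t - s)) (f s) x) < e"
    if z': "z' \<in> {0<..<t} \<times> UNIV" "dist z' z < d" for z'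
  proof -
    obtain s' x' where [simp]: "z' = (s', x')" by force
    have s': "s' \<in> {0<..<t}" using z' by auto
    have ds: "\<bar>s' - s\<bar> < d" and dx: "norm (x' - x) < d"
      using z'(2) dist_fst_le[of z' z] dist_snd_le[of z' z] by (auto simp: dist_norm dist_real_def)
    define \<tau>' where "\<tau>' = t - s'"
    have dd: "d \<le> d1" "d \<le> \<tau> / 2" "d \<le> sqrt \<tau>" "d \<le> e / (3 * (C2 + 1))" "d \<le> e / (3 * (C3 + 1))"
      unfolding d_def by (rule Min_le, simp, simp)+
    have abs\<tau>: "\<bar>\<tau>' - \<tau>\<bar> = \<bar>s' - s\<bar>"
      by (auto simp: \<tau>_def \<tau>'_def)
    then have \<tau>': "\<tau> / 2 \<le> \<tau>'" "\<tau>' \<le> 2 * \<tau>" "0 < \<tau>'" "\<tau> \<le> 2 * \<tau>'"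
      using ds dd(2) \<tau> by linarith+
    have F: "Lp_bound p (\<lambda>x. f s' x - f s x) e1"
      using d1(2)[OF s'] ds dd(1) by linarith
    obtain N' where N': "Lp_bound p (f s') N'"
      using Lp_contD[OF f s'] .
    have conv_bd: "norm (conv k g y) \<le> A * r * c * L"
      if "kernel_bound k (A * r * m powr (- \<mu>)) m" "Lp_bound p g L" "\<tau> / 2 \<le> m" "0 \<le> r"
      for k m r L y and g :: "real^3 \<Rightarrow> 'b"
    proof -
      have "norm (conv k g y) \<le> A * r * m powr (- \<mu>) * m powr (- 3 / (2 * p)) * L"
        using norm_conv_le[OF that(1,2) p] .
      also have "\<dots> = A * r * (m powr (- \<mu>) * m powr (- 3 / (2 * p))) * L"
        by (simp only: mult.assoc)
      also have "\<dots> \<le> A * r * c * L"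
        using that A0 by (intro mult_right_mono mult_left_mono c) (auto dest: Lp_boundD)
      finally show ?thesis .
    qed
    have kb1: "kernel_bound (K \<tau>') (A * 1 * \<tau>' powr (- \<mu>)) \<tau>'"
      using heat_like_bound[OF K \<tau>'(3)] by simp
    have kb2: "kernel_bound (K \<tau>) (A * 1 * \<tau> powr (- \<mu>)) \<tau>"
      using heat_like_bound[OF K \<tau>] by simp
    have "norm (conv (K \<tau>') (f s') x' - conv (K \<tau>') (f s) x') \<le> A * 1 * c * e1"
      unfolding conv_diff_right[OF kb1 N' N p p, symmetric]
      by (rule conv_bd[OF kb1 F \<tau>'(1)]) simp
    also have "\<dots> < e / 3"
    proof -
      have "A * c * e1 < (A * c + 1) * e1"
        using e1 by (intro mult_strict_right_mono) auto
      also have "\<dots> = e / 3"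
        unfolding mult.commute[of _ e1]
        by (rule nonzero_eq_divide_eq[THEN iffD1, OF _ e1_def]) (use Ac in simp)
      finally show ?thesis by simp
    qed
    finally have T1: "norm (conv (K \<tau>') (f s') x' - conv (K \<tau>') (f s) x') < e / 3" .
    have "norm (conv (K \<tau>') (f s) x' - conv (K \<tau>) (f s) x') \<le> C2 * \<bar>s' - s\<bar>"
    proof -
      have *: "norm (conv (K b) (f s) x' - conv (K a) (f s) x') \<le> C2 * (b - a)"
        if "\<tau> / 2 \<le> a" "a \<le> b" "b \<le> 2 * a" for a b
      proof -
        have a0: "0 < a" "0 < b" using that \<tau> by auto
        have "norm (conv (K b) (f s) x' - conv (K a) (f s) x') = norm (conv (\<lambda>x. K b x - K a x) (f s) x')"
          by (simp add: conv_diff_left[OF heat_like_bound[OF K a0(2)] heat_like_bound[OF K a0(1)] N p])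
        also have "\<dots> \<le> A * ((b - a) / a) * c * N"
          by (rule conv_bd[OF heat_like_time[OF K a0(1) that(2,3)] N that(1)]) (use that a0 in auto)
        also have "\<dots> \<le> A * ((b - a) / (\<tau> / 2)) * c * N"
          using A0 that \<tau> c0 N0 by (intro mult_right_mono mult_left_mono divide_left_mono) auto
        also have "\<dots> = C2 * (b - a)"
          by (simp add: C2_def)
        finally show ?thesis .
      qed
      show ?thesis
      proof (cases "\<tau> \<le> \<tau>'")
        case True
        then show ?thesis using *[of \<tau> \<tau>'] \<tau> \<tau>' abs\<tau> by auto
      next
        case False
        then show ?thesis using *[of \<tau>' \<tau>] \<tau> \<tau>' abs\<tau> by (auto simp: norm_minus_commute)
      qed
    qed
    also have "\<dots> \<le> C2 * (e / (3 * (C2 + 1)))"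
      using ds dd C2 by (intro mult_left_mono) auto
    also have "\<dots> < e / 3"
      using C2 e by (simp add: field_simps)
    finally have T2: "norm (conv (K \<tau>') (f s) x' - conv (K \<tau>) (f s) x') < e / 3" .
    define h where "h = x' - x"
    have h: "norm h \<le> sqrt \<tau>"
      using dx dd by (auto simp: h_def)
    have "norm (conv (K \<tau>) (f s) x' - conv (K \<tau>) (f s) x)
       = norm (conv (\<lambda>x. K \<tau> (x + h) - K \<tau> x) (f s) x)"
      by (simp add: conv_diff_left[OF kernel_bound_translate[OF kb2] kb2 N p] conv_translate_left h_def)
    also have "\<dots> \<le> A * (norm h / sqrt \<tau>) * c * N"
      by (rule conv_bd[OF heat_like_shift[OF K \<tau> h] N]) (use \<tau> in auto)
    also have "\<dots> = C3 * norm h"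
      by (simp add: C3_def)
    also have "\<dots> \<le> C3 * (e / (3 * (C3 + 1)))"
      using dx dd C3 by (intro mult_left_mono) (auto simp: h_def)
    also have "\<dots> < e / 3"
      using C3 e by (simp add: field_simps)
    finally have T3: "norm (conv (K \<tau>) (f s) x' - conv (K \<tau>) (f s) x) < e / 3" .
    have "conv (K \<tau>') (f s') x' - conv (K \<tau>) (f s) x
        = (conv (K \<tau>') (f s') x' - conv (K \<tau>') (f s) x')
        + (conv (K \<tau>') (f s) x' - conv (K \<tau>) (f s) x')
        + (conv (K \<tau>) (f s) x' - conv (K \<tau>) (f s) x)" (is "?l = ?a + ?b + ?c")
      by simp
    then have "norm ?l \<le> norm ?a + norm ?b + norm ?c"
      using norm_triangle_ineq[of "?a + ?b" ?c] norm_triangle_ineq[of ?a ?b] by auto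
    then have "norm ?l < e"
      using T1 T2 T3 by linarith
    then show ?thesis
      by (simp add: dist_norm \<tau>_def \<tau>'_def)
  qed
  ultimately show "\<exists>d>0. \<forall>z'\<in>{0<..<t} \<times> UNIV. dist z' z < d \<longrightarrow>
      dist (case z' of (s', x') \<Rightarrow> conv (K (t - s')) (f s') x') (case z of (s, x) \<Rightarrow> conv (K (t - s)) (f s) x) < e"
    by blast
qed

lemma time_integral_measurable:
  fixes F :: "real \<Rightarrow> real^3 \<Rightarrow> 'b::euclidean_space"
  assumes "continuous_on ({c<..<t} \<times> UNIV) (\<lambda>(s, x). F s x)"
  shows "(\<lambda>(s, x). indicator {c<..<t} s *\<^sub>R F s x) \<in> borel_measurable (lborel \<Otimes>\<^sub>M lborel)"
proof -
  have "(\<lambda>z. indicator ({c<..<t} \<times> UNIV) z *\<^sub>R (case z of (s, x) \<Rightarrow> F s x)) \<in> borel_measurable borel"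
    by (rule borel_measurable_continuous_on_indicator[OF _ assms]) (simp add: borel_open open_Times)
  also have "(\<lambda>z. indicator ({c<..<t} \<times> UNIV) z *\<^sub>R (case z of (s, x) \<Rightarrow> F s x))
     = (\<lambda>(s, x). indicator {c<..<t} s *\<^sub>R F s x)"
    by (auto simp: indicator_def fun_eq_iff)
  finally show ?thesis
    by (simp add: borel_prod[symmetric] cong: measurable_cong_sets)
qed

lemma time_integral_bound:
  fixes F :: "real \<Rightarrow> real^3 \<Rightarrow> 'b::euclidean_space"
  assumes cont: "continuous_on ({c<..<t} \<times> UNIV) (\<lambda>(s, x). F s x)" and q: "1 \<le> q"
    and F: "\<And>s. s \<in> {c<..<t} \<Longrightarrow> Lp_bound q (F s) (m s)"
    and [measurable]: "m \<in> borel_measurable borel"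
    and Z: "(\<integral>\<^sup>+s. ennreal (indicator {c<..<t} s * m s) \<partial>lborel) \<le> ennreal Z" "0 \<le> Z"
  shows "AE x in lborel. set_integrable lborel {c<..<t} (\<lambda>s. F s x)"
    and "Lp_bound q (\<lambda>x. LBINT s:{c<..<t}. F s x) Z"
proof -
  have "Lp_bound q (\<lambda>x. indicator {c<..<t} s *\<^sub>R F s x) (indicator {c<..<t} s * m s)" for s
    using F by (cases "s \<in> {c<..<t}") (auto simp: Lp_bound_zero)
  then have *: "\<And>s. s \<in> space (lborel :: real measure) \<Longrightarrow>
      Lp_bound q (\<lambda>x. indicator {c<..<t} s *\<^sub>R F s x) (indicator {c<..<t} s * m s)"
    by blast
  note mi = Minkowski_integral[OF lborel.sigma_finite_measure_axioms time_integral_measurable[OF cont] _ _ Z q]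
  show "AE x in lborel. set_integrable lborel {c<..<t} (\<lambda>s. F s x)"
    unfolding set_integrable_def by (rule mi(1)) (use * in auto)
  show "Lp_bound q (\<lambda>x. LBINT s:{c<..<t}. F s x) Z"
    unfolding set_lebesgue_integral_def by (rule mi(2)) (use * in auto)
qed

text \<open>The counterpart for the sup norm, at a fixed point \<open>x\<close>, where Minkowski's
  inequality with a finite exponent does not apply.\<close>

lemma time_integral_sup_bound:
  fixes F :: "real \<Rightarrow> real^3 \<Rightarrow> 'b::euclidean_space"
  assumes cont: "continuous_on ({c<..<t} \<times> UNIV) (\<lambda>(s, x). F s x)"
    and F: "\<And>s. s \<in> {c<..<t} \<Longrightarrow> norm (F s x) \<le> m s"
    and [measurable]: "m \<in> borel_measurable borel"
    and Z: "(\<integral>\<^sup>+s. ennreal (indicator {c<..<t} s * m s) \<partial>lborel) \<le> ennreal Z" "0 \<le> Z"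
  shows "norm (LBINT s:{c<..<t}. F s x) \<le> Z"
proof -
  have meas: "(\<lambda>s. indicator {c<..<t} s *\<^sub>R F s x) \<in> borel_measurable lborel"
    using measurable_compose_Pair1[of x lborel "\<lambda>(x, s). indicator {c<..<t} s *\<^sub>R F s x" lborel borel]
      measurable_pair_swap[OF time_integral_measurable[OF cont]] by (simp add: case_prod_unfold)
  have le: "(\<integral>\<^sup>+s. ennreal (norm (indicator {c<..<t} s *\<^sub>R F s x)) \<partial>lborel) \<le> ennreal Z"
    using F by (intro order_trans[OF nn_integral_mono Z(1)] ennreal_leI) (auto simp: indicator_def)
  then have "integrable lborel (\<lambda>s. indicator {c<..<t} s *\<^sub>R F s x)"
    using meas by (intro integrableI_bounded) (auto simp: le_less_trans)
  then have "ennreal (norm (LBINT s:{c<..<t}. F s x)) \<le> ennreal Z"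
    unfolding set_lebesgue_integral_def by (intro order_trans[OF integral_norm_bound_ennreal le])
  then show ?thesis using Z by simp
qed

section \<open>Time integrals of two singular powers\<close>

lemma nn_integral_powr_0:
  assumes t: "0 < t" and b: "b < 1"
  shows "(\<integral>\<^sup>+s. ennreal (indicator {0<..<t} s * s powr (- b)) \<partial>lborel) = ennreal (t powr (1 - b) / (1 - b))"
proof -
  have "((\<lambda>s. s powr (- b)) has_integral (t powr (- b + 1) / (- b + 1))) {0..t}"
    using t b by (intro has_integral_powr_from_0) auto
  then have "((\<lambda>s. if s \<in> {0..t} then s powr (- b) else 0) has_integral (t powr (- b + 1) / (- b + 1))) UNIV"
    by (simp only: has_integral_restrict_UNIV)
  then have "(\<integral>\<^sup>+s. ennreal (if s \<in> {0..t} then s powr (- b) else 0) \<partial>lborel) = ennreal (t powr (- b + 1) / (- b + 1))"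
    by (intro nn_integral_has_integral_lborel) auto
  moreover have "(\<integral>\<^sup>+s. ennreal (indicator {0<..<t} s * s powr (- b)) \<partial>lborel)
     = (\<integral>\<^sup>+s. ennreal (if s \<in> {0..t} then s powr (- b) else 0) \<partial>lborel)"
  proof (rule nn_integral_cong_AE)
    show "AE s in lborel. ennreal (indicator {0<..<t} s * s powr (- b)) = ennreal (if s \<in> {0..t} then s powr (- b) else 0)"
      using AE_lborel_singleton[of 0] AE_lborel_singleton[of t] by eventually_elim (auto simp: indicator_def)
  qed
  ultimately show ?thesis
    by (simp add: algebra_simps)
qed

lemma nn_integral_powr_diff:
  assumes t: "r < t" and a: "a < 1"
  shows "(\<integral>\<^sup>+s. ennreal (indicator {r<..<t} s * (t - s) powr (- a)) \<partial>lborel)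
     = ennreal ((t - r) powr (1 - a) / (1 - a))"
proof -
  have "(\<integral>\<^sup>+s. ennreal (indicator {r<..<t} s * (t - s) powr (- a)) \<partial>lborel)
      = (\<integral>\<^sup>+s. ennreal (indicator {0<..<t-r} (t - s) * (t - s) powr (- a)) \<partial>lborel)"
    by (intro nn_integral_cong) (auto simp: indicator_def)
  also have "\<dots> = (\<integral>\<^sup>+s. ennreal (indicator {0<..<t-r} s * s powr (- a)) \<partial>lborel)"
    by (rule nn_integral_reflect) measurable
  finally show ?thesis
    using nn_integral_powr_0[of "t - r" a] t a by simp
qed

text \<open>An explicit upper bound for Euler's beta function at \<open>1 - a\<close>,
  \<open>1 - b\<close>, obtained by cutting the integral at \<open>t / 2\<close>.\<close>

definition beta_const :: "real \<Rightarrow> real \<Rightarrow> real" where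
  "beta_const a b = 2 powr a / (1 - b) + 2 powr b / (1 - a)"

lemma beta_const_nonneg: "a < 1 \<Longrightarrow> b < 1 \<Longrightarrow> 0 \<le> beta_const a b"
  by (simp add: beta_const_def)

text \<open>At every time \<open>s\<close> one of the two singular factors is at most its value at
  distance \<open>t / 2\<close>. Adding both possibilities leaves two integrals of a single
  power.\<close>

lemma nn_integral_beta_le:
  assumes t: "0 < t" and a: "0 \<le> a" "a < 1" and b: "0 \<le> b" "b < 1" and C: "0 \<le> C"
  shows "(\<integral>\<^sup>+s. ennreal (indicator {0<..<t} s * (C * (t - s) powr (- a) * s powr (- b))) \<partial>lborel)
     \<le> ennreal (C * beta_const a b * t powr (1 - a - b))"
proof -
  have ptw: "(t - s) powr (- a) * s powr (- b) \<le> (t / 2) powr (- a) * s powr (- b) + (t / 2) powr (- b) * (t - s) powr (- a)"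
    if "s \<in> {0<..<t}" for s
  proof (cases "s \<le> t / 2")
    case True
    then have "(t - s) powr (- a) * s powr (- b) \<le> (t / 2) powr (- a) * s powr (- b)"
      using that a t by (intro mult_right_mono powr_mono2') auto
    also have "\<dots> \<le> (t / 2) powr (- a) * s powr (- b) + (t / 2) powr (- b) * (t - s) powr (- a)"
      by simp
    finally show ?thesis .
  next
    case False
    then have "(t - s) powr (- a) * s powr (- b) \<le> (t - s) powr (- a) * (t / 2) powr (- b)"
      using that b t by (intro mult_left_mono powr_mono2') auto
    then show ?thesis
      by (simp add: mult.commute add_increasing)
  qed
  have half: "(t / 2) powr (- c) = 2 powr c * t powr (- c)" for c
    using t by (simp add: powr_divide powr_minus field_simps)
  have "(\<integral>\<^sup>+s. ennreal (indicator {0<..<t} s * (C * (t - s) powr (- a) * s powr (- b))) \<partial>lborel)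
     \<le> (\<integral>\<^sup>+s. ennreal (C * (t / 2) powr (- a)) * ennreal (indicator {0<..<t} s * s powr (- b))
           + ennreal (C * (t / 2) powr (- b)) * ennreal (indicator {0<..<t} s * (t - s) powr (- a)) \<partial>lborel)"
  proof (rule nn_integral_mono)
    fix s
    show "ennreal (indicator {0<..<t} s * (C * (t - s) powr (- a) * s powr (- b)))
       \<le> ennreal (C * (t / 2) powr (- a)) * ennreal (indicator {0<..<t} s * s powr (- b))
           + ennreal (C * (t / 2) powr (- b)) * ennreal (indicator {0<..<t} s * (t - s) powr (- a))"
    proof (cases "s \<in> {0<..<t}")
      case True
      have "C * (t - s) powr (- a) * s powr (- b)
         \<le> C * (t / 2) powr (- a) * s powr (- b) + C * (t / 2) powr (- b) * (t - s) powr (- a)"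
        using mult_left_mono[OF ptw[OF True] C] by (simp add: algebra_simps)
      then show ?thesis
        using True C by (simp flip: ennreal_mult ennreal_plus)
    qed simp
  qed
  also have "\<dots> = ennreal (C * (t / 2) powr (- a)) * (\<integral>\<^sup>+s. ennreal (indicator {0<..<t} s * s powr (- b)) \<partial>lborel)
      + ennreal (C * (t / 2) powr (- b)) * (\<integral>\<^sup>+s. ennreal (indicator {0<..<t} s * (t - s) powr (- a)) \<partial>lborel)"
    by (subst nn_integral_add) (auto simp: nn_integral_cmult)
  also have "\<dots> = ennreal (C * (t / 2) powr (- a) * (t powr (1 - b) / (1 - b))
      + C * (t / 2) powr (- b) * (t powr (1 - a) / (1 - a)))"
    using nn_integral_powr_0[OF t b(2)] nn_integral_powr_diff[OF t a(2)] a b C t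
    by (simp flip: ennreal_mult ennreal_plus)
  also have "C * (t / 2) powr (- a) * (t powr (1 - b) / (1 - b)) + C * (t / 2) powr (- b) * (t powr (1 - a) / (1 - a))
     = C * (2 powr a / (1 - b) * (t powr (- a) * t powr (1 - b)) + 2 powr b / (1 - a) * (t powr (- b) * t powr (1 - a)))"
    unfolding half by (simp add: algebra_simps)
  also have "\<dots> = C * beta_const a b * t powr (1 - a - b)"
    unfolding powr_add[symmetric] by (simp add: beta_const_def algebra_simps)
  finally show ?thesis .
qed

text \<open>On (r, t) the weight is at most \<open>r powr (- b)\<close>, so the integral tends to
  zero as \<open>t\<close> decreases to \<open>r\<close>. This serves both time continuity and the
  continuation of uniqueness.\<close>

lemma nn_integral_tail_le:
  assumes r: "0 < r" "r < t" and a: "0 \<le> a" "a < 1" and b: "0 \<le> b" and C: "0 \<le> C"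
  shows "(\<integral>\<^sup>+s. ennreal (indicator {r<..<t} s * (C * (t - s) powr (- a) * s powr (- b))) \<partial>lborel)
     \<le> ennreal (C * r powr (- b) * ((t - r) powr (1 - a) / (1 - a)))"
proof -
  have "(\<integral>\<^sup>+s. ennreal (indicator {r<..<t} s * (C * (t - s) powr (- a) * s powr (- b))) \<partial>lborel)
     \<le> (\<integral>\<^sup>+s. ennreal (C * r powr (- b)) * ennreal (indicator {r<..<t} s * (t - s) powr (- a)) \<partial>lborel)"
  proof (rule nn_integral_mono)
    fix s
    show "ennreal (indicator {r<..<t} s * (C * (t - s) powr (- a) * s powr (- b)))
      \<le> ennreal (C * r powr (- b)) * ennreal (indicator {r<..<t} s * (t - s) powr (- a))"
    proof (cases "s \<in> {r<..<t}")
      case True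
      then have "C * (t - s) powr (- a) * s powr (- b) \<le> C * (t - s) powr (- a) * r powr (- b)"
        using r b C by (intro mult_left_mono powr_mono2') auto
      then show ?thesis
        using True C by (simp add: mult_ac flip: ennreal_mult)
    qed simp
  qed
  also have "\<dots> = ennreal (C * r powr (- b)) * (\<integral>\<^sup>+s. ennreal (indicator {r<..<t} s * (t - s) powr (- a)) \<partial>lborel)"
    by (rule nn_integral_cmult) auto
  also have "\<dots> = ennreal (C * r powr (- b) * ((t - r) powr (1 - a) / (1 - a)))"
    using nn_integral_powr_diff[OF r(2) a(2)] a C r by (simp flip: ennreal_mult)
  finally show ?thesis .
qed

definition duhamel ::
  "(real \<Rightarrow> real^3 \<Rightarrow> real) \<Rightarrow> (real \<Rightarrow> real^3 \<Rightarrow> 'b::euclidean_space) \<Rightarrow> real \<Rightarrow> real^3 \<Rightarrow> 'b" where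
  "duhamel K f t x = (LBINT s:{0<..<t}. conv (K (t - s)) (f s) x)"

lemma Lp_bound_conv_heat_like:
  fixes f :: "real^3 \<Rightarrow> 'b::euclidean_space"
  assumes K: "heat_like K \<mu> A" and t: "0 < t" and f: "Lp_bound p f N" and p: "1 \<le> p" "p \<le> q"
  shows "Lp_bound q (conv (K t) f) (A * t powr (- (\<mu> + 3/2 * (1 / p - 1 / q))) * N)"
proof -
  have e: "- (\<mu> + 3/2 * (1 / p - 1 / q)) = - \<mu> + - 3/2 * (1 / p - 1 / q)"
    by simp
  show ?thesis
    unfolding e powr_add mult.assoc[of A, symmetric] by (rule Lp_bound_conv[OF heat_like_bound[OF K t] f p])
qed

lemma norm_conv_heat_like_le:
  fixes f :: "real^3 \<Rightarrow> 'b::euclidean_space"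
  assumes K: "heat_like K \<mu> A" and t: "0 < t" and f: "Lp_bound p f N" and p: "1 \<le> p"
  shows "norm (conv (K t) f x) \<le> A * t powr (- (\<mu> + 3 / (2 * p))) * N"
proof -
  have e: "- (\<mu> + 3 / (2 * p)) = - \<mu> + - 3 / (2 * p)"
    by simp
  show ?thesis
    unfolding e powr_add mult.assoc[of A, symmetric] by (rule norm_conv_le[OF heat_like_bound[OF K t] f p])
qed

text \<open>The exponent \<open>p0\<close> supplies joint measurability of the integrand, the
  exponent \<open>p\<close> the estimate. They differ for the L^1 bound of the transport term, where
  the source is known to be continuous in time in L^(4/3) and is estimated in L^1.\<close>

lemma duhamel_bound_general:
  fixes f :: "real \<Rightarrow> real^3 \<Rightarrow> 'b::euclidean_space"
  assumes K: "heat_like K \<mu> A" and f: "Lp_cont p0 {0<..<t} f" and p0: "1 \<le> p0" and p: "1 \<le> p" "p \<le> q"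
    and m: "\<And>s. s \<in> {0<..<t} \<Longrightarrow> Lp_bound p (f s) (m s)" "m \<in> borel_measurable borel"
    and a: "a = \<mu> + 3/2 * (1 / p - 1 / q)"
    and Z: "(\<integral>\<^sup>+s. ennreal (indicator {0<..<t} s * (A * (t - s) powr (- a) * m s)) \<partial>lborel) \<le> ennreal Z" "0 \<le> Z"
  shows "AE x in lborel. set_integrable lborel {0<..<t} (\<lambda>s. conv (K (t - s)) (f s) x)"
    and "Lp_bound q (duhamel K f t) Z"
proof -
  have q: "1 \<le> q" using p by simp
  have 1: "Lp_bound q (conv (K (t - s)) (f s)) (A * (t - s) powr (- a) * m s)" if "s \<in> {0<..<t}" for s
    unfolding a using that by (intro Lp_bound_conv_heat_like[OF K] m p) auto
  note [measurable] = m(2)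
  note tib = time_integral_bound[OF conv_joint_continuous[OF K f p0] q 1 _ Z]
  show "AE x in lborel. set_integrable lborel {0<..<t} (\<lambda>s. conv (K (t - s)) (f s) x)"
    by (rule tib(1)) auto
  show "Lp_bound q (duhamel K f t) Z"
    unfolding duhamel_def by (rule tib(2)) auto
qed

lemma duhamel_bound:
  fixes f :: "real \<Rightarrow> real^3 \<Rightarrow> 'b::euclidean_space"
  assumes K: "heat_like K \<mu> A" and f: "Lp_cont p0 {0<..<t} f" and p0: "1 \<le> p0" and p: "1 \<le> p" "p \<le> q" and t: "0 < t"
    and m: "\<And>s. s \<in> {0<..<t} \<Longrightarrow> Lp_bound p (f s) (M * s powr (- b))" "0 \<le> M"
    and a: "a = \<mu> + 3/2 * (1 / p - 1 / q)" "a < 1" and b: "0 \<le> b" "b < 1"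
  shows "AE x in lborel. set_integrable lborel {0<..<t} (\<lambda>s. conv (K (t - s)) (f s) x)"
    and "Lp_bound q (duhamel K f t) (A * M * beta_const a b * t powr (1 - a - b))"
proof -
  have "1 / q \<le> 1 / p" using p by (simp add: frac_le)
  then have a0: "0 \<le> a" using heat_like_nonneg[OF K] by (simp add: a)
  have AM: "0 \<le> A * M" using heat_like_nonneg[OF K] m by simp
  have Z: "(\<integral>\<^sup>+s. ennreal (indicator {0<..<t} s * (A * (t - s) powr (- a) * (M * s powr (- b)))) \<partial>lborel)
    \<le> ennreal (A * M * beta_const a b * t powr (1 - a - b))"
    using nn_integral_beta_le[OF t a0 a(2) b AM] by (simp add: mult_ac)
  have Z0: "0 \<le> A * M * beta_const a b * t powr (1 - a - b)"
    using AM beta_const_nonneg[OF a(2) b(2)] by simp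
  show "AE x in lborel. set_integrable lborel {0<..<t} (\<lambda>s. conv (K (t - s)) (f s) x)"
    by (rule duhamel_bound_general(1)[OF K f p0 p m(1) _ a(1) Z Z0]) auto
  show "Lp_bound q (duhamel K f t) (A * M * beta_const a b * t powr (1 - a - b))"
    by (rule duhamel_bound_general(2)[OF K f p0 p m(1) _ a(1) Z Z0]) auto
qed

section \<open>Continuity of Duhamel integrals in time\<close>

text \<open>Interpolates between the size of the kernel and its Lipschitz bound in time: min(1, x)
  is at most \<open>x powr \<eta>\<close> for x = (t' - t) / t. A gain of
  \<open>(t' - t) powr \<eta>\<close> costs \<open>\<eta>\<close> in the singular exponent, whereas
  the full Lipschitz rate would cost 1.\<close>

lemma Lp_bound_conv_time_difference:
  fixes f :: "real^3 \<Rightarrow> 'b::euclidean_space"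
  assumes K: "heat_like K \<mu> A" and t: "0 < t" "t \<le> t'" and f: "Lp_bound p f N" and p: "1 \<le> p" "p \<le> q"
    and a: "a = \<mu> + 3/2 * (1 / p - 1 / q)" and \<eta>: "0 \<le> \<eta>" "\<eta> \<le> 1"
  shows "Lp_bound q (conv (\<lambda>x. K t' x - K t x) f) (2 * A * (t' - t) powr \<eta> * t powr (- a - \<eta>) * N)"
proof -
  have A0: "0 \<le> A" using heat_like_nonneg[OF K] by simp
  have N0: "0 \<le> N" using f by (rule Lp_boundD)
  have q: "1 \<le> q" using p by simp
  have "1 / q \<le> 1 / p" using p by (simp add: frac_le)
  then have a0: "0 \<le> a" using heat_like_nonneg[OF K] by (simp add: a)
  have e: "- a = - \<mu> + - 3/2 * (1 / p - 1 / q)"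
    by (simp add: a)
  have r: "((t' - t) / t) powr \<eta> * t powr (- a) = (t' - t) powr \<eta> * t powr (- a - \<eta>)"
    using t by (simp add: powr_divide powr_diff)
  show ?thesis
  proof (cases "t' \<le> 2 * t")
    case True
    have "Lp_bound q (conv (\<lambda>x. K t' x - K t x) f)
      (A * ((t' - t) / t) * t powr (- \<mu>) * t powr (- 3/2 * (1 / p - 1 / q)) * N)"
      by (rule Lp_bound_conv[OF heat_like_time[OF K t True] f p])
    moreover have "A * ((t' - t) / t) * t powr (- \<mu>) * t powr (- 3/2 * (1 / p - 1 / q)) * N
      \<le> 2 * A * (t' - t) powr \<eta> * t powr (- a - \<eta>) * N"
    proof -
      have "(t' - t) / t \<le> ((t' - t) / t) powr \<eta>"
      proof (cases "t' = t")
        case False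
        then have "((t' - t) / t) powr 1 \<le> ((t' - t) / t) powr \<eta>"
          using True t \<eta> by (intro powr_mono') (auto simp: field_simps)
        then show ?thesis using t by simp
      qed simp
      also have "\<dots> \<le> 2 * ((t' - t) / t) powr \<eta>"
        by simp
      finally have le: "(t' - t) / t \<le> 2 * ((t' - t) / t) powr \<eta>" .
      have "A * ((t' - t) / t) * t powr (- \<mu>) * t powr (- 3/2 * (1 / p - 1 / q)) * N
        = A * ((t' - t) / t) * t powr (- a) * N"
        unfolding e powr_add by (simp only: mult.assoc)
      also have "\<dots> \<le> A * (2 * ((t' - t) / t) powr \<eta>) * t powr (- a) * N"
        using A0 N0 le by (intro mult_right_mono mult_left_mono) auto
      also have "\<dots> = 2 * A * (((t' - t) / t) powr \<eta> * t powr (- a)) * N"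
        by (simp only: mult_ac)
      also have "\<dots> = 2 * A * (t' - t) powr \<eta> * t powr (- a - \<eta>) * N"
        unfolding r by (simp only: mult_ac)
      finally show ?thesis .
    qed
    ultimately show ?thesis
      using q by (intro Lp_bound_mono[where L = "2 * A * (t' - t) powr \<eta> * t powr (- a - \<eta>) * N"]) auto
  next
    case False
    have t': "0 < t'" using t by simp
    have eq: "conv (\<lambda>x. K t' x - K t x) f x = conv (K t') f x - conv (K t) f x" for x
      by (rule conv_diff_left[OF heat_like_bound[OF K t'] heat_like_bound[OF K t(1)] f p(1)])
    have "Lp_bound q (conv (\<lambda>x. K t' x - K t x) f) (A * t' powr (- a) * N + A * t powr (- a) * N)"
      unfolding eq[abs_def] a
      by (intro Lp_bound_diff Lp_bound_conv_heat_like[OF K _ f p] t t' q)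
    moreover have "A * t' powr (- a) * N + A * t powr (- a) * N \<le> 2 * A * (t' - t) powr \<eta> * t powr (- a - \<eta>) * N"
    proof -
      have "A * t' powr (- a) * N + A * t powr (- a) * N \<le> A * t powr (- a) * N + A * t powr (- a) * N"
        using A0 N0 a0 t by (intro add_mono mult_right_mono mult_left_mono powr_mono2') auto
      also have "\<dots> = 2 * A * (1 * t powr (- a)) * N"
        by simp
      also have "\<dots> \<le> 2 * A * (((t' - t) / t) powr \<eta> * t powr (- a)) * N"
        using A0 N0 \<eta> False t
        by (intro mult_right_mono mult_left_mono ge_one_powr_ge_zero) (auto simp: field_simps)
      also have "\<dots> = 2 * A * (t' - t) powr \<eta> * t powr (- a - \<eta>) * N"
        unfolding r by (simp only: mult_ac)
      finally show ?thesis .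
    qed
    ultimately show ?thesis
      using q by (intro Lp_bound_mono[where L = "2 * A * (t' - t) powr \<eta> * t powr (- a - \<eta>) * N"]) auto
  qed
qed

text \<open>The integral up to \<open>t'\<close> is split at \<open>t\<close>. Before
  \<open>t\<close> only the kernel changes, and a fractional rate with \<open>a + \<eta> < 1\<close>
  keeps its increment integrable; after \<open>t\<close> the piece is short.\<close>

lemma duhamel_time_difference:
  fixes f :: "real \<Rightarrow> real^3 \<Rightarrow> 'b::euclidean_space"
  assumes K: "heat_like K \<mu> A" and f: "Lp_cont p0 {0<..<t'} f" and p0: "1 \<le> p0" and p: "1 \<le> p" "p \<le> q"
    and t: "0 < t" "t < t'"
    and m: "\<And>s. s \<in> {0<..<t'} \<Longrightarrow> Lp_bound p (f s) (M * s powr (- b))" "0 \<le> M"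
    and a: "a = \<mu> + 3/2 * (1 / p - 1 / q)" and \<eta>: "0 \<le> \<eta>" "\<eta> \<le> 1" "a + \<eta> < 1" and b: "0 \<le> b" "b < 1"
  shows "Lp_bound q (\<lambda>x. duhamel K f t' x - duhamel K f t x)
     (2 * A * M * (t' - t) powr \<eta> * beta_const (a + \<eta>) b * t powr (1 - (a + \<eta>) - b)
        + A * M * t powr (- b) * ((t' - t) powr (1 - a) / (1 - a)))"
proof -
  have q: "1 \<le> q" using p by simp
  have "1 / q \<le> 1 / p" using p by (simp add: frac_le)
  then have a0: "0 \<le> a" using heat_like_nonneg[OF K] by (simp add: a)
  have a1: "a < 1" using \<eta> by simp
  have A0: "0 \<le> A" using heat_like_nonneg[OF K] by simp
  have t': "0 < t'" using t by simp
  have f1: "Lp_cont p0 {0<..<t} f"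
    by (rule Lp_cont_subset[OF f]) (use t in auto)
  have m1: "Lp_bound p (f s) (M * s powr (- b))" if "s \<in> {0<..<t}" for s
    by (rule m(1)) (use that t in auto)
  have cont': "continuous_on ({0<..<t'} \<times> UNIV) (\<lambda>(s, x). conv (K (t' - s)) (f s) x)"
    by (rule conv_joint_continuous[OF K f p0])
  have cont: "continuous_on ({0<..<t} \<times> UNIV) (\<lambda>(s, x). conv (K (t - s)) (f s) x)"
    by (rule conv_joint_continuous[OF K f1 p0])
  let ?F = "\<lambda>s x. conv (K (t' - s)) (f s) x - conv (K (t - s)) (f s) x"
  let ?G = "\<lambda>s x. conv (K (t' - s)) (f s) x"
  let ?Z1 = "2 * A * M * (t' - t) powr \<eta> * beta_const (a + \<eta>) b * t powr (1 - (a + \<eta>) - b)"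
  let ?Z2 = "A * M * t powr (- b) * ((t' - t) powr (1 - a) / (1 - a))"
  have "Lp_bound q (\<lambda>x. LBINT s:{0<..<t}. ?F s x) ?Z1"
  proof (rule time_integral_bound(2)[where m = "\<lambda>s. 2 * A * (t' - t) powr \<eta> * (t - s) powr (- a - \<eta>) * (M * s powr (- b))"])
    show "continuous_on ({0<..<t} \<times> UNIV) (\<lambda>(s, x). ?F s x)"
    proof -
      have sub: "{0<..<t} \<times> UNIV \<subseteq> {0<..<t'} \<times> UNIV"
        using t by auto
      show ?thesis
        using continuous_on_diff[OF continuous_on_subset[OF cont' sub] cont] by (simp add: case_prod_unfold)
    qed
    fix s assume s: "s \<in> {0<..<t}"
    then have ts: "0 < t - s" "t - s \<le> t' - s" "0 < t' - s" and s': "s \<in> {0<..<t'}" using t by auto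
    have eq: "conv (\<lambda>x. K (t' - s) x - K (t - s) x) (f s) = ?F s"
      by (rule ext, rule conv_diff_left[OF heat_like_bound[OF K ts(3)] heat_like_bound[OF K ts(1)] m(1)[OF s'] p(1)])
    show "Lp_bound q (?F s) (2 * A * (t' - t) powr \<eta> * (t - s) powr (- a - \<eta>) * (M * s powr (- b)))"
      using Lp_bound_conv_time_difference[OF K ts(1,2) m(1)[OF s'] p a \<eta>(1,2)] unfolding eq by simp
  next
    have "(\<integral>\<^sup>+s. ennreal (indicator {0<..<t} s * (2 * A * M * (t' - t) powr \<eta> * (t - s) powr (- (a + \<eta>)) * s powr (- b))) \<partial>lborel)
      \<le> ennreal (2 * A * M * (t' - t) powr \<eta> * beta_const (a + \<eta>) b * t powr (1 - (a + \<eta>) - b))"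
      using a0 \<eta> b A0 m t by (intro nn_integral_beta_le) auto
    then show "(\<integral>\<^sup>+s. ennreal (indicator {0<..<t} s * (2 * A * (t' - t) powr \<eta> * (t - s) powr (- a - \<eta>) * (M * s powr (- b)))) \<partial>lborel) \<le> ennreal ?Z1"
      by (simp add: mult_ac)
    show "0 \<le> ?Z1"
      using A0 m \<eta> b by (simp add: beta_const_nonneg)
  qed (use q in auto)
  moreover have "Lp_bound q (\<lambda>x. LBINT s:{t<..<t'}. ?G s x) ?Z2"
  proof (rule time_integral_bound(2)[where m = "\<lambda>s. A * (t' - s) powr (- a) * (M * s powr (- b))"])
    show "continuous_on ({t<..<t'} \<times> UNIV) (\<lambda>(s, x). ?G s x)"
      by (rule continuous_on_subset[OF cont']) (use t in auto)
    show "Lp_bound q (?G s) (A * (t' - s) powr (- a) * (M * s powr (- b)))" if "s \<in> {t<..<t'}" for s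
      unfolding a using that t by (intro Lp_bound_conv_heat_like[OF K] m p) auto
    have "(\<integral>\<^sup>+s. ennreal (indicator {t<..<t'} s * (A * M * (t' - s) powr (- a) * s powr (- b))) \<partial>lborel) \<le> ennreal ?Z2"
      using a0 a1 b A0 m t by (intro nn_integral_tail_le) auto
    then show "(\<integral>\<^sup>+s. ennreal (indicator {t<..<t'} s * (A * (t' - s) powr (- a) * (M * s powr (- b)))) \<partial>lborel) \<le> ennreal ?Z2"
      by (simp add: mult_ac)
    show "0 \<le> ?Z2"
      using A0 m a1 by simp
  qed (use q in auto)
  ultimately have sum: "Lp_bound q (\<lambda>x. (LBINT s:{0<..<t}. ?F s x) + (LBINT s:{t<..<t'}. ?G s x)) (?Z1 + ?Z2)"
    using q by (rule Lp_bound_add)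
  have D: "duhamel K f u \<in> borel_measurable borel" if "u \<in> {t, t'}" for u
    using duhamel_bound(2)[OF K f1 p0 p t(1) m1 m(2) a a1 b] duhamel_bound(2)[OF K f p0 p t' m a a1 b] that t
    by (auto dest!: Lp_boundD(1))
  have AE1: "AE x in lborel. set_integrable lborel {0<..<t} (\<lambda>s. conv (K (t - s)) (f s) x)"
    by (rule duhamel_bound(1)[OF K f1 p0 p t(1) m1 m(2) a a1 b])
  have AE2: "AE x in lborel. set_integrable lborel {0<..<t'} (\<lambda>s. conv (K (t' - s)) (f s) x)"
    by (rule duhamel_bound(1)[OF K f p0 p t' m a a1 b])
  have "AE x in lborel. duhamel K f t' x - duhamel K f t x
      = (LBINT s:{0<..<t}. ?F s x) + (LBINT s:{t<..<t'}. ?G s x)"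
    using AE1 AE2
  proof eventually_elim
    case (elim x)
    have i1: "set_integrable lborel {0<..<t} (\<lambda>s. ?G s x)"
      by (rule set_integrable_subset[OF elim(2)]) (use t in auto)
    have i2: "set_integrable lborel {t<..<t'} (\<lambda>s. ?G s x)"
      by (rule set_integrable_subset[OF elim(2)]) (use t in auto)
    have "(LBINT s:{0<..<t'}. ?G s x) = (LBINT s:{0<..<t} \<union> {t<..<t'}. ?G s x)"
      unfolding set_lebesgue_integral_def
    proof (rule integral_cong_AE)
      show "AE s in lborel. indicator {0<..<t'} s *\<^sub>R ?G s x = indicator ({0<..<t} \<union> {t<..<t'}) s *\<^sub>R ?G s x"
        using AE_lborel_singleton[of t] by eventually_elim (use t in \<open>auto simp: indicator_def\<close>)
      show "(\<lambda>s. indicator {0<..<t'} s *\<^sub>R ?G s x) \<in> borel_measurable lborel"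
        using elim(2) unfolding set_integrable_def by auto
      show "(\<lambda>s. indicator ({0<..<t} \<union> {t<..<t'}) s *\<^sub>R ?G s x) \<in> borel_measurable lborel"
        using set_integrable_Un[OF i1 i2] unfolding set_integrable_def by auto
    qed
    also have "\<dots> = (LBINT s:{0<..<t}. ?G s x) + (LBINT s:{t<..<t'}. ?G s x)"
      by (rule set_integral_Un[OF _ i1 i2]) auto
    finally have "duhamel K f t' x - duhamel K f t x
       = (LBINT s:{0<..<t}. ?G s x) - (LBINT s:{0<..<t}. conv (K (t - s)) (f s) x) + (LBINT s:{t<..<t'}. ?G s x)"
      by (simp add: duhamel_def)
    also have "(LBINT s:{0<..<t}. ?G s x) - (LBINT s:{0<..<t}. conv (K (t - s)) (f s) x) = (LBINT s:{0<..<t}. ?F s x)"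
      by (rule set_integral_diff(2)[OF i1 elim(1), symmetric])
    finally show ?case .
  qed
  then show ?thesis
    using q D by (intro Lp_bound_cong_AE[OF sum]) auto
qed

lemma duhamel_Lp_cont:
  fixes f :: "real \<Rightarrow> real^3 \<Rightarrow> 'b::euclidean_space"
  assumes K: "heat_like K \<mu> A" and f: "Lp_cont p0 {0<..T} f" and p0: "1 \<le> p0" and p: "1 \<le> p" "p \<le> q"
    and m: "\<And>s. s \<in> {0<..T} \<Longrightarrow> Lp_bound p (f s) (M * s powr (- b))" "0 \<le> M"
    and a: "a = \<mu> + 3/2 * (1 / p - 1 / q)" "a < 1" and b: "0 \<le> b" "b < 1"
  shows "Lp_cont q {0<..T} (duhamel K f)"
proof -
  have q: "1 \<le> q" using p by simp
  have "1 / q \<le> 1 / p" using p by (simp add: frac_le)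
  then have a0: "0 \<le> a" using heat_like_nonneg[OF K] by (simp add: a)
  have A0: "0 \<le> A" using heat_like_nonneg[OF K] by simp
  \<comment> \<open>Halfway between 0 and \<open>1 - a\<close>, so that the exponent
    \<open>a + \<eta>\<close> stays below 1.\<close>
  define \<eta> where "\<eta> = (1 - a) / 2"
  have \<eta>: "0 < \<eta>" "\<eta> \<le> 1" "a + \<eta> < 1"
    using a0 a by (auto simp: \<eta>_def field_simps)
  have f': "Lp_cont p0 {0<..<t} f" if "t \<le> T" for t
    by (rule Lp_cont_subset[OF f]) (use that in auto)
  \<comment> \<open>A modulus of continuity valid for all times in \<open>[t0, T]\<close>; with
    \<open>t0 = t / 2\<close> it covers both sides of \<open>t\<close>.\<close>
  define B where "B t0 d = 2 * A * M * d powr \<eta> * beta_const (a + \<eta>) b * (T powr (1 - (a + \<eta>)) * t0 powr (- b))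
        + A * M * t0 powr (- b) * (d powr (1 - a) / (1 - a))" for t0 d
  have diff: "Lp_bound q (\<lambda>x. duhamel K f t' x - duhamel K f t x) (B t0 (t' - t))"
    if t: "0 < t0" "t0 \<le> t" "t < t'" "t' \<le> T" for t0 t t'
  proof -
    have "Lp_bound q (\<lambda>x. duhamel K f t' x - duhamel K f t x)
     (2 * A * M * (t' - t) powr \<eta> * beta_const (a + \<eta>) b * t powr (1 - (a + \<eta>) - b)
        + A * M * t powr (- b) * ((t' - t) powr (1 - a) / (1 - a)))"
      by (rule duhamel_time_difference[OF K f'[OF t(4)] p0 p _ t(3) m(1,2) a(1)]) (use \<eta> b t in auto)
    moreover have "2 * A * M * (t' - t) powr \<eta> * beta_const (a + \<eta>) b * t powr (1 - (a + \<eta>) - b)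
        + A * M * t powr (- b) * ((t' - t) powr (1 - a) / (1 - a)) \<le> B t0 (t' - t)"
    proof -
      have "t powr (1 - (a + \<eta>) - b) = t powr (1 - (a + \<eta>)) * t powr (- b)"
        by (simp add: powr_add[symmetric])
      also have "\<dots> \<le> T powr (1 - (a + \<eta>)) * t0 powr (- b)"
        using t \<eta> b by (intro mult_mono powr_mono2 powr_mono2') auto
      finally have 1: "t powr (1 - (a + \<eta>) - b) \<le> T powr (1 - (a + \<eta>)) * t0 powr (- b)" .
      have 2: "t powr (- b) \<le> t0 powr (- b)"
        using t b by (intro powr_mono2') auto
      show ?thesis
        unfolding B_def using A0 m(2) \<eta> b a
        by (intro add_mono mult_left_mono mult_right_mono 1 2) (auto simp: beta_const_nonneg)
    qed
    ultimately show ?thesis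
      using q by (auto intro: Lp_bound_mono)
  qed
  have lim: "((\<lambda>d. B t0 d) \<longlongrightarrow> 0) (at_right 0)" for t0
  proof -
    have "\<forall>\<^sub>F d in at_right (0::real). 0 \<le> d"
      using eventually_at_right_less[of 0] by eventually_elim simp
    then have pw: "((\<lambda>d. d powr c) \<longlongrightarrow> 0) (at_right 0)" if "0 < c" for c :: real
      using that by (intro tendsto_zero_powrI[OF tendsto_ident_at tendsto_const])
    have "(B t0 \<longlongrightarrow> 2 * A * M * 0 * beta_const (a + \<eta>) b * (T powr (1 - (a + \<eta>)) * t0 powr (- b))
        + A * M * t0 powr (- b) * (0 / (1 - a))) (at_right 0)"
      unfolding B_def using a \<eta>
      by (intro tendsto_add tendsto_mult tendsto_const tendsto_divide pw) auto
    then show ?thesis by simp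
  qed
  show ?thesis
    unfolding Lp_cont_def
  proof (intro ballI conjI allI impI)
    fix t assume t: "t \<in> {0<..T}"
    then have t0: "0 < t" by auto
    have "Lp_bound q (duhamel K f t) (A * M * beta_const a b * t powr (1 - a - b))"
      by (rule duhamel_bound(2)[OF K f' p0 p _ m(1,2) a b]) (use t in auto)
    then show "\<exists>N. Lp_bound q (duhamel K f t) N" by blast
    fix e :: real assume e: "0 < e"
    have "\<forall>\<^sub>F d in at_right 0. B (t / 2) d < e"
      by (rule order_tendstoD(2)[OF lim e])
    then obtain d0 where d0: "0 < d0" "\<And>d. 0 < d \<Longrightarrow> d < d0 \<Longrightarrow> B (t / 2) d < e"
      by (auto simp: eventually_at_right_field)
    show "\<exists>d>0. \<forall>s\<in>{0<..T}. \<bar>s - t\<bar> < d \<longrightarrow> Lp_bound q (\<lambda>x. duhamel K f s x - duhamel K f t x) e"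
    proof (intro exI[of _ "min d0 (t / 2)"] conjI ballI impI)
      show "0 < min d0 (t / 2)" using d0 t by auto
      fix s assume s: "s \<in> {0<..T}" "\<bar>s - t\<bar> < min d0 (t / 2)"
      consider "s = t" | "t < s" | "s < t" by linarith
      then show "Lp_bound q (\<lambda>x. duhamel K f s x - duhamel K f t x) e"
      proof cases
        case 1
        then show ?thesis using e by (simp add: Lp_bound_zero)
      next
        case 2
        have "Lp_bound q (\<lambda>x. duhamel K f s x - duhamel K f t x) (B (t / 2) (s - t))"
          by (rule diff) (use 2 s t in auto)
        moreover have "B (t / 2) (s - t) < e"
          by (rule d0(2)) (use 2 s in auto)
        ultimately show ?thesis using q by (auto intro: Lp_bound_mono)
      next
        case 3
        have "Lp_bound q (\<lambda>x. duhamel K f t x - duhamel K f s x) (B (t / 2) (t - s))"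
          by (rule diff) (use 3 s t in \<open>auto simp: abs_if split: if_splits\<close>)
        moreover have "B (t / 2) (t - s) < e"
          by (rule d0(2)) (use 3 s in auto)
        ultimately have "Lp_bound q (\<lambda>x. duhamel K f t x - duhamel K f s x) e"
          using q by (auto intro: Lp_bound_mono)
        from Lp_bound_scaleR[OF this, of "-1"] show ?thesis using q by simp
      qed
    qed
  qed
qed

section \<open>Divergence-free fields\<close>

lemma frechet_derivative_translate:
  fixes f :: "real^3 \<Rightarrow> real"
  assumes "f differentiable at (x + a)"
  shows "frechet_derivative (\<lambda>x. f (x + a)) (at x) = frechet_derivative f (at (x + a))"
    and "(\<lambda>x. f (x + a)) differentiable at x"
proof -
  have "(f has_derivative frechet_derivative f (at (x + a))) (at (x + a))"
    using assms by (simp add: frechet_derivative_works)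
  moreover have "((\<lambda>x. x + a) has_derivative (\<lambda>v. v)) (at x)"
    by (auto intro!: derivative_eq_intros)
  ultimately have "((\<lambda>x. f (x + a)) has_derivative frechet_derivative f (at (x + a))) (at x)"
    using has_derivative_compose[of "\<lambda>x. x + a" "\<lambda>v. v" x UNIV f] by simp
  then show "frechet_derivative (\<lambda>x. f (x + a)) (at x) = frechet_derivative f (at (x + a))"
    "(\<lambda>x. f (x + a)) differentiable at x"
    by (auto simp: differentiable_def dest: frechet_derivative_at)
qed

lemma partial_deriv_translate:
  assumes "f differentiable at (x + a)"
  shows "partial_deriv k (\<lambda>x. f (x + a)) x = partial_deriv k f (x + a)"
  unfolding partial_deriv_def frechet_derivative_translate(1)[OF assms] ..

lemma Ck_translate: "Ck n f \<Longrightarrow> Ck n (\<lambda>x. f (x + a))"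
proof (induction n arbitrary: f)
  case 0
  then have "continuous_on UNIV f" by simp
  from continuous_on_compose2[OF this, of UNIV "\<lambda>x. x + a"] show ?case
    by (simp add: continuous_on_add)
next
  case (Suc n)
  from Suc.prems have d: "f differentiable at x" and c: "Ck n (partial_deriv k f)" for x k by simp_all
  have "partial_deriv k (\<lambda>x. f (x + a)) = (\<lambda>x. partial_deriv k f (x + a))" for k
    by (intro ext partial_deriv_translate d)
  then have "Ck n (partial_deriv k (\<lambda>x. f (x + a)))" for k
    using Suc.IH[OF c[of k]] by (simp only:)
  then show ?case
    using frechet_derivative_translate(2)[OF d] by (simp only: Ck.simps) blast
qed

text \<open>Translation invariance of the test functions makes divergence-free fields stable under
  translation, and hence under convolution.\<close>

lemma test_function_translate:
  assumes "test_function \<phi>"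
  shows "test_function (\<lambda>x. \<phi> (x + a))"
proof -
  have "{x. \<phi> (x + a) \<noteq> 0} = (\<lambda>x. - a + x) ` {x. \<phi> x \<noteq> 0}"
    by (auto simp: image_iff) (metis add_diff_cancel_right')
  then have "closure {x. \<phi> (x + a) \<noteq> 0} = (\<lambda>x. - a + x) ` closure {x. \<phi> x \<noteq> 0}"
    by (simp only: closure_translation)
  then have "compact (closure {x. \<phi> (x + a) \<noteq> 0})"
    using assms by (simp only: test_function_def compact_translation)
  then show ?thesis
    using assms Ck_translate by (auto simp: test_function_def)
qed

lemma test_function_differentiable: "test_function \<phi> \<Longrightarrow> \<phi> differentiable at x"
  unfolding test_function_def by (metis Ck.simps(2))

lemma grad_translate:
  assumes "test_function \<phi>"
  shows "grad (\<lambda>x. \<phi> (x + a)) x = grad \<phi> (x + a)"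
  unfolding grad_def by (simp add: partial_deriv_translate test_function_differentiable[OF assms])

text \<open>Boundedness and bounded support are expressed by invariance under truncation, so that
  the integrability of truncations applies to the gradient directly.\<close>

lemma grad_test_function:
  assumes \<phi>: "test_function \<phi>"
  obtains R where "0 \<le> R" "grad \<phi> = cutoff R (grad \<phi>)" "grad \<phi> \<in> borel_measurable borel"
    "\<And>x. norm (grad \<phi> x) \<le> R"
proof -
  let ?S = "closure {x. \<phi> x \<noteq> 0}"
  have "Ck (Suc 0) \<phi>"
    using \<phi> by (simp add: test_function_def)
  then have "continuous_on UNIV (partial_deriv k \<phi>)" for k
    by simp
  then have cont: "continuous_on UNIV (grad \<phi>)"
    unfolding grad_def[abs_def] by (rule continuous_on_vec_lambda)
  have zero: "grad \<phi> x = 0" if "x \<notin> ?S" for x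
  proof -
    have "(\<phi> has_derivative (\<lambda>_. 0)) (at x)"
    proof (rule has_derivative_transform_within_open[of "\<lambda>_. 0"])
      show "open (- ?S)" "x \<in> - ?S" using that by auto
      show "0 = \<phi> y" if "y \<in> - ?S" for y
        using that closure_subset[of "{x. \<phi> x \<noteq> 0}"] by auto
    qed auto
    then have "frechet_derivative \<phi> (at x) = (\<lambda>_. 0)"
      by (rule frechet_derivative_at[symmetric])
    then show ?thesis
      by (simp add: grad_def partial_deriv_def vec_eq_iff)
  qed
  have S: "compact ?S" using \<phi> by (simp add: test_function_def)
  obtain R1 where R1: "\<And>x. x \<in> ?S \<Longrightarrow> norm x \<le> R1"
    using compact_imp_bounded[OF S] unfolding bounded_iff by auto
  have S': "compact (grad \<phi> ` ?S)"
    by (rule compact_continuous_image[OF continuous_on_subset[OF cont] S]) simp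
  obtain R2 where R2: "\<And>x. x \<in> ?S \<Longrightarrow> norm (grad \<phi> x) \<le> R2"
    using compact_imp_bounded[OF S'] unfolding bounded_iff by auto
  define R where "R = max 0 (max R1 R2)"
  have le: "norm (grad \<phi> x) \<le> R" for x
    using R2[of x] zero[of x] by (cases "x \<in> ?S") (auto simp: R_def)
  show ?thesis
  proof (rule that[of R])
    show "grad \<phi> = cutoff R (grad \<phi>)"
    proof
      fix x
      show "grad \<phi> x = cutoff R (grad \<phi>) x"
        using R1[of x] le[of x] zero[of x] by (cases "x \<in> ?S") (auto simp: cutoff_def R_def)
    qed
    show "grad \<phi> \<in> borel_measurable borel"
      using cont by (rule borel_measurable_continuous_onI)
  qed (use le in \<open>auto simp: R_def\<close>)
qed

lemma Lp_bound_grad: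
  assumes "test_function \<phi>" "0 < p"
  obtains B where "Lp_bound p (grad \<phi>) B"
proof -
  obtain R where R: "0 \<le> R" "grad \<phi> = cutoff R (grad \<phi>)" "grad \<phi> \<in> borel_measurable borel"
    by (rule grad_test_function[OF assms(1)])
  obtain B where "Lp_bound p (cutoff R (grad \<phi>)) B"
    using Lp_bound_cutoff_any[OF R(3) assms(2) R(1)] by blast
  then show ?thesis
    unfolding R(2)[symmetric] by (rule that)
qed

lemma measurable_grad_test_function: "test_function \<phi> \<Longrightarrow> grad \<phi> \<in> borel_measurable borel"
  by (rule Lp_bound_grad[of \<phi> 1]) (auto dest: Lp_boundD)

lemma integrable_if_Lp_bound_1:
  assumes f: "Lp_bound 1 f N"
  shows "integrable lborel f" "norm (\<integral>x. f x \<partial>lborel) \<le> N"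
proof -
  have le: "(\<integral>\<^sup>+x. ennreal (norm (f x)) \<partial>lborel) \<le> ennreal N"
    using Lp_boundD(2,3)[OF f] by simp
  then show i: "integrable lborel f"
    using Lp_boundD(1)[OF f] by (intro integrableI_bounded) (auto simp: le_less_trans)
  have "ennreal (norm (\<integral>x. f x \<partial>lborel)) \<le> ennreal N"
    by (rule order_trans[OF integral_norm_bound_ennreal[OF i] le])
  then show "norm (\<integral>x. f x \<partial>lborel) \<le> N"
    using Lp_boundD(2)[OF f] by simp
qed

lemma Lp_bound_1_if_integrable:
  assumes "integrable lborel f"
  shows "Lp_bound 1 f (\<integral>x. norm (f x) \<partial>lborel)"
  using assms by (auto simp: Lp_bound_def nn_integral_eq_integral)

lemma inner_Lp_bound_1:
  fixes f g :: "'a::euclidean_space \<Rightarrow> 'b::euclidean_space"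
  assumes "Lp_bound p f A" "Lp_bound q g B" "0 < p" "0 < q" "1 / p + 1 / q = 1"
  shows "Lp_bound 1 (\<lambda>x. f x \<bullet> g x) (A * B)"
  using assms Lp_boundD(1)[OF assms(1)] Lp_boundD(1)[OF assms(2)]
  by (intro Lp_bound_Holder[OF assms(1,2)]) (auto simp: Cauchy_Schwarz_ineq2)

text \<open>By Hoelder, pairing with the gradient of a fixed test function is continuous on L^p;
  \<open>1 < p\<close> makes the dual exponent finite. Linear combinations, limits and
  superpositions of divergence-free fields all go through this bound.\<close>

lemma pairing_Lp_bound_1:
  fixes u :: "real^3 \<Rightarrow> real^3"
  assumes \<phi>: "test_function \<phi>" and p: "1 < p"
  shows "\<exists>B\<ge>0. \<forall>u N. Lp_bound p u N \<longrightarrow> Lp_bound 1 (\<lambda>x. u x \<bullet> grad \<phi> x) (N * B)"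
proof -
  define q where "q = p / (p - 1)"
  have q: "0 < q" "1 / p + 1 / q = 1" using p by (auto simp: q_def field_simps)
  obtain B where B: "Lp_bound q (grad \<phi>) B"
    using Lp_bound_grad[OF \<phi> q(1)] .
  show ?thesis
    using inner_Lp_bound_1[OF _ B _ q] p Lp_boundD(2)[OF B] by (intro exI[of _ B]) auto
qed

lemma div_freeD: "div_free u \<Longrightarrow> test_function \<phi> \<Longrightarrow> (\<integral>x. u x \<bullet> grad \<phi> x \<partial>lborel) = 0"
  unfolding div_free_def by blast

lemma div_free_diff:
  assumes "div_free u" "div_free v" and u: "Lp_bound p u N" and v: "Lp_bound p v N'" and p: "1 < p"
  shows "div_free (\<lambda>x. u x - v x)"
  unfolding div_free_def
proof (intro allI impI)
  fix \<phi> assume \<phi>: "test_function \<phi>"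
  obtain B where "\<forall>u N. Lp_bound p u N \<longrightarrow> Lp_bound 1 (\<lambda>x. u x \<bullet> grad \<phi> x) (N * B)"
    using pairing_Lp_bound_1[OF \<phi> p] by blast
  note B = this[rule_format]
  have "(\<integral>x. (u x - v x) \<bullet> grad \<phi> x \<partial>lborel)
      = (\<integral>x. u x \<bullet> grad \<phi> x \<partial>lborel) - (\<integral>x. v x \<bullet> grad \<phi> x \<partial>lborel)"
    unfolding inner_diff_left
    by (rule Bochner_Integration.integral_diff[OF integrable_if_Lp_bound_1(1)[OF B[OF u]] integrable_if_Lp_bound_1(1)[OF B[OF v]]])
  also have "\<dots> = 0"
    unfolding div_freeD[OF assms(1) \<phi>] div_freeD[OF assms(2) \<phi>] by simp
  finally show "(\<integral>x. (u x - v x) \<bullet> grad \<phi> x \<partial>lborel) = 0" .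
qed

lemma div_free_zero: "div_free (\<lambda>x. 0)"
  unfolding div_free_def inner_zero_left by simp

lemma div_free_scaleR:
  assumes "div_free u"
  shows "div_free (\<lambda>x. c *\<^sub>R u x)"
  unfolding div_free_def
  by (intro allI impI) (simp only: inner_scaleR_left integral_mult_right_zero div_freeD[OF assms] mult_zero_right)

lemma div_free_add:
  assumes "div_free u" "div_free v" and u: "Lp_bound p u N" and v: "Lp_bound p v N'" and p: "1 < p"
  shows "div_free (\<lambda>x. u x + v x)"
proof -
  have "Lp_bound p (\<lambda>x. - 1 *\<^sub>R v x) (\<bar>- 1\<bar> * N')"
    using p by (intro Lp_bound_scaleR[OF v]) simp
  from div_free_diff[OF assms(1) div_free_scaleR[OF assms(2)] u this p]
  show ?thesis by simp
qed

lemma div_free_sum: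
  assumes "finite I" "\<And>i. i \<in> I \<Longrightarrow> div_free (u i)" "\<And>i. i \<in> I \<Longrightarrow> Lp_bound p (u i) (N i)" "1 < p"
  shows "div_free (\<lambda>x. \<Sum>i\<in>I. u i x)"
  using assms(1,2,3)
proof (induction I rule: finite_induct)
  case empty
  show ?case by (simp add: div_free_zero)
next
  case (insert i I)
  then show ?case
    using assms(4) by (simp, intro div_free_add[OF _ _ _ Lp_bound_sum assms(4)]) auto
qed

lemma div_free_cong_AE:
  assumes "div_free u" and [measurable]: "u \<in> borel_measurable borel" "v \<in> borel_measurable borel"
    and "AE x in lborel. v x = u x"
  shows "div_free v"
  unfolding div_free_def
proof (intro allI impI)
  fix \<phi> assume \<phi>: "test_function \<phi>"
  then have [measurable]: "grad \<phi> \<in> borel_measurable borel"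
    by (rule measurable_grad_test_function)
  have "(\<integral>x. v x \<bullet> grad \<phi> x \<partial>lborel) = (\<integral>x. u x \<bullet> grad \<phi> x \<partial>lborel)"
    using assms(4) by (intro integral_cong_AE) (auto elim: eventually_mono)
  then show "(\<integral>x. v x \<bullet> grad \<phi> x \<partial>lborel) = 0"
    unfolding div_freeD[OF assms(1) \<phi>] .
qed

lemma div_free_translate:
  assumes u: "div_free u" and [measurable]: "u \<in> borel_measurable borel"
  shows "div_free (\<lambda>x. u (x + a))"
  unfolding div_free_def
proof (intro allI impI)
  fix \<phi> assume \<phi>: "test_function \<phi>"
  let ?\<psi> = "\<lambda>x. \<phi> (x + (- a))"
  have \<psi>: "test_function ?\<psi>"
    by (rule test_function_translate[OF \<phi>])
  have [measurable]: "grad ?\<psi> \<in> borel_measurable borel"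
    by (rule measurable_grad_test_function[OF \<psi>])
  have "(\<integral>x. u (x + a) \<bullet> grad \<phi> x \<partial>lborel) = (\<integral>x. u (x + a) \<bullet> grad ?\<psi> (x + a) \<partial>lborel)"
    unfolding grad_translate[OF \<phi>] by simp
  also have "\<dots> = (\<integral>x. u x \<bullet> grad ?\<psi> x \<partial>lborel)"
    by (rule integral_translate) measurable
  also have "\<dots> = 0"
    by (rule div_freeD[OF u \<psi>])
  finally show "(\<integral>x. u (x + a) \<bullet> grad \<phi> x \<partial>lborel) = 0" .
qed

lemma div_free_Lp_limit:
  assumes u: "Lp_bound p u N" and p: "1 < p"
    and lim: "\<And>e. 0 < e \<Longrightarrow> \<exists>v N'. div_free v \<and> Lp_bound p v N' \<and> Lp_bound p (\<lambda>x. u x - v x) e"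
  shows "div_free u"
  unfolding div_free_def
proof (intro allI impI)
  fix \<phi> assume \<phi>: "test_function \<phi>"
  obtain B where B0: "0 \<le> B" and "\<forall>u N. Lp_bound p u N \<longrightarrow> Lp_bound 1 (\<lambda>x. u x \<bullet> grad \<phi> x) (N * B)"
    using pairing_Lp_bound_1[OF \<phi> p] by blast
  note B = B0 this(2)[rule_format]
  have "\<bar>\<integral>x. u x \<bullet> grad \<phi> x \<partial>lborel\<bar> \<le> 0 + e" if e: "0 < e" for e
  proof -
    have "0 < e / (B + 1)" using e B by simp
    then obtain v N' where v: "div_free v" "Lp_bound p v N'" "Lp_bound p (\<lambda>x. u x - v x) (e / (B + 1))"
      using lim by blast
    have "(\<integral>x. u x \<bullet> grad \<phi> x \<partial>lborel) = (\<integral>x. u x \<bullet> grad \<phi> x \<partial>lborel) - (\<integral>x. v x \<bullet> grad \<phi> x \<partial>lborel)"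
      unfolding div_freeD[OF v(1) \<phi>] by simp
    also have "\<dots> = (\<integral>x. (u x - v x) \<bullet> grad \<phi> x \<partial>lborel)"
      unfolding inner_diff_left
      by (rule Bochner_Integration.integral_diff[symmetric]; rule integrable_if_Lp_bound_1(1)[OF B(2)]; fact)
    finally have "\<bar>\<integral>x. u x \<bullet> grad \<phi> x \<partial>lborel\<bar> \<le> e / (B + 1) * B"
      using integrable_if_Lp_bound_1(2)[OF B(2)[OF v(3)]] by simp
    also have "\<dots> \<le> e"
      using B e by (simp add: field_simps)
    finally show ?thesis by simp
  qed
  then have "\<bar>\<integral>x. u x \<bullet> grad \<phi> x \<partial>lborel\<bar> \<le> 0"
    by (rule field_le_epsilon)
  then show "(\<integral>x. u x \<bullet> grad \<phi> x \<partial>lborel) = 0"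
    by simp
qed

text \<open>Fubini moves the pairing with the test function inside the parameter integral, where it
  vanishes; \<open>pairing_Lp_bound_1\<close> gives integrability on the product space.\<close>

lemma div_free_integral:
  fixes h :: "'s \<Rightarrow> real^3 \<Rightarrow> real^3"
  assumes M: "sigma_finite_measure M"
    and h[measurable]: "(\<lambda>(s, x). h s x) \<in> borel_measurable (M \<Otimes>\<^sub>M lborel)"
    and a[measurable]: "a \<in> borel_measurable M"
    and bound: "\<And>s. s \<in> space M \<Longrightarrow> Lp_bound p (h s) (a s)"
    and A: "(\<integral>\<^sup>+s. ennreal (a s) \<partial>M) \<le> ennreal A" "0 \<le> A" and p: "1 < p"
    and div: "\<And>s. s \<in> space M \<Longrightarrow> div_free (h s)"
  shows "div_free (\<lambda>x. \<integral>s. h s x \<partial>M)"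
  unfolding div_free_def
proof (intro allI impI)
  fix \<phi> assume \<phi>: "test_function \<phi>"
  interpret sigma_finite_measure M by fact
  interpret P: pair_sigma_finite M "lborel :: (real^3) measure" ..
  obtain B where B0: "0 \<le> B" and "\<forall>u N. Lp_bound p u N \<longrightarrow> Lp_bound 1 (\<lambda>x. u x \<bullet> grad \<phi> x) (N * B)"
    using pairing_Lp_bound_1[OF \<phi> p] by blast
  note B = B0 this(2)[rule_format]
  have [measurable]: "grad \<phi> \<in> borel_measurable borel"
    by (rule measurable_grad_test_function[OF \<phi>])
  let ?k = "\<lambda>(s, x). h s x \<bullet> grad \<phi> x"
  have "integrable (M \<Otimes>\<^sub>M lborel) ?k"
  proof (rule integrableI_bounded)
    have "(\<integral>\<^sup>+z. ennreal (norm (?k z)) \<partial>(M \<Otimes>\<^sub>M lborel)) = (\<integral>\<^sup>+s. \<integral>\<^sup>+x. ennreal (norm (h s x \<bullet> grad \<phi> x)) \<partial>lborel \<partial>M)"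
      by (subst lborel.nn_integral_fst[symmetric]) auto
    also have "\<dots> \<le> (\<integral>\<^sup>+s. ennreal (a s) * ennreal B \<partial>M)"
    proof (rule nn_integral_mono)
      fix s assume s: "s \<in> space M"
      show "(\<integral>\<^sup>+x. ennreal (norm (h s x \<bullet> grad \<phi> x)) \<partial>lborel) \<le> ennreal (a s) * ennreal B"
        using Lp_boundD(2,3)[OF B(2)[OF bound[OF s]]] Lp_boundD(2)[OF bound[OF s]] B by (simp flip: ennreal_mult)
    qed
    also have "\<dots> = (\<integral>\<^sup>+s. ennreal (a s) \<partial>M) * ennreal B"
      by (rule nn_integral_multc) auto
    also have "\<dots> \<le> ennreal A * ennreal B"
      using A by (intro mult_right_mono) auto
    finally show "(\<integral>\<^sup>+z. ennreal (norm (?k z)) \<partial>(M \<Otimes>\<^sub>M lborel)) < \<infinity>"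
      using A B by (simp flip: ennreal_mult add: le_less_trans)
  qed auto
  note int = this
  have p1: "1 \<le> p" using p by simp
  have AEi: "AE x in lborel. integrable M (\<lambda>s. h s x)"
    by (rule Minkowski_integral(1)[OF M h a bound A p1])
  have "(\<integral>x. (\<integral>s. h s x \<partial>M) \<bullet> grad \<phi> x \<partial>lborel) = (\<integral>x. (\<integral>s. h s x \<bullet> grad \<phi> x \<partial>M) \<partial>lborel)"
  proof (rule integral_cong_AE)
    have h'[measurable]: "(\<lambda>(x, s). h s x) \<in> borel_measurable (lborel \<Otimes>\<^sub>M M)"
      using measurable_pair_swap[OF h] by (simp add: case_prod_unfold)
    show "(\<lambda>x. (\<integral>s. h s x \<partial>M) \<bullet> grad \<phi> x) \<in> borel_measurable lborel"
      by measurable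
    show "(\<lambda>x. \<integral>s. h s x \<bullet> grad \<phi> x \<partial>M) \<in> borel_measurable lborel"
      by measurable
    show "AE x in lborel. (\<integral>s. h s x \<partial>M) \<bullet> grad \<phi> x = (\<integral>s. h s x \<bullet> grad \<phi> x \<partial>M)"
      using AEi
      by eventually_elim (simp add: integral_inner_left)
  qed
  also have "\<dots> = (\<integral>s. (\<integral>x. h s x \<bullet> grad \<phi> x \<partial>lborel) \<partial>M)"
    by (rule P.Fubini_integral[OF int])
  also have "\<dots> = (\<integral>s. 0 \<partial>M)"
    by (intro Bochner_Integration.integral_cong refl div_freeD[OF div \<phi>])
  finally show "(\<integral>x. (\<integral>s. h s x \<partial>M) \<bullet> grad \<phi> x \<partial>lborel) = 0" by simp
qed

text \<open>A convolution is a superposition of translates, each of them divergence-free.\<close>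

lemma div_free_conv:
  assumes k: "kernel_bound k \<kappa> \<sigma>" and u: "Lp_bound p u N" and p: "1 < p" and div: "div_free u"
  shows "div_free (conv k u)"
proof -
  have [measurable]: "k \<in> borel_measurable borel" "u \<in> borel_measurable borel"
    using k u by (auto dest: Lp_boundD kernel_boundD)
  have nn: "0 \<le> \<kappa>" "0 \<le> N"
    using k u by (auto dest: Lp_boundD kernel_boundD)
  have "div_free (\<lambda>x. \<integral>z. k z *\<^sub>R u (x - z) \<partial>lborel)"
  proof (rule div_free_integral[where a = "\<lambda>z. \<bar>k z\<bar> * N"])
    show "sigma_finite_measure (lborel :: (real^3) measure)"
      by (rule lborel.sigma_finite_measure_axioms)
    show "Lp_bound p (\<lambda>x. k z *\<^sub>R u (x - z)) (\<bar>k z\<bar> * N)" for z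
      using Lp_bound_scaleR[OF Lp_bound_translate[OF u, of "- z"], of "k z"] p by simp
    have "(\<integral>\<^sup>+z. ennreal (\<bar>k z\<bar> * N) \<partial>lborel) = (\<integral>\<^sup>+z. ennreal \<bar>k z\<bar> \<partial>lborel) * ennreal N"
      using nn by (subst nn_integral_multc[symmetric]) (auto simp: ennreal_mult)
    also have "\<dots> \<le> ennreal \<kappa> * ennreal N"
      by (intro mult_right_mono kernel_boundD(4)[OF k]) auto
    finally show "(\<integral>\<^sup>+z. ennreal (\<bar>k z\<bar> * N) \<partial>lborel) \<le> ennreal (\<kappa> * N)"
      using nn by (simp add: ennreal_mult)
    show "div_free (\<lambda>x. k z *\<^sub>R u (x - z))" for z
      using div_free_scaleR[OF div_free_translate[OF div, of "- z"]] by simp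
  qed (use nn p in auto)
  moreover have "conv k u = (\<lambda>x. \<integral>z. k z *\<^sub>R u (x - z) \<partial>lborel)"
    by (intro ext conv_reflect) auto
  ultimately show ?thesis by simp
qed

section \<open>The Leray projector\<close>

lemma L2_inner_integrable:
  fixes f g :: "'a::euclidean_space \<Rightarrow> 'b::euclidean_space"
  assumes "Lp_bound 2 f A" "Lp_bound 2 g B"
  shows "integrable lborel (\<lambda>x. f x \<bullet> g x)"
  using integrable_if_Lp_bound_1(1)[OF inner_Lp_bound_1[OF assms]] by simp

lemma Lp_bound_2_iff:
  fixes f :: "'a::euclidean_space \<Rightarrow> 'b::euclidean_space"
  assumes f: "Lp_bound 2 f A" and K: "0 \<le> K"
  shows "Lp_bound 2 f K \<longleftrightarrow> (\<integral>x. f x \<bullet> f x \<partial>lborel) \<le> K\<^sup>2"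
proof -
  have "(\<integral>\<^sup>+x. ennreal (norm (f x) powr 2) \<partial>lborel) = (\<integral>\<^sup>+x. ennreal (f x \<bullet> f x) \<partial>lborel)"
    by (simp add: power2_norm_eq_inner)
  also have "\<dots> = ennreal (\<integral>x. f x \<bullet> f x \<partial>lborel)"
    by (rule nn_integral_eq_integral[OF L2_inner_integrable[OF f f]]) auto
  finally show ?thesis
    using K Lp_boundD(1)[OF f] by (simp add: Lp_bound_def)
qed

lemma L2_dist_expand:
  fixes f g :: "'a::euclidean_space \<Rightarrow> 'b::euclidean_space"
  assumes f: "Lp_bound 2 f A" and g: "Lp_bound 2 g B"
  shows "(\<integral>x. (f x - c *\<^sub>R g x) \<bullet> (f x - c *\<^sub>R g x) \<partial>lborel)
     = (\<integral>x. f x \<bullet> f x \<partial>lborel) - 2 * c * (\<integral>x. f x \<bullet> g x \<partial>lborel) + c\<^sup>2 * (\<integral>x. g x \<bullet> g x \<partial>lborel)"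
proof -
  note [simp] = L2_inner_integrable[OF f f] L2_inner_integrable[OF f g] L2_inner_integrable[OF g g]
  have "(\<integral>x. (f x - c *\<^sub>R g x) \<bullet> (f x - c *\<^sub>R g x) \<partial>lborel)
     = (\<integral>x. f x \<bullet> f x - 2 * c * (f x \<bullet> g x) + c\<^sup>2 * (g x \<bullet> g x) \<partial>lborel)"
    by (intro Bochner_Integration.integral_cong refl)
       (simp add: inner_diff_left inner_diff_right inner_commute power2_eq_square algebra_simps)
  also have "\<dots> = (\<integral>x. f x \<bullet> f x \<partial>lborel) - 2 * c * (\<integral>x. f x \<bullet> g x \<partial>lborel) + c\<^sup>2 * (\<integral>x. g x \<bullet> g x \<partial>lborel)"
    by simp
  finally show ?thesis .
qed

text \<open>The Hilbert space projection theorem carried out by hand: the parallelogram identity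
  makes a minimising sequence Cauchy, \<open>Riesz_Fischer\<close> gives its limit, the weak form of
  the divergence condition survives the limit, and a first variation yields orthogonality.\<close>

lemma leray_projection_exists:
  assumes f: "Lp_bound 2 f F"
  shows "\<exists>g. is_leray_projection f g"
proof -
  define V where "V = {h :: real^3 \<Rightarrow> real^3. div_free h \<and> (\<exists>N. Lp_bound 2 h N)}"
  define D where "D h = (\<integral>x. (f x - h x) \<bullet> (f x - h x) \<partial>lborel)" for h
  have V0: "(\<lambda>x. 0) \<in> V"
    by (auto simp: V_def div_free_zero intro!: exI[of _ 0] Lp_bound_zero)
  have D0: "0 \<le> D h" for h
    unfolding D_def by (intro integral_nonneg_AE) auto
  have Vsub: "\<exists>N. Lp_bound 2 (\<lambda>x. f x - h x) N" if hV: "h \<in> V" for h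
  proof -
    obtain N where N: "Lp_bound 2 h N" using hV by (auto simp: V_def)
    show ?thesis using Lp_bound_diff[OF f N] by auto
  qed
  have Vlin: "(\<lambda>x. g x - c *\<^sub>R h x) \<in> V" if gh: "g \<in> V" "h \<in> V" for g h c
  proof -
    obtain N1 N2 where N: "Lp_bound 2 g N1" "Lp_bound 2 h N2" using gh by (auto simp: V_def)
    note N3 = Lp_bound_scaleR[OF N(2), of c, simplified]
    show ?thesis
      using gh div_free_diff[OF _ div_free_scaleR N(1) N3] Lp_bound_diff[OF N(1) N3] by (auto simp: V_def)
  qed
  define d where "d = Inf (D ` V)"
  have bdd: "bdd_below (D ` V)"
    by (rule bdd_belowI[of _ 0]) (use D0 in auto)
  have dle: "d \<le> D h" if "h \<in> V" for h
    unfolding d_def using that bdd by (intro cInf_lower) auto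
  have d0: "0 \<le> d"
    unfolding d_def using V0 D0 by (intro cInf_greatest) auto
  \<comment> \<open>The rate 1/4 for squared distances makes the increments of the minimising
    sequence at most \<open>2/2 ^ n\<close>, as \<open>Riesz_Fischer\<close> requires.\<close>
  have "\<exists>h\<in>V. D h < d + (1/4) ^ n" for n :: nat
  proof -
    have "Inf (D ` V) < d + (1/4) ^ n"
      by (simp add: d_def)
    then show ?thesis
      using V0 bdd by (subst (asm) cInf_less_iff) auto
  qed
  then obtain h where h: "\<And>n. h n \<in> V" "\<And>n. D (h n) < d + (1/4) ^ n"
    by metis
  have hL: "\<exists>N. Lp_bound 2 (h n) N" for n using h(1)[of n] by (auto simp: V_def)
  have hm: "h n \<in> borel_measurable borel" for n using hL[of n] by (auto dest: Lp_boundD)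
  have cauchy: "Lp_bound 2 (\<lambda>x. h (Suc n) x - h n x) (2/2 ^ n)" for n
  proof -
    let ?a = "\<lambda>x. f x - h n x" and ?b = "\<lambda>x. f x - h (Suc n) x"
    obtain Na Nb where N: "Lp_bound 2 ?a Na" "Lp_bound 2 ?b Nb"
      using Vsub[OF h(1)[of n]] Vsub[OF h(1)[of "Suc n"]] by blast
    have exp1: "(\<integral>x. (?a x - 1 *\<^sub>R ?b x) \<bullet> (?a x - 1 *\<^sub>R ?b x) \<partial>lborel)
       = D (h n) - 2 * (\<integral>x. ?a x \<bullet> ?b x \<partial>lborel) + D (h (Suc n))"
      unfolding L2_dist_expand[OF N] by (simp add: D_def)
    have exp2: "(\<integral>x. (?a x - (-1) *\<^sub>R ?b x) \<bullet> (?a x - (-1) *\<^sub>R ?b x) \<partial>lborel)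
       = D (h n) + 2 * (\<integral>x. ?a x \<bullet> ?b x \<partial>lborel) + D (h (Suc n))"
      unfolding L2_dist_expand[OF N] by (simp add: D_def)
    \<comment> \<open>The midpoint of two consecutive terms, written as a difference because
      \<open>Vlin\<close> speaks of differences. It lies in \<open>V\<close>, so its distance is at
      least the infimum; this is what bounds the increment.\<close>
    let ?m = "\<lambda>x. (1/2) *\<^sub>R h n x - (- 1/2) *\<^sub>R h (Suc n) x"
    have "?m \<in> V"
    proof -
      have "(\<lambda>x. 0 - (-1/2) *\<^sub>R h n x) \<in> V"
        using Vlin[OF V0 h(1)] .
      from Vlin[OF this h(1), of "- 1/2" "Suc n"] show ?thesis by simp
    qed
    have "4 * D ?m = (\<integral>x. (?a x - (-1) *\<^sub>R ?b x) \<bullet> (?a x - (-1) *\<^sub>R ?b x) \<partial>lborel)"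
    proof -
      have "4 * ((f x - ?m x) \<bullet> (f x - ?m x)) = (?a x - (-1) *\<^sub>R ?b x) \<bullet> (?a x - (-1) *\<^sub>R ?b x)" for x
      proof -
        have "?a x - (-1) *\<^sub>R ?b x = 2 *\<^sub>R (f x - ?m x)"
          by (simp add: algebra_simps scaleR_2)
        then show ?thesis by simp
      qed
      then show ?thesis
        unfolding D_def integral_mult_right_zero[symmetric] by (simp only:)
    qed
    then have "(\<integral>x. (?a x - 1 *\<^sub>R ?b x) \<bullet> (?a x - 1 *\<^sub>R ?b x) \<partial>lborel) = 2 * D (h n) + 2 * D (h (Suc n)) - 4 * D ?m"
      using exp1 exp2 by simp
    also have "\<dots> \<le> 2 * (d + (1/4) ^ n) + 2 * (d + (1/4) ^ Suc n) - 4 * d"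
    proof -
      have "2 * a + 2 * b - 4 * m \<le> 2 * a' + 2 * b' - 4 * d" if "a < a'" "b < b'" "d \<le> m" for a b m a' b' :: real
        using that by simp
      from this[OF h(2)[of n] h(2)[of "Suc n"] dle[OF \<open>?m \<in> V\<close>]] show ?thesis .
    qed
    also have "\<dots> \<le> 4 * (1/4) ^ n"
      by simp
    also have "\<dots> = (2/2 ^ n)\<^sup>2"
      by (simp add: power_divide power2_eq_square flip: power_mult_distrib)
    finally have "(\<integral>x. (h (Suc n) x - h n x) \<bullet> (h (Suc n) x - h n x) \<partial>lborel) \<le> (2/2 ^ n)\<^sup>2"
      by simp
    moreover have "\<exists>N. Lp_bound 2 (\<lambda>x. h (Suc n) x - h n x) N"
    proof -
      obtain N N' where "Lp_bound 2 (h (Suc n)) N" "Lp_bound 2 (h n) N'"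
        using hL by blast
      from Lp_bound_diff[OF this] show ?thesis by auto
    qed
    ultimately show ?thesis
      using Lp_bound_2_iff[of "\<lambda>x. h (Suc n) x - h n x" _ "2/2 ^ n"] by auto
  qed
  obtain g where "g \<in> borel_measurable borel" "AE x in lborel. (\<lambda>n. h n x) \<longlonglongrightarrow> g x"
      and g: "\<And>n. Lp_bound 2 (\<lambda>x. g x - h n x) (2 * 2/2 ^ n)"
    by (rule Riesz_Fischer[OF hm cauchy]) simp_all
  have lim0: "(\<lambda>n. 4/2 ^ n :: real) \<longlonglongrightarrow> 0"
    using tendsto_mult_left[OF LIMSEQ_realpow_zero[of "1/2"], of 4] by (simp add: power_divide)
  obtain N0 where N0: "Lp_bound 2 (h 0) N0" using hL by blast
  have gL: "Lp_bound 2 g (2 * 2/2 ^ 0 + N0)"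
    using Lp_bound_add[OF g[of 0] N0] by simp
  have gdiv: "div_free g"
  proof (rule div_free_Lp_limit[OF gL])
    fix e :: real assume e: "0 < e"
    obtain n where "4/2 ^ n < e"
      using order_tendstoD(2)[OF lim0 e] by (auto simp: eventually_sequentially)
    then have "Lp_bound 2 (\<lambda>x. g x - h n x) e"
      using Lp_bound_mono[OF g[of n]] by simp
    then show "\<exists>v N'. div_free v \<and> Lp_bound 2 v N' \<and> Lp_bound 2 (\<lambda>x. g x - v x) e"
      using h(1)[of n] by (auto simp: V_def)
  qed simp
  have gV: "g \<in> V" using gL gdiv by (auto simp: V_def)
  obtain Ng where Ng: "Lp_bound 2 (\<lambda>x. f x - g x) Ng" using Vsub[OF gV] by blast
  have "Lp_bound 2 (\<lambda>x. f x - g x) (sqrt (d + (1/4) ^ n) + 4/2 ^ n)" for n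
  proof -
    obtain N where N: "Lp_bound 2 (\<lambda>x. f x - h n x) N" using Vsub[OF h(1)] by blast
    have "Lp_bound 2 (\<lambda>x. f x - h n x) (sqrt (d + (1/4) ^ n))"
      using h(2)[of n] d0 Lp_bound_2_iff[OF N, of "sqrt (d + (1/4) ^ n)"] by (simp add: D_def)
    from Lp_bound_diff[OF this g[of n]] show ?thesis by simp
  qed
  moreover have "(\<lambda>n. sqrt (d + (1/4) ^ n) + 4/2 ^ n) \<longlonglongrightarrow> sqrt (d + 0) + 0"
    by (intro tendsto_add tendsto_real_sqrt tendsto_const LIMSEQ_realpow_zero lim0) auto
  ultimately have "Lp_bound 2 (\<lambda>x. f x - g x) (sqrt (d + 0) + 0)"
    by (rule Lp_bound_LIMSEQ) simp
  then have "Lp_bound 2 (\<lambda>x. f x - g x) (sqrt d)"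
    by simp
  then have Dg: "D g \<le> d"
    using Lp_bound_2_iff[OF Ng, of "sqrt d"] d0 by (simp add: D_def)
  have orth: "(\<integral>x. (f x - g x) \<bullet> h x \<partial>lborel) = 0" if "h \<in> V" for h
  proof -
    obtain N where N: "Lp_bound 2 h N" using \<open>h \<in> V\<close> by (auto simp: V_def)
    define \<alpha> where "\<alpha> = (\<integral>x. (f x - g x) \<bullet> h x \<partial>lborel)"
    define \<beta> where "\<beta> = (\<integral>x. h x \<bullet> h x \<partial>lborel)"
    have \<beta>: "0 \<le> \<beta>" unfolding \<beta>_def by (intro integral_nonneg_AE) auto
    \<comment> \<open>The optimal step would be \<open>\<alpha> / \<beta>\<close>; adding 1 avoids
      division by zero, and minimality still forces \<open>c = 0\<close>.\<close>
    define c where "c = \<alpha> / (\<beta> + 1)"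
    have "d \<le> D (\<lambda>x. g x - (- c) *\<^sub>R h x)"
      by (rule dle[OF Vlin[OF gV \<open>h \<in> V\<close>]])
    also have "D (\<lambda>x. g x - (- c) *\<^sub>R h x) = D g - 2 * c * \<alpha> + c\<^sup>2 * \<beta>"
      using L2_dist_expand[OF Ng N, of c] by (simp add: D_def \<alpha>_def \<beta>_def diff_diff_eq)
    finally have "2 * c * \<alpha> \<le> c\<^sup>2 * \<beta>" using Dg by linarith
    moreover have "\<alpha> = c * (\<beta> + 1)" using \<beta> by (simp add: c_def)
    ultimately have "c\<^sup>2 * (\<beta> + 2) \<le> 0"
      by (simp add: power2_eq_square algebra_simps)
    then have "c = 0"
      using \<beta> by (auto simp: mult_le_0_iff)
    then show ?thesis
      using \<open>\<alpha> = c * (\<beta> + 1)\<close> by (simp add: \<alpha>_def)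
  qed
  have "is_leray_projection f g"
    using gL gdiv orth by (auto simp: is_leray_projection_def Lp_space_iff V_def)
  then show ?thesis by blast
qed

lemma leray_spec:
  assumes "Lp_bound 2 f F"
  shows "is_leray_projection f (leray f)"
  unfolding leray_def using someI_ex[OF leray_projection_exists[OF assms]] .

text \<open>\<open>leray\<close> is an arbitrary choice, so its algebraic properties are obtained by
  checking that a candidate is a projection and then using uniqueness up to null sets.\<close>

lemma leray_projection_unique:
  assumes f: "Lp_bound 2 f F" and g: "is_leray_projection f g" "is_leray_projection f h"
  shows "AE x in lborel. g x = h x"
proof -
  obtain A B where A: "Lp_bound 2 g A" and B: "Lp_bound 2 h B"
    using g by (auto simp: is_leray_projection_def Lp_space_iff)
  let ?w = "\<lambda>x. g x - h x"
  have w: "Lp_bound 2 ?w (A + B)" by (rule Lp_bound_diff[OF A B]) simp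
  have wd: "div_free ?w"
    using g by (intro div_free_diff[OF _ _ A B]) (auto simp: is_leray_projection_def)
  have "?w \<in> Lp_space 2" using w by (auto simp: Lp_space_iff)
  then have 0: "(\<integral>x. (f x - g x) \<bullet> ?w x \<partial>lborel) = 0" "(\<integral>x. (f x - h x) \<bullet> ?w x \<partial>lborel) = 0"
    using g wd by (auto simp: is_leray_projection_def)
  have "(\<integral>x. ?w x \<bullet> ?w x \<partial>lborel) = (\<integral>x. (f x - h x) \<bullet> ?w x - (f x - g x) \<bullet> ?w x \<partial>lborel)"
    by (intro Bochner_Integration.integral_cong refl) (simp add: inner_diff_left)
  also have "\<dots> = 0"
    by (subst Bochner_Integration.integral_diff)
       (auto intro!: L2_inner_integrable[OF _ w] Lp_bound_diff[OF f] A B simp: 0)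
  finally have "Lp_bound 2 ?w 0"
    using Lp_bound_2_iff[OF w, of 0] by simp
  then show ?thesis
    using Lp_bound_0_AE[of 2 ?w] by (auto elim: eventually_mono)
qed

lemma leray_div_free: "Lp_bound 2 f F \<Longrightarrow> div_free (leray f)"
  using leray_spec by (auto simp: is_leray_projection_def)

text \<open>Pythagoras: \<open>f - leray f\<close> is orthogonal to \<open>leray f\<close>, which is
  itself an admissible competitor.\<close>

lemma Lp_bound_leray:
  assumes f: "Lp_bound 2 f F"
  shows "Lp_bound 2 (leray f) F"
proof -
  let ?g = "leray f"
  have g: "is_leray_projection f ?g" by (rule leray_spec[OF f])
  then obtain G where G: "Lp_bound 2 ?g G"
    by (auto simp: is_leray_projection_def Lp_space_iff)
  have w: "Lp_bound 2 (\<lambda>x. f x - ?g x) (F + G)" by (rule Lp_bound_diff[OF f G]) simp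
  have 0: "(\<integral>x. (f x - ?g x) \<bullet> ?g x \<partial>lborel) = 0"
    using g by (auto simp: is_leray_projection_def)
  have "(\<integral>x. f x \<bullet> f x \<partial>lborel) = (\<integral>x. ((f x - ?g x) - (-1) *\<^sub>R ?g x) \<bullet> ((f x - ?g x) - (-1) *\<^sub>R ?g x) \<partial>lborel)"
    by simp
  also have "\<dots> = (\<integral>x. (f x - ?g x) \<bullet> (f x - ?g x) \<partial>lborel) + (\<integral>x. ?g x \<bullet> ?g x \<partial>lborel)"
    unfolding L2_dist_expand[OF w G] using 0 by simp
  finally have "(\<integral>x. ?g x \<bullet> ?g x \<partial>lborel) \<le> (\<integral>x. f x \<bullet> f x \<partial>lborel)"
    using integral_nonneg_AE[where M = lborel and f = "\<lambda>x. (f x - ?g x) \<bullet> (f x - ?g x)"] by simp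
  also have "\<dots> \<le> F\<^sup>2"
    using f Lp_bound_2_iff[OF f] Lp_boundD(2)[OF f] by simp
  finally show ?thesis
    using Lp_bound_2_iff[OF G] Lp_boundD(2)[OF f] by simp
qed

lemma leray_diff_AE:
  assumes f: "Lp_bound 2 f F" and f': "Lp_bound 2 f' F'"
  shows "AE x in lborel. leray (\<lambda>x. f x - f' x) x = leray f x - leray f' x"
proof (rule leray_projection_unique)
  show d: "Lp_bound 2 (\<lambda>x. f x - f' x) (F + F')" by (rule Lp_bound_diff[OF f f']) simp
  show "is_leray_projection (\<lambda>x. f x - f' x) (leray (\<lambda>x. f x - f' x))" by (rule leray_spec[OF d])
  note g = Lp_bound_leray[OF f] and g' = Lp_bound_leray[OF f']
  have gd: "Lp_bound 2 (\<lambda>x. leray f x - leray f' x) (F + F')" by (rule Lp_bound_diff[OF g g']) simp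
  show "is_leray_projection (\<lambda>x. f x - f' x) (\<lambda>x. leray f x - leray f' x)"
    unfolding is_leray_projection_def
  proof (intro conjI ballI impI)
    show "(\<lambda>x. leray f x - leray f' x) \<in> Lp_space 2" using gd by (auto simp: Lp_space_iff)
    show "div_free (\<lambda>x. leray f x - leray f' x)"
      using leray_div_free[OF f] leray_div_free[OF f'] g g' by (intro div_free_diff) auto
    fix h :: "real^3 \<Rightarrow> real^3" assume h: "h \<in> Lp_space 2" "div_free h"
    then obtain H where H: "Lp_bound 2 h H" by (auto simp: Lp_space_iff)
    have "(\<integral>x. (f x - f' x - (leray f x - leray f' x)) \<bullet> h x \<partial>lborel)
      = (\<integral>x. (f x - leray f x) \<bullet> h x - (f' x - leray f' x) \<bullet> h x \<partial>lborel)"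
      by (intro Bochner_Integration.integral_cong refl) (simp add: inner_diff_left)
    also have "\<dots> = (\<integral>x. (f x - leray f x) \<bullet> h x \<partial>lborel) - (\<integral>x. (f' x - leray f' x) \<bullet> h x \<partial>lborel)"
      by (rule Bochner_Integration.integral_diff)
         (auto intro!: L2_inner_integrable[OF _ H] Lp_bound_diff[OF f g] Lp_bound_diff[OF f' g'])
    also have "\<dots> = 0"
    proof -
      have "(\<integral>x. (f x - leray f x) \<bullet> h x \<partial>lborel) = 0" "(\<integral>x. (f' x - leray f' x) \<bullet> h x \<partial>lborel) = 0"
        using leray_spec[OF f] leray_spec[OF f'] h unfolding is_leray_projection_def by blast+
      then show ?thesis by simp
    qed
    finally show "(\<integral>x. (f x - f' x - (leray f x - leray f' x)) \<bullet> h x \<partial>lborel) = 0" .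
  qed
qed

lemma Lp_bound_leray_diff:
  assumes f: "Lp_bound 2 f F" and f': "Lp_bound 2 f' F'" and d: "Lp_bound 2 (\<lambda>x. f x - f' x) e"
  shows "Lp_bound 2 (\<lambda>x. leray f x - leray f' x) e"
  using Lp_boundD(1)[OF Lp_bound_leray[OF f]] Lp_boundD(1)[OF Lp_bound_leray[OF f']] leray_diff_AE[OF f f']
  by (intro Lp_bound_cong_AE[OF Lp_bound_leray[OF d]]) (auto elim: eventually_mono)

text \<open>The divergence-free fields form a translation invariant space, hence so does the
  projection. This lets spatial increments pass through the projector, which is the basis of the
  Lipschitz bounds for the convection source.\<close>

lemma leray_translate_AE:
  assumes f: "Lp_bound 2 f F"
  shows "AE x in lborel. leray (\<lambda>x. f (x + a)) x = leray f (x + a)"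
proof (rule leray_projection_unique)
  show d: "Lp_bound 2 (\<lambda>x. f (x + a)) F" by (rule Lp_bound_translate[OF f])
  show "is_leray_projection (\<lambda>x. f (x + a)) (leray (\<lambda>x. f (x + a)))" by (rule leray_spec[OF d])
  note g = Lp_bound_leray[OF f]
  have [measurable]: "f \<in> borel_measurable borel" "leray f \<in> borel_measurable borel"
    using f g by (auto dest: Lp_boundD)
  show "is_leray_projection (\<lambda>x. f (x + a)) (\<lambda>x. leray f (x + a))"
    unfolding is_leray_projection_def
  proof (intro conjI ballI impI)
    show "(\<lambda>x. leray f (x + a)) \<in> Lp_space 2" using Lp_bound_translate[OF g] by (auto simp: Lp_space_iff)
    show "div_free (\<lambda>x. leray f (x + a))"
      by (rule div_free_translate[OF leray_div_free[OF f]]) simp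
    fix h :: "real^3 \<Rightarrow> real^3" assume h: "h \<in> Lp_space 2" "div_free h"
    then obtain H where H: "Lp_bound 2 h H" by (auto simp: Lp_space_iff)
    then have [measurable]: "h \<in> borel_measurable borel" by (auto dest: Lp_boundD)
    have h': "(\<lambda>x. h (x + - a)) \<in> Lp_space 2" "div_free (\<lambda>x. h (x + - a))"
      using Lp_bound_translate[OF H, of "- a"] div_free_translate[OF h(2), of "- a"]
      unfolding Lp_space_iff[OF zero_less_numeral] by auto
    have "(\<integral>x. (f (x + a) - leray f (x + a)) \<bullet> h x \<partial>lborel)
       = (\<integral>x. (f (x + a) - leray f (x + a)) \<bullet> h ((x + a) + - a) \<partial>lborel)"
      by simp
    also have "\<dots> = (\<integral>x. (f x - leray f x) \<bullet> h (x + - a) \<partial>lborel)"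
      by (rule integral_translate) measurable
    also have "\<dots> = 0"
      using leray_spec[OF f] h' unfolding is_leray_projection_def by blast
    finally show "(\<integral>x. (f (x + a) - leray f (x + a)) \<bullet> h x \<partial>lborel) = 0" .
  qed
qed

lemma Lp_cont_leray:
  assumes "Lp_cont 2 S f"
  shows "Lp_cont 2 S (\<lambda>s. leray (f s))"
  unfolding Lp_cont_def
proof (intro ballI conjI allI impI)
  fix t assume t: "t \<in> S"
  obtain N where N: "Lp_bound 2 (f t) N" using Lp_contD[OF assms t] .
  then show "\<exists>N. Lp_bound 2 (leray (f t)) N" using Lp_bound_leray by blast
  fix e :: real assume e: "0 < e"
  obtain d where d: "0 < d" "\<And>s. s \<in> S \<Longrightarrow> \<bar>s - t\<bar> < d \<Longrightarrow> Lp_bound 2 (\<lambda>x. f s x - f t x) e"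
    using Lp_contE[OF assms t e] by blast
  have "Lp_bound 2 (\<lambda>x. leray (f s) x - leray (f t) x) e" if s: "s \<in> S" "\<bar>s - t\<bar> < d" for s
  proof -
    obtain N' where "Lp_bound 2 (f s) N'" using Lp_contD[OF assms s(1)] .
    then show ?thesis using Lp_bound_leray_diff[OF _ N d(2)[OF s]] by blast
  qed
  with d show "\<exists>d>0. \<forall>s\<in>S. \<bar>s - t\<bar> < d \<longrightarrow> Lp_bound 2 (\<lambda>x. leray (f s) x - leray (f t) x) e"
    by blast
qed

section \<open>The heat semigroup\<close>

lemma measurable_wide_gaussian[measurable]: "wide_gaussian t \<in> borel_measurable borel"
  unfolding wide_gaussian_def by measurable

text \<open>Away from time zero the kernel is Lipschitz in time, the case \<eta> = 1 of the time
  difference bound; no time integral is taken here, so the stronger singularity is harmless.\<close>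

lemma conv_Lp_cont:
  fixes f :: "real^3 \<Rightarrow> 'b::euclidean_space"
  assumes K: "heat_like K \<mu> A" and f: "Lp_bound p f N" and p: "1 \<le> p" "p \<le> q"
  shows "Lp_cont q {0<..} (\<lambda>t. conv (K t) f)"
  unfolding Lp_cont_def
proof (intro ballI conjI allI impI)
  fix t :: real assume "t \<in> {0<..}"
  then have t: "0 < t" by simp
  have q: "1 \<le> q" using p by simp
  have A0: "0 \<le> A" using heat_like_nonneg[OF K] by simp
  have N0: "0 \<le> N" using f by (rule Lp_boundD)
  define a where "a = \<mu> + 3/2 * (1 / p - 1 / q)"
  have "1 / q \<le> 1 / p" using p by (simp add: frac_le)
  then have a0: "0 \<le> a" using heat_like_nonneg[OF K] by (simp add: a_def)
  show "\<exists>N. Lp_bound q (conv (K t) f) N"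
    using Lp_bound_conv_heat_like[OF K t f p] by blast
  fix e :: real assume e: "0 < e"
  define C where "C = 2 * A * (t / 2) powr (- a - 1) * N"
  have C: "0 \<le> C" using A0 N0 by (simp add: C_def)
  have main: "Lp_bound q (\<lambda>x. conv (K v) f x - conv (K u) f x) (C * (v - u))"
    if uv: "t / 2 \<le> u" "u \<le> v" for u v
  proof -
    have u: "0 < u" "0 < v" using uv t by auto
    have "Lp_bound q (conv (\<lambda>x. K v x - K u x) f) (2 * A * (v - u) powr 1 * u powr (- a - 1) * N)"
      by (rule Lp_bound_conv_time_difference[OF K u(1) uv(2) f p a_def]) auto
    moreover have "2 * A * (v - u) powr 1 * u powr (- a - 1) * N \<le> C * (v - u)"
    proof -
      have "u powr (- a - 1) \<le> (t / 2) powr (- a - 1)"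
        using uv t a0 by (intro powr_mono2') auto
      then have "2 * A * (v - u) * u powr (- a - 1) * N \<le> 2 * A * (v - u) * (t / 2) powr (- a - 1) * N"
        using A0 N0 uv by (intro mult_right_mono mult_left_mono) auto
      also have "\<dots> = C * (v - u)"
        by (simp only: C_def mult_ac)
      finally show ?thesis using uv by simp
    qed
    ultimately have "Lp_bound q (conv (\<lambda>x. K v x - K u x) f) (C * (v - u))"
      by (rule Lp_bound_mono) (use q in simp)
    moreover have "conv (\<lambda>x. K v x - K u x) f = (\<lambda>x. conv (K v) f x - conv (K u) f x)"
      by (rule ext, rule conv_diff_left[OF heat_like_bound[OF K u(2)] heat_like_bound[OF K u(1)] f p(1)])
    ultimately show ?thesis by simp
  qed
  show "\<exists>d>0. \<forall>s\<in>{0<..}. \<bar>s - t\<bar> < d \<longrightarrow> Lp_bound q (\<lambda>x. conv (K s) f x - conv (K t) f x) e"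
  proof (intro exI[of _ "min (t / 2) (e / (C + 1))"] conjI ballI impI)
    show "0 < min (t / 2) (e / (C + 1))" using t e C by simp
    fix s :: real assume s: "s \<in> {0<..}" "\<bar>s - t\<bar> < min (t / 2) (e / (C + 1))"
    have "C * \<bar>s - t\<bar> \<le> C * (e / (C + 1))"
      using s C by (intro mult_left_mono) auto
    also have "\<dots> \<le> e"
      using C e by (simp add: field_simps)
    finally have le: "C * \<bar>s - t\<bar> \<le> e" .
    have h: "t / 2 \<le> s" "t / 2 \<le> t" using s t by (auto simp: abs_if split: if_splits)
    show "Lp_bound q (\<lambda>x. conv (K s) f x - conv (K t) f x) e"
    proof (cases "t \<le> s")
      case True
      then show ?thesis
        using Lp_bound_mono[OF main[OF h(2) True]] le q by simp
    next
      case False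
      then have st: "s \<le> t" by simp
      have "Lp_bound q (\<lambda>x. conv (K t) f x - conv (K s) f x) e"
        using Lp_bound_mono[OF main[OF h(1) st]] le False q by simp
      from Lp_bound_scaleR[OF this, of "-1"] show ?thesis using q by simp
    qed
  qed
qed

lemma Lp_bound_conv_heat_kernel:
  fixes f :: "real^3 \<Rightarrow> 'b::euclidean_space"
  assumes "0 < t" "Lp_bound p f N" "1 \<le> p" "p \<le> q"
  shows "Lp_bound q (conv (G t) f) (t powr (- 3/2 * (1 / p - 1 / q)) * N)"
  using Lp_bound_conv[OF kernel_bound_heat_kernel[OF assms(1)] assms(2-4)] by simp

lemma norm_conv_heat_kernel_le:
  fixes f :: "real^3 \<Rightarrow> 'b::euclidean_space"
  assumes "0 < t" "Lp_bound p f N" "1 \<le> p"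
  shows "norm (conv (G t) f x) \<le> t powr (- 3 / (2 * p)) * N"
  using norm_conv_le[OF kernel_bound_heat_kernel[OF assms(1)] assms(2,3), of x] by simp

lemma powr_small:
  assumes "0 < g" "0 \<le> (C::real)" "0 < e"
  shows "\<exists>d>0. \<forall>t. 0 < t \<and> t < d \<longrightarrow> C \<le> e * t powr (- g)"
proof (intro exI[of _ "(e / (C + 1)) powr (1 / g)"] conjI allI impI)
  show "0 < (e / (C + 1)) powr (1 / g)" using assms by simp
  fix t :: real assume "0 < t \<and> t < (e / (C + 1)) powr (1 / g)"
  then have t: "0 < t" "t < (e / (C + 1)) powr (1 / g)" by auto
  have "t powr g \<le> ((e / (C + 1)) powr (1 / g)) powr g"
    using t assms by (intro powr_mono2) auto
  also have "\<dots> = e / (C + 1)" using assms by (simp add: powr_powr)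
  finally have "t powr g * (C + 1) \<le> e" using assms by (simp add: field_simps)
  moreover have "t powr g * C \<le> t powr g * (C + 1)"
    by (intro mult_left_mono) auto
  ultimately have "C * t powr g \<le> e" by (simp add: mult.commute)
  then show "C \<le> e * t powr (- g)"
    using t by (simp add: powr_minus field_simps)
qed

section \<open>Vanishing of the weighted heat flow at time zero\<close>

text \<open>Smallness by density: the truncated part has a bounded L^q norm, negligible against a
  negative power of \<open>t\<close>, and the remainder is small in L^p and enjoys the
  scale-invariant bound. This is why large data are admissible for a short time.\<close>

lemma heat_decay_small:
  fixes f :: "real^3 \<Rightarrow> 'b::euclidean_space"
  assumes f: "Lp_bound p f N" and p: "1 \<le> p" "p < q" and e: "0 < e"
  shows "\<exists>d>0. \<forall>t. 0 < t \<and> t < d \<longrightarrow>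
     Lp_bound q (conv (G t) f) (e * t powr (- (3/2 * (1 / p - 1 / q))))"
proof -
  define g where "g = 3/2 * (1 / p - 1 / q)"
  have g: "0 < g" using p by (simp add: g_def frac_less2)
  have fm[measurable]: "f \<in> borel_measurable borel" using f by (rule Lp_boundD)
  have pos: "0 < p" using p by simp
  obtain R where R: "0 \<le> R" "Lp_bound p (\<lambda>x. f x - cutoff R f x) (e / 2)"
    by (rule Lp_bound_minus_cutoff[OF f pos half_gt_zero[OF e]])
  obtain N1 where N1: "Lp_bound q (cutoff R f) N1"
    using Lp_bound_cutoff_any[OF fm _ R(1), of q] p by auto
  obtain N2 where N2: "Lp_bound p (cutoff R f) N2"
    using Lp_bound_cutoff_any[OF fm pos R(1)] by blast
  have N1': "0 \<le> N1" using N1 by (rule Lp_boundD)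
  obtain d where "0 < d" "\<forall>t. 0 < t \<and> t < d \<longrightarrow> N1 \<le> e / 2 * t powr (- g)"
    using powr_small[OF g N1' half_gt_zero[OF e]] by blast
  then have d: "0 < d" "\<And>t. 0 < t \<Longrightarrow> t < d \<Longrightarrow> N1 \<le> e / 2 * t powr (- g)" by blast+
  have "Lp_bound q (conv (G t) f) (e * t powr (- g))" if t: "0 < t" "t < d" for t
  proof -
    have 1: "Lp_bound q (conv (G t) (\<lambda>x. f x - cutoff R f x)) (t powr (- 3/2 * (1 / p - 1 / q)) * (e / 2))"
      by (rule Lp_bound_conv_heat_kernel[OF t(1) R(2)]) (use p in auto)
    have 2: "Lp_bound q (conv (G t) (cutoff R f)) N1"
      using Lp_bound_conv_heat_kernel[OF t(1) N1, of q] p t by simp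
    have eq: "conv (G t) f x = conv (G t) (\<lambda>x. f x - cutoff R f x) x + conv (G t) (cutoff R f) x" for x
      by (simp add: conv_diff_right[OF kernel_bound_heat_kernel[OF t(1)] f N2 p(1) p(1)])
    have "Lp_bound q (conv (G t) f) (t powr (- 3/2 * (1 / p - 1 / q)) * (e / 2) + N1)"
      unfolding eq[abs_def] by (rule Lp_bound_add[OF 1 2]) (use p in simp)
    moreover have "t powr (- 3/2 * (1 / p - 1 / q)) = t powr (- g)"
      by (simp add: g_def)
    ultimately have "Lp_bound q (conv (G t) f) (t powr (- g) * (e / 2) + N1)"
      by (simp only:)
    then show ?thesis
      by (rule Lp_bound_mono) (use d(2)[OF t] p in \<open>auto simp: field_simps\<close>)
  qed
  then show ?thesis
    using d(1) unfolding g_def by blast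
qed

lemma heat_decay_small_sup:
  fixes f :: "real^3 \<Rightarrow> 'b::euclidean_space"
  assumes f: "Lp_bound p f N" and p: "1 \<le> p" and e: "0 < e"
  shows "\<exists>d>0. \<forall>t x. 0 < t \<and> t < d \<longrightarrow> norm (conv (G t) f x) \<le> e * t powr (- (3 / (2 * p)))"
proof -
  define g where "g = 3 / (2 * p)"
  have g: "0 < g" using p by (simp add: g_def)
  have fm[measurable]: "f \<in> borel_measurable borel" using f by (rule Lp_boundD)
  have pos: "0 < p" using p by simp
  obtain R where R: "0 \<le> R" "Lp_bound p (\<lambda>x. f x - cutoff R f x) (e / 2)"
    by (rule Lp_bound_minus_cutoff[OF f pos half_gt_zero[OF e]])
  obtain N2 where N2: "Lp_bound p (cutoff R f) N2"
    using Lp_bound_cutoff_any[OF fm pos R(1)] by blast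
  obtain d where "0 < d" "\<forall>t. 0 < t \<and> t < d \<longrightarrow> R \<le> e / 2 * t powr (- g)"
    using powr_small[OF g R(1) half_gt_zero[OF e]] by blast
  then have d: "0 < d" "\<And>t. 0 < t \<Longrightarrow> t < d \<Longrightarrow> R \<le> e / 2 * t powr (- g)" by blast+
  have "norm (conv (G t) f x) \<le> e * t powr (- g)" if t: "0 < t" "t < d" for t x
  proof -
    have 1: "norm (conv (G t) (\<lambda>x. f x - cutoff R f x) x) \<le> t powr (- 3 / (2 * p)) * (e / 2)"
      by (rule norm_conv_heat_kernel_le[OF t(1) R(2) p])
    have i: "integrable lborel (\<lambda>y. G t (x - y) *\<^sub>R cutoff R f y)"
      by (rule conv_integrable[OF kernel_bound_heat_kernel[OF t(1)] N2 p])
    have "ennreal (norm (conv (G t) (cutoff R f) x))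
        \<le> (\<integral>\<^sup>+y. ennreal (norm (G t (x - y) *\<^sub>R cutoff R f y)) \<partial>lborel)"
      unfolding conv_def by (rule integral_norm_bound_ennreal[OF i])
    also have "\<dots> \<le> (\<integral>\<^sup>+y. ennreal (G t (x - y)) * ennreal R \<partial>lborel)"
      using R by (intro nn_integral_mono)
        (auto simp: heat_kernel_nonneg norm_cutoff_le simp flip: ennreal_mult intro!: ennreal_leI mult_left_mono)
    also have "\<dots> = (\<integral>\<^sup>+y. ennreal (G t (x - y)) \<partial>lborel) * ennreal R"
      by (rule nn_integral_multc) auto
    also have "\<dots> = ennreal R"
      using nn_integral_reflect[of "\<lambda>y. ennreal (G t y)" x] nn_integral_heat_kernel[OF t(1)] by simp
    finally have 2: "norm (conv (G t) (cutoff R f) x) \<le> R"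
      using R by simp
    have eq: "conv (G t) f x = conv (G t) (\<lambda>x. f x - cutoff R f x) x + conv (G t) (cutoff R f) x"
      by (simp add: conv_diff_right[OF kernel_bound_heat_kernel[OF t(1)] f N2 p p])
    have "norm (conv (G t) f x) \<le> t powr (- 3 / (2 * p)) * (e / 2) + R"
      unfolding eq by (rule order_trans[OF norm_triangle_ineq add_mono[OF 1 2]])
    also have "t powr (- 3 / (2 * p)) * (e / 2) + R = t powr (- g) * (e / 2) + R"
      by (simp add: g_def)
    also have "\<dots> \<le> e * t powr (- g)"
      using d(2)[OF t] by (simp add: field_simps)
    finally show ?thesis .
  qed
  then show ?thesis
    using d(1) unfolding g_def by blast
qed

section \<open>Strong continuity of the heat semigroup at time zero\<close>

definition heat_approx :: "real \<Rightarrow> (real^3 \<Rightarrow> 'b::euclidean_space) \<Rightarrow> bool" where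
  "heat_approx p f \<longleftrightarrow> (\<forall>e>0. \<exists>d>0. \<forall>t. 0 < t \<and> t < d \<longrightarrow>
     Lp_bound p (\<lambda>x. conv (G t) f x - f x) e)"

text \<open>Convolution with the heat kernel is a contraction, so an argument with three thirds of
  \<open>e\<close> applies. The lemma drives the approximation from open sets to measurable sets,
  then to integrable functions and to L^p.\<close>

lemma heat_approx_closed:
  fixes f :: "real^3 \<Rightarrow> 'b::euclidean_space"
  assumes p: "1 \<le> p" and f: "Lp_bound p f N"
    and ex: "\<And>e. 0 < e \<Longrightarrow> \<exists>g N'. Lp_bound p g N' \<and> heat_approx p g \<and> Lp_bound p (\<lambda>x. f x - g x) e"
  shows "heat_approx p f"
  unfolding heat_approx_def
proof (intro allI impI)
  fix e :: real assume e: "0 < e"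
  then obtain g N' where g: "Lp_bound p g N'" "heat_approx p g" "Lp_bound p (\<lambda>x. f x - g x) (e / 3)"
    using ex[of "e / 3"] by auto
  have e3: "0 < e / 3" using e by simp
  obtain d where d: "0 < d" "\<forall>t. 0 < t \<and> t < d \<longrightarrow> Lp_bound p (\<lambda>x. conv (G t) g x - g x) (e / 3)"
    using g(2) e3 unfolding heat_approx_def by blast
  have "Lp_bound p (\<lambda>x. conv (G t) f x - f x) e" if t: "0 < t" "t < d" for t
  proof -
    have c: "Lp_bound p (conv (G t) (\<lambda>x. f x - g x)) (e / 3)"
      using Lp_bound_conv_same[OF kernel_bound_heat_kernel[OF t(1)] g(3) p] by simp
    have "Lp_bound p (\<lambda>x. (conv (G t) (\<lambda>x. f x - g x) x - (f x - g x)) + (conv (G t) g x - g x))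
       (e / 3 + e / 3 + e / 3)"
      by (intro Lp_bound_add Lp_bound_diff c g(3) d(2)[rule_format] conjI t p)
    then show ?thesis
      by (simp add: conv_diff_right[OF kernel_bound_heat_kernel[OF t(1)] f g(1) p p])
  qed
  then show "\<exists>d>0. \<forall>t. 0 < t \<and> t < d \<longrightarrow> Lp_bound p (\<lambda>x. conv (G t) f x - f x) e"
    using d(1) by blast
qed

lemma Lp_bound_1_indicator:
  assumes [measurable]: "U \<in> sets borel" and "emeasure lborel U \<le> ennreal m" "0 \<le> m"
  shows "Lp_bound 1 (\<lambda>x. indicator U x *\<^sub>R c) (m * norm c)"
proof -
  have "(\<integral>\<^sup>+x. ennreal (norm (indicator U x *\<^sub>R c)) \<partial>lborel) = (\<integral>\<^sup>+x. ennreal (norm c) * indicator U x \<partial>lborel)"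
    by (intro nn_integral_cong) (auto simp: indicator_def)
  also have "\<dots> = ennreal (norm c) * emeasure lborel U"
    by (simp add: nn_integral_cmult_indicator)
  also have "\<dots> \<le> ennreal (norm c) * ennreal m"
    by (intro mult_left_mono assms) auto
  finally show ?thesis
    using assms by (simp add: Lp_bound_def mult.commute flip: ennreal_mult)
qed

text \<open>A Chebyshev estimate for the kernel mass outside the ball: there |x - y|^2 / (4 t) is at
  least r^2 / (4 t), and multiplied with the kernel it is at most four wide Gaussians. The constant
  128 is 16 * 8, with 8 the bound for the mass of the wide Gaussian.\<close>

lemma conv_indicator_lower:
  assumes t: "0 < t" and U[measurable]: "U \<in> sets borel" and r: "0 < r" "ball x r \<subseteq> U"
    and fin: "emeasure lborel U < \<infinity>"
  shows "1 \<le> conv (G t) (indicator U :: real^3 \<Rightarrow> real) x + 128 * t / r\<^sup>2"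
proof -
  have em: "emeasure lborel U \<le> ennreal (measure lborel U)"
    using fin by (simp add: emeasure_eq_ennreal_measure)
  have L1: "Lp_bound 1 (indicator U :: real^3 \<Rightarrow> real) (measure lborel U)"
    using Lp_bound_1_indicator[OF U em, of "1::real"] by simp
  have i: "integrable lborel (\<lambda>y. G t (x - y) *\<^sub>R (indicator U y :: real))"
    by (rule conv_integrable[OF kernel_bound_heat_kernel[OF t] L1]) simp
  have c: "ennreal (conv (G t) (indicator U) x) = (\<integral>\<^sup>+y. ennreal (G t (x - y) * indicator U y) \<partial>lborel)"
    unfolding conv_def using i by (subst nn_integral_eq_integral) (auto simp: heat_kernel_nonneg)
  have c0: "0 \<le> conv (G t) (indicator U :: real^3 \<Rightarrow> real) x"
    unfolding conv_def by (intro integral_nonneg_AE) (auto simp: heat_kernel_nonneg)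
  have "1 = (\<integral>\<^sup>+y. ennreal (G t (x - y)) \<partial>lborel)"
    using nn_integral_reflect[of "\<lambda>y. ennreal (G t y)" x] nn_integral_heat_kernel[OF t] by simp
  also have "\<dots> \<le> (\<integral>\<^sup>+y. ennreal (G t (x - y) * indicator U y) + ennreal (16 * t / r\<^sup>2 * \<bar>wide_gaussian t (x - y)\<bar>) \<partial>lborel)"
  proof (rule nn_integral_mono)
    fix y :: "real^3"
    show "ennreal (G t (x - y)) \<le> ennreal (G t (x - y) * indicator U y) + ennreal (16 * t / r\<^sup>2 * \<bar>wide_gaussian t (x - y)\<bar>)"
    proof (cases "y \<in> U")
      case False
      then have d: "r \<le> norm (x - y)" using r by (auto simp: subset_eq dist_norm not_less[symmetric])
      define u where "u = (norm (x - y))\<^sup>2 / (4 * t)"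
      have u0: "0 \<le> u" using t by (simp add: u_def)
      have "r\<^sup>2 \<le> (norm (x - y))\<^sup>2" using d r by (intro power_mono) auto
      then have "r\<^sup>2 / (4 * t) \<le> u" using t by (simp add: u_def divide_right_mono)
      then have "r\<^sup>2 / (4 * t) * G t (x - y) \<le> u * G t (x - y)"
        by (intro mult_right_mono heat_kernel_nonneg)
      also have "\<dots> \<le> 4 * wide_gaussian t (x - y)"
        using gaussian_coeffs(3)[OF u0] t unfolding u_def by (intro gaussian_poly_le) auto
      finally have "G t (x - y) \<le> 16 * t / r\<^sup>2 * wide_gaussian t (x - y)"
        using r t by (simp add: field_simps)
      then show ?thesis using False by (simp add: wide_gaussian_nonneg ennreal_leI)
    qed simp
  qed
  also have "\<dots> = ennreal (conv (G t) (indicator U) x) + (\<integral>\<^sup>+y. ennreal (16 * t / r\<^sup>2 * \<bar>wide_gaussian t (x - y)\<bar>) \<partial>lborel)"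
    unfolding c by (rule nn_integral_add) (auto simp: wide_gaussian_def)
  also have "(\<integral>\<^sup>+y. ennreal (16 * t / r\<^sup>2 * \<bar>wide_gaussian t (x - y)\<bar>) \<partial>lborel)
     = (\<integral>\<^sup>+y. ennreal (16 * t / r\<^sup>2) * ennreal \<bar>wide_gaussian t (x - y)\<bar> \<partial>lborel)"
    using t by (intro nn_integral_cong ennreal_mult) auto
  also have "\<dots> = (\<integral>\<^sup>+y. ennreal (16 * t / r\<^sup>2) * ennreal \<bar>wide_gaussian t y\<bar> \<partial>lborel)"
    by (rule nn_integral_reflect) measurable
  also have "\<dots> = ennreal (16 * t / r\<^sup>2) * (\<integral>\<^sup>+y. ennreal \<bar>wide_gaussian t y\<bar> \<partial>lborel)"
    by (rule nn_integral_cmult) (auto simp: wide_gaussian_def)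
  also have "\<dots> \<le> ennreal (16 * t / r\<^sup>2) * ennreal 8"
    by (intro mult_left_mono kernel_boundD(4)[OF kernel_bound_wide_gaussian[OF t]]) auto
  also have "\<dots> = ennreal (128 * t / r\<^sup>2)"
    using t by (subst ennreal_mult[symmetric]) auto
  finally have "ennreal 1 \<le> ennreal (conv (G t) (indicator U) x + 128 * t / r\<^sup>2)"
    using c0 t by (simp add: ennreal_plus)
  then show ?thesis
    using c0 t by (subst (asm) ennreal_le_iff) auto
qed

text \<open>
  Since convolution with the heat kernel preserves mass, it suffices that the convolution of the
  indicator function of an open set converges to 1 inside the set.
\<close>

lemma heat_approx_open:
  fixes U :: "(real^3) set" and c :: "'b::euclidean_space"
  assumes U: "open U" and fin: "emeasure lborel U < \<infinity>"
  shows "heat_approx 1 (\<lambda>x. indicator U x *\<^sub>R c)"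
proof -
  let ?i = "indicator U :: real^3 \<Rightarrow> real"
  let ?g = "\<lambda>t. conv (G t) ?i"
  define m where "m = measure lborel U"
  have [measurable]: "U \<in> sets borel" using U by auto
  have em: "emeasure lborel U = ennreal m"
    using fin by (simp add: emeasure_eq_ennreal_measure m_def)
  have m0: "0 \<le> m" by (simp add: m_def)
  have L1: "Lp_bound 1 ?i m"
    using Lp_bound_1_indicator[of U m "1::real"] em m0 by simp
  have g0: "0 \<le> ?g t x" for t x
    unfolding conv_def by (intro integral_nonneg_AE) (auto simp: heat_kernel_nonneg)
  have gL: "Lp_bound 1 (?g t) m" if "0 < t" for t
    using Lp_bound_conv_same[OF kernel_bound_heat_kernel[OF that] L1] by simp
  have gm: "?g t \<in> borel_measurable borel" if "0 < t" for t
    using gL[OF that] by (rule Lp_boundD)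
  have g1: "?g t x \<le> 1" if t: "0 < t" for t x
  proof -
    have "ennreal (?g t x) = (\<integral>\<^sup>+y. ennreal (G t (x - y) * ?i y) \<partial>lborel)"
      unfolding conv_def using conv_integrable[OF kernel_bound_heat_kernel[OF t] L1, of x]
      by (subst nn_integral_eq_integral) (auto simp: heat_kernel_nonneg)
    also have "\<dots> \<le> (\<integral>\<^sup>+y. ennreal (G t (x - y)) \<partial>lborel)"
      by (intro nn_integral_mono ennreal_leI) (auto simp: indicator_def heat_kernel_nonneg)
    also have "\<dots> = 1"
      using nn_integral_reflect[of "\<lambda>y. ennreal (G t y)" x] nn_integral_heat_kernel[OF t] by simp
    finally show ?thesis by simp
  qed
  \<comment> \<open>With 1_U the indicator of U, pointwise |g - 1_U| + 1_U = g + 2 (1 - g) 1_U since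
    0 <= g <= 1. Integrating and cancelling the mass \<open>m\<close> reduces the L^1 distance to
    the mass missing inside \<open>U\<close>, and avoids subtracting extended reals.\<close>
  have bound: "(\<integral>\<^sup>+x. ennreal (norm (?g t x - ?i x)) \<partial>lborel) \<le> 2 * (\<integral>\<^sup>+x. ennreal ((1 - ?g t x) * ?i x) \<partial>lborel)"
    if t: "0 < t" for t
  proof -
    note [measurable] = gm[OF t]
    have "(\<integral>\<^sup>+x. ennreal (norm (?g t x - ?i x)) \<partial>lborel) + ennreal m
       = (\<integral>\<^sup>+x. ennreal (norm (?g t x - ?i x)) + indicator U x \<partial>lborel)"
      by (subst nn_integral_add) (auto simp: em)
    also have "\<dots> = (\<integral>\<^sup>+x. ennreal (norm (?g t x)) + 2 * ennreal ((1 - ?g t x) * ?i x) \<partial>lborel)"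
    proof (rule nn_integral_cong)
      fix x
      show "ennreal (norm (?g t x - ?i x)) + indicator U x = ennreal (norm (?g t x)) + 2 * ennreal ((1 - ?g t x) * ?i x)"
      proof (cases "x \<in> U")
        case True
        have "ennreal (norm (?g t x - ?i x)) + indicator U x = ennreal (2 - ?g t x)"
          using True g0[of t x] g1[OF t, of x] by (simp flip: ennreal_plus ennreal_1)
        moreover have "ennreal (norm (?g t x)) + 2 * ennreal ((1 - ?g t x) * ?i x)
            = ennreal (?g t x) + ennreal (2 * (1 - ?g t x))"
        proof -
          have "2 * ennreal y = ennreal (2 * y)" for y
            by (simp add: ennreal_mult')
          then show ?thesis
            using True g0[of t x] by (simp only: indicator_simps mult_1_right real_norm_def abs_of_nonneg)
        qed
        moreover have "ennreal (?g t x) + ennreal (2 * (1 - ?g t x)) = ennreal (2 - ?g t x)"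
          using g0[of t x] g1[OF t, of x] by (subst ennreal_plus[symmetric]) auto
        ultimately show ?thesis by simp
      qed simp
    qed
    also have "\<dots> = (\<integral>\<^sup>+x. ennreal (norm (?g t x)) \<partial>lborel) + 2 * (\<integral>\<^sup>+x. ennreal ((1 - ?g t x) * ?i x) \<partial>lborel)"
      by (subst nn_integral_add) (auto simp: nn_integral_cmult)
    also have "\<dots> \<le> ennreal m + 2 * (\<integral>\<^sup>+x. ennreal ((1 - ?g t x) * ?i x) \<partial>lborel)"
      using Lp_boundD(3)[OF gL[OF t]] m0 by (intro add_right_mono) simp
    finally show ?thesis
      by (simp add: add.commute[of _ "ennreal m"] ennreal_add_left_cancel_le)
  qed
  show ?thesis
    unfolding heat_approx_def
  proof (intro allI impI)
    fix e :: real assume e: "0 < e"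
    define e' where "e' = e / (2 * (norm c + 1))"
    have nc: "0 < norm c + 1" by (simp add: add_nonneg_pos)
    have e': "0 < e'" using e nc by (simp add: e'_def)
    have "\<forall>\<^sub>F t in at_right 0. (\<integral>\<^sup>+x. ennreal ((1 - ?g t x) * ?i x) \<partial>lborel) < ennreal e'"
    proof (rule sequentially_imp_eventually_at_right[of 0 1])
      fix f :: "nat \<Rightarrow> real" assume f: "\<And>n. 0 < f n" "f \<longlonglongrightarrow> 0"
      have [measurable]: "?g (f n) \<in> borel_measurable borel" for n by (rule gm[OF f(1)])
      have "(\<lambda>n. \<integral>\<^sup>+x. ennreal ((1 - ?g (f n) x) * ?i x) \<partial>lborel) \<longlonglongrightarrow> (\<integral>\<^sup>+x. 0 \<partial>(lborel :: (real^3) measure))"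
      proof (rule nn_integral_dominated_convergence[where w = "indicator U"])
        show "AE x in lborel. ennreal ((1 - ?g (f n) x) * ?i x) \<le> indicator U x" for n
          using g0 by (intro AE_I2) (auto simp: indicator_def simp flip: ennreal_1 intro!: ennreal_leI)
        show "(\<integral>\<^sup>+x. indicator U x \<partial>lborel) < \<infinity>" using fin by simp
        show "AE x in lborel. (\<lambda>n. ennreal ((1 - ?g (f n) x) * ?i x)) \<longlonglongrightarrow> 0"
        proof (rule AE_I2)
          fix x :: "real^3"
          show "(\<lambda>n. ennreal ((1 - ?g (f n) x) * ?i x)) \<longlonglongrightarrow> 0"
          proof (cases "x \<in> U")
            case True
            then obtain r where r: "0 < r" "ball x r \<subseteq> U" using U open_contains_ball by blast
            have "(\<lambda>n. 128 * f n / r\<^sup>2) \<longlonglongrightarrow> 128 * 0 / r\<^sup>2"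
              using r by (intro tendsto_intros f(2)) auto
            then have lim: "(\<lambda>n. 128 * f n / r\<^sup>2) \<longlonglongrightarrow> 0" by simp
            have "(\<lambda>n. (1 - ?g (f n) x) * ?i x) \<longlonglongrightarrow> 0"
            proof (rule tendsto_sandwich[OF _ _ tendsto_const lim])
              show "\<forall>\<^sub>F n in sequentially. 0 \<le> (1 - ?g (f n) x) * ?i x"
                using g1[OF f(1)] by (intro always_eventually) auto
              show "\<forall>\<^sub>F n in sequentially. (1 - ?g (f n) x) * ?i x \<le> 128 * f n / r\<^sup>2"
                using conv_indicator_lower[OF f(1) _ r fin] True
                by (intro always_eventually allI) (simp add: algebra_simps)
            qed
            then show ?thesis using tendsto_ennrealI by fastforce
          qed simp
        qed
      qed auto
      then have "(\<lambda>n. \<integral>\<^sup>+x. ennreal ((1 - ?g (f n) x) * ?i x) \<partial>lborel) \<longlonglongrightarrow> 0"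
        by simp
      then show "\<forall>\<^sub>F n in sequentially. (\<integral>\<^sup>+x. ennreal ((1 - ?g (f n) x) * ?i x) \<partial>lborel) < ennreal e'"
        using e' by (intro order_tendstoD(2)[of _ 0]) auto
    qed simp
    then obtain d where d: "0 < d" "\<forall>t. 0 < t \<and> t < d \<longrightarrow> (\<integral>\<^sup>+x. ennreal ((1 - ?g t x) * ?i x) \<partial>lborel) < ennreal e'"
      by (auto simp: eventually_at_right_field)
    have "Lp_bound 1 (\<lambda>x. conv (G t) (\<lambda>x. indicator U x *\<^sub>R c) x - indicator U x *\<^sub>R c) e" if t: "0 < t" "t < d" for t
    proof -
      note [measurable] = gm[OF t(1)]
      have "(\<integral>\<^sup>+x. ennreal (norm (?g t x - ?i x)) \<partial>lborel) \<le> 2 * ennreal e'"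
        using order_trans[OF bound[OF t(1)] mult_left_mono[OF less_imp_le[OF d(2)[rule_format, OF conjI[OF t]]], of 2]] by simp
      also have "\<dots> = ennreal (2 * e')" using e' by (simp add: ennreal_mult')
      finally have L: "Lp_bound 1 (\<lambda>x. ?g t x - ?i x) (2 * e')"
        using e' by (simp add: Lp_bound_def)
      have cv: "conv (G t) (\<lambda>x. indicator U x *\<^sub>R c) x = ?g t x *\<^sub>R c" for x
        unfolding conv_def
        using integral_scaleR_left[where M = lborel and f = "\<lambda>y. G t (x - y) * ?i y" and c = c]
          conv_integrable[OF kernel_bound_heat_kernel[OF t(1)] L1, of x] by simp
      have "Lp_bound 1 (\<lambda>x. (?g t x - ?i x) *\<^sub>R c) (norm c * (2 * e'))"
        by (rule Lp_bound_scaled_AE[OF L]) (auto simp: mult.commute)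
      moreover have "norm c * (2 * e') \<le> e"
        using e nc by (simp add: e'_def field_simps)
      ultimately have "Lp_bound 1 (\<lambda>x. (?g t x - ?i x) *\<^sub>R c) e"
        by (rule Lp_bound_mono) simp
      then show ?thesis
        unfolding cv scaleR_diff_left .
    qed
    then show "\<exists>d>0. \<forall>t. 0 < t \<and> t < d \<longrightarrow>
        Lp_bound 1 (\<lambda>x. conv (G t) (\<lambda>x. indicator U x *\<^sub>R c) x - indicator U x *\<^sub>R c) e"
      using d(1) by blast
  qed
qed

text \<open>Outer regularity of Lebesgue measure approximates the set by an open one in L^1.\<close>

lemma heat_approx_indicator:
  fixes A :: "(real^3) set" and c :: "'b::euclidean_space"
  assumes "A \<in> sets lborel" and fin: "emeasure lborel A < \<infinity>"
  shows "heat_approx 1 (\<lambda>x. indicator A x *\<^sub>R c)"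
proof -
  have A[measurable]: "A \<in> sets borel" using assms by simp
  have em: "emeasure lborel A \<le> ennreal (measure lborel A)"
    using fin by (simp add: emeasure_eq_ennreal_measure)
  show ?thesis
  proof (rule heat_approx_closed[OF order_refl Lp_bound_1_indicator[OF A em measure_nonneg]])
    fix e :: real assume e: "0 < e"
    define e' where "e' = e / (norm c + 1)"
    have nc: "0 < norm c + 1" by (simp add: add_nonneg_pos)
    have e': "0 < e'" using e nc by (simp add: e'_def)
    obtain U where U: "open U" "A \<subseteq> U" "emeasure lborel (U - A) < ennreal e'"
      using outer_regular_lborel[OF A e'] by blast
    have [measurable]: "U \<in> sets borel" using U by auto
    have "emeasure lborel U = emeasure lborel A + emeasure lborel (U - A)"
    proof -
      have "emeasure lborel A + emeasure lborel (U - A) = emeasure lborel (A \<union> (U - A))"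
        by (rule plus_emeasure) auto
      moreover have "A \<union> (U - A) = U" using U(2) by blast
      ultimately show ?thesis by simp
    qed
    then have finU: "emeasure lborel U < \<infinity>" using fin U(3)
      by (auto simp: less_top[symmetric])
    have emU: "emeasure lborel U \<le> ennreal (measure lborel U)"
      using finU by (simp add: emeasure_eq_ennreal_measure)
    have "Lp_bound 1 (\<lambda>x. indicator (U - A) x *\<^sub>R c) (e' * norm c)"
      using U e' by (intro Lp_bound_1_indicator) auto
    then have "Lp_bound 1 (\<lambda>x. indicator A x *\<^sub>R c - indicator U x *\<^sub>R c) (e' * norm c)"
      by (rule Lp_bound_mono_AE) (use U(2) in \<open>auto simp: indicator_def\<close>)
    moreover have "e' * norm c \<le> e"
      using e nc by (simp add: e'_def field_simps)
    ultimately have "Lp_bound 1 (\<lambda>x. indicator A x *\<^sub>R c - indicator U x *\<^sub>R c) e"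
      by (rule Lp_bound_mono) simp
    then show "\<exists>g N'. Lp_bound 1 g N' \<and> heat_approx 1 g \<and> Lp_bound 1 (\<lambda>x. indicator A x *\<^sub>R c - g x) e"
      using heat_approx_open[OF U(1) finU, of c] Lp_bound_1_indicator[OF _ emU, of c] by auto
  qed
qed

lemma heat_approx_add:
  fixes f g :: "real^3 \<Rightarrow> 'b::euclidean_space"
  assumes add: "integrable lborel f" "integrable lborel g" "heat_approx 1 f" "heat_approx 1 g"
  shows "heat_approx 1 (\<lambda>x. f x + g x)"
proof -
  note f = Lp_bound_1_if_integrable[OF add(1)] and g = Lp_bound_1_if_integrable[OF add(2)]
  show ?thesis
    unfolding heat_approx_def
  proof (intro allI impI)
    fix e :: real assume "0 < e"
    then have e: "0 < e / 2" by simp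
    obtain d1 where d1: "0 < d1" "\<forall>t. 0 < t \<and> t < d1 \<longrightarrow> Lp_bound 1 (\<lambda>x. conv (G t) f x - f x) (e / 2)"
      using add(3) e unfolding heat_approx_def by blast
    obtain d2 where d2: "0 < d2" "\<forall>t. 0 < t \<and> t < d2 \<longrightarrow> Lp_bound 1 (\<lambda>x. conv (G t) g x - g x) (e / 2)"
      using add(4) e unfolding heat_approx_def by blast
    have "Lp_bound 1 (\<lambda>x. conv (G t) (\<lambda>x. f x + g x) x - (f x + g x)) e" if t: "0 < t" "t < min d1 d2" for t
    proof -
      have eq: "conv (G t) (\<lambda>x. f x + g x) x = conv (G t) f x + conv (G t) g x" for x
        unfolding conv_def scaleR_add_right
        by (rule Bochner_Integration.integral_add; rule conv_integrable[OF kernel_bound_heat_kernel[OF t(1)]])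
           (use f g in auto)
      have "Lp_bound 1 (\<lambda>x. (conv (G t) f x - f x) + (conv (G t) g x - g x)) (e / 2 + e / 2)"
        using d1 d2 t by (intro Lp_bound_add) auto
      then show ?thesis unfolding eq by (simp add: algebra_simps)
    qed
    then show "\<exists>d>0. \<forall>t. 0 < t \<and> t < d \<longrightarrow> Lp_bound 1 (\<lambda>x. conv (G t) (\<lambda>x. f x + g x) x - (f x + g x)) e"
      using d1(1) d2(1) by (intro exI[of _ "min d1 d2"]) auto
  qed
qed

text \<open>The limit step of the induction over integrable functions, whose hypotheses determine
  the form of the statement.\<close>

lemma heat_approx_dominated:
  fixes f :: "real^3 \<Rightarrow> 'b::euclidean_space"
  assumes lim: "\<And>i. integrable lborel (s i)" "\<And>i. heat_approx 1 (s i)"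
    "\<And>x. (\<lambda>i. s i x) \<longlonglongrightarrow> f x"
    "\<And>i x. norm (s i x) \<le> 2 * norm (f x)" "integrable lborel f"
  shows "heat_approx 1 f"
proof -
  have [measurable]: "f \<in> borel_measurable borel" "\<And>i. s i \<in> borel_measurable borel"
    using borel_measurable_integrable[OF lim(5)] borel_measurable_integrable[OF lim(1)] by simp_all
  show ?thesis
  proof (rule heat_approx_closed[OF order_refl Lp_bound_1_if_integrable[OF lim(5)]])
    fix e :: real assume e: "0 < e"
    have "(\<lambda>i. \<integral>\<^sup>+x. ennreal (norm (f x - s i x)) \<partial>lborel) \<longlonglongrightarrow> (\<integral>\<^sup>+x. 0 \<partial>(lborel :: (real^3) measure))"
    proof (rule nn_integral_dominated_convergence[where w = "\<lambda>x. 3 * ennreal (norm (f x))"])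
      show "AE x in lborel. ennreal (norm (f x - s i x)) \<le> 3 * ennreal (norm (f x))" for i
      proof (rule AE_I2)
        fix x
        have "norm (f x - s i x) \<le> 3 * norm (f x)"
          using norm_triangle_ineq4[of "f x" "s i x"] lim(4)[of i x] by auto
        then show "ennreal (norm (f x - s i x)) \<le> 3 * ennreal (norm (f x))"
          using ennreal_leI[of "norm (f x - s i x)" "3 * norm (f x)"] by (simp add: ennreal_mult')
      qed
      show "(\<integral>\<^sup>+x. 3 * ennreal (norm (f x)) \<partial>lborel) < \<infinity>"
        using lim(5) by (simp add: nn_integral_cmult integrable_iff_bounded ennreal_mult_less_top)
      show "AE x in lborel. (\<lambda>i. ennreal (norm (f x - s i x))) \<longlonglongrightarrow> 0"
      proof (rule AE_I2)
        fix x
        have "(\<lambda>i. norm (f x - s i x)) \<longlonglongrightarrow> norm (f x - f x)"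
          by (intro tendsto_intros lim(3))
        then show "(\<lambda>i. ennreal (norm (f x - s i x))) \<longlonglongrightarrow> 0"
          using tendsto_ennrealI by fastforce
      qed
    qed auto
    then have "\<forall>\<^sub>F i in sequentially. (\<integral>\<^sup>+x. ennreal (norm (f x - s i x)) \<partial>lborel) < ennreal e"
      using e by (intro order_tendstoD(2)[of _ 0]) auto
    then obtain i where "(\<integral>\<^sup>+x. ennreal (norm (f x - s i x)) \<partial>lborel) < ennreal e"
      by (auto simp: eventually_sequentially)
    then have "Lp_bound 1 (\<lambda>x. f x - s i x) e"
      using e by (simp add: Lp_bound_def)
    then show "\<exists>g N'. Lp_bound 1 g N' \<and> heat_approx 1 g \<and> Lp_bound 1 (\<lambda>x. f x - g x) e"
      using lim(2) Lp_bound_1_if_integrable[OF lim(1)] by blast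
  qed
qed

lemma heat_approx_1:
  fixes f :: "real^3 \<Rightarrow> 'b::euclidean_space"
  assumes "integrable lborel f"
  shows "heat_approx 1 f"
proof (rule integrable_induct[OF assms, where P = "heat_approx 1"], goal_cases)
  case (1 A c)
  then show ?case by (rule heat_approx_indicator)
next
  case (2 f g)
  then show ?case by (intro heat_approx_add)
next
  case (3 f s)
  show ?case by (rule heat_approx_dominated[of s]) (use 3 in simp_all)
qed

text \<open>Truncations are dense in L^p. For a truncation, convergence in L^1 is interpolated with
  a uniform bound, since neither it nor its heat flow exceeds \<open>R\<close>.\<close>

lemma heat_approx_Lp:
  fixes f :: "real^3 \<Rightarrow> 'b::euclidean_space"
  assumes f: "Lp_bound p f N" and p: "1 \<le> p"
  shows "heat_approx p f"
proof (rule heat_approx_closed[OF p f])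
  fix e :: real assume e: "0 < e"
  have fm[measurable]: "f \<in> borel_measurable borel" using f by (rule Lp_boundD)
  have pos: "0 < p" using p by simp
  obtain R where R: "0 \<le> R" "Lp_bound p (\<lambda>x. f x - cutoff R f x) e"
    by (rule Lp_bound_minus_cutoff[OF f pos e])
  obtain N1 where N1: "Lp_bound p (cutoff R f) N1"
    using Lp_bound_cutoff_any[OF fm pos R(1)] by blast
  obtain N2 where N2: "Lp_bound 1 (cutoff R f) N2"
    using Lp_bound_cutoff_any[OF fm zero_less_one R(1)] by blast
  have "heat_approx p (cutoff R f)"
    unfolding heat_approx_def
  proof (intro allI impI)
    fix e :: real assume e: "0 < e"
    \<comment> \<open>The sup bound used is \<open>2 * R + 1\<close>, positive even for
      \<open>R = 0\<close>. The tolerance \<open>e'\<close> below solves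
      \<open>C * e' powr (1 / p) = e\<close>.\<close>
    define C where "C = (2 * R + 1) powr (1 - 1 / p)"
    have C: "0 < C" using R by (simp add: C_def)
    define e' where "e' = (e / C) powr p"
    have e': "0 < e'" using e C by (simp add: e'_def)
    have "heat_approx 1 (cutoff R f)"
      by (rule heat_approx_1[OF integrable_if_Lp_bound_1(1)[OF N2]])
    then obtain d where d: "0 < d" "\<forall>t. 0 < t \<and> t < d \<longrightarrow> Lp_bound 1 (\<lambda>x. conv (G t) (cutoff R f) x - cutoff R f x) e'"
      using e' unfolding heat_approx_def by blast
    have "Lp_bound p (\<lambda>x. conv (G t) (cutoff R f) x - cutoff R f x) e" if t: "0 < t" "t < d" for t
    proof -
      have "norm (conv (G t) (cutoff R f) x) \<le> R" for x
      proof -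
        have "ennreal (norm (conv (G t) (cutoff R f) x))
            \<le> (\<integral>\<^sup>+y. ennreal (norm (G t (x - y) *\<^sub>R cutoff R f y)) \<partial>lborel)"
          unfolding conv_def
          by (rule integral_norm_bound_ennreal[OF conv_integrable[OF kernel_bound_heat_kernel[OF t(1)] N1 p]])
        also have "\<dots> \<le> (\<integral>\<^sup>+y. ennreal (G t (x - y)) * ennreal R \<partial>lborel)"
          using R by (intro nn_integral_mono)
            (auto simp: heat_kernel_nonneg norm_cutoff_le simp flip: ennreal_mult intro!: ennreal_leI mult_left_mono)
        also have "\<dots> = (\<integral>\<^sup>+y. ennreal (G t (x - y)) \<partial>lborel) * ennreal R"
          by (rule nn_integral_multc) auto
        also have "\<dots> = ennreal R"
          using nn_integral_reflect[of "\<lambda>y. ennreal (G t y)" x] nn_integral_heat_kernel[OF t(1)] by simp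
        finally show ?thesis using R by simp
      qed
      then have le: "norm (conv (G t) (cutoff R f) x - cutoff R f x) \<le> 2 * R + 1" for x
        using norm_triangle_ineq4[of "conv (G t) (cutoff R f) x" "cutoff R f x"] norm_cutoff_le[OF R(1), of f x]
        by (smt (verit))
      have "Lp_bound p (\<lambda>x. conv (G t) (cutoff R f) x - cutoff R f x) ((2 * R + 1) powr (1 - 1 / p) * e' powr (1 / p))"
        by (rule Lp_bound_interpolate) (use d t le p R in auto)
      moreover have "(2 * R + 1) powr (1 - 1 / p) * e' powr (1 / p) = e"
        using C e p by (simp add: e'_def powr_powr C_def[symmetric])
      ultimately show ?thesis by metis
    qed
    then show "\<exists>d>0. \<forall>t. 0 < t \<and> t < d \<longrightarrow> Lp_bound p (\<lambda>x. conv (G t) (cutoff R f) x - cutoff R f x) e"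
      using d(1) by blast
  qed
  then show "\<exists>g N'. Lp_bound p g N' \<and> heat_approx p g \<and> Lp_bound p (\<lambda>x. f x - g x) e"
    using N1 R(2) by blast
qed

lemma heat_Lp_cont:
  fixes f :: "real^3 \<Rightarrow> 'b::euclidean_space"
  assumes f: "Lp_bound p f N" and p: "1 \<le> p"
  shows "Lp_cont p {0..} (\<lambda>t. heat t f)"
  unfolding Lp_cont_def
proof (intro ballI conjI allI impI)
  have heat: "heat t f = (if t = 0 then f else conv (G t) f)" for t
    by (auto simp: heat_def conv_def fun_eq_iff)
  fix t :: real assume t: "t \<in> {0..}"
  show "\<exists>N. Lp_bound p (heat t f) N"
    using f Lp_bound_conv_same[OF kernel_bound_heat_kernel f p, of t] t by (auto simp: heat)
  fix e :: real assume e: "0 < e"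
  show "\<exists>d>0. \<forall>s\<in>{0..}. \<bar>s - t\<bar> < d \<longrightarrow> Lp_bound p (\<lambda>x. heat s f x - heat t f x) e"
  proof (cases "t = 0")
    case True
    obtain d where "0 < d" "\<forall>t. 0 < t \<and> t < d \<longrightarrow> Lp_bound p (\<lambda>x. conv (G t) f x - f x) e"
      using heat_approx_Lp[OF f p] e unfolding heat_approx_def by blast
    then show ?thesis
      using True e by (intro exI[of _ d]) (auto simp: heat Lp_bound_zero)
  next
    case False
    then have t0: "t \<in> {0<..}" using t by auto
    obtain d where d: "0 < d" "\<And>s. s \<in> {0<..} \<Longrightarrow> \<bar>s - t\<bar> < d \<Longrightarrow> Lp_bound p (\<lambda>x. conv (G s) f x - conv (G t) f x) e"
      using Lp_contE[OF conv_Lp_cont[OF heat_like_heat_kernel f p order_refl] t0 e] by blast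
    then show ?thesis
      using False t0 by (intro exI[of _ "min d t"]) (auto simp: heat)
  qed
qed

section \<open>Products and Duhamel terms\<close>

lemma borel_measurable_vec_nth[measurable (raw)]:
  fixes f :: "'a \<Rightarrow> real^3"
  assumes [measurable]: "f \<in> borel_measurable M"
  shows "(\<lambda>x. f x $ k) \<in> borel_measurable M"
  unfolding cart_eq_inner_axis by measurable

text \<open>Abstracts the products of temperature and a velocity component, and of a velocity
  component and the velocity, so that bounds, continuity and differences are proved once. Additivity
  is stated for differences, the form in which it is applied.\<close>

definition product_like :: "('a::euclidean_space \<Rightarrow> 'b::euclidean_space \<Rightarrow> 'c::euclidean_space) \<Rightarrow> bool" where
  "product_like P \<longleftrightarrow> (\<forall>a a' b. P (a - a') b = P a b - P a' b) \<and> (\<forall>a b b'. P a (b - b') = P a b - P a b') \<and>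
     (\<forall>a b. norm (P a b) \<le> norm a * norm b) \<and>
     (\<forall>u v :: real^3 \<Rightarrow> _. u \<in> borel_measurable borel \<longrightarrow> v \<in> borel_measurable borel \<longrightarrow>
        (\<lambda>x. P (u x) (v x)) \<in> borel_measurable borel)"

lemma product_likeD:
  fixes P :: "'a::euclidean_space \<Rightarrow> 'b::euclidean_space \<Rightarrow> 'c::euclidean_space"
    and u :: "real^3 \<Rightarrow> 'a" and v :: "real^3 \<Rightarrow> 'b"
  assumes "product_like P"
  shows "P (a - a') b = P a b - P a' b" "P a (b - b') = P a b - P a b'" "norm (P a b) \<le> norm a * norm b"
    "u \<in> borel_measurable borel \<Longrightarrow> v \<in> borel_measurable borel \<Longrightarrow> (\<lambda>x. P (u x) (v x)) \<in> borel_measurable borel"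
  using assms by (simp_all add: product_like_def)

lemma product_like_heat: "product_like (\<lambda>(a::real) (v::real^3). a * v $ k)"
  unfolding product_like_def
proof (intro conjI allI impI)
  fix a :: real and v :: "real^3"
  show "norm (a * v $ k) \<le> norm a * norm v"
    by (simp add: abs_mult mult_left_mono component_le_norm_cart)
next
  fix u :: "real^3 \<Rightarrow> real" and v :: "real^3 \<Rightarrow> real^3"
  assume [measurable]: "u \<in> borel_measurable borel" "v \<in> borel_measurable borel"
  show "(\<lambda>x. u x * v x $ k) \<in> borel_measurable borel" by measurable
qed (simp_all add: algebra_simps)

lemma product_like_stress: "product_like (\<lambda>(v::real^3) (w::real^3). v $ k *\<^sub>R w)"
  unfolding product_like_def
proof (intro conjI allI impI)
  fix v w :: "real^3"
  show "norm (v $ k *\<^sub>R w) \<le> norm v * norm w"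
    by (simp add: mult_right_mono component_le_norm_cart)
next
  fix u v :: "real^3 \<Rightarrow> real^3"
  assume [measurable]: "u \<in> borel_measurable borel" "v \<in> borel_measurable borel"
  show "(\<lambda>x. u x $ k *\<^sub>R v x) \<in> borel_measurable borel" by measurable
qed (simp_all add: algebra_simps)

lemma Lp_bound_product:
  fixes f :: "real^3 \<Rightarrow> 'a::euclidean_space" and g :: "real^3 \<Rightarrow> 'b::euclidean_space"
  assumes P: "product_like P" and f: "Lp_bound p f A" and g: "Lp_bound q g B"
    and pqr: "0 < p" "0 < q" "0 < r" "1 / p + 1 / q = 1 / r"
  shows "Lp_bound r (\<lambda>x. P (f x) (g x)) (A * B)"
  by (rule Lp_bound_Holder[OF f g product_likeD(4)[OF P Lp_boundD(1)[OF f] Lp_boundD(1)[OF g]]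
        product_likeD(3)[OF P] pqr])

text \<open>The discrete product rule: P f g - P f' g' = P (f - f') g + P f' (g - g').\<close>

lemma Lp_bound_product_diff:
  fixes f :: "real^3 \<Rightarrow> 'a::euclidean_space" and g :: "real^3 \<Rightarrow> 'b::euclidean_space"
  assumes P: "product_like P" and f: "Lp_bound p (\<lambda>x. f x - f' x) d" and g: "Lp_bound q g B"
    and f': "Lp_bound p f' A" and g': "Lp_bound q (\<lambda>x. g x - g' x) d'"
    and pqr: "0 < p" "0 < q" "1 \<le> r" "1 / p + 1 / q = 1 / r"
  shows "Lp_bound r (\<lambda>x. P (f x) (g x) - P (f' x) (g' x)) (d * B + A * d')"
proof -
  have r: "0 < r" using pqr by simp
  have "Lp_bound r (\<lambda>x. P (f x - f' x) (g x) + P (f' x) (g x - g' x)) (d * B + A * d')"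
    by (intro Lp_bound_add Lp_bound_product[OF P f g pqr(1,2) r pqr(4)] Lp_bound_product[OF P f' g' pqr(1,2) r pqr(4)] pqr(3))
  then show ?thesis
    by (simp add: product_likeD(1,2)[OF P])
qed

lemma Lp_cont_product:
  assumes P: "product_like P" and f: "Lp_cont p S f" and g: "Lp_cont q S g"
    and pqr: "1 \<le> p" "1 \<le> q" "1 \<le> r" "1 / p + 1 / q = 1 / r"
  shows "Lp_cont r S (\<lambda>s x. P (f s x) (g s x))"
  unfolding Lp_cont_def
proof (intro ballI conjI allI impI)
  have pos: "0 < p" "0 < q" "0 < r" using pqr by auto
  fix t assume t: "t \<in> S"
  obtain A where A: "Lp_bound p (f t) A" using Lp_contD[OF f t] .
  obtain B where B: "Lp_bound q (g t) B" using Lp_contD[OF g t] .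
  have nn: "0 \<le> A" "0 \<le> B" using A B by (auto dest: Lp_boundD(2))
  show "\<exists>N. Lp_bound r (\<lambda>x. P (f t x) (g t x)) N"
    using Lp_bound_product[OF P A B pos pqr(4)] by blast
  fix e :: real assume e: "0 < e"
  \<comment> \<open>The cap at 1 turns the quadratic term \<open>e' * e'\<close> into at most
    \<open>e'\<close>.\<close>
  define e' where "e' = min 1 (e / (A + B + 1))"
  have e': "0 < e'" using e nn by (simp add: e'_def add_nonneg_pos)
  obtain d1 where d1: "0 < d1" "\<And>s. s \<in> S \<Longrightarrow> \<bar>s - t\<bar> < d1 \<Longrightarrow> Lp_bound p (\<lambda>x. f s x - f t x) e'"
    using Lp_contE[OF f t e'] by blast
  obtain d2 where d2: "0 < d2" "\<And>s. s \<in> S \<Longrightarrow> \<bar>s - t\<bar> < d2 \<Longrightarrow> Lp_bound q (\<lambda>x. g s x - g t x) e'"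
    using Lp_contE[OF g t e'] by blast
  have "Lp_bound r (\<lambda>x. P (f s x) (g s x) - P (f t x) (g t x)) e" if s: "s \<in> S" "\<bar>s - t\<bar> < min d1 d2" for s
  proof -
    have f1: "Lp_bound p (\<lambda>x. f s x - f t x) e'" and g1: "Lp_bound q (\<lambda>x. g s x - g t x) e'"
      using d1 d2 s by auto
    have g2: "Lp_bound q (g s) (e' + B)"
      using Lp_bound_add[OF g1 B pqr(2)] by simp
    have "e' * (e' + B) + A * e' = e' * (A + B + e')"
      by (simp add: algebra_simps)
    also have "\<dots> \<le> e' * (A + B + 1)"
      using e' by (intro mult_left_mono add_left_mono) (auto simp: e'_def)
    also have "\<dots> \<le> e / (A + B + 1) * (A + B + 1)"
      using nn by (intro mult_right_mono) (auto simp: e'_def)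
    also have "\<dots> = e" using nn by simp
    finally have le: "e' * (e' + B) + A * e' \<le> e" .
    show ?thesis
      by (rule Lp_bound_mono[OF Lp_bound_product_diff[OF P f1 g2 A g1 pos(1,2) pqr(3,4)] le]) (use pos in simp)
  qed
  then show "\<exists>d>0. \<forall>s\<in>S. \<bar>s - t\<bar> < d \<longrightarrow> Lp_bound r (\<lambda>x. P (f s x) (g s x) - P (f t x) (g t x)) e"
    using d1(1) d2(1) by (intro exI[of _ "min d1 d2"]) auto
qed

definition heat_source :: "3 \<Rightarrow> (real \<Rightarrow> real^3 \<Rightarrow> real) \<Rightarrow> (real \<Rightarrow> real^3 \<Rightarrow> real^3) \<Rightarrow> real \<Rightarrow> real^3 \<Rightarrow> real" where
  "heat_source k \<theta> u s x = \<theta> s x * u s x $ k"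

definition stress :: "3 \<Rightarrow> (real \<Rightarrow> real^3 \<Rightarrow> real^3) \<Rightarrow> real \<Rightarrow> real^3 \<Rightarrow> real^3" where
  "stress k u s x = u s x $ k *\<^sub>R u s x"

definition stress_source :: "3 \<Rightarrow> (real \<Rightarrow> real^3 \<Rightarrow> real^3) \<Rightarrow> real \<Rightarrow> real^3 \<Rightarrow> real^3" where
  "stress_source k u s = leray (stress k u s)"

definition buoyancy_source :: "(real \<Rightarrow> real^3 \<Rightarrow> real) \<Rightarrow> real \<Rightarrow> real^3 \<Rightarrow> real^3" where
  "buoyancy_source \<theta> s = leray (\<lambda>x. \<theta> s x *\<^sub>R e3)"

text \<open>The weights are the decay rates of the heat flow from L^3 to L^4 and from L^1 to L^2.
  Velocity and temperature keep separate constants because buoyancy feeds \<open>N\<close> linearly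
  into the velocity bound.\<close>

definition crit_bound ::
  "real \<Rightarrow> real \<Rightarrow> real \<Rightarrow> (real \<Rightarrow> real^3 \<Rightarrow> real^3) \<Rightarrow> (real \<Rightarrow> real^3 \<Rightarrow> real) \<Rightarrow> bool" where
  "crit_bound T M N u \<theta> \<longleftrightarrow> 0 \<le> M \<and> 0 \<le> N \<and> Lp_cont 4 {0<..T} u \<and> Lp_cont 2 {0<..T} \<theta> \<and>
     (\<forall>t\<in>{0<..T}. Lp_bound 4 (u t) (M * t powr (- (1/8))) \<and> Lp_bound 2 (\<theta> t) (N * t powr (- (3/4))))"

lemma crit_boundD:
  assumes "crit_bound T M N u \<theta>"
  shows "0 \<le> M" "0 \<le> N" "Lp_cont 4 {0<..T} u" "Lp_cont 2 {0<..T} \<theta>"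
    "t \<in> {0<..T} \<Longrightarrow> Lp_bound 4 (u t) (M * t powr (- (1/8)))"
    "t \<in> {0<..T} \<Longrightarrow> Lp_bound 2 (\<theta> t) (N * t powr (- (3/4)))"
  using assms unfolding crit_bound_def by blast+

lemma crit_bound_subset:
  assumes "crit_bound T M N u \<theta>" "S \<le> T"
  shows "crit_bound S M N u \<theta>"
  using assms(2) crit_boundD[OF assms(1)] unfolding crit_bound_def
  by (auto intro: Lp_cont_subset)

lemma e3_norm: "norm e3 = 1"
  by (simp add: e3_def)

lemma Lp_bound_e3:
  assumes f: "Lp_bound p f N" and p: "0 \<le> p"
  shows "Lp_bound p (\<lambda>x. f x *\<^sub>R e3) N"
  using Lp_boundD(1)[OF f] by (intro Lp_bound_mono_AE[OF f _ _ p]) (auto simp: e3_norm)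

lemma powr_split: "(x::real) powr (- (a + b)) = x powr (- a) * x powr (- b)"
  by (simp add: powr_add[symmetric])

lemma heat_source_bound:
  assumes "crit_bound T M N u \<theta>" "s \<in> {0<..T}"
  shows "Lp_bound (4/3) (heat_source k \<theta> u s) (N * M * s powr (- (7/8)))"
proof -
  have "Lp_bound (4/3) (\<lambda>x. \<theta> s x * u s x $ k) (N * s powr (- (3/4)) * (M * s powr (- (1/8))))"
    by (rule Lp_bound_product[OF product_like_heat crit_boundD(6,5)[OF assms(1,2)]]) auto
  moreover have "N * s powr (- (3/4)) * (M * s powr (- (1/8))) = N * M * s powr (- (7/8))"
    using powr_split[of s "3/4" "1/8"] by simp
  ultimately show ?thesis
    by (simp add: heat_source_def[abs_def])
qed

lemma stress_bound:
  assumes "crit_bound T M N u \<theta>" "s \<in> {0<..T}"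
  shows "Lp_bound 2 (stress k u s) (M * M * s powr (- (1/4)))"
proof -
  have "Lp_bound 2 (\<lambda>x. u s x $ k *\<^sub>R u s x) (M * s powr (- (1/8)) * (M * s powr (- (1/8))))"
    by (rule Lp_bound_product[OF product_like_stress crit_boundD(5,5)[OF assms(1,2)]]) (use assms in auto)
  moreover have "M * s powr (- (1/8)) * (M * s powr (- (1/8))) = M * M * s powr (- (1/4))"
    using powr_split[of s "1/8" "1/8"] by simp
  ultimately show ?thesis
    by (simp add: stress_def[abs_def])
qed

lemma stress_source_bound:
  assumes "crit_bound T M N u \<theta>" "s \<in> {0<..T}"
  shows "Lp_bound 2 (stress_source k u s) (M * M * s powr (- (1/4)))"
  unfolding stress_source_def by (rule Lp_bound_leray[OF stress_bound[OF assms]])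

lemma buoyancy_source_bound:
  assumes "crit_bound T M N u \<theta>" "s \<in> {0<..T}"
  shows "Lp_bound 2 (buoyancy_source \<theta> s) (N * s powr (- (3/4)))"
  unfolding buoyancy_source_def
  by (rule Lp_bound_leray[OF Lp_bound_e3[OF crit_boundD(6)[OF assms]]]) simp

lemma heat_source_cont:
  assumes "crit_bound T M N u \<theta>"
  shows "Lp_cont (4/3) {0<..T} (heat_source k \<theta> u)"
  unfolding heat_source_def[abs_def]
  by (rule Lp_cont_product[OF product_like_heat crit_boundD(4,3)[OF assms]]) auto

lemma stress_source_cont:
  assumes "crit_bound T M N u \<theta>"
  shows "Lp_cont 2 {0<..T} (stress_source k u)"
proof -
  have "Lp_cont 2 {0<..T} (stress k u)"
    unfolding stress_def[abs_def]
    by (rule Lp_cont_product[OF product_like_stress crit_boundD(3,3)[OF assms]]) (use assms in auto)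
  from Lp_cont_leray[OF this] show ?thesis
    by (simp add: stress_source_def[abs_def])
qed

lemma buoyancy_source_cont:
  assumes "crit_bound T M N u \<theta>"
  shows "Lp_cont 2 {0<..T} (buoyancy_source \<theta>)"
proof -
  note c = crit_boundD(4)[OF assms]
  have "Lp_cont 2 {0<..T} (\<lambda>s x. \<theta> s x *\<^sub>R e3)"
    unfolding Lp_cont_def
  proof (intro ballI conjI allI impI)
    fix t assume t: "t \<in> {0<..T}"
    show "\<exists>N. Lp_bound 2 (\<lambda>x. \<theta> t x *\<^sub>R e3) N"
      using Lp_bound_e3[OF crit_boundD(6)[OF assms t]] by auto
    fix e :: real assume e: "0 < e"
    obtain d where d: "0 < d" "\<And>s. s \<in> {0<..T} \<Longrightarrow> \<bar>s - t\<bar> < d \<Longrightarrow> Lp_bound 2 (\<lambda>x. \<theta> s x - \<theta> t x) e"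
      using Lp_contE[OF c t e] by blast
    have "Lp_bound 2 (\<lambda>x. \<theta> s x *\<^sub>R e3 - \<theta> t x *\<^sub>R e3) e" if "s \<in> {0<..T}" "\<bar>s - t\<bar> < d" for s
      using Lp_bound_e3[OF d(2)[OF that]] by (simp add: scaleR_diff_left)
    then show "\<exists>d>0. \<forall>s\<in>{0<..T}. \<bar>s - t\<bar> < d \<longrightarrow> Lp_bound 2 (\<lambda>x. \<theta> s x *\<^sub>R e3 - \<theta> t x *\<^sub>R e3) e"
      using d(1) by blast
  qed
  from Lp_cont_leray[OF this] show ?thesis
    by (simp add: buoyancy_source_def[abs_def])
qed

section \<open>The Duhamel terms and the mild formulation\<close>

abbreviation dheat :: "3 \<Rightarrow> real \<Rightarrow> real^3 \<Rightarrow> real" where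
  "dheat k t \<equiv> partial_deriv k (G t)"

definition transport :: "(real \<Rightarrow> real^3 \<Rightarrow> real) \<Rightarrow> (real \<Rightarrow> real^3 \<Rightarrow> real^3) \<Rightarrow> real \<Rightarrow> real^3 \<Rightarrow> real" where
  "transport \<theta> u t x = (\<Sum>k\<in>UNIV. duhamel (dheat k) (heat_source k \<theta> u) t x)"

definition convection :: "(real \<Rightarrow> real^3 \<Rightarrow> real^3) \<Rightarrow> real \<Rightarrow> real^3 \<Rightarrow> real^3" where
  "convection u t x = (\<Sum>k\<in>UNIV. duhamel (dheat k) (stress_source k u) t x)"

definition buoyancy :: "(real \<Rightarrow> real^3 \<Rightarrow> real) \<Rightarrow> real \<Rightarrow> real^3 \<Rightarrow> real^3" where
  "buoyancy \<theta> t x = duhamel G (buoyancy_source \<theta>) t x"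

text \<open>Each summand is at most 2 / (1/8) = 16.\<close>

lemma beta_const_le:
  assumes "0 \<le> a" "a \<le> 7/8" "0 \<le> b" "b \<le> 7/8"
  shows "beta_const a b \<le> 32"
proof -
  have *: "2 powr a / (1 - b) \<le> 16" if "0 \<le> a" "a \<le> 7/8" "0 \<le> b" "b \<le> 7/8" for a b :: real
  proof -
    have "2 powr a \<le> (2::real) powr 1" using that by (intro powr_mono) auto
    then have "2 powr a / (1 - b) \<le> 2 / (1/8)" using that by (intro frac_le) auto
    then show ?thesis by simp
  qed
  show ?thesis
    unfolding beta_const_def using *[of a b] *[of b a] assms by simp
qed

text \<open>The uniform version for exponents up to 7/8; 1024 is the kernel constant 32 times the
  beta bound 32.\<close>

lemma duhamel_bound_32:
  fixes f :: "real \<Rightarrow> real^3 \<Rightarrow> 'b::euclidean_space"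
  assumes K: "heat_like K \<mu> 32" and f: "Lp_cont p0 {0<..<t} f" and p0: "1 \<le> p0" and p: "1 \<le> p" "p \<le> q" and t: "0 < t"
    and m: "\<And>s. s \<in> {0<..<t} \<Longrightarrow> Lp_bound p (f s) (M * s powr (- b))" "0 \<le> M"
    and a: "a = \<mu> + 3/2 * (1 / p - 1 / q)" "a \<le> 7/8" and b: "0 \<le> b" "b \<le> 7/8"
  shows "AE x in lborel. set_integrable lborel {0<..<t} (\<lambda>s. conv (K (t - s)) (f s) x)"
    and "Lp_bound q (duhamel K f t) (1024 * M * t powr (1 - a - b))"
proof -
  have "1 / q \<le> 1 / p" using p by (simp add: frac_le)
  then have a0: "0 \<le> a" using heat_like_nonneg[OF K] by (simp add: a(1))
  have ab: "a < 1" "b < 1" using a(2) b(2) by auto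
  show "AE x in lborel. set_integrable lborel {0<..<t} (\<lambda>s. conv (K (t - s)) (f s) x)"
    by (rule duhamel_bound(1)[OF K f p0 p t m(1,2) a(1) ab(1) b(1) ab(2)])
  have 1: "Lp_bound q (duhamel K f t) (32 * M * beta_const a b * t powr (1 - a - b))"
    by (rule duhamel_bound(2)[OF K f p0 p t m(1,2) a(1) ab(1) b(1) ab(2)])
  have "32 * M * beta_const a b * t powr (1 - a - b) \<le> 32 * M * 32 * t powr (1 - a - b)"
    using m(2) beta_const_le[OF a0 a(2) b] by (intro mult_right_mono mult_left_mono) auto
  then show "Lp_bound q (duhamel K f t) (1024 * M * t powr (1 - a - b))"
    by (intro Lp_bound_mono[OF 1]) (use p in auto)
qed

context
  fixes T M N :: real and u :: "real \<Rightarrow> real^3 \<Rightarrow> real^3" and \<theta> :: "real \<Rightarrow> real^3 \<Rightarrow> real"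
  assumes cb: "crit_bound T M N u \<theta>"
begin

lemma source_cont_open:
  assumes "t \<le> T"
  shows "Lp_cont (4/3) {0<..<t} (heat_source k \<theta> u)" "Lp_cont 2 {0<..<t} (stress_source k u)"
    "Lp_cont 2 {0<..<t} (buoyancy_source \<theta>)"
  by (rule Lp_cont_subset[OF heat_source_cont[OF cb]] Lp_cont_subset[OF stress_source_cont[OF cb]]
      Lp_cont_subset[OF buoyancy_source_cont[OF cb]]; use assms in auto)+

text \<open>From L^(4/3) to L^2 the differentiated kernel has exponent 1/2 + 3/2 (3/4 - 1/2) = 7/8,
  and the source has weight 7/8. The result 1 - 7/8 - 7/8 = -3/4 is the weight of the temperature
  again.\<close>

lemma transport_terms:
  assumes t: "t \<in> {0<..T}"
  shows "AE x in lborel. set_integrable lborel {0<..<t} (\<lambda>s. conv (dheat k (t - s)) (heat_source k \<theta> u s) x)"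
    and "Lp_bound 2 (duhamel (dheat k) (heat_source k \<theta> u) t) (1024 * (N * M) * t powr (- (3/4)))"
proof -
  have t': "0 < t" "t \<le> T" using t by auto
  have m: "Lp_bound (4/3) (heat_source k \<theta> u s) (N * M * s powr (- (7/8)))" if "s \<in> {0<..<t}" for s
    by (rule heat_source_bound[OF cb]) (use that t in auto)
  note d = duhamel_bound_32[OF heat_like_partial_deriv source_cont_open(1)[OF t'(2)] _ _ _ t'(1) m]
  show "AE x in lborel. set_integrable lborel {0<..<t} (\<lambda>s. conv (dheat k (t - s)) (heat_source k \<theta> u s) x)"
    by (rule d(1)[where q = 2 and a = "7/8"]) (use crit_boundD(1,2)[OF cb] in auto)
  have "Lp_bound 2 (duhamel (dheat k) (heat_source k \<theta> u) t) (1024 * (N * M) * t powr (1 - 7/8 - 7/8))"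
    by (rule d(2)) (use crit_boundD(1,2)[OF cb] in auto)
  then show "Lp_bound 2 (duhamel (dheat k) (heat_source k \<theta> u) t) (1024 * (N * M) * t powr (- (3/4)))"
    by simp
qed

text \<open>The source has weight 1/4 in L^2. The kernel exponent is 7/8 into L^4, which reproduces
  the weight 1/8, and 3/4 into L^3, where the powers of \<open>t\<close> cancel.\<close>

lemma convection_terms:
  assumes t: "t \<in> {0<..T}"
  shows "AE x in lborel. set_integrable lborel {0<..<t} (\<lambda>s. conv (dheat k (t - s)) (stress_source k u s) x)"
    and "Lp_bound 4 (duhamel (dheat k) (stress_source k u) t) (1024 * (M * M) * t powr (- (1/8)))"
    and "Lp_bound 3 (duhamel (dheat k) (stress_source k u) t) (1024 * (M * M))"
proof -
  have t': "0 < t" "t \<le> T" using t by auto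
  have m: "Lp_bound 2 (stress_source k u s) (M * M * s powr (- (1/4)))" if "s \<in> {0<..<t}" for s
    by (rule stress_source_bound[OF cb]) (use that t in auto)
  note d = duhamel_bound_32[OF heat_like_partial_deriv source_cont_open(2)[OF t'(2)] _ _ _ t'(1) m]
  show "AE x in lborel. set_integrable lborel {0<..<t} (\<lambda>s. conv (dheat k (t - s)) (stress_source k u s) x)"
    by (rule d(1)[where q = 4 and a = "7/8"]) (use crit_boundD(1,2)[OF cb] in auto)
  have "Lp_bound 4 (duhamel (dheat k) (stress_source k u) t) (1024 * (M * M) * t powr (1 - 7/8 - 1/4))"
    by (rule d(2)) (use crit_boundD(1,2)[OF cb] in auto)
  then show "Lp_bound 4 (duhamel (dheat k) (stress_source k u) t) (1024 * (M * M) * t powr (- (1/8)))"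
    by simp
  have "Lp_bound 3 (duhamel (dheat k) (stress_source k u) t) (1024 * (M * M) * t powr (1 - 3/4 - 1/4))"
    by (rule d(2)) (use crit_boundD(1,2)[OF cb] in auto)
  then show "Lp_bound 3 (duhamel (dheat k) (stress_source k u) t) (1024 * (M * M))"
    using t' by simp
qed

text \<open>The kernel carries no derivative here: the exponents are 3/8 into L^4 and 1/4 into L^3,
  against the source weight 3/4. The bound is linear in \<open>N\<close>.\<close>

lemma buoyancy_terms:
  assumes t: "t \<in> {0<..T}"
  shows "AE x in lborel. set_integrable lborel {0<..<t} (\<lambda>s. conv (G (t - s)) (buoyancy_source \<theta> s) x)"
    and "Lp_bound 4 (buoyancy \<theta> t) (1024 * N * t powr (- (1/8)))"
    and "Lp_bound 3 (buoyancy \<theta> t) (1024 * N)"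
proof -
  have t': "0 < t" "t \<le> T" using t by auto
  have m: "Lp_bound 2 (buoyancy_source \<theta> s) (N * s powr (- (3/4)))" if "s \<in> {0<..<t}" for s
    by (rule buoyancy_source_bound[OF cb]) (use that t in auto)
  note d = duhamel_bound_32[OF heat_like_heat_kernel source_cont_open(3)[OF t'(2)] _ _ _ t'(1) m]
  show "AE x in lborel. set_integrable lborel {0<..<t} (\<lambda>s. conv (G (t - s)) (buoyancy_source \<theta> s) x)"
    by (rule d(1)[where q = 4 and a = "3/8"]) (use crit_boundD(1,2)[OF cb] in auto)
  have "Lp_bound 4 (duhamel G (buoyancy_source \<theta>) t) (1024 * N * t powr (1 - 3/8 - 3/4))"
    by (rule d(2)) (use crit_boundD(1,2)[OF cb] in auto)
  then show "Lp_bound 4 (buoyancy \<theta> t) (1024 * N * t powr (- (1/8)))"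
    by (simp add: buoyancy_def[abs_def])
  have "Lp_bound 3 (duhamel G (buoyancy_source \<theta>) t) (1024 * N * t powr (1 - 1/4 - 3/4))"
    by (rule d(2)) (use crit_boundD(1,2)[OF cb] in auto)
  then show "Lp_bound 3 (buoyancy \<theta> t) (1024 * N)"
    using t' by (simp add: buoyancy_def[abs_def])
qed

lemma transport_bound:
  assumes t: "t \<in> {0<..T}"
  shows "Lp_bound 2 (transport \<theta> u t) (3072 * (N * M) * t powr (- (3/4)))"
proof -
  have "Lp_bound 2 (\<lambda>x. \<Sum>k\<in>UNIV. duhamel (dheat k) (heat_source k \<theta> u) t x) (\<Sum>k\<in>(UNIV :: 3 set). 1024 * (N * M) * t powr (- (3/4)))"
    by (intro Lp_bound_sum transport_terms(2)[OF t]) auto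
  then show ?thesis by (simp add: transport_def[abs_def] mult.assoc)
qed

lemma convection_bound:
  assumes t: "t \<in> {0<..T}"
  shows "Lp_bound 4 (convection u t) (3072 * (M * M) * t powr (- (1/8)))"
    and "Lp_bound 3 (convection u t) (3072 * (M * M))"
proof -
  have "Lp_bound 4 (\<lambda>x. \<Sum>k\<in>UNIV. duhamel (dheat k) (stress_source k u) t x) (\<Sum>k\<in>(UNIV :: 3 set). 1024 * (M * M) * t powr (- (1/8)))"
    by (intro Lp_bound_sum convection_terms(2)[OF t]) auto
  then show "Lp_bound 4 (convection u t) (3072 * (M * M) * t powr (- (1/8)))"
    by (simp add: convection_def[abs_def] mult.assoc)
  have "Lp_bound 3 (\<lambda>x. \<Sum>k\<in>UNIV. duhamel (dheat k) (stress_source k u) t x) (\<Sum>k\<in>(UNIV :: 3 set). 1024 * (M * M))"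
    by (intro Lp_bound_sum convection_terms(3)[OF t]) auto
  then show "Lp_bound 3 (convection u t) (3072 * (M * M))"
    by (simp add: convection_def[abs_def] mult.assoc)
qed

lemma set_integrable_sum:
  fixes f :: "'i \<Rightarrow> real \<Rightarrow> 'b::euclidean_space"
  assumes "finite I" "\<And>i. i \<in> I \<Longrightarrow> set_integrable lborel S (f i)"
  shows "set_integrable lborel S (\<lambda>s. \<Sum>i\<in>I. f i s)"
    and "(LBINT s:S. (\<Sum>i\<in>I. f i s)) = (\<Sum>i\<in>I. LBINT s:S. f i s)"
proof -
  have i: "integrable lborel (\<lambda>s. indicator S s *\<^sub>R f i s)" if "i \<in> I" for i
    using assms(2)[OF that] unfolding set_integrable_def .
  show "set_integrable lborel S (\<lambda>s. \<Sum>i\<in>I. f i s)"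
    unfolding set_integrable_def scaleR_sum_right by (rule Bochner_Integration.integrable_sum[OF i])
  show "(LBINT s:S. (\<Sum>i\<in>I. f i s)) = (\<Sum>i\<in>I. LBINT s:S. f i s)"
    unfolding set_lebesgue_integral_def scaleR_sum_right by (rule Bochner_Integration.integral_sum[OF i])
qed

lemma heat_div_eq:
  assumes s: "s \<in> {0<..T}" and \<tau>: "0 < \<tau>"
  shows "heat_div \<tau> (\<lambda>y. \<theta> s y *\<^sub>R u s y) x = (\<Sum>k\<in>UNIV. conv (dheat k \<tau>) (heat_source k \<theta> u s) x)"
proof -
  have "heat_div \<tau> (\<lambda>y. \<theta> s y *\<^sub>R u s y) x
     = (\<integral>y. (\<Sum>k\<in>UNIV. dheat k \<tau> (x - y) *\<^sub>R heat_source k \<theta> u s y) \<partial>lborel)"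
    unfolding heat_div_def by (simp add: inner_vec_def grad_def heat_source_def)
  also have "\<dots> = (\<Sum>k\<in>UNIV. \<integral>y. dheat k \<tau> (x - y) *\<^sub>R heat_source k \<theta> u s y \<partial>lborel)"
    by (intro Bochner_Integration.integral_sum conv_integrable[OF heat_like_bound[OF heat_like_partial_deriv \<tau>] heat_source_bound[OF cb s]]) auto
  finally show ?thesis by (simp add: conv_def)
qed

lemma heat_leray_div_eq:
  "heat_leray_div \<tau> (\<lambda>y. tensor (u s y) (u s y)) x = (\<Sum>k\<in>UNIV. conv (dheat k \<tau>) (stress_source k u s) x)"
proof -
  have "tensor a b $ k = a $ k *\<^sub>R b" for a b k
    by (simp add: tensor_def vec_eq_iff)
  then show ?thesis
    by (simp add: heat_leray_div_def conv_def stress_source_def stress_def[abs_def])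
qed

lemma heat_leray_eq:
  assumes "\<tau> \<noteq> 0"
  shows "heat \<tau> (leray (\<lambda>y. \<theta> s y *\<^sub>R e3)) x = conv (G \<tau>) (buoyancy_source \<theta> s) x"
  using assms by (simp add: heat_def conv_def buoyancy_source_def)

lemma mild_transport:
  assumes t: "t \<in> {0<..T}"
  shows "AE x in lborel. set_integrable lborel {0<..<t} (\<lambda>s. heat_div (t - s) (\<lambda>y. \<theta> s y *\<^sub>R u s y) x) \<and>
     (LBINT s:{0<..<t}. heat_div (t - s) (\<lambda>y. \<theta> s y *\<^sub>R u s y) x) = transport \<theta> u t x"
proof -
  have "AE x in lborel. \<forall>k\<in>UNIV. set_integrable lborel {0<..<t} (\<lambda>s. conv (dheat k (t - s)) (heat_source k \<theta> u s) x)"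
    using transport_terms(1)[OF t] by (subst AE_ball_countable) auto
  then show ?thesis
  proof eventually_elim
    case (elim x)
    have eq: "heat_div (t - s) (\<lambda>y. \<theta> s y *\<^sub>R u s y) x = (\<Sum>k\<in>UNIV. conv (dheat k (t - s)) (heat_source k \<theta> u s) x)"
      if "s \<in> {0<..<t}" for s
      by (rule heat_div_eq) (use that t in auto)
    have "set_integrable lborel {0<..<t} (\<lambda>s. \<Sum>k\<in>UNIV. conv (dheat k (t - s)) (heat_source k \<theta> u s) x)"
      "(LBINT s:{0<..<t}. (\<Sum>k\<in>UNIV. conv (dheat k (t - s)) (heat_source k \<theta> u s) x)) = transport \<theta> u t x"
      unfolding transport_def duhamel_def by (intro set_integrable_sum; use elim in simp)+
    moreover have "set_integrable lborel {0<..<t} (\<lambda>s. heat_div (t - s) (\<lambda>y. \<theta> s y *\<^sub>R u s y) x)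
      = set_integrable lborel {0<..<t} (\<lambda>s. \<Sum>k\<in>UNIV. conv (dheat k (t - s)) (heat_source k \<theta> u s) x)"
      by (rule set_integrable_cong) (simp_all only: eq)
    moreover have "(LBINT s:{0<..<t}. heat_div (t - s) (\<lambda>y. \<theta> s y *\<^sub>R u s y) x)
      = (LBINT s:{0<..<t}. (\<Sum>k\<in>UNIV. conv (dheat k (t - s)) (heat_source k \<theta> u s) x))"
      by (rule set_lebesgue_integral_cong) (simp_all add: eq)
    ultimately show ?case by (simp only: simp_thms)
  qed
qed

lemma mild_convection:
  assumes t: "t \<in> {0<..T}"
  shows "AE x in lborel. set_integrable lborel {0<..<t} (\<lambda>s. heat_leray_div (t - s) (\<lambda>y. tensor (u s y) (u s y)) x) \<and>
     (LBINT s:{0<..<t}. heat_leray_div (t - s) (\<lambda>y. tensor (u s y) (u s y)) x) = convection u t x"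
proof -
  have "AE x in lborel. \<forall>k\<in>UNIV. set_integrable lborel {0<..<t} (\<lambda>s. conv (dheat k (t - s)) (stress_source k u s) x)"
    using convection_terms(1)[OF t] by (subst AE_ball_countable) auto
  then show ?thesis
  proof eventually_elim
    case (elim x)
    then have i: "set_integrable lborel {0<..<t} (\<lambda>s. conv (dheat k (t - s)) (stress_source k u s) x)" for k
      by blast
    show ?case
      unfolding heat_leray_div_eq convection_def duhamel_def
      by (intro conjI set_integrable_sum i) auto
  qed
qed

lemma mild_buoyancy:
  assumes t: "t \<in> {0<..T}"
  shows "AE x in lborel. set_integrable lborel {0<..<t} (\<lambda>s. heat (t - s) (leray (\<lambda>y. \<theta> s y *\<^sub>R e3)) x) \<and>
     (LBINT s:{0<..<t}. heat (t - s) (leray (\<lambda>y. \<theta> s y *\<^sub>R e3)) x) = buoyancy \<theta> t x"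
  using buoyancy_terms(1)[OF t]
proof eventually_elim
  case (elim x)
  have eq: "heat (t - s) (leray (\<lambda>y. \<theta> s y *\<^sub>R e3)) x = conv (G (t - s)) (buoyancy_source \<theta> s) x"
    if "s \<in> {0<..<t}" for s
    by (rule heat_leray_eq) (use that in auto)
  have "set_integrable lborel {0<..<t} (\<lambda>s. heat (t - s) (leray (\<lambda>y. \<theta> s y *\<^sub>R e3)) x)
      = set_integrable lborel {0<..<t} (\<lambda>s. conv (G (t - s)) (buoyancy_source \<theta> s) x)"
    by (rule set_integrable_cong) (simp_all only: eq)
  moreover have "(LBINT s:{0<..<t}. heat (t - s) (leray (\<lambda>y. \<theta> s y *\<^sub>R e3)) x)
      = (LBINT s:{0<..<t}. conv (G (t - s)) (buoyancy_source \<theta> s) x)"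
    by (rule set_lebesgue_integral_cong) (simp_all add: eq)
  ultimately show ?case
    using elim by (simp only: buoyancy_def duhamel_def simp_thms)
qed

text \<open>The critical bounds make all time integrals converge absolutely at almost every point,
  so the integrability clauses disappear and only equations almost everywhere remain. At time zero
  the integrals are empty and \<open>heat 0\<close> is the identity.\<close>

lemma mild_solution_iff:
  "mild_solution T u0 \<theta>0 u \<theta> \<longleftrightarrow> div_free u0 \<and>
     (0 \<le> T \<longrightarrow> (AE x in lborel. \<theta> 0 x = \<theta>0 x) \<and> (AE x in lborel. u 0 x = u0 x)) \<and>
     (\<forall>t\<in>{0<..T}. (AE x in lborel. \<theta> t x = conv (G t) \<theta>0 x - transport \<theta> u t x) \<and>
        (AE x in lborel. u t x = conv (G t) u0 x - convection u t x + buoyancy \<theta> t x))"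
proof -
  have split: "(\<forall>t\<in>{0..T}. P t) \<longleftrightarrow> (0 \<le> T \<longrightarrow> P 0) \<and> (\<forall>t\<in>{0<..T}. P t)" for P :: "real \<Rightarrow> bool"
    by (auto simp: less_eq_real_def)
  have heat: "heat t f x = conv (G t) f x" if "t \<in> {0<..T}" for t x and f :: "real^3 \<Rightarrow> 'c::euclidean_space"
    using that by (simp add: heat_def conv_def)
  have AE_swap: "(AE x in lborel. P x) \<longleftrightarrow> (AE x in lborel. Q x)"
    if "AE x in lborel. P x \<longleftrightarrow> Q x" for P Q :: "real^3 \<Rightarrow> bool"
  proof
    assume "AE x in lborel. P x"
    with that show "AE x in lborel. Q x" by eventually_elim simp
  next
    assume "AE x in lborel. Q x"
    with that show "AE x in lborel. P x" by eventually_elim simp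
  qed
  have A: "(AE x in lborel. set_integrable lborel {0<..<t} (\<lambda>s. heat_div (t - s) (\<lambda>y. \<theta> s y *\<^sub>R u s y) x) \<and>
        \<theta> t x = heat t \<theta>0 x - (LBINT s:{0<..<t}. heat_div (t - s) (\<lambda>y. \<theta> s y *\<^sub>R u s y) x)) \<longleftrightarrow>
      (AE x in lborel. \<theta> t x = conv (G t) \<theta>0 x - transport \<theta> u t x)" if t: "t \<in> {0<..T}" for t
  proof (rule AE_swap)
    show "AE x in lborel. (set_integrable lborel {0<..<t} (\<lambda>s. heat_div (t - s) (\<lambda>y. \<theta> s y *\<^sub>R u s y) x) \<and>
        \<theta> t x = heat t \<theta>0 x - (LBINT s:{0<..<t}. heat_div (t - s) (\<lambda>y. \<theta> s y *\<^sub>R u s y) x)) \<longleftrightarrow>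
      \<theta> t x = conv (G t) \<theta>0 x - transport \<theta> u t x"
      using mild_transport[OF t] by eventually_elim (simp add: heat[OF t])
  qed
  have B: "(AE x in lborel.
        set_integrable lborel {0<..<t} (\<lambda>s. heat_leray_div (t - s) (\<lambda>y. tensor (u s y) (u s y)) x) \<and>
        set_integrable lborel {0<..<t} (\<lambda>s. heat (t - s) (leray (\<lambda>y. \<theta> s y *\<^sub>R e3)) x) \<and>
        u t x = heat t u0 x
          - (LBINT s:{0<..<t}. heat_leray_div (t - s) (\<lambda>y. tensor (u s y) (u s y)) x)
          + (LBINT s:{0<..<t}. heat (t - s) (leray (\<lambda>y. \<theta> s y *\<^sub>R e3)) x)) \<longleftrightarrow>
      (AE x in lborel. u t x = conv (G t) u0 x - convection u t x + buoyancy \<theta> t x)" if t: "t \<in> {0<..T}" for t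
  proof (rule AE_swap)
    show "AE x in lborel. (set_integrable lborel {0<..<t} (\<lambda>s. heat_leray_div (t - s) (\<lambda>y. tensor (u s y) (u s y)) x) \<and>
        set_integrable lborel {0<..<t} (\<lambda>s. heat (t - s) (leray (\<lambda>y. \<theta> s y *\<^sub>R e3)) x) \<and>
        u t x = heat t u0 x
          - (LBINT s:{0<..<t}. heat_leray_div (t - s) (\<lambda>y. tensor (u s y) (u s y)) x)
          + (LBINT s:{0<..<t}. heat (t - s) (leray (\<lambda>y. \<theta> s y *\<^sub>R e3)) x)) \<longleftrightarrow>
      u t x = conv (G t) u0 x - convection u t x + buoyancy \<theta> t x"
      using mild_convection[OF t] mild_buoyancy[OF t]
      by eventually_elim (simp add: heat[OF t])
  qed
  have C1: "(AE x in lborel. set_integrable lborel {0<..<0} (\<lambda>s. heat_div (0 - s) (\<lambda>y. \<theta> s y *\<^sub>R u s y) x) \<and>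
        \<theta> 0 x = heat 0 \<theta>0 x - (LBINT s:{0<..<0}. heat_div (0 - s) (\<lambda>y. \<theta> s y *\<^sub>R u s y) x)) \<longleftrightarrow>
      (AE x in lborel. \<theta> 0 x = \<theta>0 x)"
    by (simp add: set_integrable_def heat_def set_lebesgue_integral_def)
  have C2: "(AE x in lborel.
        set_integrable lborel {0<..<0} (\<lambda>s. heat_leray_div (0 - s) (\<lambda>y. tensor (u s y) (u s y)) x) \<and>
        set_integrable lborel {0<..<0} (\<lambda>s. heat (0 - s) (leray (\<lambda>y. \<theta> s y *\<^sub>R e3)) x) \<and>
        u 0 x = heat 0 u0 x
          - (LBINT s:{0<..<0}. heat_leray_div (0 - s) (\<lambda>y. tensor (u s y) (u s y)) x)
          + (LBINT s:{0<..<0}. heat (0 - s) (leray (\<lambda>y. \<theta> s y *\<^sub>R e3)) x)) \<longleftrightarrow>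
      (AE x in lborel. u 0 x = u0 x)"
    by (simp add: set_integrable_def heat_def set_lebesgue_integral_def)
  show ?thesis
    unfolding mild_solution_def split C1 C2 by (simp only: A B cong: ball_cong) blast
qed

end

section \<open>Difference quotients of the heat kernel\<close>

lemma heat_kernel_diff_le:
  assumes t: "0 < t" and h: "norm h \<le> sqrt t"
  shows "\<bar>G t (x + h) - G t x\<bar> \<le> 4 * (norm h / sqrt t) * wide_gaussian t x"
proof -
  have "\<forall>r. 0 \<le> r \<and> r \<le> 1 \<longrightarrow> (\<exists>D. ((\<lambda>r. G t (x + r *\<^sub>R h)) has_field_derivative D) (at r) \<and>
         \<bar>D\<bar> \<le> 4 * (norm h / sqrt t) * wide_gaussian t x)"
    using heat_kernel_line_derivative[OF t h] by blast
  then obtain D where D: "\<forall>r. 0 \<le> r \<and> r \<le> 1 \<longrightarrow> ((\<lambda>r. G t (x + r *\<^sub>R h)) has_field_derivative D r) (at r) \<and>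
         \<bar>D r\<bar> \<le> 4 * (norm h / sqrt t) * wide_gaussian t x"
    by metis
  have "\<exists>z. 0 < z \<and> z < 1 \<and> G t (x + 1 *\<^sub>R h) - G t (x + 0 *\<^sub>R h) = (1 - 0) * D z"
    by (rule MVT2) (use D in auto)
  then obtain z where "0 < z" "z < 1" "G t (x + h) - G t x = D z"
    by auto
  then show ?thesis
    using D by simp
qed

text \<open>For shifts longer than \<open>sqrt t\<close> the trivial mass bound 2 is already below
  \<open>32 * norm h / sqrt t\<close>, so the estimate holds for all \<open>h\<close>.\<close>

lemma heat_shift_kernel:
  assumes t: "0 < t"
  shows "kernel_bound (\<lambda>x. G t (x + h) - G t x) (32 * norm h * t powr (- (1/2))) t"
proof -
  have sq: "norm h * t powr (- (1/2)) = norm h / sqrt t"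
    using t by (simp add: powr_half_sqrt[symmetric] powr_minus_divide)
  have nn: "0 \<le> norm h * t powr (- (1/2))" by simp
  show ?thesis
  proof (cases "norm h \<le> sqrt t")
    case True
    then have "kernel_bound (\<lambda>x. G t (x + h) - G t x) (32 * (norm h / sqrt t) * t powr (- 0)) t"
      by (rule heat_like_shift[OF heat_like_heat_kernel t])
    then show ?thesis using t by (simp add: sq mult.assoc)
  next
    case False
    then have "1 \<le> norm h * t powr (- (1/2))"
      unfolding sq using t by simp
    then have le: "2 \<le> 32 * norm h * t powr (- (1/2))" by simp
    have meas: "(\<lambda>x. - G t x) \<in> borel_measurable borel"
      by measurable
    have "kernel_bound (\<lambda>x. - G t x) (1 * 1) t"
      by (rule kernel_bound_dominated[OF kernel_bound_heat_kernel[OF t] meas]) auto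
    then have "kernel_bound (\<lambda>x. - G t x) 1 t" by simp
    from kernel_bound_add[OF kernel_bound_translate[OF kernel_bound_heat_kernel[OF t]] this]
    have "kernel_bound (\<lambda>x. G t (x + h) - G t x) 2 t" by simp
    then show ?thesis
      by (rule kernel_bound_mono) (use le t in auto)
  qed
qed

text \<open>The bound comes from moving a difference quotient of the heat kernel onto \<open>g\<close>.\<close>

lemma norm_conv_dheat_le:
  fixes g :: "real^3 \<Rightarrow> 'b::euclidean_space"
  assumes t: "0 < t" and g: "Lp_bound 2 g N"
    and lip: "\<And>h. Lp_bound 2 (\<lambda>x. g (x + h) - g x) (W * norm h)"
  shows "norm (conv (dheat k t) g x) \<le> t powr (- (3/4)) * W"
proof -
  define e where "e = (axis k 1 :: real^3)"
  have ne: "norm e = 1" by (simp add: e_def)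
  have [measurable]: "g \<in> borel_measurable borel" using g by (rule Lp_boundD)
  \<comment> \<open>The increments start late enough that each is at most \<open>sqrt t\<close>, the
    range in which the difference quotients are dominated by a wide Gaussian.\<close>
  obtain n0 where n0: "inverse (real (Suc n0)) < sqrt t"
    using reals_Archimedean[of "sqrt t"] t by auto
  define h where "h n = inverse (real (Suc (n + n0)))" for n
  have h0: "0 < h n" for n by (simp add: h_def)
  have ht: "h n \<le> sqrt t" for n
  proof -
    have "h n \<le> inverse (real (Suc n0))" by (simp add: h_def field_simps)
    then show ?thesis using n0 by simp
  qed
  have hlim: "h \<longlonglongrightarrow> 0"
    unfolding h_def using LIMSEQ_ignore_initial_segment[OF LIMSEQ_inverse_real_of_nat, of n0] by simp
  let ?D = "\<lambda>n y. (G t (y + h n *\<^sub>R e) - G t y) / h n"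
  have "(\<lambda>n. \<integral>y. ?D n (x - y) *\<^sub>R g y \<partial>lborel) \<longlonglongrightarrow> (\<integral>y. dheat k t (x - y) *\<^sub>R g y \<partial>lborel)"
  proof (rule integral_dominated_convergence[where w = "\<lambda>y. 4 / sqrt t * norm (wide_gaussian t (x - y) *\<^sub>R g y)"])
    show "(\<lambda>y. dheat k t (x - y) *\<^sub>R g y) \<in> borel_measurable lborel"
      using heat_like_measurable[OF heat_like_partial_deriv t] by measurable
    show "integrable lborel (\<lambda>y. 4 / sqrt t * norm (wide_gaussian t (x - y) *\<^sub>R g y))"
      using conv_integrable[OF kernel_bound_wide_gaussian[OF t] g, of x] by (intro integrable_mult_right integrable_norm) auto
    show "AE y in lborel. (\<lambda>n. ?D n (x - y) *\<^sub>R g y) \<longlonglongrightarrow> dheat k t (x - y) *\<^sub>R g y"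
    proof (intro AE_I2 tendsto_scaleR tendsto_const)
      fix y
      let ?f = "\<lambda>r. G t (x - y + r *\<^sub>R e)"
      have "(?f has_field_derivative - ((x - y + 0 *\<^sub>R e) \<bullet> e) / (2 * t) * ?f 0) (at 0)"
        by (rule DERIV_heat_kernel_line[OF t])
      then have "(?f has_field_derivative dheat k t (x - y)) (at 0)"
        by (simp add: partial_deriv_heat_kernel[OF t] e_def inner_axis)
      then have "((\<lambda>r. (?f (0 + r) - ?f 0) / r) \<longlongrightarrow> dheat k t (x - y)) (at 0)"
        by (simp only: DERIV_def)
      moreover have "filterlim h (at 0) sequentially"
        using hlim h0 by (auto simp: filterlim_at intro!: always_eventually) (metis less_irrefl)
      ultimately have "(\<lambda>n. (?f (0 + h n) - ?f 0) / h n) \<longlonglongrightarrow> dheat k t (x - y)"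
        by (rule filterlim_compose)
      then show "(\<lambda>n. ?D n (x - y)) \<longlonglongrightarrow> dheat k t (x - y)" by simp
    qed
    show "AE y in lborel. norm (?D n (x - y) *\<^sub>R g y) \<le> 4 / sqrt t * norm (wide_gaussian t (x - y) *\<^sub>R g y)" for n
    proof (rule AE_I2)
      fix y
      have "\<bar>G t (x - y + h n *\<^sub>R e) - G t (x - y)\<bar> \<le> 4 * (norm (h n *\<^sub>R e) / sqrt t) * wide_gaussian t (x - y)"
        using ht[of n] h0[of n] ne by (intro heat_kernel_diff_le[OF t]) simp
      then have "\<bar>G t (x - y + h n *\<^sub>R e) - G t (x - y)\<bar> / h n \<le> 4 / sqrt t * wide_gaussian t (x - y)"
        using h0[of n] ne by (simp add: field_simps)
      then have "\<bar>G t (x - y + h n *\<^sub>R e) - G t (x - y)\<bar> / h n * norm (g y) \<le> 4 / sqrt t * wide_gaussian t (x - y) * norm (g y)"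
        by (intro mult_right_mono) auto
      then show "norm (?D n (x - y) *\<^sub>R g y) \<le> 4 / sqrt t * norm (wide_gaussian t (x - y) *\<^sub>R g y)"
        using h0[of n] by (simp add: abs_divide abs_mult wide_gaussian_nonneg mult.assoc)
    qed
  qed measurable
  then have lim: "(\<lambda>n. norm (\<integral>y. ?D n (x - y) *\<^sub>R g y \<partial>lborel)) \<longlonglongrightarrow> norm (conv (dheat k t) g x)"
    unfolding conv_def by (rule tendsto_norm)
  have "norm (\<integral>y. ?D n (x - y) *\<^sub>R g y \<partial>lborel) \<le> t powr (- (3/4)) * W" for n
  proof -
    let ?h = "h n *\<^sub>R e"
    have g': "Lp_bound 2 (\<lambda>y. g (y + ?h)) N" by (rule Lp_bound_translate[OF g])
    note kb = kernel_bound_heat_kernel[OF t]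
    have "(\<integral>y. ?D n (x - y) *\<^sub>R g y \<partial>lborel) = conv (\<lambda>y. inverse (h n) * (G t (y + ?h) - G t y)) g x"
      by (simp add: conv_def divide_inverse mult.commute)
    also have "\<dots> = inverse (h n) *\<^sub>R (conv (G t) g (x + ?h) - conv (G t) g x)"
      unfolding conv_scaleR_left by (simp add: conv_diff_left[OF kernel_bound_translate[OF kb] kb g] conv_translate_left)
    also have "conv (G t) g (x + ?h) - conv (G t) g x = conv (G t) (\<lambda>y. g (y + ?h) - g y) x"
      by (simp add: conv_diff_right[OF kb g' g] conv_translate_right)
    finally have eq: "(\<integral>y. ?D n (x - y) *\<^sub>R g y \<partial>lborel) = inverse (h n) *\<^sub>R conv (G t) (\<lambda>y. g (y + ?h) - g y) x" .
    have "norm (conv (G t) (\<lambda>y. g (y + ?h) - g y) x) \<le> t powr (- 3 / (2 * 2)) * (W * norm ?h)"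
      by (rule norm_conv_heat_kernel_le[OF t lip]) simp
    then have "inverse (h n) * norm (conv (G t) (\<lambda>y. g (y + ?h) - g y) x) \<le> inverse (h n) * (t powr (- (3/4)) * (W * h n))"
      using h0[of n] ne by (intro mult_left_mono) auto
    also have "\<dots> = t powr (- (3/4)) * W"
      using h0[of n] by simp
    finally show ?thesis
      unfolding eq using h0[of n] by simp
  qed
  then show ?thesis
    by (intro LIMSEQ_le_const2[OF lim]) auto
qed

section \<open>Estimates for Duhamel terms\<close>

lemma time_integral_borel:
  fixes F :: "real \<Rightarrow> real^3 \<Rightarrow> 'b::euclidean_space"
  assumes "continuous_on ({c<..<t} \<times> UNIV) (\<lambda>(s, x). F s x)"
  shows "(\<lambda>x. LBINT s:{c<..<t}. F s x) \<in> borel_measurable borel"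
proof -
  have "(\<lambda>(x, s). indicator {c<..<t} s *\<^sub>R F s x) \<in> borel_measurable (lborel \<Otimes>\<^sub>M lborel)"
    using measurable_pair_swap[OF time_integral_measurable[OF assms]] by (simp add: case_prod_unfold)
  from lborel.borel_measurable_lebesgue_integral[OF this] show ?thesis
    by (simp add: set_lebesgue_integral_def)
qed

text \<open>The two integrals converge separately, but the difference of the integrands is estimated
  before integrating; this keeps its better bound.\<close>

lemma duhamel_diff_general:
  fixes f g :: "real \<Rightarrow> real^3 \<Rightarrow> 'b::euclidean_space"
  assumes K: "heat_like K \<mu> A" and f: "Lp_cont p0 {0<..<t} f" and g: "Lp_cont p0 {0<..<t} g" and p0: "1 \<le> p0" and q: "1 \<le> q"
    and fi: "AE x in lborel. set_integrable lborel {0<..<t} (\<lambda>s. conv (K (t - s)) (f s) x)"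
    and gi: "AE x in lborel. set_integrable lborel {0<..<t} (\<lambda>s. conv (K (t - s)) (g s) x)"
    and m: "\<And>s. s \<in> {0<..<t} \<Longrightarrow> Lp_bound q (\<lambda>x. conv (K (t - s)) (f s) x - conv (K (t - s)) (g s) x) (m s)"
    and m'[measurable]: "m \<in> borel_measurable borel"
    and Z: "(\<integral>\<^sup>+s. ennreal (indicator {0<..<t} s * m s) \<partial>lborel) \<le> ennreal Z" "0 \<le> Z"
  shows "Lp_bound q (\<lambda>x. duhamel K f t x - duhamel K g t x) Z"
proof -
  note cf = conv_joint_continuous[OF K f p0] and cg = conv_joint_continuous[OF K g p0]
  have c: "continuous_on ({0<..<t} \<times> UNIV) (\<lambda>(s, x). conv (K (t - s)) (f s) x - conv (K (t - s)) (g s) x)"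
    using continuous_on_diff[OF cf cg] by (simp add: case_prod_unfold)
  have 1: "Lp_bound q (\<lambda>x. LBINT s:{0<..<t}. (conv (K (t - s)) (f s) x - conv (K (t - s)) (g s) x)) Z"
    by (rule time_integral_bound(2)[OF c q m m' Z])
  have 2: "AE x in lborel. duhamel K f t x - duhamel K g t x = (LBINT s:{0<..<t}. (conv (K (t - s)) (f s) x - conv (K (t - s)) (g s) x))"
    using fi gi by eventually_elim (simp add: duhamel_def set_integral_diff)
  have 3: "(\<lambda>x. duhamel K f t x - duhamel K g t x) \<in> borel_measurable borel"
    unfolding duhamel_def by (intro borel_measurable_diff time_integral_borel cf cg)
  show ?thesis
    by (rule Lp_bound_cong_AE[OF 1 3 2]) (use q in simp)
qed

text \<open>The time integral that arises when two sources agree up to time \<open>r\<close>. With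
  \<open>r = 0\<close> it measures contraction from the start, with positive \<open>r\<close> the
  continuation of agreement.\<close>

definition tail_integral :: "real \<Rightarrow> real \<Rightarrow> real \<Rightarrow> real \<Rightarrow> ennreal" where
  "tail_integral a b r t = (\<integral>\<^sup>+s. ennreal (indicator {0<..<t} s * ((t - s) powr (- a) * (indicator {r<..} s * s powr (- b)))) \<partial>lborel)"

lemma tail_integral_le:
  assumes t: "0 < t" and ab: "0 \<le> a" "a \<le> 7/8" "0 \<le> b" "b \<le> 7/8"
  shows "tail_integral a b r t \<le> ennreal (32 * t powr (1 - a - b))"
proof -
  have "tail_integral a b r t \<le> (\<integral>\<^sup>+s. ennreal (indicator {0<..<t} s * (1 * (t - s) powr (- a) * s powr (- b))) \<partial>lborel)"
    unfolding tail_integral_def by (intro nn_integral_mono ennreal_leI) (auto simp: indicator_def)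
  also have "\<dots> \<le> ennreal (1 * beta_const a b * t powr (1 - a - b))"
    using t ab by (intro nn_integral_beta_le) auto
  also have "\<dots> \<le> ennreal (32 * t powr (1 - a - b))"
    using beta_const_le[OF ab] by (intro ennreal_leI) (simp add: mult_right_mono)
  finally show ?thesis .
qed

text \<open>For \<open>t\<close> close to \<open>r\<close> this is small without any smallness of
  the solutions. The factor 8 is the largest value of \<open>1 / (1 - a)\<close>.\<close>

lemma tail_integral_late_le:
  assumes r: "0 < r" "r < t" and ab: "0 \<le> a" "a \<le> 7/8" "0 \<le> b"
  shows "tail_integral a b r t \<le> ennreal (8 * r powr (- b) * (t - r) powr (1 - a))"
proof -
  have "tail_integral a b r t = (\<integral>\<^sup>+s. ennreal (indicator {r<..<t} s * (1 * (t - s) powr (- a) * s powr (- b))) \<partial>lborel)"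
    unfolding tail_integral_def using r by (intro nn_integral_cong) (auto simp: indicator_def)
  also have "\<dots> \<le> ennreal (1 * r powr (- b) * ((t - r) powr (1 - a) / (1 - a)))"
    using r ab by (intro nn_integral_tail_le) auto
  also have "\<dots> \<le> ennreal (8 * r powr (- b) * (t - r) powr (1 - a))"
  proof (rule ennreal_leI)
    have "(t - r) powr (1 - a) / (1 - a) \<le> (t - r) powr (1 - a) / (1/8)"
      using ab by (intro divide_left_mono) auto
    then have "r powr (- b) * ((t - r) powr (1 - a) / (1 - a)) \<le> r powr (- b) * ((t - r) powr (1 - a) / (1/8))"
      by (intro mult_left_mono) auto
    then show "1 * r powr (- b) * ((t - r) powr (1 - a) / (1 - a)) \<le> 8 * r powr (- b) * (t - r) powr (1 - a)"
      by simp
  qed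
  finally show ?thesis .
qed

lemma nn_integral_tail_scaled:
  assumes J: "tail_integral a b r t \<le> ennreal J" "0 \<le> J" and C: "0 \<le> C"
  shows "(\<integral>\<^sup>+s. ennreal (indicator {0<..<t} s * (C * ((t - s) powr (- a) * (indicator {r<..} s * s powr (- b))))) \<partial>lborel) \<le> ennreal (C * J)"
proof -
  have "(\<integral>\<^sup>+s. ennreal (indicator {0<..<t} s * (C * ((t - s) powr (- a) * (indicator {r<..} s * s powr (- b))))) \<partial>lborel)
     = (\<integral>\<^sup>+s. ennreal C * ennreal (indicator {0<..<t} s * ((t - s) powr (- a) * (indicator {r<..} s * s powr (- b)))) \<partial>lborel)"
    using C by (intro nn_integral_cong) (simp add: ennreal_mult[symmetric] mult_ac)
  also have "\<dots> = ennreal C * tail_integral a b r t"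
    unfolding tail_integral_def by (rule nn_integral_cmult) measurable
  also have "\<dots> \<le> ennreal C * ennreal J"
    by (intro mult_left_mono J) auto
  finally show ?thesis using C J by (simp add: ennreal_mult)
qed

lemma duhamel_diff_tail:
  fixes f g :: "real \<Rightarrow> real^3 \<Rightarrow> 'b::euclidean_space"
  assumes K: "heat_like K \<mu> 32" and f: "Lp_cont p {0<..<t} f" and g: "Lp_cont p {0<..<t} g" and p: "1 \<le> p" "p \<le> q"
    and fi: "AE x in lborel. set_integrable lborel {0<..<t} (\<lambda>s. conv (K (t - s)) (f s) x)"
    and gi: "AE x in lborel. set_integrable lborel {0<..<t} (\<lambda>s. conv (K (t - s)) (g s) x)"
    and m: "\<And>s. s \<in> {0<..<t} \<Longrightarrow> Lp_bound p (\<lambda>x. f s x - g s x) (C * (indicator {r<..} s * s powr (- b)))" "0 \<le> C"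
    and a: "a = \<mu> + 3/2 * (1 / p - 1 / q)"
    and J: "tail_integral a b r t \<le> ennreal J" "0 \<le> J"
  shows "Lp_bound q (\<lambda>x. duhamel K f t x - duhamel K g t x) (32 * C * J)"
proof (rule duhamel_diff_general[OF K f g p(1) _ fi gi])
  show "1 \<le> q" using p by simp
  fix s assume s: "s \<in> {0<..<t}"
  then have ts: "0 < t - s" by simp
  obtain N where N: "Lp_bound p (f s) N" using Lp_contD[OF f s] .
  obtain N' where N': "Lp_bound p (g s) N'" using Lp_contD[OF g s] .
  have "conv (K (t - s)) (\<lambda>x. f s x - g s x) = (\<lambda>x. conv (K (t - s)) (f s) x - conv (K (t - s)) (g s) x)"
    by (rule ext, rule conv_diff_right[OF heat_like_bound[OF K ts] N N' p(1) p(1)])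
  then show "Lp_bound q (\<lambda>x. conv (K (t - s)) (f s) x - conv (K (t - s)) (g s) x)
      (32 * C * ((t - s) powr (- a) * (indicator {r<..} s * s powr (- b))))"
    using Lp_bound_conv_heat_like[OF K ts m(1)[OF s] p] unfolding a by (simp add: mult_ac)
next
  show "(\<integral>\<^sup>+s. ennreal (indicator {0<..<t} s * (32 * C * ((t - s) powr (- a) * (indicator {r<..} s * s powr (- b))))) \<partial>lborel) \<le> ennreal (32 * C * J)"
    by (rule nn_integral_tail_scaled[OF J]) (use m in simp)
qed (use m J in auto)

context
  fixes T M N :: real and u v :: "real \<Rightarrow> real^3 \<Rightarrow> real^3" and \<theta> \<eta> :: "real \<Rightarrow> real^3 \<Rightarrow> real"
  assumes cu: "crit_bound T M N u \<theta>" and cv: "crit_bound T M N v \<eta>"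
begin

text \<open>The product rule makes the difference linear in \<delta> and \<delta>' with coefficients
  \<open>N\<close> and \<open>M\<close>. The factor 96 is 3 * 32: three coordinates times the kernel
  constant.\<close>

lemma transport_diff:
  assumes t: "t \<in> {0<..T}" and d: "0 \<le> \<delta>" "0 \<le> \<delta>'"
    and du: "\<And>s. s \<in> {0<..<t} \<Longrightarrow> Lp_bound 4 (\<lambda>x. u s x - v s x) (\<delta> * (indicator {r<..} s * s powr (- (1/8))))"
    and d\<theta>: "\<And>s. s \<in> {0<..<t} \<Longrightarrow> Lp_bound 2 (\<lambda>x. \<theta> s x - \<eta> s x) (\<delta>' * (indicator {r<..} s * s powr (- (3/4))))"
    and J: "tail_integral (7/8) (7/8) r t \<le> ennreal J" "0 \<le> J"
  shows "Lp_bound 2 (\<lambda>x. transport \<theta> u t x - transport \<eta> v t x) (96 * (\<delta>' * M + N * \<delta>) * J)"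
proof -
  have tT: "t \<le> T" using t by simp
  have MN: "0 \<le> M" "0 \<le> N" using crit_boundD(1,2)[OF cu] by auto
  have "Lp_bound 2 (\<lambda>x. duhamel (dheat k) (heat_source k \<theta> u) t x - duhamel (dheat k) (heat_source k \<eta> v) t x)
    (32 * (\<delta>' * M + N * \<delta>) * J)" for k
  proof (rule duhamel_diff_tail[OF heat_like_partial_deriv source_cont_open(1)[OF cu tT] source_cont_open(1)[OF cv tT] _ _
        transport_terms(1)[OF cu t] transport_terms(1)[OF cv t] _ _ _ J])
    fix s assume s: "s \<in> {0<..<t}"
    then have s': "s \<in> {0<..T}" using t by auto
    have "Lp_bound (4/3) (\<lambda>x. \<theta> s x * u s x $ k - \<eta> s x * v s x $ k)
       (\<delta>' * (indicator {r<..} s * s powr (- (3/4))) * (M * s powr (- (1/8)))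
         + N * s powr (- (3/4)) * (\<delta> * (indicator {r<..} s * s powr (- (1/8)))))"
      by (rule Lp_bound_product_diff[OF product_like_heat d\<theta>[OF s] crit_boundD(5)[OF cu s'] crit_boundD(6)[OF cv s'] du[OF s]]) auto
    moreover have "\<delta>' * (indicator {r<..} s * s powr (- (3/4))) * (M * s powr (- (1/8)))
         + N * s powr (- (3/4)) * (\<delta> * (indicator {r<..} s * s powr (- (1/8))))
         = (\<delta>' * M + N * \<delta>) * (indicator {r<..} s * (s powr (- (3/4)) * s powr (- (1/8))))"
      by (simp add: algebra_simps)
    moreover have "s powr (- (3/4)) * s powr (- (1/8)) = s powr (- (7/8))"
      using powr_split[of s "3/4" "1/8"] by simp
    ultimately show "Lp_bound (4/3) (\<lambda>x. heat_source k \<theta> u s x - heat_source k \<eta> v s x)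
       ((\<delta>' * M + N * \<delta>) * (indicator {r<..} s * s powr (- (7/8))))"
      unfolding heat_source_def by (simp only:)
  qed (use MN d in auto)
  then have "Lp_bound 2 (\<lambda>x. \<Sum>k\<in>UNIV. (duhamel (dheat k) (heat_source k \<theta> u) t x - duhamel (dheat k) (heat_source k \<eta> v) t x))
    (\<Sum>k\<in>(UNIV :: 3 set). 32 * (\<delta>' * M + N * \<delta>) * J)"
    by (intro Lp_bound_sum) auto
  then show ?thesis
    by (simp add: transport_def sum_subtractf algebra_simps)
qed

lemma stress_source_diff:
  assumes s': "s \<in> {0<..T}" and d: "Lp_bound 4 (\<lambda>x. u s x - v s x) (\<delta> * (indicator {r<..} s * s powr (- (1/8))))"
  shows "Lp_bound 2 (\<lambda>x. stress_source k u s x - stress_source k v s x) (2 * M * \<delta> * (indicator {r<..} s * s powr (- (1/4))))"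
proof -
  have "Lp_bound 2 (\<lambda>x. u s x $ k *\<^sub>R u s x - v s x $ k *\<^sub>R v s x)
       (\<delta> * (indicator {r<..} s * s powr (- (1/8))) * (M * s powr (- (1/8)))
         + M * s powr (- (1/8)) * (\<delta> * (indicator {r<..} s * s powr (- (1/8)))))"
    by (rule Lp_bound_product_diff[OF product_like_stress d crit_boundD(5)[OF cu s'] crit_boundD(5)[OF cv s'] d]) auto
  moreover have "\<delta> * (indicator {r<..} s * s powr (- (1/8))) * (M * s powr (- (1/8)))
         + M * s powr (- (1/8)) * (\<delta> * (indicator {r<..} s * s powr (- (1/8))))
       = 2 * M * \<delta> * (indicator {r<..} s * (s powr (- (1/8)) * s powr (- (1/8))))"
    by (simp add: algebra_simps)
  moreover have "s powr (- (1/8)) * s powr (- (1/8)) = s powr (- (1/4))"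
    using powr_split[of s "1/8" "1/8"] by simp
  ultimately have "Lp_bound 2 (\<lambda>x. stress k u s x - stress k v s x) (2 * M * \<delta> * (indicator {r<..} s * s powr (- (1/4))))"
    unfolding stress_def by (simp only:)
  then show ?thesis
    unfolding stress_source_def by (rule Lp_bound_leray_diff[OF stress_bound[OF cu s'] stress_bound[OF cv s']])
qed

text \<open>The stress is quadratic, so its difference carries \<open>2 * M * \<delta>\<close>; with
  three coordinates and the kernel constant, 192 = 3 * 32 * 2.\<close>

lemma convection_diff:
  assumes t: "t \<in> {0<..T}" and d: "0 \<le> \<delta>"
    and du: "\<And>s. s \<in> {0<..<t} \<Longrightarrow> Lp_bound 4 (\<lambda>x. u s x - v s x) (\<delta> * (indicator {r<..} s * s powr (- (1/8))))"
    and J: "tail_integral (7/8) (1/4) r t \<le> ennreal J" "0 \<le> J"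
  shows "Lp_bound 4 (\<lambda>x. convection u t x - convection v t x) (192 * (M * \<delta>) * J)"
proof -
  have tT: "t \<le> T" using t by simp
  have MN: "0 \<le> M" "0 \<le> N" using crit_boundD(1,2)[OF cu] by auto
  have "Lp_bound 4 (\<lambda>x. duhamel (dheat k) (stress_source k u) t x - duhamel (dheat k) (stress_source k v) t x)
    (32 * (2 * M * \<delta>) * J)" for k
  proof (rule duhamel_diff_tail[OF heat_like_partial_deriv source_cont_open(2)[OF cu tT] source_cont_open(2)[OF cv tT] _ _
        convection_terms(1)[OF cu t] convection_terms(1)[OF cv t] _ _ _ J])
    fix s assume s: "s \<in> {0<..<t}"
    then show "Lp_bound 2 (\<lambda>x. stress_source k u s x - stress_source k v s x) (2 * M * \<delta> * (indicator {r<..} s * s powr (- (1/4))))"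
      using t by (intro stress_source_diff du) auto
  qed (use MN d in auto)
  then have "Lp_bound 4 (\<lambda>x. \<Sum>k\<in>UNIV. (duhamel (dheat k) (stress_source k u) t x - duhamel (dheat k) (stress_source k v) t x))
    (\<Sum>k\<in>(UNIV :: 3 set). 32 * (2 * M * \<delta>) * J)"
    by (intro Lp_bound_sum) auto
  then show ?thesis
    by (simp add: convection_def sum_subtractf mult.assoc)
qed

lemma buoyancy_diff:
  assumes t: "t \<in> {0<..T}" and d: "0 \<le> \<delta>'"
    and d\<theta>: "\<And>s. s \<in> {0<..<t} \<Longrightarrow> Lp_bound 2 (\<lambda>x. \<theta> s x - \<eta> s x) (\<delta>' * (indicator {r<..} s * s powr (- (3/4))))"
    and J: "tail_integral (3/8) (3/4) r t \<le> ennreal J" "0 \<le> J"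
  shows "Lp_bound 4 (\<lambda>x. buoyancy \<theta> t x - buoyancy \<eta> t x) (32 * \<delta>' * J)"
  unfolding buoyancy_def
proof (rule duhamel_diff_tail[OF heat_like_heat_kernel source_cont_open(3)[OF cu] source_cont_open(3)[OF cv] _ _
      buoyancy_terms(1)[OF cu t] buoyancy_terms(1)[OF cv t] _ _ _ J])
  fix s assume s: "s \<in> {0<..<t}"
  then have s': "s \<in> {0<..T}" using t by auto
  have "Lp_bound 2 (\<lambda>x. \<theta> s x *\<^sub>R e3 - \<eta> s x *\<^sub>R e3) (\<delta>' * (indicator {r<..} s * s powr (- (3/4))))"
    using Lp_bound_e3[OF d\<theta>[OF s]] by (simp add: scaleR_diff_left)
  then show "Lp_bound 2 (\<lambda>x. buoyancy_source \<theta> s x - buoyancy_source \<eta> s x) (\<delta>' * (indicator {r<..} s * s powr (- (3/4))))"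
    unfolding buoyancy_source_def
    by (rule Lp_bound_leray_diff[OF Lp_bound_e3[OF crit_boundD(6)[OF cu s']] Lp_bound_e3[OF crit_boundD(6)[OF cv s']], rotated 2]) auto
qed (use t d in auto)

end

section \<open>Operations on continuous families; divergence of Duhamel integrals\<close>

lemma Lp_cont_add:
  assumes f: "Lp_cont p S f" and g: "Lp_cont p S g" and p: "1 \<le> p"
  shows "Lp_cont p S (\<lambda>s x. f s x + g s x)"
  unfolding Lp_cont_def
proof (intro ballI conjI allI impI)
  fix t assume t: "t \<in> S"
  obtain A where A: "Lp_bound p (f t) A" using Lp_contD[OF f t] .
  obtain B where B: "Lp_bound p (g t) B" using Lp_contD[OF g t] .
  show "\<exists>N. Lp_bound p (\<lambda>x. f t x + g t x) N"
    using Lp_bound_add[OF A B p] by blast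
  fix e :: real assume "0 < e"
  then have e: "0 < e / 2" by simp
  obtain d1 where d1: "0 < d1" "\<And>s. s \<in> S \<Longrightarrow> \<bar>s - t\<bar> < d1 \<Longrightarrow> Lp_bound p (\<lambda>x. f s x - f t x) (e / 2)"
    using Lp_contE[OF f t e] by blast
  obtain d2 where d2: "0 < d2" "\<And>s. s \<in> S \<Longrightarrow> \<bar>s - t\<bar> < d2 \<Longrightarrow> Lp_bound p (\<lambda>x. g s x - g t x) (e / 2)"
    using Lp_contE[OF g t e] by blast
  have "Lp_bound p (\<lambda>x. f s x + g s x - (f t x + g t x)) e" if s: "s \<in> S" "\<bar>s - t\<bar> < min d1 d2" for s
  proof -
    have "Lp_bound p (\<lambda>x. (f s x - f t x) + (g s x - g t x)) (e / 2 + e / 2)"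
      using d1 d2 s by (intro Lp_bound_add p) auto
    then show ?thesis by (simp add: algebra_simps)
  qed
  then show "\<exists>d>0. \<forall>s\<in>S. \<bar>s - t\<bar> < d \<longrightarrow> Lp_bound p (\<lambda>x. f s x + g s x - (f t x + g t x)) e"
    using d1(1) d2(1) by (intro exI[of _ "min d1 d2"]) auto
qed

lemma Lp_cont_uminus:
  fixes f :: "real \<Rightarrow> real^3 \<Rightarrow> 'b::euclidean_space"
  assumes f: "Lp_cont p S f" and p: "1 \<le> p"
  shows "Lp_cont p S (\<lambda>s x. - f s x)"
proof -
  have neg: "Lp_bound p (\<lambda>x. - g x) K" if "Lp_bound p g K" for g :: "real^3 \<Rightarrow> 'b" and K
    using Lp_bound_scaleR[OF that, of "-1"] p by simp
  show ?thesis
    unfolding Lp_cont_def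
  proof (intro ballI conjI allI impI)
    fix t assume t: "t \<in> S"
    obtain A where A: "Lp_bound p (f t) A" using Lp_contD[OF f t] .
    show "\<exists>N. Lp_bound p (\<lambda>x. - f t x) N"
      using neg[OF A] by blast
    fix e :: real assume e: "0 < e"
    obtain d where d: "0 < d" "\<And>s. s \<in> S \<Longrightarrow> \<bar>s - t\<bar> < d \<Longrightarrow> Lp_bound p (\<lambda>x. f s x - f t x) e"
      using Lp_contE[OF f t e] by blast
    have "Lp_bound p (\<lambda>x. - f s x - - f t x) e" if "s \<in> S" "\<bar>s - t\<bar> < d" for s
      using neg[OF d(2)[OF that]] by simp
    then show "\<exists>d>0. \<forall>s\<in>S. \<bar>s - t\<bar> < d \<longrightarrow> Lp_bound p (\<lambda>x. - f s x - - f t x) e"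
      using d(1) by blast
  qed
qed

lemma Lp_cont_diff:
  assumes "Lp_cont p S f" "Lp_cont p S g" "1 \<le> p"
  shows "Lp_cont p S (\<lambda>s x. f s x - g s x)"
  using Lp_cont_add[OF assms(1) Lp_cont_uminus[OF assms(2,3)] assms(3)] by simp

lemma Lp_cont_zero: "Lp_cont p S (\<lambda>s x. 0)"
  unfolding Lp_cont_def by (auto intro!: exI[of _ 0] exI[of _ 1] Lp_bound_zero)

lemma Lp_cont_sum:
  assumes "finite I" "\<And>i. i \<in> I \<Longrightarrow> Lp_cont p S (f i)" "1 \<le> p"
  shows "Lp_cont p S (\<lambda>s x. \<Sum>i\<in>I. f i s x)"
  using assms(1,2)
proof (induction I rule: finite_induct)
  case empty
  then show ?case by (simp add: Lp_cont_zero)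
next
  case (insert i I)
  then have "Lp_cont p S (\<lambda>s x. f i s x + (\<Sum>i\<in>I. f i s x))"
    by (intro Lp_cont_add assms(3)) auto
  then show ?case using insert by simp
qed

lemma Lp_cont_translate:
  assumes f: "Lp_cont p S f"
  shows "Lp_cont p S (\<lambda>s x. f s (x + h))"
  unfolding Lp_cont_def
proof (intro ballI conjI allI impI)
  fix t assume t: "t \<in> S"
  obtain A where A: "Lp_bound p (f t) A" using Lp_contD[OF f t] .
  show "\<exists>N. Lp_bound p (\<lambda>x. f t (x + h)) N"
    using Lp_bound_translate[OF A] by blast
  fix e :: real assume e: "0 < e"
  obtain d where d: "0 < d" "\<And>s. s \<in> S \<Longrightarrow> \<bar>s - t\<bar> < d \<Longrightarrow> Lp_bound p (\<lambda>x. f s x - f t x) e"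
    using Lp_contE[OF f t e] by blast
  then show "\<exists>d>0. \<forall>s\<in>S. \<bar>s - t\<bar> < d \<longrightarrow> Lp_bound p (\<lambda>x. f s (x + h) - f t (x + h)) e"
    using Lp_bound_translate[of p "\<lambda>x. f s x - f t x" e h for s] by blast
qed

lemma duhamel_translate:
  fixes f :: "real \<Rightarrow> real^3 \<Rightarrow> 'b::euclidean_space"
  assumes K: "heat_like K \<mu> A" and f: "Lp_cont p {0<..<t} f"
  shows "duhamel K f t (x + h) = duhamel K (\<lambda>s y. f s (y + h)) t x"
  unfolding duhamel_def
proof (rule set_lebesgue_integral_cong)
  show "\<forall>s. s \<in> {0<..<t} \<longrightarrow> conv (K (t - s)) (f s) (x + h) = conv (K (t - s)) (\<lambda>y. f s (y + h)) x"
  proof (intro allI impI)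
    fix s assume s: "s \<in> {0<..<t}"
    obtain N where N: "Lp_bound p (f s) N" using Lp_contD[OF f s] .
    have "K (t - s) \<in> borel_measurable borel" using heat_like_measurable[OF K, of "t - s"] s by simp
    then show "conv (K (t - s)) (f s) (x + h) = conv (K (t - s)) (\<lambda>y. f s (y + h)) x"
      using conv_translate_right[of "K (t - s)" "f s" h x] Lp_boundD(1)[OF N] by simp
  qed
qed simp

text \<open>The integral superposes divergence-free convolutions. L^3 serves as auxiliary norm: the
  kernel exponent \<open>\<mu> + 1/4\<close> is at most 3/4, so the norms are integrable in
  time.\<close>

lemma duhamel_div_free:
  assumes K: "heat_like K \<mu> 32" and f: "Lp_cont 2 {0<..<t} f" and t: "0 < t"
    and m: "\<And>s. s \<in> {0<..<t} \<Longrightarrow> Lp_bound 2 (f s) (M * s powr (- b))" "0 \<le> M"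
    and a: "\<mu> \<le> 1/2" and b: "0 \<le> b" "b \<le> 7/8"
    and div: "\<And>s. s \<in> {0<..<t} \<Longrightarrow> div_free (f s)"
  shows "div_free (duhamel K f t)"
proof -
  define a where "a = \<mu> + 3/2 * (1/2 - 1/3)"
  have a': "0 \<le> a" "a \<le> 7/8" using a heat_like_nonneg[OF K] by (auto simp: a_def)
  let ?h = "\<lambda>s x. indicator {0<..<t} s *\<^sub>R conv (K (t - s)) (f s) x"
  let ?a = "\<lambda>s. indicator {0<..<t} s * (32 * M * (t - s) powr (- a) * s powr (- b))"
  have ha: "Lp_bound 3 (?h s) (?a s)" for s
  proof (cases "s \<in> {0<..<t}")
    case True
    then have ts: "0 < t - s" by simp
    have "Lp_bound 3 (conv (K (t - s)) (f s)) (32 * (t - s) powr (- (\<mu> + 3/2 * (1/2 - 1/3))) * (M * s powr (- b)))"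
      by (rule Lp_bound_conv_heat_like[OF K ts m(1)[OF True]]) auto
    moreover have "32 * (t - s) powr (- (\<mu> + 3/2 * (1/2 - 1/3))) * (M * s powr (- b)) = ?a s"
      using True by (simp add: a_def mult_ac)
    moreover have "?h s = conv (K (t - s)) (f s)"
      using True by auto
    ultimately show ?thesis by (simp only:)
  next
    case False
    then show ?thesis by (simp add: Lp_bound_zero)
  qed
  have hd: "div_free (?h s)" for s
  proof (cases "s \<in> {0<..<t}")
    case True
    then have ts: "0 < t - s" by simp
    have "div_free (conv (K (t - s)) (f s))"
      by (rule div_free_conv[OF heat_like_bound[OF K ts] m(1)[OF True] _ div[OF True]]) simp
    moreover have "?h s = conv (K (t - s)) (f s)"
      using True by auto
    ultimately show ?thesis by (simp only:)
  next
    case False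
    then have "?h s = (\<lambda>x. 0)" by auto
    then show ?thesis by (simp only: div_free_zero)
  qed
  have am: "?a \<in> borel_measurable lborel" by measurable
  have le: "(\<integral>\<^sup>+s. ennreal (?a s) \<partial>lborel) \<le> ennreal (32 * M * beta_const a b * t powr (1 - a - b))"
    using t a' b m by (intro nn_integral_beta_le) auto
  have nn: "0 \<le> 32 * M * beta_const a b * t powr (1 - a - b)"
    using m beta_const_nonneg[of a b] a' b by simp
  have "div_free (\<lambda>x. \<integral>s. ?h s x \<partial>lborel)"
    by (rule div_free_integral[OF lborel.sigma_finite_measure_axioms
          time_integral_measurable[OF conv_joint_continuous[OF K f]] am ha le nn _ hd]) auto
  then show ?thesis
    by (simp add: duhamel_def[abs_def] set_lebesgue_integral_def)
qed

context
  fixes T M N :: real and u :: "real \<Rightarrow> real^3 \<Rightarrow> real^3" and \<theta> :: "real \<Rightarrow> real^3 \<Rightarrow> real"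
  assumes cb: "crit_bound T M N u \<theta>"
begin

lemma convection_div_free:
  assumes t: "t \<in> {0<..T}"
  shows "div_free (convection u t)"
proof -
  have t': "0 < t" "t \<le> T" using t by auto
  have MN: "0 \<le> M" "0 \<le> N" using crit_boundD(1,2)[OF cb] by auto
  have d: "div_free (duhamel (dheat k) (stress_source k u) t)" for k
  proof (rule duhamel_div_free[OF heat_like_partial_deriv source_cont_open(2)[OF cb t'(2)] t'(1), where M = "M * M" and b = "1/4"])
    fix s assume "s \<in> {0<..<t}"
    then have s: "s \<in> {0<..T}" using t by auto
    show "Lp_bound 2 (stress_source k u s) (M * M * s powr - (1/4))"
      by (rule stress_source_bound[OF cb s])
    show "div_free (stress_source k u s)"
      unfolding stress_source_def by (rule leray_div_free[OF stress_bound[OF cb s]])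
  qed (use MN in auto)
  have "div_free (\<lambda>x. \<Sum>k\<in>UNIV. duhamel (dheat k) (stress_source k u) t x)"
    by (rule div_free_sum[of _ _ 3, OF _ d convection_terms(3)[OF cb t]]) auto
  then show ?thesis by (simp only: convection_def[abs_def])
qed

lemma buoyancy_div_free:
  assumes t: "t \<in> {0<..T}"
  shows "div_free (buoyancy \<theta> t)"
proof -
  have t': "0 < t" "t \<le> T" using t by auto
  have MN: "0 \<le> M" "0 \<le> N" using crit_boundD(1,2)[OF cb] by auto
  have "div_free (duhamel G (buoyancy_source \<theta>) t)"
  proof (rule duhamel_div_free[OF heat_like_heat_kernel source_cont_open(3)[OF cb t'(2)] t'(1), where M = N and b = "3/4"])
    fix s assume "s \<in> {0<..<t}"
    then have s: "s \<in> {0<..T}" using t by auto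
    show "Lp_bound 2 (buoyancy_source \<theta> s) (N * s powr - (3/4))"
      by (rule buoyancy_source_bound[OF cb s])
    show "div_free (buoyancy_source \<theta> s)"
      unfolding buoyancy_source_def by (rule leray_div_free[OF Lp_bound_e3[OF crit_boundD(6)[OF cb s]]]) simp
  qed (use MN in auto)
  then show ?thesis by (simp only: buoyancy_def[abs_def])
qed

lemma convection_cont:
  "Lp_cont 4 {0<..T} (convection u)" "Lp_cont 3 {0<..T} (convection u)"
proof -
  have MN: "0 \<le> M" "0 \<le> N" using crit_boundD(1,2)[OF cb] by auto
  have *: "Lp_cont q {0<..T} (\<lambda>t x. \<Sum>k\<in>UNIV. duhamel (dheat k) (stress_source k u) t x)"
    if q: "2 \<le> q" "a = 1/2 + 3/2 * (1/2 - 1 / q)" "a < 1" for q a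
    by (intro Lp_cont_sum duhamel_Lp_cont[OF heat_like_partial_deriv stress_source_cont[OF cb] _ _ _ stress_source_bound[OF cb] _ q(2,3)])
       (use q MN in auto)
  show "Lp_cont 4 {0<..T} (convection u)" "Lp_cont 3 {0<..T} (convection u)"
    using *[of 4 "7/8"] *[of 3 "3/4"] by (simp_all add: convection_def[abs_def])
qed

lemma buoyancy_cont:
  "Lp_cont 4 {0<..T} (buoyancy \<theta>)" "Lp_cont 3 {0<..T} (buoyancy \<theta>)"
proof -
  have MN: "0 \<le> M" "0 \<le> N" using crit_boundD(1,2)[OF cb] by auto
  have *: "Lp_cont q {0<..T} (duhamel G (buoyancy_source \<theta>))"
    if q: "2 \<le> q" "a = 0 + 3/2 * (1/2 - 1 / q)" "a < 1" for q a
    by (rule duhamel_Lp_cont[OF heat_like_heat_kernel buoyancy_source_cont[OF cb] _ _ _ buoyancy_source_bound[OF cb] _ q(2,3)])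
       (use q MN in auto)
  show "Lp_cont 4 {0<..T} (buoyancy \<theta>)" "Lp_cont 3 {0<..T} (buoyancy \<theta>)"
    using *[of 4 "3/8"] *[of 3 "1/4"] by (simp_all add: buoyancy_def[abs_def])
qed

lemma transport_cont: "Lp_cont 2 {0<..T} (transport \<theta> u)"
proof -
  have MN: "0 \<le> M" "0 \<le> N" using crit_boundD(1,2)[OF cb] by auto
  have "Lp_cont 2 {0<..T} (\<lambda>t x. \<Sum>k\<in>UNIV. duhamel (dheat k) (heat_source k \<theta> u) t x)"
    by (intro Lp_cont_sum duhamel_Lp_cont[OF heat_like_partial_deriv heat_source_cont[OF cb] _ _ _ heat_source_bound[OF cb], where a = "7/8"])
       (use MN in auto)
  then show ?thesis by (simp add: transport_def[abs_def])
qed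

section \<open>Bounds outside the critical norms\<close>

lemma heat_source_L1:
  assumes s: "s \<in> {0<..T}" and c: "Lp_bound 1 (\<theta> s) c" and b: "AE x in lborel. norm (u s x) \<le> b * s powr (- (1/2))" "0 \<le> b"
  shows "Lp_bound 1 (heat_source k \<theta> u s) (b * c * s powr (- (1/2)))"
proof -
  have [measurable]: "\<theta> s \<in> borel_measurable borel" "u s \<in> borel_measurable borel"
    using crit_boundD(5,6)[OF cb s] by (auto dest: Lp_boundD(1))
  have "Lp_bound 1 (heat_source k \<theta> u s) (b * s powr (- (1/2)) * c)"
  proof (rule Lp_bound_scaled_AE[OF c])
    show "heat_source k \<theta> u s \<in> borel_measurable borel"
      unfolding heat_source_def by measurable
    show "AE x in lborel. norm (heat_source k \<theta> u s x) \<le> b * s powr (- (1/2)) * norm (\<theta> s x)"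
      using b(1)
    proof eventually_elim
      case (elim x)
      have "\<bar>\<theta> s x\<bar> * \<bar>u s x $ k\<bar> \<le> \<bar>\<theta> s x\<bar> * (b * s powr (- (1/2)))"
        by (intro mult_left_mono order_trans[OF component_le_norm_cart elim]) auto
      then show ?case by (simp add: heat_source_def abs_mult mult.commute)
    qed
  qed (use b in auto)
  then show ?thesis by (simp add: mult_ac)
qed

text \<open>The critical norms place the product of temperature and velocity in L^(4/3), so L^1 is
  reached by the weighted sup bound of the velocity. Source and kernel both have exponent 1/2 and
  the powers of \<open>t\<close> cancel; the estimate is linear in \<open>c\<close>, with a factor
  \<open>b\<close> that is small for the solution.\<close>

lemma transport_L1:
  assumes c: "\<And>s. s \<in> {0<..T} \<Longrightarrow> Lp_bound 1 (\<theta> s) c" "0 \<le> c"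
    and b: "\<And>s. s \<in> {0<..T} \<Longrightarrow> AE x in lborel. norm (u s x) \<le> b * s powr (- (1/2))" "0 \<le> b"
  shows "t \<in> {0<..T} \<Longrightarrow> Lp_bound 1 (transport \<theta> u t) (3072 * (b * c))"
    and "Lp_cont 1 {0<..T} (transport \<theta> u)"
proof -
  have m: "Lp_bound 1 (heat_source k \<theta> u s) (b * c * s powr (- (1/2)))" if "s \<in> {0<..T}" for s k
    by (rule heat_source_L1[OF that c(1)[OF that] b(1)[OF that] b(2)])
  show "Lp_bound 1 (transport \<theta> u t) (3072 * (b * c))" if t: "t \<in> {0<..T}"
  proof -
    have t': "0 < t" "t \<le> T" using t by auto
    have "Lp_bound 1 (duhamel (dheat k) (heat_source k \<theta> u) t) (1024 * (b * c) * t powr (1 - 1/2 - 1/2))" for k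
      by (rule duhamel_bound_32(2)[OF heat_like_partial_deriv source_cont_open(1)[OF cb t'(2)] _ _ _ t'(1) m])
         (use t b c in auto)
    then have "Lp_bound 1 (\<lambda>x. \<Sum>k\<in>UNIV. duhamel (dheat k) (heat_source k \<theta> u) t x) (\<Sum>k\<in>(UNIV :: 3 set). 1024 * (b * c))"
      using t' by (intro Lp_bound_sum) auto
    then show ?thesis by (simp add: transport_def[abs_def])
  qed
  have "Lp_cont 1 {0<..T} (\<lambda>t x. \<Sum>k\<in>UNIV. duhamel (dheat k) (heat_source k \<theta> u) t x)"
    by (intro Lp_cont_sum duhamel_Lp_cont[OF heat_like_partial_deriv heat_source_cont[OF cb] _ _ _ m, where a = "1/2"])
       (use b c in auto)
  then show "Lp_cont 1 {0<..T} (transport \<theta> u)"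
    by (simp add: transport_def[abs_def])
qed

text \<open>
  For \<open>s \<le> t / 2\<close> the kernel maps \<open>L\<^sup>4\<^sup>/\<^sup>3\<close> to \<open>L\<^sup>\<infinity>\<close>, for \<open>s \<ge> t / 2\<close> it maps \<open>L\<^sup>4\<close> to \<open>L\<^sup>\<infinity>\<close>; in both cases
  the integrand is at most a multiple of \<open>(t / 2) powr (- 3/4) * (t - s) powr (- 7/8) * s powr (- 7/8)\<close>.
\<close>

lemma transport_sup:
  assumes t: "t \<in> {0<..T}"
    and d: "\<And>s. s \<in> {0<..T} \<Longrightarrow> AE x in lborel. norm (\<theta> s x) \<le> d * s powr (- (3/2))" "0 \<le> d"
  shows "norm (transport \<theta> u t x) \<le> 6144 * ((N + d) * M) * t powr (- (3/2))"
proof -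
  have t': "0 < t" "t \<le> T" using t by auto
  have MN: "0 \<le> M" "0 \<le> N" using crit_boundD(1,2)[OF cb] by auto
  have half: "(t / 2) powr (- (3/4)) \<le> 2 * t powr (- (3/4))"
  proof -
    have "(t / 2) powr (- (3/4)) = 2 powr (3/4) * t powr (- (3/4))"
      using t' by (simp add: powr_divide powr_minus field_simps)
    also have "(2::real) powr (3/4) \<le> 2 powr 1" by (intro powr_mono) auto
    finally show ?thesis using t' by (simp add: mult_right_mono)
  qed
  \<comment> \<open>64 is the kernel constant 32 times the factor 2 from \<open>half\<close>. The
    final 6144 is 64 times the beta bound 32 times three coordinates.\<close>
  define C where "C = 64 * ((N + d) * M) * t powr (- (3/4))"
  have C0: "0 \<le> C" using MN d by (simp add: C_def)
  have ptw: "norm (conv (dheat k (t - s)) (heat_source k \<theta> u s) x) \<le> C * (t - s) powr (- (7/8)) * s powr (- (7/8))"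
    if s: "s \<in> {0<..<t}" for s k
  proof -
    have s': "s \<in> {0<..T}" and ts: "0 < t - s" using s t by auto
    have [measurable]: "\<theta> s \<in> borel_measurable borel" "u s \<in> borel_measurable borel"
      using crit_boundD(5,6)[OF cb s'] by (auto dest: Lp_boundD(1))
    have fin: "32 * X * (Y * M) * P \<le> C * P" if "0 \<le> Y" "Y \<le> N + d" "0 \<le> P" "0 \<le> X" "X \<le> (t / 2) powr (- (3/4))" for X Y P
    proof -
      have "32 * X * (Y * M) * P \<le> 32 * (2 * t powr (- (3/4))) * ((N + d) * M) * P"
        using that MN half by (intro mult_right_mono mult_mono) auto
      also have "\<dots> = C * P"
        by (simp add: C_def algebra_simps)
      finally show ?thesis .
    qed
    show ?thesis
    proof (cases "s \<le> t / 2")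
      case True
      have "norm (conv (dheat k (t - s)) (heat_source k \<theta> u s) x)
         \<le> 32 * (t - s) powr (- (1/2 + 3 / (2 * (4/3)))) * (N * M * s powr (- (7/8)))"
        by (rule norm_conv_heat_like_le[OF heat_like_partial_deriv ts heat_source_bound[OF cb s']]) simp
      also have "(t - s) powr (- (1/2 + 3 / (2 * (4/3)))) = (t - s) powr (- (3/4)) * (t - s) powr (- (7/8))"
        using powr_split[of "t - s" "3/4" "7/8"] by simp
      also have "32 * ((t - s) powr (- (3/4)) * (t - s) powr (- (7/8))) * (N * M * s powr (- (7/8)))
         = 32 * (t - s) powr (- (3/4)) * (N * M) * ((t - s) powr (- (7/8)) * s powr (- (7/8)))"
        by (simp only: mult_ac)
      also have "\<dots> \<le> C * ((t - s) powr (- (7/8)) * s powr (- (7/8)))"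
        using True t' MN d by (intro fin powr_mono2') auto
      finally show ?thesis by (simp only: mult.assoc)
    next
      case False
      have L4: "Lp_bound 4 (heat_source k \<theta> u s) (d * s powr (- (3/2)) * (M * s powr (- (1/8))))"
      proof (rule Lp_bound_scaled_AE[OF crit_boundD(5)[OF cb s']])
        show "heat_source k \<theta> u s \<in> borel_measurable borel"
          unfolding heat_source_def by measurable
        show "AE x in lborel. norm (heat_source k \<theta> u s x) \<le> d * s powr (- (3/2)) * norm (u s x)"
          using d(1)[OF s']
        proof eventually_elim
          case (elim x)
          have "\<bar>\<theta> s x\<bar> * \<bar>u s x $ k\<bar> \<le> d * s powr (- (3/2)) * norm (u s x)"
            using elim d by (intro mult_mono component_le_norm_cart) auto
          then show ?case by (simp add: heat_source_def abs_mult)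
        qed
      qed (use d in auto)
      have "norm (conv (dheat k (t - s)) (heat_source k \<theta> u s) x)
         \<le> 32 * (t - s) powr (- (1/2 + 3 / (2 * 4))) * (d * s powr (- (3/2)) * (M * s powr (- (1/8))))"
        by (rule norm_conv_heat_like_le[OF heat_like_partial_deriv ts L4]) simp
      also have "\<dots> = 32 * s powr (- (3/4)) * (d * M) * ((t - s) powr (- (7/8)) * s powr (- (7/8)))"
      proof -
        have "s powr (- (3/2)) * s powr (- (1/8)) = s powr (- (3/4)) * s powr (- (7/8))"
          using powr_split[of s "3/2" "1/8"] powr_split[of s "3/4" "7/8"] by simp
        then have "d * s powr (- (3/2)) * (M * s powr (- (1/8))) = d * M * (s powr (- (3/4)) * s powr (- (7/8)))"
          by (simp add: mult_ac)
        then show ?thesis by simp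
      qed
      also have "\<dots> \<le> C * ((t - s) powr (- (7/8)) * s powr (- (7/8)))"
        using False t' MN d by (intro fin powr_mono2') auto
      finally show ?thesis by (simp only: mult.assoc)
    qed
  qed
  have "norm (duhamel (dheat k) (heat_source k \<theta> u) t x) \<le> C * 32 * t powr (- (3/4))" for k
    unfolding duhamel_def
  proof (rule time_integral_sup_bound[OF conv_joint_continuous[OF heat_like_partial_deriv source_cont_open(1)[OF cb t'(2)]] ptw])
    have "(\<integral>\<^sup>+s. ennreal (indicator {0<..<t} s * (C * (t - s) powr (- (7/8)) * s powr (- (7/8)))) \<partial>lborel)
      \<le> ennreal (C * beta_const (7/8) (7/8) * t powr (1 - 7/8 - 7/8))"
      using t' C0 by (intro nn_integral_beta_le) auto
    also have "\<dots> \<le> ennreal (C * 32 * t powr (- (3/4)))"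
      using C0 beta_const_le[of "7/8" "7/8"] by (intro ennreal_leI) (simp add: mult_right_mono mult_left_mono)
    finally show "(\<integral>\<^sup>+s. ennreal (indicator {0<..<t} s * (C * (t - s) powr (- (7/8)) * s powr (- (7/8)))) \<partial>lborel)
      \<le> ennreal (C * 32 * t powr (- (3/4)))" .
  qed (use C0 in auto)
  then have "norm (transport \<theta> u t x) \<le> (\<Sum>k\<in>(UNIV :: 3 set). C * 32 * t powr (- (3/4)))"
    unfolding transport_def by (intro order_trans[OF norm_sum] sum_mono) auto
  also have "\<dots> = 6144 * ((N + d) * M) * (t powr (- (3/4)) * t powr (- (3/4)))"
    by (simp add: C_def)
  also have "t powr (- (3/4)) * t powr (- (3/4)) = t powr (- (3/2))"
    using powr_split[of t "3/4" "3/4"] by simp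
  finally show ?thesis .
qed

text \<open>Without a derivative, L^2 to L^\<infinity> costs only the exponent 3/4; together with
  the source weight 3/4 this gives the weight 1/2.\<close>

lemma buoyancy_sup:
  assumes t: "t \<in> {0<..T}"
  shows "norm (buoyancy \<theta> t x) \<le> 1024 * N * t powr (- (1/2))"
proof -
  have t': "0 < t" "t \<le> T" using t by auto
  have MN: "0 \<le> M" "0 \<le> N" using crit_boundD(1,2)[OF cb] by auto
  have ptw: "norm (conv (G (t - s)) (buoyancy_source \<theta> s) x) \<le> 32 * N * (t - s) powr (- (3/4)) * s powr (- (3/4))"
    if s: "s \<in> {0<..<t}" for s
  proof -
    have s': "s \<in> {0<..T}" and ts: "0 < t - s" using s t by auto
    have "norm (conv (G (t - s)) (buoyancy_source \<theta> s) x) \<le> 32 * (t - s) powr (- (0 + 3 / (2 * 2))) * (N * s powr (- (3/4)))"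
      by (rule norm_conv_heat_like_le[OF heat_like_heat_kernel ts buoyancy_source_bound[OF cb s']]) simp
    then show ?thesis by (simp add: mult_ac)
  qed
  have "norm (duhamel G (buoyancy_source \<theta>) t x) \<le> 1024 * N * t powr (- (1/2))"
    unfolding duhamel_def
  proof (rule time_integral_sup_bound[OF conv_joint_continuous[OF heat_like_heat_kernel source_cont_open(3)[OF cb t'(2)]] ptw])
    have "(\<integral>\<^sup>+s. ennreal (indicator {0<..<t} s * (32 * N * (t - s) powr (- (3/4)) * s powr (- (3/4)))) \<partial>lborel)
      \<le> ennreal (32 * N * beta_const (3/4) (3/4) * t powr (1 - 3/4 - 3/4))"
      using t' MN by (intro nn_integral_beta_le) auto
    also have "\<dots> \<le> ennreal (1024 * N * t powr (- (1/2)))"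
    proof (rule ennreal_leI)
      have "32 * N * beta_const (3/4) (3/4) * t powr (- (1/2)) \<le> 32 * N * 32 * t powr (- (1/2))"
        using MN beta_const_le[of "3/4" "3/4"] by (intro mult_right_mono mult_left_mono) auto
      then show "32 * N * beta_const (3/4) (3/4) * t powr (1 - 3/4 - 3/4) \<le> 1024 * N * t powr (- (1/2))"
        by simp
    qed
    finally show "(\<integral>\<^sup>+s. ennreal (indicator {0<..<t} s * (32 * N * (t - s) powr (- (3/4)) * s powr (- (3/4)))) \<partial>lborel)
      \<le> ennreal (1024 * N * t powr (- (1/2)))" .
  qed (use MN in auto)
  then show ?thesis by (simp only: buoyancy_def)
qed

text \<open>The shift is placed on the kernel and costs the exponent 1/2: 1/2 + 3/8 = 7/8 remains
  integrable, and 7/8 + 3/4 - 1 = 5/8 is the Lipschitz weight.\<close>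

lemma buoyancy_lip:
  assumes t: "t \<in> {0<..T}"
  shows "Lp_bound 4 (\<lambda>x. buoyancy \<theta> t (x + h) - buoyancy \<theta> t x) (1024 * N * norm h * t powr (- (5/8)))"
proof -
  have t': "0 < t" "t \<le> T" using t by auto
  have MN: "0 \<le> M" "0 \<le> N" using crit_boundD(1,2)[OF cb] by auto
  let ?f = "buoyancy_source \<theta>" and ?g = "\<lambda>s x. buoyancy_source \<theta> s (x + h)"
  note cf = source_cont_open(3)[OF cb t'(2)]
  note cg = Lp_cont_translate[OF cf, of h]
  have src: "Lp_bound 2 (?f s) (N * s powr (- (3/4)))" if "s \<in> {0<..<t}" for s
    using buoyancy_source_bound[OF cb, of s] that t by auto
  have gi: "AE x in lborel. set_integrable lborel {0<..<t} (\<lambda>s. conv (G (t - s)) (?g s) x)"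
    by (rule duhamel_bound_32(1)[OF heat_like_heat_kernel cg _ _ _ t'(1) Lp_bound_translate[OF src], where q = 2 and a = 0]) (use MN in auto)
  have "Lp_bound 4 (\<lambda>x. duhamel G ?g t x - duhamel G ?f t x) (1024 * N * norm h * t powr (- (5/8)))"
  proof (rule duhamel_diff_general[OF heat_like_heat_kernel cg cf _ _ gi buoyancy_terms(1)[OF cb t]])
    fix s assume s: "s \<in> {0<..<t}"
    then have ts: "0 < t - s" by simp
    note kb = kernel_bound_heat_kernel[OF ts]
    have "Lp_bound 4 (conv (\<lambda>x. G (t - s) (x + h) - G (t - s) x) (?f s))
       (32 * norm h * (t - s) powr (- (1/2)) * (t - s) powr (- 3/2 * (1/2 - 1/4)) * (N * s powr (- (3/4))))"
      by (rule Lp_bound_conv[OF heat_shift_kernel[OF ts] src[OF s]]) auto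
    moreover have "conv (\<lambda>x. G (t - s) (x + h) - G (t - s) x) (?f s)
       = (\<lambda>x. conv (G (t - s)) (?g s) x - conv (G (t - s)) (?f s) x)"
      by (rule ext) (simp add: conv_diff_left[OF kernel_bound_translate[OF kb] kb src[OF s]] conv_translate_left
          conv_translate_right[OF measurable_heat_kernel Lp_boundD(1)[OF src[OF s]]])
    moreover have "32 * norm h * (t - s) powr (- (1/2)) * (t - s) powr (- 3/2 * (1/2 - 1/4)) * (N * s powr (- (3/4)))
       = 32 * norm h * N * (t - s) powr (- (7/8)) * s powr (- (3/4))"
      using powr_split[of "t - s" "1/2" "3/8"] by simp
    ultimately show "Lp_bound 4 (\<lambda>x. conv (G (t - s)) (?g s) x - conv (G (t - s)) (?f s) x)
       (32 * norm h * N * (t - s) powr (- (7/8)) * s powr (- (3/4)))"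
      by (simp only:)
  next
    have "(\<integral>\<^sup>+s. ennreal (indicator {0<..<t} s * (32 * norm h * N * (t - s) powr (- (7/8)) * s powr (- (3/4)))) \<partial>lborel)
      \<le> ennreal (32 * norm h * N * beta_const (7/8) (3/4) * t powr (1 - 7/8 - 3/4))"
      using t' MN by (intro nn_integral_beta_le) auto
    also have "\<dots> \<le> ennreal (1024 * N * norm h * t powr (- (5/8)))"
    proof (rule ennreal_leI)
      have "32 * norm h * N * beta_const (7/8) (3/4) * t powr (- (5/8)) \<le> 32 * norm h * N * 32 * t powr (- (5/8))"
        using MN beta_const_le[of "7/8" "3/4"] by (intro mult_right_mono mult_left_mono) auto
      then show "32 * norm h * N * beta_const (7/8) (3/4) * t powr (1 - 7/8 - 3/4) \<le> 1024 * N * norm h * t powr (- (5/8))"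
        by (simp add: mult_ac)
    qed
    finally show "(\<integral>\<^sup>+s. ennreal (indicator {0<..<t} s * (32 * norm h * N * (t - s) powr (- (7/8)) * s powr (- (3/4)))) \<partial>lborel)
      \<le> ennreal (1024 * N * norm h * t powr (- (5/8)))" .
  qed (use MN in auto)
  then show ?thesis
    by (simp add: buoyancy_def duhamel_translate[OF heat_like_heat_kernel cf])
qed

context
  fixes E :: real
  assumes E: "0 \<le> E"
    and lip: "\<And>s h. s \<in> {0<..T} \<Longrightarrow> Lp_bound 4 (\<lambda>x. u s (x + h) - u s x) (E * norm h * s powr (- (5/8)))"
begin

text \<open>The product rule for spatial increments gives the weight 5/8 + 1/8 = 3/4. The projector
  commutes with translations and contracts L^2, so the bound of the unprojected stress
  survives.\<close>

lemma stress_source_lip: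
  assumes s: "s \<in> {0<..T}"
  shows "Lp_bound 2 (\<lambda>x. stress_source k u s (x + h) - stress_source k u s x) (2 * M * E * s powr (- (3/4)) * norm h)"
proof -
  note us = crit_boundD(5)[OF cb s] and st = stress_bound[OF cb s, of k]
  have "Lp_bound 2 (\<lambda>x. u s (x + h) $ k *\<^sub>R u s (x + h) - u s x $ k *\<^sub>R u s x)
     (E * norm h * s powr (- (5/8)) * (M * s powr (- (1/8))) + M * s powr (- (1/8)) * (E * norm h * s powr (- (5/8))))"
    by (rule Lp_bound_product_diff[OF product_like_stress lip[OF s] Lp_bound_translate[OF us] us lip[OF s]]) auto
  moreover have "E * norm h * s powr (- (5/8)) * (M * s powr (- (1/8))) + M * s powr (- (1/8)) * (E * norm h * s powr (- (5/8)))
     = 2 * M * E * (s powr (- (5/8)) * s powr (- (1/8))) * norm h"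
    by (simp add: algebra_simps)
  moreover have "s powr (- (5/8)) * s powr (- (1/8)) = s powr (- (3/4))"
    using powr_split[of s "5/8" "1/8"] by simp
  ultimately have d: "Lp_bound 2 (\<lambda>x. stress k u s (x + h) - stress k u s x) (2 * M * E * s powr (- (3/4)) * norm h)"
    unfolding stress_def by (simp only:)
  note st' = Lp_bound_translate[OF st, of h]
  have l: "Lp_bound 2 (\<lambda>x. leray (\<lambda>x. stress k u s (x + h)) x - leray (stress k u s) x) (2 * M * E * s powr (- (3/4)) * norm h)"
    by (rule Lp_bound_leray_diff[OF st' st d])
  have m: "(\<lambda>x. leray (stress k u s) (x + h) - leray (stress k u s) x) \<in> borel_measurable borel"
    using Lp_boundD(1)[OF Lp_bound_leray[OF st]] Lp_boundD(1)[OF Lp_bound_translate[OF Lp_bound_leray[OF st], of h]] by simp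
  have "AE x in lborel. leray (stress k u s) (x + h) - leray (stress k u s) x = leray (\<lambda>x. stress k u s (x + h)) x - leray (stress k u s) x"
    using leray_translate_AE[OF st, of h] by eventually_elim simp
  then show ?thesis
    unfolding stress_source_def by (intro Lp_bound_cong_AE[OF l m]) auto
qed

text \<open>With the derivative moved onto the Lipschitz source by
  \<open>norm_conv_dheat_le\<close>, the exponents are 3/4 for the kernel and 3/4 for the source,
  instead of the nonintegrable 5/4 for the kernel. The bound is proportional to \<open>M\<close>, so
  it shrinks with the data part although \<open>E\<close> is fixed.\<close>

lemma convection_sup:
  assumes t: "t \<in> {0<..T}"
  shows "norm (convection u t x) \<le> 192 * (M * E) * t powr (- (1/2))"
proof -
  have t': "0 < t" "t \<le> T" using t by auto
  have MN: "0 \<le> M" "0 \<le> N" using crit_boundD(1,2)[OF cb] by auto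
  have ptw: "norm (conv (dheat k (t - s)) (stress_source k u s) x) \<le> 2 * M * E * (t - s) powr (- (3/4)) * s powr (- (3/4))"
    if s: "s \<in> {0<..<t}" for s k
  proof -
    have s': "s \<in> {0<..T}" and ts: "0 < t - s" using s t by auto
    have "norm (conv (dheat k (t - s)) (stress_source k u s) x) \<le> (t - s) powr (- (3/4)) * (2 * M * E * s powr (- (3/4)))"
      by (rule norm_conv_dheat_le[OF ts stress_source_bound[OF cb s'] stress_source_lip[OF s']])
    then show ?thesis by (simp add: mult_ac)
  qed
  have "norm (duhamel (dheat k) (stress_source k u) t x) \<le> 64 * (M * E) * t powr (- (1/2))" for k
    unfolding duhamel_def
  proof (rule time_integral_sup_bound[OF conv_joint_continuous[OF heat_like_partial_deriv source_cont_open(2)[OF cb t'(2)]] ptw])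
    have "(\<integral>\<^sup>+s. ennreal (indicator {0<..<t} s * (2 * M * E * (t - s) powr (- (3/4)) * s powr (- (3/4)))) \<partial>lborel)
      \<le> ennreal (2 * M * E * beta_const (3/4) (3/4) * t powr (1 - 3/4 - 3/4))"
      using t' MN E by (intro nn_integral_beta_le) auto
    also have "\<dots> \<le> ennreal (64 * (M * E) * t powr (- (1/2)))"
    proof (rule ennreal_leI)
      have "2 * M * E * beta_const (3/4) (3/4) * t powr (- (1/2)) \<le> 2 * M * E * 32 * t powr (- (1/2))"
        using MN E beta_const_le[of "3/4" "3/4"] by (intro mult_right_mono mult_left_mono) auto
      then show "2 * M * E * beta_const (3/4) (3/4) * t powr (1 - 3/4 - 3/4) \<le> 64 * (M * E) * t powr (- (1/2))"
        by simp
    qed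
    finally show "(\<integral>\<^sup>+s. ennreal (indicator {0<..<t} s * (2 * M * E * (t - s) powr (- (3/4)) * s powr (- (3/4)))) \<partial>lborel)
      \<le> ennreal (64 * (M * E) * t powr (- (1/2)))" .
  qed (use MN E in auto)
  then have "norm (convection u t x) \<le> (\<Sum>k\<in>(UNIV :: 3 set). 64 * (M * E) * t powr (- (1/2)))"
    unfolding convection_def by (intro order_trans[OF norm_sum] sum_mono) auto
  then show ?thesis by simp
qed

text \<open>Unlike for buoyancy, the shift is placed on the source: the kernel exponent is already
  7/8 and cannot take another 1/2. The source weight is 3/4, and 7/8 + 3/4 - 1 = 5/8 as
  required.\<close>

lemma convection_lip:
  assumes t: "t \<in> {0<..T}"
  shows "Lp_bound 4 (\<lambda>x. convection u t (x + h) - convection u t x) (6144 * (M * E) * norm h * t powr (- (5/8)))"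
proof -
  have t': "0 < t" "t \<le> T" using t by auto
  have MN: "0 \<le> M" "0 \<le> N" using crit_boundD(1,2)[OF cb] by auto
  have J: "tail_integral (7/8) (3/4) 0 t \<le> ennreal (32 * t powr (- (5/8)))"
    using tail_integral_le[of t "7/8" "3/4" 0] t' by simp
  have "Lp_bound 4 (\<lambda>x. duhamel (dheat k) (stress_source k u) t (x + h) - duhamel (dheat k) (stress_source k u) t x)
     (32 * (2 * M * E * norm h) * (32 * t powr (- (5/8))))" for k
  proof -
    let ?f = "stress_source k u" and ?g = "\<lambda>s x. stress_source k u s (x + h)"
    note cf = source_cont_open(2)[OF cb t'(2), of k]
    note cg = Lp_cont_translate[OF cf, of h]
    have src: "Lp_bound 2 (?f s) (M * M * s powr (- (1/4)))" if "s \<in> {0<..<t}" for s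
      using stress_source_bound[OF cb, of s] that t by auto
    have gi: "AE x in lborel. set_integrable lborel {0<..<t} (\<lambda>s. conv (dheat k (t - s)) (?g s) x)"
      by (rule duhamel_bound_32(1)[OF heat_like_partial_deriv cg _ _ _ t'(1) Lp_bound_translate[OF src], where q = 2 and a = "1/2"]) (use MN in auto)
    have "Lp_bound 4 (\<lambda>x. duhamel (dheat k) ?g t x - duhamel (dheat k) ?f t x)
       (32 * (2 * M * E * norm h) * (32 * t powr (- (5/8))))"
    proof (rule duhamel_diff_tail[OF heat_like_partial_deriv cg cf _ _ gi convection_terms(1)[OF cb t] _ _ _ J])
      fix s assume s: "s \<in> {0<..<t}"
      then have s': "s \<in> {0<..T}" using t by auto
      show "Lp_bound 2 (\<lambda>x. ?g s x - ?f s x) (2 * M * E * norm h * (indicator {0<..} s * s powr (- (3/4))))"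
        using stress_source_lip[OF s', of k h] s by (simp add: mult_ac)
    qed (use MN E in auto)
    then show ?thesis
      by (simp add: duhamel_translate[OF heat_like_partial_deriv cf])
  qed
  then have "Lp_bound 4 (\<lambda>x. \<Sum>k\<in>UNIV. (duhamel (dheat k) (stress_source k u) t (x + h) - duhamel (dheat k) (stress_source k u) t x))
     (\<Sum>k\<in>(UNIV :: 3 set). 32 * (2 * M * E * norm h) * (32 * t powr (- (5/8))))"
    by (intro Lp_bound_sum) auto
  then show ?thesis
    by (simp add: convection_def sum_subtractf mult_ac)
qed

end

end

section \<open>The fixed point equation\<close>

definition step_u :: "(real^3 \<Rightarrow> real^3) \<Rightarrow> (real \<Rightarrow> real^3 \<Rightarrow> real^3) \<Rightarrow> (real \<Rightarrow> real^3 \<Rightarrow> real) \<Rightarrow> real \<Rightarrow> real^3 \<Rightarrow> real^3" where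
  "step_u u0 u \<theta> t x = conv (G t) u0 x - convection u t x + buoyancy \<theta> t x"

definition step_\<theta> :: "(real^3 \<Rightarrow> real) \<Rightarrow> (real \<Rightarrow> real^3 \<Rightarrow> real^3) \<Rightarrow> (real \<Rightarrow> real^3 \<Rightarrow> real) \<Rightarrow> real \<Rightarrow> real^3 \<Rightarrow> real" where
  "step_\<theta> \<theta>0 u \<theta> t x = conv (G t) \<theta>0 x - transport \<theta> u t x"

definition fixed_on ::
  "(real^3 \<Rightarrow> real^3) \<Rightarrow> (real^3 \<Rightarrow> real) \<Rightarrow> real \<Rightarrow> (real \<Rightarrow> real^3 \<Rightarrow> real^3) \<Rightarrow> (real \<Rightarrow> real^3 \<Rightarrow> real) \<Rightarrow> bool" where
  "fixed_on u0 \<theta>0 T u \<theta> \<longleftrightarrow> (\<forall>t\<in>{0<..T}. (AE x in lborel. u t x = step_u u0 u \<theta> t x) \<and>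
     (AE x in lborel. \<theta> t x = step_\<theta> \<theta>0 u \<theta> t x))"

definition agree_on ::
  "real \<Rightarrow> (real \<Rightarrow> real^3 \<Rightarrow> real^3) \<Rightarrow> (real \<Rightarrow> real^3 \<Rightarrow> real) \<Rightarrow> (real \<Rightarrow> real^3 \<Rightarrow> real^3) \<Rightarrow> (real \<Rightarrow> real^3 \<Rightarrow> real) \<Rightarrow> bool" where
  "agree_on r u \<theta> v \<eta> \<longleftrightarrow> (\<forall>t\<in>{0<..r}. (AE x in lborel. u t x = v t x) \<and> (AE x in lborel. \<theta> t x = \<eta> t x))"

context
  fixes T M N :: real and u v :: "real \<Rightarrow> real^3 \<Rightarrow> real^3" and \<theta> \<eta> :: "real \<Rightarrow> real^3 \<Rightarrow> real"
  assumes cu: "crit_bound T M N u \<theta>" and cv: "crit_bound T M N v \<eta>"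
begin

lemma step_diff:
  assumes t: "t \<in> {0<..T}" and d: "0 \<le> \<delta>" "0 \<le> \<delta>'"
    and du: "\<And>s. s \<in> {0<..<t} \<Longrightarrow> Lp_bound 4 (\<lambda>x. u s x - v s x) (\<delta> * (indicator {r<..} s * s powr (- (1/8))))"
    and d\<theta>: "\<And>s. s \<in> {0<..<t} \<Longrightarrow> Lp_bound 2 (\<lambda>x. \<theta> s x - \<eta> s x) (\<delta>' * (indicator {r<..} s * s powr (- (3/4))))"
    and J1: "tail_integral (7/8) (1/4) r t \<le> ennreal J1" "0 \<le> J1"
    and J2: "tail_integral (3/8) (3/4) r t \<le> ennreal J2" "0 \<le> J2"
    and J3: "tail_integral (7/8) (7/8) r t \<le> ennreal J3" "0 \<le> J3"
  shows "Lp_bound 4 (\<lambda>x. step_u u0 u \<theta> t x - step_u u0 v \<eta> t x) (192 * (M * \<delta>) * J1 + 32 * \<delta>' * J2)"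
    and "Lp_bound 2 (\<lambda>x. step_\<theta> \<theta>0 u \<theta> t x - step_\<theta> \<theta>0 v \<eta> t x) (96 * (\<delta>' * M + N * \<delta>) * J3)"
proof -
  have "Lp_bound 4 (\<lambda>x. (-1) *\<^sub>R (convection u t x - convection v t x) + (buoyancy \<theta> t x - buoyancy \<eta> t x))
     (\<bar>-1\<bar> * (192 * (M * \<delta>) * J1) + 32 * \<delta>' * J2)"
    by (intro Lp_bound_add Lp_bound_scaleR convection_diff[OF cu cv t d(1) du J1] buoyancy_diff[OF cu cv t d(2) d\<theta> J2]) auto
  then show "Lp_bound 4 (\<lambda>x. step_u u0 u \<theta> t x - step_u u0 v \<eta> t x) (192 * (M * \<delta>) * J1 + 32 * \<delta>' * J2)"
    by (simp add: step_u_def algebra_simps)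
  have "Lp_bound 2 (\<lambda>x. (-1) *\<^sub>R (transport \<theta> u t x - transport \<eta> v t x)) (\<bar>-1\<bar> * (96 * (\<delta>' * M + N * \<delta>) * J3))"
    by (intro Lp_bound_scaleR transport_diff[OF cu cv t d du d\<theta> J3]) auto
  then show "Lp_bound 2 (\<lambda>x. step_\<theta> \<theta>0 u \<theta> t x - step_\<theta> \<theta>0 v \<eta> t x) (96 * (\<delta>' * M + N * \<delta>) * J3)"
    by (simp add: step_\<theta>_def algebra_simps)
qed

text \<open>The case of differences present from time zero. All three tail integrals are at most 32
  times the appropriate power, whence 6144 = 192 * 32, 1024 = 32 * 32 and 3072 = 96 * 32.\<close>

lemma step_diff_0:
  assumes t: "t \<in> {0<..T}" and d: "0 \<le> \<delta>" "0 \<le> \<delta>'"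
    and du: "\<And>s. s \<in> {0<..<t} \<Longrightarrow> Lp_bound 4 (\<lambda>x. u s x - v s x) (\<delta> * s powr (- (1/8)))"
    and d\<theta>: "\<And>s. s \<in> {0<..<t} \<Longrightarrow> Lp_bound 2 (\<lambda>x. \<theta> s x - \<eta> s x) (\<delta>' * s powr (- (3/4)))"
  shows "Lp_bound 4 (\<lambda>x. step_u u0 u \<theta> t x - step_u u0 v \<eta> t x) ((6144 * (M * \<delta>) + 1024 * \<delta>') * t powr (- (1/8)))"
    and "Lp_bound 2 (\<lambda>x. step_\<theta> \<theta>0 u \<theta> t x - step_\<theta> \<theta>0 v \<eta> t x) (3072 * (\<delta>' * M + N * \<delta>) * t powr (- (3/4)))"
proof -
  have t0: "0 < t" using t by simp
  have J: "tail_integral (7/8) (1/4) 0 t \<le> ennreal (32 * t powr (- (1/8)))"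
    "tail_integral (3/8) (3/4) 0 t \<le> ennreal (32 * t powr (- (1/8)))"
    "tail_integral (7/8) (7/8) 0 t \<le> ennreal (32 * t powr (- (3/4)))"
    using tail_integral_le[OF t0, of "7/8" "1/4" 0] tail_integral_le[OF t0, of "3/8" "3/4" 0] tail_integral_le[OF t0, of "7/8" "7/8" 0]
    by simp_all
  have du': "Lp_bound 4 (\<lambda>x. u s x - v s x) (\<delta> * (indicator {0<..} s * s powr (- (1/8))))" if "s \<in> {0<..<t}" for s
    using du[OF that] that by simp
  have d\<theta>': "Lp_bound 2 (\<lambda>x. \<theta> s x - \<eta> s x) (\<delta>' * (indicator {0<..} s * s powr (- (3/4))))" if "s \<in> {0<..<t}" for s
    using d\<theta>[OF that] that by simp
  note sd = step_diff[OF t d du' d\<theta>' J(1) _ J(2) _ J(3)]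
  have 1: "Lp_bound 4 (\<lambda>x. step_u u0 u \<theta> t x - step_u u0 v \<eta> t x) (192 * (M * \<delta>) * (32 * t powr (- (1/8))) + 32 * \<delta>' * (32 * t powr (- (1/8))))"
    by (rule sd(1)) auto
  have 2: "Lp_bound 2 (\<lambda>x. step_\<theta> \<theta>0 u \<theta> t x - step_\<theta> \<theta>0 v \<eta> t x) (96 * (\<delta>' * M + N * \<delta>) * (32 * t powr (- (3/4))))"
    by (rule sd(2)) auto
  show "Lp_bound 4 (\<lambda>x. step_u u0 u \<theta> t x - step_u u0 v \<eta> t x) ((6144 * (M * \<delta>) + 1024 * \<delta>') * t powr (- (1/8)))"
    using 1 by (simp add: algebra_simps)
  show "Lp_bound 2 (\<lambda>x. step_\<theta> \<theta>0 u \<theta> t x - step_\<theta> \<theta>0 v \<eta> t x) (3072 * (\<delta>' * M + N * \<delta>) * t powr (- (3/4)))"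
    using 2 by (simp add: algebra_simps)
qed

lemma Lp_bound_diff_fixed:
  assumes "fixed_on u0 \<theta>0 T u \<theta>" "fixed_on u0 \<theta>0 T v \<eta>" and t: "t \<in> {0<..T}"
  shows "Lp_bound 4 (\<lambda>x. step_u u0 u \<theta> t x - step_u u0 v \<eta> t x) K \<Longrightarrow> Lp_bound 4 (\<lambda>x. u t x - v t x) K"
    and "Lp_bound 2 (\<lambda>x. step_\<theta> \<theta>0 u \<theta> t x - step_\<theta> \<theta>0 v \<eta> t x) K \<Longrightarrow> Lp_bound 2 (\<lambda>x. \<theta> t x - \<eta> t x) K"
proof -
  note m = crit_boundD(5,6)[OF cu t, THEN Lp_boundD(1)] crit_boundD(5,6)[OF cv t, THEN Lp_boundD(1)]
  have *: "AE x in lborel. u t x = step_u u0 u \<theta> t x" "AE x in lborel. v t x = step_u u0 v \<eta> t x"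
    "AE x in lborel. \<theta> t x = step_\<theta> \<theta>0 u \<theta> t x" "AE x in lborel. \<eta> t x = step_\<theta> \<theta>0 v \<eta> t x"
    using assms unfolding fixed_on_def by blast+
  have 1: "AE x in lborel. u t x - v t x = step_u u0 u \<theta> t x - step_u u0 v \<eta> t x"
    using *(1,2) by eventually_elim simp
  have 2: "AE x in lborel. \<theta> t x - \<eta> t x = step_\<theta> \<theta>0 u \<theta> t x - step_\<theta> \<theta>0 v \<eta> t x"
    using *(3,4) by eventually_elim simp
  show "Lp_bound 4 (\<lambda>x. u t x - v t x) K" if "Lp_bound 4 (\<lambda>x. step_u u0 u \<theta> t x - step_u u0 v \<eta> t x) K"
    by (rule Lp_bound_cong_AE[OF that _ 1]) (use m in auto)
  show "Lp_bound 2 (\<lambda>x. \<theta> t x - \<eta> t x) K" if "Lp_bound 2 (\<lambda>x. step_\<theta> \<theta>0 u \<theta> t x - step_\<theta> \<theta>0 v \<eta> t x) K"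
    by (rule Lp_bound_cong_AE[OF that _ 2]) (use m in auto)
qed

text \<open>
  The weight 30000 makes the linear buoyancy term a contraction: a difference \<open>\<delta>\<close> of velocities is
  balanced by a difference \<open>\<delta> / 30000\<close> of temperatures.
\<close>

lemma agree_on_extend:
  assumes fx: "fixed_on u0 \<theta>0 T u \<theta>" "fixed_on u0 \<theta>0 T v \<eta>" and agree: "agree_on r u \<theta> v \<eta>"
    and R: "R \<le> T"
    and J: "\<And>t. t \<in> {r<..R} \<Longrightarrow> 0 < t \<Longrightarrow> tail_integral (7/8) (1/4) r t \<le> ennreal (J1 t) \<and> 0 \<le> J1 t \<and> 192 * M * J1 t \<le> 1/4 * t powr (- (1/8))"
      "\<And>t. t \<in> {r<..R} \<Longrightarrow> 0 < t \<Longrightarrow> tail_integral (3/8) (3/4) r t \<le> ennreal (J2 t) \<and> 0 \<le> J2 t \<and> 32 * J2 t \<le> 7500 * t powr (- (1/8))"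
      "\<And>t. t \<in> {r<..R} \<Longrightarrow> 0 < t \<Longrightarrow> tail_integral (7/8) (7/8) r t \<le> ennreal (J3 t) \<and> 0 \<le> J3 t \<and> 96 * (M + 30000 * N) * J3 t \<le> 1/2 * t powr (- (3/4))"
  shows "agree_on R u \<theta> v \<eta>"
proof -
  have MN: "0 \<le> M" "0 \<le> N" using crit_boundD(1,2)[OF cu] by auto
  \<comment> \<open>The start value combines the crude differences \<open>2 * M\<close> and
    \<open>2 * N\<close>, the latter multiplied by the weight 30000; each application of the
    equation halves it.\<close>
  define \<delta> where "\<delta> n = (2 * M + 60000 * N) / 2 ^ n" for n :: nat
  have \<delta>0: "0 \<le> \<delta> n" for n using MN by (simp add: \<delta>_def)
  have \<delta>S: "\<delta> (Suc n) = \<delta> n / 2" for n by (simp add: \<delta>_def)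
  have zero: "Lp_bound 4 (\<lambda>x. u t x - v t x) 0" "Lp_bound 2 (\<lambda>x. \<theta> t x - \<eta> t x) 0" if t: "t \<in> {0<..r}" "t \<le> T" for t
  proof -
    have t': "t \<in> {0<..T}" using t by auto
    note m = crit_boundD(5,6)[OF cu t', THEN Lp_boundD(1)] crit_boundD(5,6)[OF cv t', THEN Lp_boundD(1)]
    have a: "AE x in lborel. u t x - v t x = 0" "AE x in lborel. \<theta> t x - \<eta> t x = 0"
      using agree t unfolding agree_on_def by auto
    show "Lp_bound 4 (\<lambda>x. u t x - v t x) 0"
      by (rule Lp_bound_cong_AE[OF Lp_bound_zero[OF order_refl] _ a(1)]) (use m in auto)
    show "Lp_bound 2 (\<lambda>x. \<theta> t x - \<eta> t x) 0"
      by (rule Lp_bound_cong_AE[OF Lp_bound_zero[OF order_refl] _ a(2)]) (use m in auto)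
  qed
  have bd: "\<forall>t\<in>{0<..R}. Lp_bound 4 (\<lambda>x. u t x - v t x) (\<delta> n * (indicator {r<..} t * t powr (- (1/8)))) \<and>
      Lp_bound 2 (\<lambda>x. \<theta> t x - \<eta> t x) (\<delta> n / 30000 * (indicator {r<..} t * t powr (- (3/4))))" for n
  proof (induction n)
    case 0
    show ?case
    proof (intro ballI)
      fix t assume t: "t \<in> {0<..R}"
      then have t': "t \<in> {0<..T}" using R by auto
      show "Lp_bound 4 (\<lambda>x. u t x - v t x) (\<delta> 0 * (indicator {r<..} t * t powr (- (1/8)))) \<and>
        Lp_bound 2 (\<lambda>x. \<theta> t x - \<eta> t x) (\<delta> 0/30000 * (indicator {r<..} t * t powr (- (3/4))))"
      proof (cases "t \<le> r")
        case True
        then show ?thesis using zero[of t] t t' by auto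
      next
        case False
        have 1: "Lp_bound 4 (\<lambda>x. u t x - v t x) (M * t powr (- (1/8)) + M * t powr (- (1/8)))"
          by (intro Lp_bound_diff crit_boundD(5)[OF cu t'] crit_boundD(5)[OF cv t']) auto
        have 2: "Lp_bound 2 (\<lambda>x. \<theta> t x - \<eta> t x) (N * t powr (- (3/4)) + N * t powr (- (3/4)))"
          by (intro Lp_bound_diff crit_boundD(6)[OF cu t'] crit_boundD(6)[OF cv t']) auto
        have "Lp_bound 4 (\<lambda>x. u t x - v t x) (\<delta> 0 * (indicator {r<..} t * t powr (- (1/8))))"
          by (rule Lp_bound_mono[OF 1]) (use False MN in \<open>auto simp: \<delta>_def algebra_simps\<close>)
        moreover have "Lp_bound 2 (\<lambda>x. \<theta> t x - \<eta> t x) (\<delta> 0/30000 * (indicator {r<..} t * t powr (- (3/4))))"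
          by (rule Lp_bound_mono[OF 2]) (use False MN in \<open>auto simp: \<delta>_def algebra_simps\<close>)
        ultimately show ?thesis ..
      qed
    qed
  next
    case (Suc n)
    show ?case
    proof (intro ballI)
      fix t assume t: "t \<in> {0<..R}"
      then have t': "t \<in> {0<..T}" using R by auto
      show "Lp_bound 4 (\<lambda>x. u t x - v t x) (\<delta> (Suc n) * (indicator {r<..} t * t powr (- (1/8)))) \<and>
        Lp_bound 2 (\<lambda>x. \<theta> t x - \<eta> t x) (\<delta> (Suc n) / 30000 * (indicator {r<..} t * t powr (- (3/4))))"
      proof (cases "t \<le> r")
        case True
        then show ?thesis using zero[of t] t t' by auto
      next
        case False
        have tr: "t \<in> {r<..R}" "0 < t" using False t by auto
        note J1 = J(1)[OF tr] and J2 = J(2)[OF tr] and J3 = J(3)[OF tr]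
        have s: "Lp_bound 4 (\<lambda>x. u s x - v s x) (\<delta> n * (indicator {r<..} s * s powr (- (1/8))))"
          "Lp_bound 2 (\<lambda>x. \<theta> s x - \<eta> s x) (\<delta> n / 30000 * (indicator {r<..} s * s powr (- (3/4))))" if "s \<in> {0<..<t}" for s
          using Suc that t by auto
        note sd = step_diff[OF t' \<delta>0 _ s J1[THEN conjunct1] J1[THEN conjunct2, THEN conjunct1] J2[THEN conjunct1] J2[THEN conjunct2, THEN conjunct1]
            J3[THEN conjunct1] J3[THEN conjunct2, THEN conjunct1]]
        have 1: "Lp_bound 4 (\<lambda>x. u t x - v t x) (192 * (M * \<delta> n) * J1 t + 32 * (\<delta> n / 30000) * J2 t)"
          by (rule Lp_bound_diff_fixed(1)[OF fx t' sd(1)]) (use \<delta>0 in auto)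
        have 2: "Lp_bound 2 (\<lambda>x. \<theta> t x - \<eta> t x) (96 * (\<delta> n / 30000 * M + N * \<delta> n) * J3 t)"
          by (rule Lp_bound_diff_fixed(2)[OF fx t' sd(2)]) (use \<delta>0 in auto)
        have "192 * (M * \<delta> n) * J1 t + 32 * (\<delta> n / 30000) * J2 t = \<delta> n * (192 * M * J1 t) + \<delta> n / 30000 * (32 * J2 t)"
          by (simp add: algebra_simps)
        also have "\<dots> \<le> \<delta> n * (1/4 * t powr (- (1/8))) + \<delta> n / 30000 * (7500 * t powr (- (1/8)))"
          using J1 J2 \<delta>0 by (intro add_mono mult_left_mono) auto
        also have "\<dots> = \<delta> (Suc n) * (indicator {r<..} t * t powr (- (1/8)))"
          using False by (simp add: \<delta>S)
        finally have le1: "192 * (M * \<delta> n) * J1 t + 32 * (\<delta> n / 30000) * J2 t \<le> \<delta> (Suc n) * (indicator {r<..} t * t powr (- (1/8)))" .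
        have "96 * (\<delta> n / 30000 * M + N * \<delta> n) * J3 t = \<delta> n / 30000 * (96 * (M + 30000 * N) * J3 t)"
          by (simp add: algebra_simps)
        also have "\<dots> \<le> \<delta> n / 30000 * (1/2 * t powr (- (3/4)))"
          using J3 \<delta>0 by (intro mult_left_mono) auto
        also have "\<dots> = \<delta> (Suc n) / 30000 * (indicator {r<..} t * t powr (- (3/4)))"
          using False by (simp add: \<delta>S)
        finally have le2: "96 * (\<delta> n / 30000 * M + N * \<delta> n) * J3 t \<le> \<delta> (Suc n) / 30000 * (indicator {r<..} t * t powr (- (3/4)))" .
        show ?thesis
          using Lp_bound_mono[OF 1 le1] Lp_bound_mono[OF 2 le2] by simp
      qed
    qed
  qed
  have \<delta>lim: "\<delta> \<longlonglongrightarrow> 0"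
    unfolding \<delta>_def using tendsto_mult_left[OF LIMSEQ_realpow_zero[of "1/2"], of "2 * M + 60000 * N"] by (simp add: power_divide)
  show ?thesis
    unfolding agree_on_def
  proof (intro ballI conjI)
    fix t assume t: "t \<in> {0<..R}"
    have l1: "(\<lambda>n. \<delta> n * (indicator {r<..} t * t powr (- (1/8)))) \<longlonglongrightarrow> 0 * (indicator {r<..} t * t powr (- (1/8)))"
      by (intro tendsto_mult_right \<delta>lim)
    have l2: "(\<lambda>n. \<delta> n / 30000 * (indicator {r<..} t * t powr (- (3/4)))) \<longlonglongrightarrow> 0/30000 * (indicator {r<..} t * t powr (- (3/4)))"
      by (intro tendsto_mult_right tendsto_divide \<delta>lim tendsto_const) auto
    have "Lp_bound 4 (\<lambda>x. u t x - v t x) (0 * (indicator {r<..} t * t powr (- (1/8))))"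
      by (rule Lp_bound_LIMSEQ[OF _ l1]) (use bd t in auto)
    then have "Lp_bound 4 (\<lambda>x. u t x - v t x) 0" by simp
    from Lp_bound_0_AE[OF this] show "AE x in lborel. u t x = v t x" by eventually_elim simp
    have "Lp_bound 2 (\<lambda>x. \<theta> t x - \<eta> t x) (0/30000 * (indicator {r<..} t * t powr (- (3/4))))"
      by (rule Lp_bound_LIMSEQ[OF _ l2]) (use bd t in auto)
    then have "Lp_bound 2 (\<lambda>x. \<theta> t x - \<eta> t x) 0" by simp
    from Lp_bound_0_AE[OF this] show "AE x in lborel. \<theta> t x = \<eta> t x" by eventually_elim simp
  qed
qed

end

lemma fixed_on_subset: "fixed_on u0 \<theta>0 T u \<theta> \<Longrightarrow> S \<le> T \<Longrightarrow> fixed_on u0 \<theta>0 S u \<theta>"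
  by (auto simp: fixed_on_def)

lemma agree_on_start:
  assumes cu: "crit_bound T M N u \<theta>" and cv: "crit_bound T M N v \<eta>"
    and fx: "fixed_on u0 \<theta>0 T u \<theta>" "fixed_on u0 \<theta>0 T v \<eta>"
    and small: "6144 * M \<le> 1/4" "3072 * (M + 30000 * N) \<le> 1/2"
  shows "agree_on T u \<theta> v \<eta>"
proof (rule agree_on_extend[OF cu cv fx, where r = 0 and ?J1.0 = "\<lambda>t. 32 * t powr (- (1/8))" and ?J2.0 = "\<lambda>t. 32 * t powr (- (1/8))"
      and ?J3.0 = "\<lambda>t. 32 * t powr (- (3/4))"])
  show "agree_on 0 u \<theta> v \<eta>" by (simp add: agree_on_def)
  fix t :: real assume t: "0 < t"
  have "192 * M * (32 * t powr (- (1/8))) = 6144 * M * t powr (- (1/8))" by simp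
  also have "\<dots> \<le> 1/4 * t powr (- (1/8))" using small by (intro mult_right_mono) auto
  finally show "tail_integral (7/8) (1/4) 0 t \<le> ennreal (32 * t powr (- (1/8))) \<and> 0 \<le> 32 * t powr (- (1/8)) \<and>
     192 * M * (32 * t powr (- (1/8))) \<le> 1/4 * t powr (- (1/8))"
    using tail_integral_le[OF t, of "7/8" "1/4" 0] by simp
  show "tail_integral (3/8) (3/4) 0 t \<le> ennreal (32 * t powr (- (1/8))) \<and> 0 \<le> 32 * t powr (- (1/8)) \<and>
     32 * (32 * t powr (- (1/8))) \<le> 7500 * t powr (- (1/8))"
    using tail_integral_le[OF t, of "3/8" "3/4" 0] by simp
  have "96 * (M + 30000 * N) * (32 * t powr (- (3/4))) = 3072 * (M + 30000 * N) * t powr (- (3/4))" by simp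
  also have "\<dots> \<le> 1/2 * t powr (- (3/4))" using small by (intro mult_right_mono) auto
  finally show "tail_integral (7/8) (7/8) 0 t \<le> ennreal (32 * t powr (- (3/4))) \<and> 0 \<le> 32 * t powr (- (3/4)) \<and>
     96 * (M + 30000 * N) * (32 * t powr (- (3/4))) \<le> 1/2 * t powr (- (3/4))"
    using tail_integral_le[OF t, of "7/8" "7/8" 0] by simp
qed simp

text \<open>\<open>M\<close> and \<open>N\<close> may be large here. Beyond \<open>r > 0\<close> the
  tail integrals carry a positive power of \<open>t - r\<close>, and this alone makes the equation a
  contraction just after \<open>r\<close>.\<close>

lemma agree_on_continue:
  assumes cu: "crit_bound T M N u \<theta>" and cv: "crit_bound T M N v \<eta>"
    and fx: "fixed_on u0 \<theta>0 T u \<theta>" "fixed_on u0 \<theta>0 T v \<eta>"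
    and agree: "agree_on r u \<theta> v \<eta>" and r: "0 < r" "r < T"
  shows "\<exists>R. r < R \<and> R \<le> T \<and> agree_on R u \<theta> v \<eta>"
proof -
  have MN: "0 \<le> M" "0 \<le> N" using crit_boundD(1,2)[OF cu] by auto
  let ?J1 = "\<lambda>t. 8 * r powr (- (1/4)) * (t - r) powr (1 - 7/8)"
  let ?J2 = "\<lambda>t. 8 * r powr (- (3/4)) * (t - r) powr (1 - 3/8)"
  let ?J3 = "\<lambda>t. 8 * r powr (- (7/8)) * (t - r) powr (1 - 7/8)"
  have pw: "((\<lambda>t. (t - r) powr c) \<longlongrightarrow> 0) (at_right r)" if "0 < c" for c
  proof -
    have 1: "((\<lambda>t. t - r) \<longlongrightarrow> 0) (at_right r)"
      using tendsto_diff[OF tendsto_ident_at tendsto_const[of r], of "r" "{r<..}"] by simp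
    have "\<forall>\<^sub>F t in at_right r. 0 \<le> t - r"
      using eventually_at_right_less[of r] by eventually_elim simp
    then have "((\<lambda>t. (t - r) powr c) \<longlongrightarrow> 0 powr c) (at_right r)"
      by (intro tendsto_powr'[OF 1 tendsto_const]) (use that in auto)
    then show ?thesis by simp
  qed
  have l1: "((\<lambda>t. 192 * M * ?J1 t) \<longlongrightarrow> 192 * M * (8 * r powr (- (1/4)) * 0)) (at_right r)"
    by (intro tendsto_mult tendsto_const pw) simp
  have l2: "((\<lambda>t. 32 * ?J2 t) \<longlongrightarrow> 32 * (8 * r powr (- (3/4)) * 0)) (at_right r)"
    by (intro tendsto_mult tendsto_const pw) simp
  have l3: "((\<lambda>t. 96 * (M + 30000 * N) * ?J3 t) \<longlongrightarrow> 96 * (M + 30000 * N) * (8 * r powr (- (7/8)) * 0)) (at_right r)"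
    by (intro tendsto_mult tendsto_const pw) simp
  have T0: "0 < T" using r by simp
  \<comment> \<open>The negative powers on the right are smallest at \<open>T\<close>, so comparing
    with their values at \<open>T\<close> covers all times up to \<open>T\<close>.\<close>
  have "\<forall>\<^sub>F t in at_right r. 192 * M * ?J1 t < 1/4 * T powr (- (1/8))"
    by (rule order_tendstoD(2)[OF l1]) (use T0 in simp)
  moreover have "\<forall>\<^sub>F t in at_right r. 32 * ?J2 t < 7500 * T powr (- (1/8))"
    by (rule order_tendstoD(2)[OF l2]) (use T0 in simp)
  moreover have "\<forall>\<^sub>F t in at_right r. 96 * (M + 30000 * N) * ?J3 t < 1/2 * T powr (- (3/4))"
    by (rule order_tendstoD(2)[OF l3]) (use T0 in simp)
  ultimately have "\<forall>\<^sub>F t in at_right r. 192 * M * ?J1 t < 1/4 * T powr (- (1/8)) \<and> 32 * ?J2 t < 7500 * T powr (- (1/8)) \<and>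
     96 * (M + 30000 * N) * ?J3 t < 1/2 * T powr (- (3/4))"
    by eventually_elim blast
  then obtain b where b: "r < b" "\<forall>t>r. t < b \<longrightarrow> 192 * M * ?J1 t < 1/4 * T powr (- (1/8)) \<and> 32 * ?J2 t < 7500 * T powr (- (1/8)) \<and>
     96 * (M + 30000 * N) * ?J3 t < 1/2 * T powr (- (3/4))"
    unfolding eventually_at_right_field by blast
  define R where "R = min T ((r + b) / 2)"
  have R: "r < R" "R \<le> T" "R < b" using r b(1) by (auto simp: R_def min_def)
  have "agree_on R u \<theta> v \<eta>"
  proof (rule agree_on_extend[OF cu cv fx agree R(2), where ?J1.0 = ?J1 and ?J2.0 = ?J2 and ?J3.0 = ?J3])
    fix t assume t: "t \<in> {r<..R}" "0 < t"
    then have tr: "r < t" "t \<le> T" and lt: "192 * M * ?J1 t < 1/4 * T powr (- (1/8))" "32 * ?J2 t < 7500 * T powr (- (1/8))"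
      "96 * (M + 30000 * N) * ?J3 t < 1/2 * T powr (- (3/4))"
      using b(2) R by auto
    have m: "T powr (- (1/8)) \<le> t powr (- (1/8))" "T powr (- (3/4)) \<le> t powr (- (3/4))"
      using tr t by (auto intro!: powr_mono2')
    show "tail_integral (7/8) (1/4) r t \<le> ennreal (?J1 t) \<and> 0 \<le> ?J1 t \<and> 192 * M * ?J1 t \<le> 1/4 * t powr (- (1/8))"
      using tail_integral_late_le[OF r(1) tr(1), of "7/8" "1/4"] lt(1) m(1) by auto
    show "tail_integral (3/8) (3/4) r t \<le> ennreal (?J2 t) \<and> 0 \<le> ?J2 t \<and> 32 * ?J2 t \<le> 7500 * t powr (- (1/8))"
      using tail_integral_late_le[OF r(1) tr(1), of "3/8" "3/4"] lt(2) m(1) by auto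
    show "tail_integral (7/8) (7/8) r t \<le> ennreal (?J3 t) \<and> 0 \<le> ?J3 t \<and> 96 * (M + 30000 * N) * ?J3 t \<le> 1/2 * t powr (- (3/4))"
      using tail_integral_late_le[OF r(1) tr(1), of "7/8" "7/8"] lt(3) m(2) by auto
  qed
  then show ?thesis using R by blast
qed

text \<open>The equation at time \<open>r\<close> involves the sources only at earlier times, so
  agreement before \<open>r\<close> fixes the value at \<open>r\<close>.\<close>

lemma agree_on_closed:
  assumes cu: "crit_bound T M N u \<theta>" and cv: "crit_bound T M N v \<eta>"
    and fx: "fixed_on u0 \<theta>0 T u \<theta>" "fixed_on u0 \<theta>0 T v \<eta>"
    and agree: "\<And>s. s < r \<Longrightarrow> agree_on s u \<theta> v \<eta>" and r: "0 < r" "r \<le> T"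
  shows "agree_on r u \<theta> v \<eta>"
proof -
  have rT: "r \<in> {0<..T}" using r by simp
  have eq: "AE x in lborel. u s x = v s x" "AE x in lborel. \<theta> s x = \<eta> s x" if "s \<in> {0<..<r}" for s
    using agree[of s] that unfolding agree_on_def by auto
  have s1: "Lp_bound 4 (\<lambda>x. u s x - v s x) (0 * s powr (- (1/8)))" if s: "s \<in> {0<..<r}" for s
  proof -
    have s': "s \<in> {0<..T}" using s r by auto
    have "AE x in lborel. u s x - v s x = 0" using eq(1)[OF s] by eventually_elim simp
    from Lp_bound_cong_AE[OF Lp_bound_zero[OF order_refl] _ this, of 4] show ?thesis
      using crit_boundD(5)[OF cu s', THEN Lp_boundD(1)] crit_boundD(5)[OF cv s', THEN Lp_boundD(1)] by simp
  qed
  have s2: "Lp_bound 2 (\<lambda>x. \<theta> s x - \<eta> s x) (0 * s powr (- (3/4)))" if s: "s \<in> {0<..<r}" for s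
  proof -
    have s': "s \<in> {0<..T}" using s r by auto
    have "AE x in lborel. \<theta> s x - \<eta> s x = 0" using eq(2)[OF s] by eventually_elim simp
    from Lp_bound_cong_AE[OF Lp_bound_zero[OF order_refl] _ this, of 2] show ?thesis
      using crit_boundD(6)[OF cu s', THEN Lp_boundD(1)] crit_boundD(6)[OF cv s', THEN Lp_boundD(1)] by simp
  qed
  note sd = step_diff_0[OF cu cv rT order_refl order_refl s1 s2]
  have "Lp_bound 4 (\<lambda>x. u r x - v r x) 0"
    by (rule Lp_bound_diff_fixed(1)[OF cu cv fx rT]) (use sd(1)[of u0] in simp)
  from Lp_bound_0_AE[OF this] have "AE x in lborel. u r x = v r x" by eventually_elim simp
  moreover have "Lp_bound 2 (\<lambda>x. \<theta> r x - \<eta> r x) 0"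
    by (rule Lp_bound_diff_fixed(2)[OF cu cv fx rT]) (use sd(2)[of \<theta>0] in simp)
  from Lp_bound_0_AE[OF this] have "AE x in lborel. \<theta> r x = \<eta> r x" by eventually_elim simp
  ultimately have "(AE x in lborel. u t x = v t x) \<and> (AE x in lborel. \<theta> t x = \<eta> t x)" if "t \<in> {0<..r}" for t
    using eq[of t] that by (cases "t = r") simp_all
  then show ?thesis
    unfolding agree_on_def by blast
qed

text \<open>A continuation argument: the agreement times contain an initial interval, their supremum
  is an agreement time, and agreement extends past any time before \<open>T\<close>. Smallness is
  required only of the constants \<open>M'\<close> and \<open>N'\<close> on the initial
  interval.\<close>

lemma fixed_point_unique:
  assumes cu: "crit_bound T M N u \<theta>" and cv: "crit_bound T M N v \<eta>"
    and fx: "fixed_on u0 \<theta>0 T u \<theta>" "fixed_on u0 \<theta>0 T v \<eta>"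
    and \<tau>: "0 < \<tau>" "\<tau> \<le> T" and cu': "crit_bound \<tau> M' N' u \<theta>" and cv': "crit_bound \<tau> M' N' v \<eta>"
    and small: "6144 * M' \<le> 1/4" "3072 * (M' + 30000 * N') \<le> 1/2"
  shows "agree_on T u \<theta> v \<eta>"
proof -
  define S where "S = {r. 0 < r \<and> r \<le> T \<and> agree_on r u \<theta> v \<eta>}"
  have "agree_on \<tau> u \<theta> v \<eta>"
    by (rule agree_on_start[OF cu' cv' fixed_on_subset[OF fx(1) \<tau>(2)] fixed_on_subset[OF fx(2) \<tau>(2)] small])
  then have \<tau>S: "\<tau> \<in> S" using \<tau> by (simp add: S_def)
  have bdd: "bdd_above S" by (rule bdd_aboveI[of _ T]) (simp add: S_def)
  define r where "r = Sup S"
  have "\<tau> \<le> r" unfolding r_def by (rule cSup_upper[OF \<tau>S bdd])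
  moreover have "r \<le> T" unfolding r_def by (rule cSup_least) (use \<tau>S in \<open>auto simp: S_def\<close>)
  ultimately have r: "0 < r" "r \<le> T" using \<tau>(1) by simp_all
  have "agree_on s u \<theta> v \<eta>" if "s < r" for s
  proof -
    have "S \<noteq> {}" using \<tau>S by blast
    then have "\<exists>r'\<in>S. s < r'" using that bdd by (simp add: r_def less_cSup_iff)
    then obtain r' where r': "r' \<in> S" "s < r'" by blast
    show ?thesis
      unfolding agree_on_def
    proof
      fix t assume "t \<in> {0<..s}"
      then have "t \<in> {0<..r'}" using r' by simp
      then show "(AE x in lborel. u t x = v t x) \<and> (AE x in lborel. \<theta> t x = \<eta> t x)"
        using r'(1) unfolding S_def agree_on_def by blast
    qed
  qed
  then have ar: "agree_on r u \<theta> v \<eta>"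
    by (rule agree_on_closed[OF cu cv fx _ r])
  have "r = T"
  proof (rule ccontr)
    assume "r \<noteq> T"
    then have "r < T" using r by simp
    from agree_on_continue[OF cu cv fx ar r(1) this] obtain R where R: "r < R" "R \<le> T" "agree_on R u \<theta> v \<eta>"
      by blast
    have "R \<in> S" unfolding S_def using R r(1) by simp
    from cSup_upper[OF this bdd] show False using R(1) by (simp add: r_def)
  qed
  then show ?thesis using ar by simp
qed

section \<open>Construction of the solution\<close>

definition lin_small :: "(real^3 \<Rightarrow> real^3) \<Rightarrow> (real^3 \<Rightarrow> real) \<Rightarrow> real \<Rightarrow> real \<Rightarrow> bool" where
  "lin_small u0 \<theta>0 \<alpha> \<tau> \<longleftrightarrow> (\<forall>t\<in>{0<..\<tau>}.
     Lp_bound 4 (conv (G t) u0) (\<alpha> * t powr (- (1/8))) \<and>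
     (\<forall>x. norm (conv (G t) u0 x) \<le> \<alpha> * t powr (- (1/2))) \<and>
     Lp_bound 2 (conv (G t) \<theta>0) (\<alpha> * t powr (- (3/4))) \<and>
     (\<forall>x. norm (conv (G t) \<theta>0 x) \<le> \<alpha> * t powr (- (3/2))))"

lemma lin_small_exists:
  assumes u0: "Lp_bound 3 u0 A3" and \<theta>0: "Lp_bound 1 \<theta>0 A1" and \<alpha>: "0 < \<alpha>"
  shows "\<exists>\<tau>>0. lin_small u0 \<theta>0 \<alpha> \<tau>"
proof -
  have p: "(3/2 * (1/3 - 1/4)) = (1/8 :: real)" "(3/2 * (1/1 - 1/2)) = (3/4 :: real)"
    "(3 / (2 * 3)) = (1/2 :: real)" "(3 / (2 * 1)) = (3/2 :: real)"
    by simp_all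
  obtain d1 where d1: "0 < d1" "\<forall>t. 0 < t \<and> t < d1 \<longrightarrow> Lp_bound 4 (conv (G t) u0) (\<alpha> * t powr (- (1/8)))"
    using heat_decay_small[OF u0 _ _ \<alpha>, of 4, unfolded p] by auto
  obtain d2 where d2: "0 < d2" "\<forall>t x. 0 < t \<and> t < d2 \<longrightarrow> norm (conv (G t) u0 x) \<le> \<alpha> * t powr (- (1/2))"
    using heat_decay_small_sup[OF u0 _ \<alpha>, unfolded p] by auto
  obtain d3 where d3: "0 < d3" "\<forall>t. 0 < t \<and> t < d3 \<longrightarrow> Lp_bound 2 (conv (G t) \<theta>0) (\<alpha> * t powr (- (3/4)))"
    using heat_decay_small[OF \<theta>0 _ _ \<alpha>, of 2, unfolded p] by auto
  obtain d4 where d4: "0 < d4" "\<forall>t x. 0 < t \<and> t < d4 \<longrightarrow> norm (conv (G t) \<theta>0 x) \<le> \<alpha> * t powr (- (3/2))"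
    using heat_decay_small_sup[OF \<theta>0 _ \<alpha>, unfolded p] by auto
  define \<tau> where "\<tau> = min (min d1 d2) (min d3 d4) / 2"
  have "0 < \<tau>" "\<tau> < d1" "\<tau> < d2" "\<tau> < d3" "\<tau> < d4"
    using d1(1) d2(1) d3(1) d4(1) by (auto simp: \<tau>_def min_def)
  moreover from this have "lin_small u0 \<theta>0 \<alpha> \<tau>"
    unfolding lin_small_def using d1(2) d2(2) d3(2) d4(2) by auto
  ultimately show ?thesis by blast
qed

text \<open>
  The \<open>L\<^sup>\<infinity>\<close> bound of the convection term needs some regularity of \<open>u\<close>: the Leray projector is only
  controlled in \<open>L\<^sup>2\<close>, so a derivative of the heat kernel has to be compensated by a Lipschitz bound in \<open>L\<^sup>4\<close>.
\<close>

definition controlled ::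
  "real \<Rightarrow> real \<Rightarrow> real \<Rightarrow> real \<Rightarrow> (real \<Rightarrow> real^3 \<Rightarrow> real^3) \<Rightarrow> (real \<Rightarrow> real^3 \<Rightarrow> real) \<Rightarrow> bool" where
  "controlled E A \<alpha> \<tau> u \<theta> \<longleftrightarrow> crit_bound \<tau> (30000 * \<alpha>) (2 * \<alpha>) u \<theta> \<and> (\<forall>t\<in>{0<..\<tau>}.
     (AE x in lborel. norm (u t x) \<le> 6000000 * (E + 1) * \<alpha> * t powr (- (1/2))) \<and>
     (AE x in lborel. norm (\<theta> t x) \<le> 2 * \<alpha> * t powr (- (3/2))) \<and>
     Lp_bound 1 (\<theta> t) (2 * A) \<and>
     (\<forall>h. Lp_bound 4 (\<lambda>x. u t (x + h) - u t x) (E * norm h * t powr (- (5/8)))))"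

lemma controlledD:
  assumes "controlled E A \<alpha> \<tau> u \<theta>"
  shows "crit_bound \<tau> (30000 * \<alpha>) (2 * \<alpha>) u \<theta>"
    "t \<in> {0<..\<tau>} \<Longrightarrow> AE x in lborel. norm (u t x) \<le> 6000000 * (E + 1) * \<alpha> * t powr (- (1/2))"
    "t \<in> {0<..\<tau>} \<Longrightarrow> AE x in lborel. norm (\<theta> t x) \<le> 2 * \<alpha> * t powr (- (3/2))"
    "t \<in> {0<..\<tau>} \<Longrightarrow> Lp_bound 1 (\<theta> t) (2 * A)"
    "t \<in> {0<..\<tau>} \<Longrightarrow> Lp_bound 4 (\<lambda>x. u t (x + h) - u t x) (E * norm h * t powr (- (5/8)))"
  using assms unfolding controlled_def by blast+

lemma AE_translate:
  assumes "AE x in lborel. P (x::'a::euclidean_space)"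
  shows "AE x in lborel. P (x + h)"
proof -
  obtain N where N: "N \<in> null_sets lborel" "{x. \<not> P x} \<subseteq> N"
    using assms unfolding eventually_ae_filter by auto
  have "AE x in distr lborel borel ((+) h). x \<notin> N"
    using AE_not_in[OF N(1)] by (simp only: lborel_distr_plus)
  then have "AE x in lborel. h + x \<notin> N"
    by (rule AE_distrD[rotated]) simp
  then show ?thesis
    by eventually_elim (use N(2) in \<open>auto simp: add.commute\<close>)
qed

lemma Lp_cont_uniform_limit:
  assumes p: "1 \<le> p" and u: "\<And>t. t \<in> S \<Longrightarrow> \<exists>N. Lp_bound p (u t) N"
    and lim: "\<And>t e. t \<in> S \<Longrightarrow> 0 < e \<Longrightarrow> \<exists>v d. 0 < d \<and> Lp_cont p S v \<and>
       (\<forall>s\<in>S. \<bar>s - t\<bar> < d \<longrightarrow> Lp_bound p (\<lambda>x. u s x - v s x) e)"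
  shows "Lp_cont p S u"
  unfolding Lp_cont_def
proof (intro ballI conjI allI impI)
  fix t assume t: "t \<in> S"
  show "\<exists>N. Lp_bound p (u t) N" by (rule u[OF t])
  fix e :: real assume e: "0 < e"
  then have e3: "0 < e / 3" by simp
  obtain v d where d: "0 < d" "Lp_cont p S v" "\<forall>s\<in>S. \<bar>s - t\<bar> < d \<longrightarrow> Lp_bound p (\<lambda>x. u s x - v s x) (e / 3)"
    using lim[OF t e3] by blast
  have "\<exists>d'>0. \<forall>s\<in>S. \<bar>s - t\<bar> < d' \<longrightarrow> Lp_bound p (\<lambda>x. v s x - v t x) (e / 3)"
    using d(2) t e3 unfolding Lp_cont_def by blast
  then obtain d' where d': "0 < d'" "\<forall>s\<in>S. \<bar>s - t\<bar> < d' \<longrightarrow> Lp_bound p (\<lambda>x. v s x - v t x) (e / 3)" by blast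
  have "Lp_bound p (\<lambda>x. u s x - u t x) e" if s: "s \<in> S" "\<bar>s - t\<bar> < min d d'" for s
  proof -
    have 1: "Lp_bound p (\<lambda>x. u s x - v s x) (e / 3)" using d(3) s by simp
    have 2: "Lp_bound p (\<lambda>x. v s x - v t x) (e / 3)" using d'(2) s by simp
    have 3: "Lp_bound p (\<lambda>x. u t x - v t x) (e / 3)" using d(1,3) t by simp
    have "Lp_bound p (\<lambda>x. (u s x - v s x) + (v s x - v t x) - (u t x - v t x)) (e / 3 + e / 3 + e / 3)"
      by (rule Lp_bound_diff[OF Lp_bound_add[OF 1 2 p] 3 p])
    then show ?thesis by simp
  qed
  then show "\<exists>d>0. \<forall>s\<in>S. \<bar>s - t\<bar> < d \<longrightarrow> Lp_bound p (\<lambda>x. u s x - u t x) e"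
    using d(1) d'(1) by (intro exI[of _ "min d d'"]) simp
qed

text \<open>The error has a weight singular at zero, so convergence is uniform only locally, here on
  times at least \<open>t / 2\<close>; this suffices for continuity.\<close>

lemma Lp_cont_geometric_limit:
  assumes f: "\<And>n. Lp_cont p {0<..\<tau>} (f n)" and p: "1 \<le> p" and b: "0 \<le> b" and K: "0 \<le> K"
    and d: "\<And>n t. t \<in> {0<..\<tau>} \<Longrightarrow> Lp_bound p (\<lambda>x. u t x - f n t x) (K / 2 ^ n * t powr (- b))"
  shows "Lp_cont p {0<..\<tau>} u"
proof (rule Lp_cont_uniform_limit[OF p])
  fix t assume t: "t \<in> {0<..\<tau>}"
  obtain N where N: "Lp_bound p (f 0 t) N" using Lp_contD[OF f t] .
  have "Lp_bound p (\<lambda>x. (u t x - f 0 t x) + f 0 t x) (K / 2 ^ 0 * t powr (- b) + N)"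
    by (rule Lp_bound_add[OF d[OF t] N p])
  then show "\<exists>N. Lp_bound p (u t) N" by auto
  fix e :: real assume e: "0 < e"
  have "(\<lambda>n. K * (1/2) ^ n * (t / 2) powr (- b)) \<longlonglongrightarrow> K * 0 * (t / 2) powr (- b)"
    by (intro tendsto_mult tendsto_const LIMSEQ_realpow_zero) auto
  then have "\<forall>\<^sub>F n in sequentially. K * (1/2) ^ n * (t / 2) powr (- b) < e"
    by (rule order_tendstoD(2)) (use e in simp)
  then obtain n where n: "K * (1/2) ^ n * (t / 2) powr (- b) < e"
    using eventually_happens sequentially_bot by blast
  have "Lp_bound p (\<lambda>x. u s x - f n s x) e" if s: "s \<in> {0<..\<tau>}" "\<bar>s - t\<bar> < t / 2" for s
  proof (rule Lp_bound_mono[OF d[OF s(1)]])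
    have "t / 2 \<le> s" using s(2) abs_ge_minus_self[of "s - t"] by linarith
    then have "s powr (- b) \<le> (t / 2) powr (- b)" using t b by (intro powr_mono2') auto
    then have "K / 2 ^ n * s powr (- b) \<le> K / 2 ^ n * (t / 2) powr (- b)"
      using K by (intro mult_left_mono) auto
    then show "K / 2 ^ n * s powr (- b) \<le> e" using n by (simp add: power_divide)
  qed (use p in simp)
  then show "\<exists>v d. 0 < d \<and> Lp_cont p {0<..\<tau>} v \<and> (\<forall>s\<in>{0<..\<tau>}. \<bar>s - t\<bar> < d \<longrightarrow> Lp_bound p (\<lambda>x. u s x - v s x) e)"
    using f[of n] t by (intro exI[of _ "f n"] exI[of _ "t / 2"]) auto
qed

text \<open>The limit is chosen separately for each time, and the value at time zero is prescribed
  so that the data are attained.\<close>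

lemma Riesz_Fischer_family:
  fixes f :: "nat \<Rightarrow> real \<Rightarrow> real^3 \<Rightarrow> 'b::euclidean_space"
  assumes f: "\<And>n t. t \<in> {0<..T} \<Longrightarrow> f n t \<in> borel_measurable borel"
    and d: "\<And>n t. t \<in> {0<..T} \<Longrightarrow> Lp_bound p (\<lambda>x. f (Suc n) t x - f n t x) (K t / 2 ^ n)"
    and K: "\<And>t. 0 \<le> K t" and p: "1 \<le> p"
  shows "\<exists>u. u 0 = v \<and> (\<forall>t\<in>{0<..T}. u t \<in> borel_measurable borel \<and> (AE x in lborel. (\<lambda>n. f n t x) \<longlonglongrightarrow> u t x) \<and>
      (\<forall>n. Lp_bound p (\<lambda>x. u t x - f n t x) (2 * K t / 2 ^ n)))"
proof -
  have "\<forall>t. \<exists>w. (t = 0 \<longrightarrow> w = v) \<and> (t \<in> {0<..T} \<longrightarrow> w \<in> borel_measurable borel \<and> (AE x in lborel. (\<lambda>n. f n t x) \<longlonglongrightarrow> w x) \<and>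
      (\<forall>n. Lp_bound p (\<lambda>x. w x - f n t x) (2 * K t / 2 ^ n)))"
  proof
    fix t
    show "\<exists>w. (t = 0 \<longrightarrow> w = v) \<and> (t \<in> {0<..T} \<longrightarrow> w \<in> borel_measurable borel \<and> (AE x in lborel. (\<lambda>n. f n t x) \<longlonglongrightarrow> w x) \<and>
      (\<forall>n. Lp_bound p (\<lambda>x. w x - f n t x) (2 * K t / 2 ^ n)))"
    proof (cases "t \<in> {0<..T}")
      case True
      show ?thesis
      proof (rule Riesz_Fischer[OF f[OF True] d[OF True] p K])
        fix w assume "w \<in> borel_measurable borel" "AE x in lborel. (\<lambda>n. f n t x) \<longlonglongrightarrow> w x"
          "\<And>n. Lp_bound p (\<lambda>x. w x - f n t x) (2 * K t / 2 ^ n)"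
        then show ?thesis using True by (intro exI[of _ w]) auto
      qed
    qed auto
  qed
  from choice[OF this] show ?thesis by blast
qed

context
  fixes u0 :: "real^3 \<Rightarrow> real^3" and \<theta>0 :: "real^3 \<Rightarrow> real" and A3 A1 E :: real
  assumes u0: "Lp_bound 3 u0 A3" and \<theta>0: "Lp_bound 1 \<theta>0 A1" and E: "E = 64 * A3 + 1"
begin

lemma A_nonneg: "0 \<le> A3" "0 \<le> A1" "1 \<le> E"
  using Lp_boundD(2)[OF u0] Lp_boundD(2)[OF \<theta>0] E by auto

text \<open>The shift on the kernel costs 1/2 and the passage from L^3 to L^4 costs 1/8, which
  explains the weight 5/8 in the Lipschitz bounds.\<close>

lemma lin_lip:
  assumes t: "0 < t"
  shows "Lp_bound 4 (\<lambda>x. conv (G t) u0 (x + h) - conv (G t) u0 x) (32 * A3 * norm h * t powr (- (5/8)))"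
proof -
  have eq: "conv (\<lambda>x. G t (x + h) - G t x) u0 = (\<lambda>x. conv (G t) u0 (x + h) - conv (G t) u0 x)"
    by (rule ext, subst conv_diff_left[OF kernel_bound_translate[OF kernel_bound_heat_kernel[OF t]] kernel_bound_heat_kernel[OF t] u0])
      (auto simp: conv_translate_left)
  have 1: "Lp_bound 4 (conv (\<lambda>x. G t (x + h) - G t x) u0)
      (32 * norm h * t powr (- (1/2)) * t powr (- 3/2 * (1/3 - 1/4)) * A3)"
    by (rule Lp_bound_conv[OF heat_shift_kernel[OF t] u0]) auto
  have "t powr (- (1/2)) * t powr (- 3/2 * (1/3 - 1/4)) = t powr (- (5/8))"
    by (simp add: powr_add[symmetric])
  then have "32 * norm h * t powr (- (1/2)) * t powr (- 3/2 * (1/3 - 1/4)) * A3 = 32 * A3 * norm h * t powr (- (5/8))"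
    by (simp only: mult.assoc mult.commute[of _ A3] mult.left_commute[of A3])
  with 1 show ?thesis by (simp only: eq)
qed

lemma step_cont:
  assumes cb: "crit_bound \<tau> M N u \<theta>"
  shows "Lp_cont 4 {0<..\<tau>} (step_u u0 u \<theta>)" "Lp_cont 2 {0<..\<tau>} (step_\<theta> \<theta>0 u \<theta>)"
proof -
  have 1: "Lp_cont 4 {0<..\<tau>} (\<lambda>t. conv (G t) u0)"
    by (rule Lp_cont_subset[OF conv_Lp_cont[OF heat_like_heat_kernel u0]]) auto
  have 2: "Lp_cont 2 {0<..\<tau>} (\<lambda>t. conv (G t) \<theta>0)"
    by (rule Lp_cont_subset[OF conv_Lp_cont[OF heat_like_heat_kernel \<theta>0]]) auto
  have "Lp_cont 4 {0<..\<tau>} (\<lambda>t x. conv (G t) u0 x - convection u t x + buoyancy \<theta> t x)"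
    by (rule Lp_cont_add[OF Lp_cont_diff[OF 1 convection_cont(1)[OF cb]] buoyancy_cont(1)[OF cb]]) auto
  then show "Lp_cont 4 {0<..\<tau>} (step_u u0 u \<theta>)" by (simp add: step_u_def[abs_def])
  have "Lp_cont 2 {0<..\<tau>} (\<lambda>t x. conv (G t) \<theta>0 x - transport \<theta> u t x)"
    by (rule Lp_cont_diff[OF 2 transport_cont[OF cb]]) auto
  then show "Lp_cont 2 {0<..\<tau>} (step_\<theta> \<theta>0 u \<theta>)" by (simp add: step_\<theta>_def[abs_def])
qed

text \<open>The tightest requirement is the L^1 bound of the temperature, where the factor 3072 *
  6000000 * 2, about 3.7 * 10^10, has to be beaten. \<open>E + 1\<close> enters because the sup
  bound of the velocity is proportional to \<open>(E + 1) * \<alpha>\<close>.\<close>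

definition small :: "real \<Rightarrow> bool" where
  "small \<alpha> \<longleftrightarrow> 0 \<le> \<alpha> \<and> \<alpha> * (E + 1) \<le> 1/100000000000"

lemma smallD:
  assumes "small \<alpha>"
  shows "0 \<le> \<alpha>" "\<alpha> \<le> 1/100000000000" "\<alpha> * E \<le> 1/100000000000" "0 \<le> \<alpha> * E"
    "\<alpha> * \<alpha> * 100000000000 \<le> \<alpha>"
proof -
  show 0: "0 \<le> \<alpha>" using assms by (simp add: small_def)
  show 1: "0 \<le> \<alpha> * E" using 0 A_nonneg by simp
  have "\<alpha> * E + \<alpha> \<le> 1/100000000000" using assms by (simp add: small_def algebra_simps)
  then show 2: "\<alpha> \<le> 1/100000000000" and "\<alpha> * E \<le> 1/100000000000" using 0 1 by simp_all
  show "\<alpha> * \<alpha> * 100000000000 \<le> \<alpha>" using mult_left_mono[OF 2 0] by simp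
qed

lemma controlled_zero:
  assumes "small \<alpha>"
  shows "controlled E A1 \<alpha> \<tau> (\<lambda>t x. 0) (\<lambda>t x. 0)"
  unfolding controlled_def crit_bound_def
  using smallD[OF assms] A_nonneg by (auto intro!: Lp_cont_zero Lp_bound_zero mult_nonneg_nonneg)

text \<open>The constants of \<open>controlled\<close> close up: 30000 exceeds 1 + 2 * 1024 plus a
  quadratic remainder, and 6000000 exceeds the convection factor 192 * 30000. \<open>E\<close> and
  \<open>A1\<close> do not shrink with \<alpha>; their nonlinear corrections do, so the bounds
  \<open>E\<close> and \<open>2 * A1\<close> reproduce themselves.\<close>

lemma controlled_step:
  assumes c: "controlled E A1 \<alpha> \<tau> u \<theta>" and l: "lin_small u0 \<theta>0 \<alpha> \<tau>" and s: "small \<alpha>"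
  shows "controlled E A1 \<alpha> \<tau> (step_u u0 u \<theta>) (step_\<theta> \<theta>0 u \<theta>)"
proof -
  note cb = controlledD(1)[OF c] and s' = smallD[OF s]
  note lip = controlledD(5)[OF c]
  have E0: "0 \<le> E" using A_nonneg by simp
  have u4: "Lp_bound 4 (step_u u0 u \<theta> t) (30000 * \<alpha> * t powr (- (1/8)))"
    and us: "norm (step_u u0 u \<theta> t x) \<le> 6000000 * (E + 1) * \<alpha> * t powr (- (1/2))"
    and ul: "Lp_bound 4 (\<lambda>x. step_u u0 u \<theta> t (x + h) - step_u u0 u \<theta> t x) (E * norm h * t powr (- (5/8)))"
    and t2: "Lp_bound 2 (step_\<theta> \<theta>0 u \<theta> t) (2 * \<alpha> * t powr (- (3/4)))"
    and ts: "norm (step_\<theta> \<theta>0 u \<theta> t x) \<le> 2 * \<alpha> * t powr (- (3/2))"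
    and t1: "Lp_bound 1 (step_\<theta> \<theta>0 u \<theta> t) (2 * A1)"
    if t: "t \<in> {0<..\<tau>}" for t x h
  proof -
    have t0: "0 < t" using t by simp
    note L = l[unfolded lin_small_def, rule_format, OF t]
    have "Lp_bound 4 (\<lambda>x. conv (G t) u0 x - convection u t x + buoyancy \<theta> t x)
      (\<alpha> * t powr (- (1/8)) + 3072 * (30000 * \<alpha> * (30000 * \<alpha>)) * t powr (- (1/8)) + 1024 * (2 * \<alpha>) * t powr (- (1/8)))"
      by (rule Lp_bound_add[OF Lp_bound_diff[OF L[THEN conjunct1] convection_bound(1)[OF cb t]] buoyancy_terms(2)[OF cb t]]) auto
    then have 1: "Lp_bound 4 (step_u u0 u \<theta> t) ((\<alpha> + 3072 * (30000 * \<alpha> * (30000 * \<alpha>)) + 1024 * (2 * \<alpha>)) * t powr (- (1/8)))"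
      by (simp only: distrib_right step_u_def[abs_def])
    show "Lp_bound 4 (step_u u0 u \<theta> t) (30000 * \<alpha> * t powr (- (1/8)))"
      by (rule Lp_bound_mono[OF 1]) (use s' in \<open>auto intro!: mult_right_mono\<close>)
    have "norm (conv (G t) u0 x - convection u t x + buoyancy \<theta> t x) \<le>
        norm (conv (G t) u0 x) + norm (convection u t x) + norm (buoyancy \<theta> t x)"
      by (intro norm_triangle_le add_mono norm_triangle_ineq4 order_refl)
    also have "\<dots> \<le> \<alpha> * t powr (- (1/2)) + 192 * (30000 * \<alpha> * E) * t powr (- (1/2)) + 1024 * (2 * \<alpha>) * t powr (- (1/2))"
      by (intro add_mono convection_sup[OF cb E0 lip t] buoyancy_sup[OF cb t]) (use L in auto)
    also have "\<dots> = (\<alpha> + 192 * (30000 * \<alpha> * E) + 1024 * (2 * \<alpha>)) * t powr (- (1/2))"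
      by (simp only: distrib_right)
    also have "\<dots> \<le> 6000000 * (E + 1) * \<alpha> * t powr (- (1/2))"
      by (rule mult_right_mono) (use s' in \<open>auto simp: algebra_simps\<close>)
    finally show "norm (step_u u0 u \<theta> t x) \<le> 6000000 * (E + 1) * \<alpha> * t powr (- (1/2))"
      by (simp only: step_u_def)
    have "Lp_bound 4 (\<lambda>x. (conv (G t) u0 (x + h) - conv (G t) u0 x) - (convection u t (x + h) - convection u t x)
        + (buoyancy \<theta> t (x + h) - buoyancy \<theta> t x))
      (32 * A3 * norm h * t powr (- (5/8)) + 6144 * (30000 * \<alpha> * E) * norm h * t powr (- (5/8)) + 1024 * (2 * \<alpha>) * norm h * t powr (- (5/8)))"
      by (rule Lp_bound_add[OF Lp_bound_diff[OF lin_lip[OF t0] convection_lip[OF cb E0 lip t]] buoyancy_lip[OF cb t]]) auto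
    then have 2: "Lp_bound 4 (\<lambda>x. step_u u0 u \<theta> t (x + h) - step_u u0 u \<theta> t x)
        ((32 * A3 + 6144 * (30000 * \<alpha> * E) + 1024 * (2 * \<alpha>)) * (norm h * t powr (- (5/8))))"
      by (simp add: step_u_def algebra_simps)
    \<comment> \<open>This inequality dictates \<open>E\<close>: the linear part takes
      \<open>32 * A3\<close>, and the summand 1 leaves room for terms small with \<alpha>.\<close>
    have "32 * A3 + 6144 * (30000 * \<alpha> * E) + 1024 * (2 * \<alpha>) \<le> E"
      using s' A_nonneg(1) E by simp
    then have "(32 * A3 + 6144 * (30000 * \<alpha> * E) + 1024 * (2 * \<alpha>)) * (norm h * t powr (- (5/8))) \<le> E * (norm h * t powr (- (5/8)))"
      by (rule mult_right_mono) simp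
    from Lp_bound_mono[OF 2 this]
    show "Lp_bound 4 (\<lambda>x. step_u u0 u \<theta> t (x + h) - step_u u0 u \<theta> t x) (E * norm h * t powr (- (5/8)))"
      by (simp add: mult.assoc)
    have "Lp_bound 2 (\<lambda>x. conv (G t) \<theta>0 x - transport \<theta> u t x)
        (\<alpha> * t powr (- (3/4)) + 3072 * (2 * \<alpha> * (30000 * \<alpha>)) * t powr (- (3/4)))"
      by (rule Lp_bound_diff[OF _ transport_bound[OF cb t]]) (use L in auto)
    then have 3: "Lp_bound 2 (step_\<theta> \<theta>0 u \<theta> t) ((\<alpha> + 3072 * (2 * \<alpha> * (30000 * \<alpha>))) * t powr (- (3/4)))"
      by (simp only: distrib_right step_\<theta>_def[abs_def])
    show "Lp_bound 2 (step_\<theta> \<theta>0 u \<theta> t) (2 * \<alpha> * t powr (- (3/4)))"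
      by (rule Lp_bound_mono[OF 3]) (use s' in \<open>auto intro!: mult_right_mono\<close>)
    have "norm (conv (G t) \<theta>0 x - transport \<theta> u t x) \<le> norm (conv (G t) \<theta>0 x) + norm (transport \<theta> u t x)"
      by (rule norm_triangle_ineq4)
    also have "\<dots> \<le> \<alpha> * t powr (- (3/2)) + 6144 * ((2 * \<alpha> + 2 * \<alpha>) * (30000 * \<alpha>)) * t powr (- (3/2))"
      by (intro add_mono transport_sup[OF cb t controlledD(3)[OF c]]) (use L s' in auto)
    also have "\<dots> = (\<alpha> + 6144 * ((2 * \<alpha> + 2 * \<alpha>) * (30000 * \<alpha>))) * t powr (- (3/2))"
      by (simp only: distrib_right)
    also have "\<dots> \<le> 2 * \<alpha> * t powr (- (3/2))"
      by (rule mult_right_mono) (use s' in auto)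
    finally show "norm (step_\<theta> \<theta>0 u \<theta> t x) \<le> 2 * \<alpha> * t powr (- (3/2))"
      by (simp only: step_\<theta>_def)
    have B0: "0 \<le> 6000000 * (E + 1) * \<alpha>" using s' E0 by simp
    have A: "Lp_bound 1 (conv (G t) \<theta>0) (t powr (- 3/2 * (1/1 - 1/1)) * A1)"
      by (rule Lp_bound_conv_heat_kernel[OF t0 \<theta>0]) auto
    have "Lp_bound 1 (\<lambda>x. conv (G t) \<theta>0 x - transport \<theta> u t x)
        (t powr (- 3/2 * (1/1 - 1/1)) * A1 + 3072 * (6000000 * (E + 1) * \<alpha> * (2 * A1)))"
      by (rule Lp_bound_diff[OF A transport_L1(1)[OF cb controlledD(4)[OF c] _ controlledD(2)[OF c] B0 t]]) (use A_nonneg in auto)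
    then have 4: "Lp_bound 1 (step_\<theta> \<theta>0 u \<theta> t) (A1 + 3072 * (6000000 * (E + 1) * \<alpha> * (2 * A1)))"
      using t0 by (simp add: step_\<theta>_def[abs_def])
    \<comment> \<open>Here the numerical size of \<open>small\<close> is really used; the left side
      is about 0.74 in the worst case.\<close>
    have "3072 * 6000000 * (\<alpha> * E + \<alpha>) * 2 \<le> 1" using s' by simp
    then have "3072 * 6000000 * (\<alpha> * E + \<alpha>) * 2 * A1 \<le> 1 * A1"
      by (rule mult_right_mono) (rule A_nonneg)
    then have le4: "A1 + 3072 * (6000000 * (E + 1) * \<alpha> * (2 * A1)) \<le> 2 * A1"
      by (simp add: algebra_simps)
    show "Lp_bound 1 (step_\<theta> \<theta>0 u \<theta> t) (2 * A1)"
      by (rule Lp_bound_mono[OF 4 le4]) simp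
  qed
  show ?thesis
    unfolding controlled_def crit_bound_def
    using step_cont[OF cb] s'(1) u4 us ul t2 ts t1 by (simp add: AE_I2)
qed

text \<open>All bounds pass to an almost everywhere limit, the sup bounds pointwise and the integral
  bounds by Fatou. Continuity in time does not, and has to come from geometric convergence.\<close>

lemma controlled_limit:
  assumes c: "\<And>n. controlled E A1 \<alpha> \<tau> (f n) (g n)"
    and m: "\<And>t. t \<in> {0<..\<tau>} \<Longrightarrow> u t \<in> borel_measurable borel" "\<And>t. t \<in> {0<..\<tau>} \<Longrightarrow> \<theta> t \<in> borel_measurable borel"
    and lim: "\<And>t. t \<in> {0<..\<tau>} \<Longrightarrow> AE x in lborel. (\<lambda>n. f n t x) \<longlonglongrightarrow> u t x" "\<And>t. t \<in> {0<..\<tau>} \<Longrightarrow> AE x in lborel. (\<lambda>n. g n t x) \<longlonglongrightarrow> \<theta> t x"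
    and cont: "Lp_cont 4 {0<..\<tau>} u" "Lp_cont 2 {0<..\<tau>} \<theta>"
  shows "controlled E A1 \<alpha> \<tau> u \<theta>"
proof -
  note cb = controlledD(1)[OF c]
  have u4: "Lp_bound 4 (u t) (30000 * \<alpha> * t powr (- (1/8)))"
    and us: "AE x in lborel. norm (u t x) \<le> 6000000 * (E + 1) * \<alpha> * t powr (- (1/2))"
    and ul: "Lp_bound 4 (\<lambda>x. u t (x + h) - u t x) (E * norm h * t powr (- (5/8)))"
    and t2: "Lp_bound 2 (\<theta> t) (2 * \<alpha> * t powr (- (3/4)))"
    and ts: "AE x in lborel. norm (\<theta> t x) \<le> 2 * \<alpha> * t powr (- (3/2))"
    and t1: "Lp_bound 1 (\<theta> t) (2 * A1)"
    if t: "t \<in> {0<..\<tau>}" for t h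
  proof -
    note [measurable] = m[OF t]
    show "Lp_bound 4 (u t) (30000 * \<alpha> * t powr (- (1/8)))"
      by (rule Lp_bound_Fatou[OF crit_boundD(5)[OF cb t] m(1)[OF t] lim(1)[OF t]]) simp
    show "Lp_bound 2 (\<theta> t) (2 * \<alpha> * t powr (- (3/4)))"
      by (rule Lp_bound_Fatou[OF crit_boundD(6)[OF cb t] m(2)[OF t] lim(2)[OF t]]) simp
    show "Lp_bound 1 (\<theta> t) (2 * A1)"
      by (rule Lp_bound_Fatou[OF controlledD(4)[OF c t] m(2)[OF t] lim(2)[OF t]]) simp
    have sh: "AE x in lborel. (\<lambda>n. f n t (x + h) - f n t x) \<longlonglongrightarrow> u t (x + h) - u t x"
      using AE_translate[OF lim(1)[OF t], of h] lim(1)[OF t] by eventually_elim (rule tendsto_diff)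
    show "Lp_bound 4 (\<lambda>x. u t (x + h) - u t x) (E * norm h * t powr (- (5/8)))"
      by (rule Lp_bound_Fatou[OF controlledD(5)[OF c t] _ sh]) simp_all
    have "AE x in lborel. \<forall>n. norm (f n t x) \<le> 6000000 * (E + 1) * \<alpha> * t powr (- (1/2))"
      unfolding AE_all_countable using controlledD(2)[OF c t] by blast
    then show "AE x in lborel. norm (u t x) \<le> 6000000 * (E + 1) * \<alpha> * t powr (- (1/2))"
      using lim(1)[OF t] by eventually_elim (rule LIMSEQ_le_const2[OF tendsto_norm], blast+)
    have "AE x in lborel. \<forall>n. norm (g n t x) \<le> 2 * \<alpha> * t powr (- (3/2))"
      unfolding AE_all_countable using controlledD(3)[OF c t] by blast
    then show "AE x in lborel. norm (\<theta> t x) \<le> 2 * \<alpha> * t powr (- (3/2))"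
      using lim(2)[OF t] by eventually_elim (rule LIMSEQ_le_const2[OF tendsto_norm], blast+)
  qed
  show ?thesis
    unfolding controlled_def crit_bound_def
    using crit_boundD(1,2)[OF cb] cont u4 us ul t2 ts t1 by simp
qed

text \<open>The iteration contains neither \<alpha> nor a time horizon, so the same sequence obeys
  the bounds of every admissible pair of smallness parameter and time interval.\<close>

primrec picard :: "nat \<Rightarrow> (real \<Rightarrow> real^3 \<Rightarrow> real^3) \<times> (real \<Rightarrow> real^3 \<Rightarrow> real)" where
  "picard 0 = (\<lambda>t x. 0, \<lambda>t x. 0)"
| "picard (Suc n) = (step_u u0 (fst (picard n)) (snd (picard n)), step_\<theta> \<theta>0 (fst (picard n)) (snd (picard n)))"

lemma controlled_picard:
  assumes "lin_small u0 \<theta>0 \<alpha> \<tau>" "small \<alpha>"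
  shows "controlled E A1 \<alpha> \<tau> (fst (picard n)) (snd (picard n))"
proof (induction n)
  case 0
  then show ?case using controlled_zero[OF assms(2)] by simp
next
  case (Suc n)
  then show ?case using controlled_step[OF _ assms] by simp
qed

text \<open>If the temperatures differ by \<open>d\<close> and the velocities by
  \<open>30000 * d\<close>, buoyancy contributes only \<open>1024 * d\<close> to the next velocity
  difference, well below the allowed half \<open>15000 * d\<close>; all other terms carry
  \<alpha>.\<close>

lemma contraction_factors:
  assumes s: "small \<alpha>" and d: "0 \<le> d"
  shows "6144 * (30000 * \<alpha> * (30000 * d)) + 1024 * d \<le> 15000 * d"
    "3072 * (d * (30000 * \<alpha>) + 2 * \<alpha> * (30000 * d)) \<le> d / 2"
proof -
  have "\<alpha> * d \<le> 1/100000000000 * d" using smallD(2)[OF s] d by (rule mult_right_mono)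
  then show "6144 * (30000 * \<alpha> * (30000 * d)) + 1024 * d \<le> 15000 * d"
    "3072 * (d * (30000 * \<alpha>) + 2 * \<alpha> * (30000 * d)) \<le> d / 2"
    using d by (simp_all add: algebra_simps)
qed

lemma picard_diff:
  assumes l: "lin_small u0 \<theta>0 \<alpha> \<tau>" and s: "small \<alpha>"
  shows "\<forall>t\<in>{0<..\<tau>}.
    Lp_bound 4 (\<lambda>x. fst (picard (Suc n)) t x - fst (picard n) t x) (30000 * (2 * \<alpha> / 2 ^ n) * t powr (- (1/8))) \<and>
    Lp_bound 2 (\<lambda>x. snd (picard (Suc n)) t x - snd (picard n) t x) (2 * \<alpha> / 2 ^ n * t powr (- (3/4)))"
proof (induction n)
  case 0
  note c = controlledD(1)[OF controlled_picard[OF l s, of 1]]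
  have "Lp_bound 4 (fst (picard 1) t) (30000 * (2 * \<alpha>) * t powr (- (1/8)))" if t: "t \<in> {0<..\<tau>}" for t
    by (rule Lp_bound_mono[OF crit_boundD(5)[OF c t]]) (use smallD(1)[OF s] in \<open>auto intro!: mult_right_mono\<close>)
  then show ?case using crit_boundD(6)[OF c] by simp
next
  case (Suc n)
  define d where "d = 2 * \<alpha> / 2 ^ n"
  have d0: "0 \<le> d" using smallD(1)[OF s] by (simp add: d_def)
  have dS: "2 * \<alpha> / 2 ^ Suc n = d / 2" by (simp add: d_def)
  note c = controlledD(1)[OF controlled_picard[OF l s]]
  note k = contraction_factors[OF s d0]
  show ?case
  proof
    fix t assume t: "t \<in> {0<..\<tau>}"
    have IH: "Lp_bound 4 (\<lambda>x. fst (picard (Suc n)) r x - fst (picard n) r x) (30000 * d * r powr (- (1/8)))"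
      "Lp_bound 2 (\<lambda>x. snd (picard (Suc n)) r x - snd (picard n) r x) (d * r powr (- (3/4)))" if "r \<in> {0<..<t}" for r
      using Suc that t by (auto simp: d_def)
    have d30: "0 \<le> 30000 * d" using d0 by simp
    note sd = step_diff_0[OF c c t d30 d0 IH]
    have 1: "Lp_bound 4 (\<lambda>x. fst (picard (Suc (Suc n))) t x - fst (picard (Suc n)) t x)
        ((6144 * (30000 * \<alpha> * (30000 * d)) + 1024 * d) * t powr (- (1/8)))"
      unfolding picard.simps(2)[of "Suc n"] fst_conv using sd(1)[of u0] by (simp only: picard.simps fst_conv)
    have 2: "Lp_bound 2 (\<lambda>x. snd (picard (Suc (Suc n))) t x - snd (picard (Suc n)) t x)
        (3072 * (d * (30000 * \<alpha>) + 2 * \<alpha> * (30000 * d)) * t powr (- (3/4)))"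
      unfolding picard.simps(2)[of "Suc n"] snd_conv using sd(2)[of \<theta>0] by (simp only: picard.simps snd_conv)
    have 3: "(6144 * (30000 * \<alpha> * (30000 * d)) + 1024 * d) * t powr (- (1/8)) \<le> 30000 * (d / 2) * t powr (- (1/8))"
      by (rule mult_right_mono) (use k(1) in simp_all)
    have 4: "3072 * (d * (30000 * \<alpha>) + 2 * \<alpha> * (30000 * d)) * t powr (- (3/4)) \<le> d / 2 * t powr (- (3/4))"
      by (rule mult_right_mono) (use k(2) in simp_all)
    show "Lp_bound 4 (\<lambda>x. fst (picard (Suc (Suc n))) t x - fst (picard (Suc n)) t x) (30000 * (2 * \<alpha> / 2 ^ Suc n) * t powr (- (1/8))) \<and>
      Lp_bound 2 (\<lambda>x. snd (picard (Suc (Suc n))) t x - snd (picard (Suc n)) t x) (2 * \<alpha> / 2 ^ Suc n * t powr (- (3/4)))"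
      unfolding dS using Lp_bound_mono[OF 1 3] Lp_bound_mono[OF 2 4] by simp
  qed
qed

lemma picard_limit:
  assumes l: "lin_small u0 \<theta>0 \<alpha> T" and s: "small \<alpha>"
  shows "\<exists>u. u 0 = u0 \<and> (\<forall>t\<in>{0<..T}. u t \<in> borel_measurable borel \<and> (AE x in lborel. (\<lambda>n. fst (picard n) t x) \<longlonglongrightarrow> u t x) \<and>
      (\<forall>n. Lp_bound 4 (\<lambda>x. u t x - fst (picard n) t x) (2 * (60000 * \<alpha> * t powr (- (1/8))) / 2 ^ n)))" (is ?u)
    and "\<exists>\<theta>. \<theta> 0 = \<theta>0 \<and> (\<forall>t\<in>{0<..T}. \<theta> t \<in> borel_measurable borel \<and> (AE x in lborel. (\<lambda>n. snd (picard n) t x) \<longlonglongrightarrow> \<theta> t x) \<and>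
      (\<forall>n. Lp_bound 2 (\<lambda>x. \<theta> t x - snd (picard n) t x) (2 * (2 * \<alpha> * t powr (- (3/4))) / 2 ^ n)))" (is ?\<theta>)
proof -
  note c = controlledD(1)[OF controlled_picard[OF l s]]
  have a0: "0 \<le> \<alpha>" by (rule smallD(1)[OF s])
  have d: "Lp_bound 4 (\<lambda>x. fst (picard (Suc n)) t x - fst (picard n) t x) (60000 * \<alpha> * t powr (- (1/8)) / 2 ^ n)"
    "Lp_bound 2 (\<lambda>x. snd (picard (Suc n)) t x - snd (picard n) t x) (2 * \<alpha> * t powr (- (3/4)) / 2 ^ n)"
    if "t \<in> {0<..T}" for n t
    using picard_diff[OF l s, of n] that by (simp_all del: picard.simps)
  show ?u by (rule Riesz_Fischer_family[OF Lp_boundD(1)[OF crit_boundD(5)[OF c]] d(1)]) (use a0 in simp_all)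
  show ?\<theta> by (rule Riesz_Fischer_family[OF Lp_boundD(1)[OF crit_boundD(6)[OF c]] d(2)]) (use a0 in simp_all)
qed

text \<open>The final clause is what yields the limits at time zero: the bounds of the iterates hold
  for each pair \<beta>, \<tau> with the same sequence, hence for its limit. The fixed point
  equation follows from the stability of one step.\<close>

lemma fixed_point_exists:
  assumes l: "lin_small u0 \<theta>0 \<alpha> T" and s: "small \<alpha>"
  shows "\<exists>u \<theta>. fixed_on u0 \<theta>0 T u \<theta> \<and> u 0 = u0 \<and> \<theta> 0 = \<theta>0 \<and>
    (\<forall>\<beta> \<tau>. \<tau> \<le> T \<longrightarrow> small \<beta> \<longrightarrow> lin_small u0 \<theta>0 \<beta> \<tau> \<longrightarrow> controlled E A1 \<beta> \<tau> u \<theta>)"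
proof -
  have a0: "0 \<le> \<alpha>" by (rule smallD(1)[OF s])
  obtain u where u: "u 0 = u0" and H1: "\<forall>t\<in>{0<..T}. u t \<in> borel_measurable borel \<and> (AE x in lborel. (\<lambda>n. fst (picard n) t x) \<longlonglongrightarrow> u t x) \<and>
      (\<forall>n. Lp_bound 4 (\<lambda>x. u t x - fst (picard n) t x) (2 * (60000 * \<alpha> * t powr (- (1/8))) / 2 ^ n))"
    using picard_limit(1)[OF l s] by (elim exE conjE) (rule that)
  obtain \<theta> where \<theta>: "\<theta> 0 = \<theta>0" and H2: "\<forall>t\<in>{0<..T}. \<theta> t \<in> borel_measurable borel \<and> (AE x in lborel. (\<lambda>n. snd (picard n) t x) \<longlonglongrightarrow> \<theta> t x) \<and>
      (\<forall>n. Lp_bound 2 (\<lambda>x. \<theta> t x - snd (picard n) t x) (2 * (2 * \<alpha> * t powr (- (3/4))) / 2 ^ n))"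
    using picard_limit(2)[OF l s] by (elim exE conjE) (rule that)
  note init = u \<theta>
  note m = bspec[OF H1, THEN conjunct1] bspec[OF H2, THEN conjunct1]
    and lim = bspec[OF H1, THEN conjunct2, THEN conjunct1] bspec[OF H2, THEN conjunct2, THEN conjunct1]
  have du: "Lp_bound 4 (\<lambda>x. u t x - fst (picard n) t x) (30000 * (4 * \<alpha> / 2 ^ n) * t powr (- (1/8)))"
    and du': "Lp_bound 4 (\<lambda>x. u t x - fst (picard n) t x) (120000 * \<alpha> / 2 ^ n * t powr (- (1/8)))"
    and d\<theta>: "Lp_bound 2 (\<lambda>x. \<theta> t x - snd (picard n) t x) (4 * \<alpha> / 2 ^ n * t powr (- (3/4)))" if "t \<in> {0<..T}" for t n
    using bspec[OF H1 that, THEN conjunct2, THEN conjunct2, THEN spec, of n] bspec[OF H2 that, THEN conjunct2, THEN conjunct2, THEN spec, of n]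
    by (simp_all add: mult.assoc)
  note c = controlled_picard[OF l s]
  have a0': "0 \<le> 120000 * \<alpha>" "0 \<le> 4 * \<alpha>" using a0 by simp_all
  have cont4: "Lp_cont 4 {0<..T} u"
    by (rule Lp_cont_geometric_limit[OF crit_boundD(3)[OF controlledD(1)[OF c]] _ _ a0'(1) du']) simp_all
  have cont2: "Lp_cont 2 {0<..T} \<theta>"
    by (rule Lp_cont_geometric_limit[OF crit_boundD(4)[OF controlledD(1)[OF c]] _ _ a0'(2) d\<theta>]) simp_all
  have good: "controlled E A1 \<beta> \<tau> u \<theta>" if b: "\<tau> \<le> T" "small \<beta>" "lin_small u0 \<theta>0 \<beta> \<tau>" for \<beta> \<tau>
  proof -
    have sub: "{0<..\<tau>} \<subseteq> {0<..T}" using b(1) by auto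
    then have sub': "t \<in> {0<..T}" if "t \<in> {0<..\<tau>}" for t using that by blast
    show ?thesis
      by (rule controlled_limit[OF controlled_picard[OF b(3,2)] m(1)[OF sub'] m(2)[OF sub'] lim(1)[OF sub'] lim(2)[OF sub']
            Lp_cont_subset[OF cont4 sub] Lp_cont_subset[OF cont2 sub]])
  qed
  note cu = controlledD(1)[OF good[OF order_refl s l]] and cp = controlledD(1)[OF c]
  have "fixed_on u0 \<theta>0 T u \<theta>"
    unfolding fixed_on_def
  proof
    fix t assume t: "t \<in> {0<..T}"
    define d where "d n = 4 * \<alpha> / 2 ^ n" for n :: nat
    have d0: "0 \<le> d n" "0 \<le> 30000 * d n" for n using a0 by (auto simp: d_def)
    have ds: "Lp_bound 4 (\<lambda>x. u r x - fst (picard n) r x) (30000 * d n * r powr (- (1/8)))"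
      "Lp_bound 2 (\<lambda>x. \<theta> r x - snd (picard n) r x) (d n * r powr (- (3/4)))" if "r \<in> {0<..<t}" for r n
      using du[of r n] d\<theta>[of r n] that t by (auto simp: d_def)
    have dl: "d \<longlonglongrightarrow> 0"
      unfolding d_def using tendsto_mult_left[OF LIMSEQ_realpow_zero[of "1/2"], of "4 * \<alpha>"] by (simp add: power_divide)
    have dS: "d (Suc n) = d n / 2" for n by (simp add: d_def)
    note sd = step_diff_0[OF cu cp t d0(2) d0(1) ds]
    \<comment> \<open>The defect is compared through the next iterate: the distance of
      \<open>u\<close> to it and the distance of the step of \<open>u\<close> to it are each at most
      \<open>15000 * d n\<close>.\<close>
    have 1: "Lp_bound 4 (\<lambda>x. u t x - step_u u0 u \<theta> t x) (45000 * d n * t powr (- (1/8)))" for n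
    proof -
      have A: "Lp_bound 4 (\<lambda>x. step_u u0 u \<theta> t x - fst (picard (Suc n)) t x) ((6144 * (30000 * \<alpha> * (30000 * d n)) + 1024 * d n) * t powr (- (1/8)))"
        using sd(1)[of u0 n] by (simp only: picard.simps fst_conv)
      have B: "(6144 * (30000 * \<alpha> * (30000 * d n)) + 1024 * d n) * t powr (- (1/8)) \<le> 15000 * d n * t powr (- (1/8))"
        by (rule mult_right_mono[OF contraction_factors(1)[OF s d0(1)]]) simp
      have "Lp_bound 4 (\<lambda>x. (u t x - fst (picard (Suc n)) t x) - (step_u u0 u \<theta> t x - fst (picard (Suc n)) t x))
        (30000 * (4 * \<alpha> / 2 ^ Suc n) * t powr (- (1/8)) + 15000 * d n * t powr (- (1/8)))"
        by (rule Lp_bound_diff[OF du[OF t] Lp_bound_mono[OF A B]]) auto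
      then have C: "Lp_bound 4 (\<lambda>x. u t x - step_u u0 u \<theta> t x) (30000 * (4 * \<alpha> / 2 ^ Suc n) * t powr (- (1/8)) + 15000 * d n * t powr (- (1/8)))"
        by (simp only: diff_diff_eq2 diff_add_cancel)
      show ?thesis by (rule Lp_bound_mono[OF C]) (use mult_nonneg_nonneg[OF d0(1)[of n], of "t powr (- (1/8))"] in \<open>simp_all add: d_def\<close>)
    qed
    have 2: "Lp_bound 2 (\<lambda>x. \<theta> t x - step_\<theta> \<theta>0 u \<theta> t x) (d n * t powr (- (3/4)))" for n
    proof -
      have A: "Lp_bound 2 (\<lambda>x. step_\<theta> \<theta>0 u \<theta> t x - snd (picard (Suc n)) t x) (3072 * (d n * (30000 * \<alpha>) + 2 * \<alpha> * (30000 * d n)) * t powr (- (3/4)))"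
        using sd(2)[of \<theta>0 n] by (simp only: picard.simps snd_conv)
      have B: "3072 * (d n * (30000 * \<alpha>) + 2 * \<alpha> * (30000 * d n)) * t powr (- (3/4)) \<le> d n / 2 * t powr (- (3/4))"
        by (rule mult_right_mono[OF contraction_factors(2)[OF s d0(1)]]) simp
      have "Lp_bound 2 (\<lambda>x. (\<theta> t x - snd (picard (Suc n)) t x) - (step_\<theta> \<theta>0 u \<theta> t x - snd (picard (Suc n)) t x))
        (4 * \<alpha> / 2 ^ Suc n * t powr (- (3/4)) + d n / 2 * t powr (- (3/4)))"
        by (rule Lp_bound_diff[OF d\<theta>[OF t] Lp_bound_mono[OF A B]]) auto
      then have C: "Lp_bound 2 (\<lambda>x. \<theta> t x - step_\<theta> \<theta>0 u \<theta> t x) (4 * \<alpha> / 2 ^ Suc n * t powr (- (3/4)) + d n / 2 * t powr (- (3/4)))"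
        by (simp only: diff_diff_eq2 diff_add_cancel)
      show ?thesis by (rule Lp_bound_mono[OF C]) (simp_all add: d_def)
    qed
    have "(\<lambda>n. 45000 * d n * t powr (- (1/8))) \<longlonglongrightarrow> 45000 * 0 * t powr (- (1/8))"
      by (intro tendsto_mult tendsto_const dl)
    from Lp_bound_LIMSEQ[OF 1 this]
    have "Lp_bound 4 (\<lambda>x. u t x - step_u u0 u \<theta> t x) 0" by simp
    from Lp_bound_0_AE[OF this] have A: "AE x in lborel. u t x = step_u u0 u \<theta> t x" by eventually_elim simp
    have "(\<lambda>n. d n * t powr (- (3/4))) \<longlonglongrightarrow> 0 * t powr (- (3/4))"
      by (intro tendsto_mult tendsto_const dl)
    from Lp_bound_LIMSEQ[OF 2 this] have "Lp_bound 2 (\<lambda>x. \<theta> t x - step_\<theta> \<theta>0 u \<theta> t x) 0" by simp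
    from Lp_bound_0_AE[OF this] have B: "AE x in lborel. \<theta> t x = step_\<theta> \<theta>0 u \<theta> t x" by eventually_elim simp
    show "(AE x in lborel. u t x = step_u u0 u \<theta> t x) \<and> (AE x in lborel. \<theta> t x = step_\<theta> \<theta>0 u \<theta> t x)"
      using A B ..
  qed
  then show ?thesis
    using init good by (intro exI[of _ u] exI[of _ \<theta>]) simp
qed

end

section \<open>The solution spaces\<close>

lemma Lp_cont_measurable:
  assumes "Lp_cont p S f" "t \<in> S"
  shows "f t \<in> borel_measurable borel"
proof -
  obtain N where "Lp_bound p (f t) N" using Lp_contD[OF assms] .
  then show ?thesis by (rule Lp_boundD(1))
qed

lemma C_Lp_iff:
  fixes f :: "real \<Rightarrow> real^3 \<Rightarrow> 'b::euclidean_space"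
  assumes p: "0 < p"
  shows "f \<in> C_Lp p T \<longleftrightarrow> Lp_cont p {0..T} f"
proof
  assume f: "f \<in> C_Lp p T"
  show "Lp_cont p {0..T} f"
    unfolding Lp_cont_def
  proof (intro ballI conjI allI impI)
    fix t assume t: "t \<in> {0..T}"
    then show N: "\<exists>N. Lp_bound p (f t) N" using f by (auto simp: C_Lp_def Lp_space_iff[OF p])
    fix e :: real assume e: "0 < e"
    have "((\<lambda>s. Lp_norm p (\<lambda>x. f s x - f t x)) \<longlongrightarrow> 0) (at t within {0..T})"
      using f t by (auto simp: C_Lp_def)
    then have "\<forall>\<^sub>F s in at t within {0..T}. Lp_norm p (\<lambda>x. f s x - f t x) < ennreal e"
      by (rule order_tendstoD(2)) (use e in simp)
    then obtain d where d: "0 < d" "\<forall>s\<in>{0..T}. s \<noteq> t \<and> dist s t < d \<longrightarrow> Lp_norm p (\<lambda>x. f s x - f t x) < ennreal e"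
      unfolding eventually_at by blast
    have "Lp_bound p (\<lambda>x. f s x - f t x) e" if s: "s \<in> {0..T}" "\<bar>s - t\<bar> < d" for s
    proof (cases "s = t")
      case True
      then show ?thesis using e Lp_bound_zero[of e p] by simp
    next
      case False
      have "f s \<in> borel_measurable borel" "f t \<in> borel_measurable borel"
        using f s t by (auto simp: C_Lp_def Lp_space_iff[OF p] dest: Lp_boundD(1))
      then have m: "(\<lambda>x. f s x - f t x) \<in> borel_measurable borel" by measurable
      show ?thesis
        by (rule Lp_bound_if_Lp_norm_le[OF m _ _ p]) (use d(2) s False e in \<open>auto simp: dist_real_def less_imp_le\<close>)
    qed
    then show "\<exists>d>0. \<forall>s\<in>{0..T}. \<bar>s - t\<bar> < d \<longrightarrow> Lp_bound p (\<lambda>x. f s x - f t x) e"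
      using d(1) by blast
  qed
next
  assume f: "Lp_cont p {0..T} f"
  show "f \<in> C_Lp p T"
    unfolding C_Lp_def mem_Collect_eq
  proof (intro conjI ballI)
    fix t assume t: "t \<in> {0..T}"
    then show "f t \<in> Lp_space p" using f unfolding Lp_space_iff[OF p] Lp_cont_def by blast
    show "((\<lambda>s. Lp_norm p (\<lambda>x. f s x - f t x)) \<longlongrightarrow> 0) (at t within {0..T})"
    proof (rule order_tendstoI)
      fix a :: ennreal assume "0 < a"
      then obtain b where b: "0 < b" "b < a" using dense by blast
      then obtain e where e: "b = ennreal e" "0 < e" by (cases b) auto
      obtain d where d: "0 < d" "\<And>s. s \<in> {0..T} \<Longrightarrow> \<bar>s - t\<bar> < d \<Longrightarrow> Lp_bound p (\<lambda>x. f s x - f t x) e"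
        using Lp_contE[OF f t e(2)] by blast
      have "Lp_norm p (\<lambda>x. f s x - f t x) < a" if "s \<in> {0..T}" "dist s t < d" for s
        using Lp_norm_leI[OF d(2)[OF that(1)] p] that(2) b e by (auto simp: dist_real_def)
      then show "\<forall>\<^sub>F s in at t within {0..T}. Lp_norm p (\<lambda>x. f s x - f t x) < a"
        unfolding eventually_at using d(1) by blast
    qed auto
  qed
qed

lemma weighted_Linf_leI:
  assumes "f \<in> borel_measurable borel" "AE x in lborel. norm (f x) \<le> K * t powr (- c)" "0 < t" "0 \<le> K"
  shows "ennreal (t powr c) * Linf_norm f \<le> ennreal K"
proof -
  have "ennreal (t powr c) * Linf_norm f \<le> ennreal (t powr c) * ennreal (K * t powr (- c))"
    by (rule mult_left_mono[OF Linf_norm_leI[OF assms(1,2)]]) simp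
  also have "\<dots> = ennreal K"
    using assms(3,4) by (simp add: ennreal_mult[symmetric] powr_minus)
  finally show ?thesis .
qed

lemma weighted_Linf_leD:
  assumes le: "ennreal (t powr c) * Linf_norm f \<le> ennreal K" and t: "0 < t" and K: "0 \<le> K"
  shows "AE x in lborel. norm (f x) \<le> K * t powr (- c)"
proof (rule AE_le_if_Linf_norm_le)
  have "Linf_norm f = ennreal (t powr (- c)) * (ennreal (t powr c) * Linf_norm f)"
    using t by (simp add: mult.assoc[symmetric] ennreal_mult[symmetric] powr_minus)
  also have "\<dots> \<le> ennreal (t powr (- c)) * ennreal K"
    by (rule mult_left_mono[OF le]) simp
  also have "\<dots> = ennreal (K * t powr (- c))"
    using K by (simp add: ennreal_mult[symmetric] mult.commute)
  finally show "Linf_norm f \<le> ennreal (K * t powr (- c))" .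
qed (use K in simp)

text \<open>Without the divergence condition, \<open>X\<close> is the case \<open>p = 3\<close>, \<open>c = 1/2\<close> and \<open>Y\<close> the case \<open>p = 1\<close>, \<open>c = 3/2\<close>.\<close>

definition crit_space :: "real \<Rightarrow> real \<Rightarrow> real \<Rightarrow> (real \<Rightarrow> real^3 \<Rightarrow> 'b::euclidean_space) \<Rightarrow> bool" where
  "crit_space p c T f \<longleftrightarrow> Lp_cont p {0..T} f \<and>
     (\<exists>A. \<forall>t\<in>{0..T}. Lp_bound p (f t) A) \<and>
     (\<exists>B\<ge>0. \<forall>t\<in>{0<..T}. AE x in lborel. norm (f t x) \<le> B * t powr (- c)) \<and>
     (\<forall>e>0. \<exists>d>0. \<forall>t\<in>{0<..T}. t < d \<longrightarrow> (AE x in lborel. norm (f t x) \<le> e * t powr (- c)))"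

lemma crit_space_iff:
  fixes f :: "real \<Rightarrow> real^3 \<Rightarrow> 'b::euclidean_space"
  assumes p: "1 \<le> p" and T: "0 < T"
    and W: "\<And>t. 0 < t \<Longrightarrow> W t = t powr c"
  shows "f \<in> C_Lp p T \<and> (SUP t\<in>{0..T}. Lp_norm p (f t)) + (SUP t\<in>{0<..T}. ennreal (W t) * Linf_norm (f t)) < \<infinity> \<and>
      ((\<lambda>t. ennreal (W t) * Linf_norm (f t)) \<longlongrightarrow> 0) (at_right 0) \<longleftrightarrow> crit_space p c T f"
    (is "?C \<and> ?S1 + ?S2 < \<infinity> \<and> ?L \<longleftrightarrow> _")
proof
  have p0: "0 < p" using p by simp
  assume H: "?C \<and> ?S1 + ?S2 < \<infinity> \<and> ?L"
  then have C: "Lp_cont p {0..T} f" using C_Lp_iff[OF p0] by blast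
  have "?S1 < \<infinity>" "?S2 < \<infinity>" using H by auto
  then obtain A B where A: "?S1 = ennreal A" "0 \<le> A" and B: "?S2 = ennreal B" "0 \<le> B"
    by (cases ?S1; cases ?S2) auto
  have "Lp_bound p (f t) A" if t: "t \<in> {0..T}" for t
  proof (rule Lp_bound_if_Lp_norm_le[OF _ _ A(2) p0])
    show "f t \<in> borel_measurable borel" by (rule Lp_cont_measurable[OF C t])
    show "Lp_norm p (f t) \<le> ennreal A" unfolding A(1)[symmetric] by (rule SUP_upper[OF t])
  qed
  moreover have "AE x in lborel. norm (f t x) \<le> B * t powr (- c)" if t: "t \<in> {0<..T}" for t
  proof (rule weighted_Linf_leD[OF _ _ B(2)])
    show "ennreal (t powr c) * Linf_norm (f t) \<le> ennreal B"
      unfolding B(1)[symmetric] using t W by (intro SUP_upper2[OF t]) simp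
  qed (use t in simp)
  moreover have "\<exists>d>0. \<forall>t\<in>{0<..T}. t < d \<longrightarrow> (AE x in lborel. norm (f t x) \<le> e * t powr (- c))" if e: "0 < e" for e
  proof -
    have "\<forall>\<^sub>F t in at_right 0. ennreal (W t) * Linf_norm (f t) < ennreal e"
      by (rule order_tendstoD(2)[where y = 0]) (use H e in auto)
    then obtain d where d: "0 < d" "\<forall>t>0. t < d \<longrightarrow> ennreal (W t) * Linf_norm (f t) < ennreal e"
      unfolding eventually_at_right_field by blast
    have "AE x in lborel. norm (f t x) \<le> e * t powr (- c)" if "t \<in> {0<..T}" "t < d" for t
      by (rule weighted_Linf_leD) (use d(2) that e W in \<open>auto simp: less_imp_le\<close>)
    then show ?thesis using d(1) by blast
  qed
  ultimately show "crit_space p c T f" unfolding crit_space_def using C B(2) by blast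
next
  have p0: "0 < p" using p by simp
  assume H: "crit_space p c T f"
  then have C: "Lp_cont p {0..T} f" unfolding crit_space_def by blast
  have m: "f t \<in> borel_measurable borel" if "t \<in> {0..T}" for t
    by (rule Lp_cont_measurable[OF C that])
  obtain A where A: "\<forall>t\<in>{0..T}. Lp_bound p (f t) A" using H unfolding crit_space_def by blast
  obtain B where B: "0 \<le> B" "\<forall>t\<in>{0<..T}. AE x in lborel. norm (f t x) \<le> B * t powr (- c)"
    using H unfolding crit_space_def by blast
  have "?S1 \<le> ennreal A" by (rule SUP_least) (use A Lp_norm_leI[OF _ p0] in blast)
  moreover have "?S2 \<le> ennreal B"
  proof (rule SUP_least)
    fix t assume t: "t \<in> {0<..T}"
    then have t': "t \<in> {0..T}" "0 < t" by auto
    show "ennreal (W t) * Linf_norm (f t) \<le> ennreal B"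
      unfolding W[OF t'(2)] by (rule weighted_Linf_leI[OF m[OF t'(1)] _ t'(2) B(1)]) (use B(2) t in blast)
  qed
  ultimately have "?S1 + ?S2 \<le> ennreal A + ennreal B" by (rule add_mono)
  also have "\<dots> < \<infinity>" by simp
  finally have S: "?S1 + ?S2 < \<infinity>" .
  have ?L
  proof (rule order_tendstoI)
    fix a :: ennreal assume "0 < a"
    then obtain b where b: "0 < b" "b < a" using dense by blast
    then obtain e where e: "b = ennreal e" "0 < e" by (cases b) auto
    obtain d where d: "0 < d" "\<forall>t\<in>{0<..T}. t < d \<longrightarrow> (AE x in lborel. norm (f t x) \<le> e * t powr (- c))"
      using H e(2) unfolding crit_space_def by blast
    have "ennreal (W t) * Linf_norm (f t) < a" if t: "0 < t" "t < min d T" for t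
    proof -
      have t': "t \<in> {0..T}" "t \<in> {0<..T}" "t < d" using t by auto
      have "ennreal (W t) * Linf_norm (f t) \<le> ennreal e"
        unfolding W[OF t(1)] by (rule weighted_Linf_leI[OF m[OF t'(1)] _ t(1)]) (use d(2) t' e in auto)
      then show ?thesis using b e by simp
    qed
    then show "\<forall>\<^sub>F t in at_right 0. ennreal (W t) * Linf_norm (f t) < a"
      unfolding eventually_at_right_field using d(1) T by (intro exI[of _ "min d T"]) auto
  qed auto
  with S C show "?C \<and> ?S1 + ?S2 < \<infinity> \<and> ?L" using C_Lp_iff[OF p0] by blast
qed

lemma X_space_iff:
  assumes "0 < T"
  shows "u \<in> X_space T \<longleftrightarrow> (\<forall>t\<in>{0..T}. div_free (u t)) \<and> crit_space 3 (1/2) T u"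
  using crit_space_iff[OF _ assms, of 3 sqrt "1/2" u] by (auto simp: X_space_def X_norm_def powr_half_sqrt)

lemma Y_space_iff:
  assumes "0 < T"
  shows "\<theta> \<in> Y_space T \<longleftrightarrow> crit_space 1 (3/2) T \<theta>"
  using crit_space_iff[OF _ assms, of 1 "\<lambda>t. t powr (3/2)" "3/2" \<theta>] by (auto simp: Y_space_def Y_norm_def)

lemma Lp_bound_interpolate_weighted:
  assumes f: "Lp_bound p f A" and K: "AE x in lborel. norm (f x) \<le> K * t powr (- c)" "0 \<le> K" and pq: "1 \<le> p" "p \<le> q"
    and b: "b = c * (1 - p / q)" and t: "0 < t"
  shows "Lp_bound q f (K powr (1 - p / q) * A powr (p / q) * t powr (- b))"
proof -
  have "Lp_bound q f ((K * t powr (- c)) powr (1 - p / q) * A powr (p / q))"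
    by (rule Lp_bound_interpolate[OF f K(1)]) (use pq K in auto)
  moreover have "(K * t powr (- c)) powr (1 - p / q) = K powr (1 - p / q) * t powr (- b)"
    using K t by (simp add: powr_mult powr_powr b)
  ultimately show ?thesis by (simp add: mult.assoc mult.commute mult.left_commute)
qed

lemma powr_eventually_small:
  assumes g: "0 < g" and C: "0 \<le> (C::real)" and e: "0 < e"
  shows "\<exists>k>0. k powr g * C \<le> e"
proof (intro exI conjI)
  let ?k = "(e / (C + 1)) powr (1 / g)"
  have "?k powr g * C = e / (C + 1) * C" using g C e by (simp add: powr_powr)
  also have "\<dots> \<le> e / (C + 1) * (C + 1)" using C e by (intro mult_left_mono) auto
  also have "\<dots> = e" using C by simp
  finally show "?k powr g * C \<le> e" .
  show "0 < ?k" using C e by simp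
qed

text \<open>Interpolation between L^p and the weighted sup norm. Since the sup norm enters with the
  positive power \<open>1 - p / q\<close>, its vanishing at time zero passes to the weighted L^q
  norm; continuity in L^q follows from continuity in L^p and a local sup bound.\<close>

lemma crit_space_interpolate:
  fixes f :: "real \<Rightarrow> real^3 \<Rightarrow> 'b::euclidean_space"
  assumes f: "crit_space p c T f" and pq: "1 \<le> p" "p < q" and c: "0 \<le> c" and b: "b = c * (1 - p / q)"
  shows "Lp_cont q {0<..T} f"
    and "\<exists>M\<ge>0. \<forall>t\<in>{0<..T}. Lp_bound q (f t) (M * t powr (- b))"
    and "0 < e \<Longrightarrow> \<exists>d>0. \<forall>t\<in>{0<..T}. t < d \<longrightarrow> Lp_bound q (f t) (e * t powr (- b))"
proof -
  have r: "0 < 1 - p / q" using pq by (simp add: field_simps)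
  have C: "Lp_cont p {0..T} f" using f unfolding crit_space_def by blast
  obtain A where A: "\<forall>t\<in>{0..T}. Lp_bound p (f t) A" using f unfolding crit_space_def by blast
  obtain B where B: "0 \<le> B" "\<forall>t\<in>{0<..T}. AE x in lborel. norm (f t x) \<le> B * t powr (- c)"
    using f unfolding crit_space_def by blast
  have bd: "Lp_bound q (f t) (B powr (1 - p / q) * A powr (p / q) * t powr (- b))" if t: "t \<in> {0<..T}" for t
    by (rule Lp_bound_interpolate_weighted[OF _ _ B(1) _ _ b]) (use A B t pq in auto)
  then show "\<exists>M\<ge>0. \<forall>t\<in>{0<..T}. Lp_bound q (f t) (M * t powr (- b))"
    by (intro exI[of _ "B powr (1 - p / q) * A powr (p / q)"]) auto
  show "\<exists>d>0. \<forall>t\<in>{0<..T}. t < d \<longrightarrow> Lp_bound q (f t) (e * t powr (- b))" if e: "0 < e"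
  proof -
    obtain k where k: "0 < k" "k powr (1 - p / q) * A powr (p / q) \<le> e"
      using powr_eventually_small[OF r _ e, of "A powr (p / q)"] by auto
    obtain d where d: "0 < d" "\<forall>t\<in>{0<..T}. t < d \<longrightarrow> (AE x in lborel. norm (f t x) \<le> k * t powr (- c))"
      using f k(1) unfolding crit_space_def by blast
    have "Lp_bound q (f t) (e * t powr (- b))" if t: "t \<in> {0<..T}" "t < d" for t
    proof (rule Lp_bound_mono)
      show "Lp_bound q (f t) (k powr (1 - p / q) * A powr (p / q) * t powr (- b))"
        by (rule Lp_bound_interpolate_weighted[OF _ _ _ _ _ b]) (use A d t pq k in auto)
      show "k powr (1 - p / q) * A powr (p / q) * t powr (- b) \<le> e * t powr (- b)"
        by (rule mult_right_mono[OF k(2)]) simp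
    qed (use pq in simp)
    then show ?thesis using d(1) by blast
  qed
  show "Lp_cont q {0<..T} f"
    unfolding Lp_cont_def
  proof (intro ballI conjI allI impI)
    fix t assume t: "t \<in> {0<..T}"
    show "\<exists>N. Lp_bound q (f t) N" using bd[OF t] by blast
    fix e :: real assume e: "0 < e"
    \<comment> \<open>A sup bound for the difference at any two times not before
      \<open>t / 2\<close>.\<close>
    define K where "K = 2 * B * (t / 2) powr (- c)"
    have K0: "0 \<le> K" using B by (simp add: K_def)
    have pq': "0 < p / q" using pq by simp
    obtain k where k: "0 < k" "k powr (p / q) * K powr (1 - p / q) \<le> e"
      using powr_eventually_small[OF pq' _ e, of "K powr (1 - p / q)"] by auto
    have t': "t \<in> {0..T}" using t by simp
    obtain d where d: "0 < d" "\<And>s. s \<in> {0..T} \<Longrightarrow> \<bar>s - t\<bar> < d \<Longrightarrow> Lp_bound p (\<lambda>x. f s x - f t x) k"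
      using Lp_contE[OF C t' k(1)] by blast
    have "Lp_bound q (\<lambda>x. f s x - f t x) e" if s: "s \<in> {0<..T}" "\<bar>s - t\<bar> < min d (t / 2)" for s
    proof -
      have "t / 2 \<le> s" "t / 2 \<le> t" using s(2) abs_ge_minus_self[of "s - t"] t by auto
      then have le: "s powr (- c) \<le> (t / 2) powr (- c)" "t powr (- c) \<le> (t / 2) powr (- c)"
        using t c by (auto intro!: powr_mono2')
      have "AE x in lborel. norm (f s x) \<le> B * s powr (- c)" "AE x in lborel. norm (f t x) \<le> B * t powr (- c)"
        using B(2) s(1) t by auto
      then have "AE x in lborel. norm (f s x - f t x) \<le> K"
      proof eventually_elim
        case (elim x)
        have "norm (f s x - f t x) \<le> B * s powr (- c) + B * t powr (- c)"
          using norm_triangle_ineq4[of "f s x" "f t x"] elim by simp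
        also have "\<dots> \<le> B * (t / 2) powr (- c) + B * (t / 2) powr (- c)"
          using B(1) le by (intro add_mono mult_left_mono) auto
        also have "\<dots> = K" by (simp add: K_def)
        finally show ?case .
      qed
      then have 1: "Lp_bound q (\<lambda>x. f s x - f t x) (K powr (1 - p / q) * k powr (p / q))"
        by (intro Lp_bound_interpolate[OF d(2)]) (use s pq K0 in auto)
      show ?thesis by (rule Lp_bound_mono[OF 1]) (use k(2) pq in \<open>auto simp: mult.commute\<close>)
    qed
    then show "\<exists>d>0. \<forall>s\<in>{0<..T}. \<bar>s - t\<bar> < d \<longrightarrow> Lp_bound q (\<lambda>x. f s x - f t x) e"
      using d(1) t by (intro exI[of _ "min d (t / 2)"]) auto
  qed
qed

lemma crit_bound_mono:
  assumes c: "crit_bound T M N u \<theta>" and le: "M \<le> M'" "N \<le> N'"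
  shows "crit_bound T M' N' u \<theta>"
proof -
  have "Lp_bound 4 (u t) (M' * t powr (- (1/8)))" "Lp_bound 2 (\<theta> t) (N' * t powr (- (3/4)))" if t: "t \<in> {0<..T}" for t
    by (rule Lp_bound_mono[OF crit_boundD(5)[OF c t] mult_right_mono[OF le(1)]]; simp)
      (rule Lp_bound_mono[OF crit_boundD(6)[OF c t] mult_right_mono[OF le(2)]]; simp)
  then show ?thesis using crit_boundD(1-4)[OF c] le unfolding crit_bound_def by auto
qed

lemma crit_bound_of_spaces:
  assumes T: "0 < T" and u: "u \<in> X_space T" and \<theta>: "\<theta> \<in> Y_space T"
  shows "\<exists>M. crit_bound T M M u \<theta>" and "0 < e \<Longrightarrow> \<exists>\<tau>>0. \<tau> \<le> T \<and> crit_bound \<tau> e e u \<theta>"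
proof -
  have cu: "crit_space 3 (1/2) T u" using u X_space_iff[OF T] by blast
  have c\<theta>: "crit_space 1 (3/2) T \<theta>" using \<theta> Y_space_iff[OF T] by blast
  have b: "(1/8 :: real) = 1/2 * (1 - 3/4)" "(3/4 :: real) = 3/2 * (1 - 1/2)" by simp_all
  note iu = crit_space_interpolate[OF cu _ _ _ b(1)] and i\<theta> = crit_space_interpolate[OF c\<theta> _ _ _ b(2)]
  have cont: "Lp_cont 4 {0<..T} u" "Lp_cont 2 {0<..T} \<theta>" by (rule iu(1) i\<theta>(1); simp)+
  obtain M where M: "0 \<le> M" "\<forall>t\<in>{0<..T}. Lp_bound 4 (u t) (M * t powr (- (1/8)))" using iu(2) by auto
  obtain N where N: "0 \<le> N" "\<forall>t\<in>{0<..T}. Lp_bound 2 (\<theta> t) (N * t powr (- (3/4)))" using i\<theta>(2) by auto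
  have "crit_bound T M N u \<theta>" unfolding crit_bound_def using M N cont by blast
  from crit_bound_mono[OF this, of "max M N" "max M N"] show "\<exists>M. crit_bound T M M u \<theta>" by auto
  show "\<exists>\<tau>>0. \<tau> \<le> T \<and> crit_bound \<tau> e e u \<theta>" if e: "0 < e"
  proof -
    obtain d1 where d1: "0 < d1" "\<forall>t\<in>{0<..T}. t < d1 \<longrightarrow> Lp_bound 4 (u t) (e * t powr (- (1/8)))" using iu(3)[OF _ _ _ e] by auto
    obtain d2 where d2: "0 < d2" "\<forall>t\<in>{0<..T}. t < d2 \<longrightarrow> Lp_bound 2 (\<theta> t) (e * t powr (- (3/4)))" using i\<theta>(3)[OF _ _ _ e] by auto
    define \<tau> where "\<tau> = min T (min d1 d2/2)"
    have \<tau>: "0 < \<tau>" "\<tau> \<le> T" "\<tau> < d1" "\<tau> < d2" using T d1(1) d2(1) by (auto simp: \<tau>_def min_def)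
    have sub: "{0<..\<tau>} \<subseteq> {0<..T}" using \<tau> by auto
    have "crit_bound \<tau> e e u \<theta>"
      unfolding crit_bound_def
      using e d1(2) d2(2) \<tau> Lp_cont_subset[OF cont(1) sub] Lp_cont_subset[OF cont(2) sub] by auto
    then show ?thesis using \<tau> by blast
  qed
qed

lemma mild_solution_iff_fixed_on:
  assumes cb: "crit_bound T M N u \<theta>" and T: "0 < T"
  shows "mild_solution T u0 \<theta>0 u \<theta> \<longleftrightarrow> div_free u0 \<and> (AE x in lborel. \<theta> 0 x = \<theta>0 x) \<and> (AE x in lborel. u 0 x = u0 x) \<and>
    fixed_on u0 \<theta>0 T u \<theta>"
  unfolding mild_solution_iff[OF cb] fixed_on_def step_u_def step_\<theta>_def using T by auto

text \<open>The bounds on the whole interval come from the finite norms, those on a short initial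
  interval from the limits at zero in the definitions of the two spaces. The value at time zero is
  fixed by the mild equation itself.\<close>

lemma mild_solution_unique:
  assumes T: "0 < T" and u: "u \<in> X_space T" "\<theta> \<in> Y_space T" "mild_solution T u0 \<theta>0 u \<theta>"
    and v: "v \<in> X_space T" "\<eta> \<in> Y_space T" "mild_solution T u0 \<theta>0 v \<eta>" and t: "t \<in> {0..T}"
  shows "AE x in lborel. v t x = u t x" "AE x in lborel. \<eta> t x = \<theta> t x"
proof -
  obtain M where M: "crit_bound T M M u \<theta>" using crit_bound_of_spaces(1)[OF T u(1,2)] by blast
  obtain M' where M': "crit_bound T M' M' v \<eta>" using crit_bound_of_spaces(1)[OF T v(1,2)] by blast
  define K where "K = max M M'"
  have K: "crit_bound T K K u \<theta>" "crit_bound T K K v \<eta>"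
    by (rule crit_bound_mono[OF M] crit_bound_mono[OF M']; simp add: K_def)+
  \<comment> \<open>Small enough for the start of uniqueness, where the weight 30000 multiplies it
    by 3072 * 30001.\<close>
  define e :: real where "e = 1/1000000000"
  have e: "0 < e" "6144 * e \<le> 1/4" "3072 * (e + 30000 * e) \<le> 1/2" by (simp_all add: e_def)
  obtain \<tau>1 where \<tau>1: "0 < \<tau>1" "\<tau>1 \<le> T" "crit_bound \<tau>1 e e u \<theta>" using crit_bound_of_spaces(2)[OF T u(1,2) e(1)] by blast
  obtain \<tau>2 where \<tau>2: "0 < \<tau>2" "\<tau>2 \<le> T" "crit_bound \<tau>2 e e v \<eta>" using crit_bound_of_spaces(2)[OF T v(1,2) e(1)] by blast
  define \<tau> where "\<tau> = min \<tau>1 \<tau>2"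
  have \<tau>: "0 < \<tau>" "\<tau> \<le> T" "\<tau> \<le> \<tau>1" "\<tau> \<le> \<tau>2" using \<tau>1 \<tau>2 by (auto simp: \<tau>_def)
  note mu = u(3)[unfolded mild_solution_iff_fixed_on[OF K(1) T]] and mv = v(3)[unfolded mild_solution_iff_fixed_on[OF K(2) T]]
  have fx: "fixed_on u0 \<theta>0 T u \<theta>" "fixed_on u0 \<theta>0 T v \<eta>" using mu mv by auto
  have agree: "agree_on T u \<theta> v \<eta>"
    by (rule fixed_point_unique[OF K fx \<tau>(1,2) crit_bound_subset[OF \<tau>1(3) \<tau>(3)] crit_bound_subset[OF \<tau>2(3) \<tau>(4)] e(2,3)])
  have "AE x in lborel. u 0 x = u0 x" "AE x in lborel. v 0 x = u0 x" "AE x in lborel. \<theta> 0 x = \<theta>0 x" "AE x in lborel. \<eta> 0 x = \<theta>0 x"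
    using mu mv by auto
  then have "AE x in lborel. v 0 x = u 0 x" "AE x in lborel. \<eta> 0 x = \<theta> 0 x" by auto
  moreover have "AE x in lborel. v t x = u t x" "AE x in lborel. \<eta> t x = \<theta> t x" if "t \<in> {0<..T}"
    using bspec[OF agree[unfolded agree_on_def] that] by auto
  ultimately show "AE x in lborel. v t x = u t x" "AE x in lborel. \<eta> t x = \<theta> t x"
    using t by (cases "t = 0"; auto)+
qed

lemma Lp_cont_cong_AE:
  fixes f g :: "real \<Rightarrow> real^3 \<Rightarrow> 'b::euclidean_space"
  assumes f: "Lp_cont p S f" and p: "0 \<le> p" and g: "\<And>t. t \<in> S \<Longrightarrow> g t \<in> borel_measurable borel"
    and eq: "\<And>t. t \<in> S \<Longrightarrow> AE x in lborel. g t x = f t x"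
  shows "Lp_cont p S g"
  unfolding Lp_cont_def
proof (intro ballI conjI allI impI)
  fix t assume t: "t \<in> S"
  obtain N where "Lp_bound p (f t) N" using Lp_contD[OF f t] .
  from Lp_bound_cong_AE[OF this g[OF t] eq[OF t] p] show "\<exists>N. Lp_bound p (g t) N" ..
  fix e :: real assume "0 < e"
  then obtain d where d: "0 < d" "\<And>s. s \<in> S \<Longrightarrow> \<bar>s - t\<bar> < d \<Longrightarrow> Lp_bound p (\<lambda>x. f s x - f t x) e"
    using Lp_contE[OF f t] by blast
  have "Lp_bound p (\<lambda>x. g s x - g t x) e" if s: "s \<in> S" "\<bar>s - t\<bar> < d" for s
  proof (rule Lp_bound_cong_AE[OF d(2)[OF s] _ _ p])
    show "(\<lambda>x. g s x - g t x) \<in> borel_measurable borel" using g[OF s(1)] g[OF t] by measurable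
    show "AE x in lborel. g s x - g t x = f s x - f t x" using eq[OF s(1)] eq[OF t] by eventually_elim simp
  qed
  then show "\<exists>d>0. \<forall>s\<in>S. \<bar>s - t\<bar> < d \<longrightarrow> Lp_bound p (\<lambda>x. g s x - g t x) e"
    using d(1) by blast
qed

text \<open>The Duhamel terms are controlled on \<open>{0<..T}\<close>; their smallness as the time
  tends to zero extends continuity to the closed interval with value zero.\<close>

lemma Lp_cont_extend_zero:
  fixes w :: "real \<Rightarrow> real^3 \<Rightarrow> 'b::euclidean_space"
  assumes w: "Lp_cont p {0<..T} w"
    and small: "\<And>e. 0 < e \<Longrightarrow> \<exists>d>0. \<forall>t\<in>{0<..T}. t < d \<longrightarrow> Lp_bound p (w t) e"
  shows "Lp_cont p {0..T} (\<lambda>t x. if t = 0 then 0 else w t x)"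
  unfolding Lp_cont_def
proof (intro ballI conjI allI impI)
  fix t assume t: "t \<in> {0..T}"
  show "\<exists>N. Lp_bound p (\<lambda>x. if t = 0 then 0 else w t x) N"
  proof (cases "t = 0")
    case True
    then show ?thesis using Lp_bound_zero[OF order_refl] by auto
  next
    case False
    then have "t \<in> {0<..T}" using t by simp
    from Lp_contD[OF w this] show ?thesis using False by auto
  qed
  fix e :: real assume e: "0 < e"
  show "\<exists>d>0. \<forall>s\<in>{0..T}. \<bar>s - t\<bar> < d \<longrightarrow> Lp_bound p (\<lambda>x. (if s = 0 then 0 else w s x) - (if t = 0 then 0 else w t x)) e"
  proof (cases "t = 0")
    case True
    obtain d where d: "0 < d" "\<forall>t\<in>{0<..T}. t < d \<longrightarrow> Lp_bound p (w t) e" using small[OF e] by blast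
    have "Lp_bound p (\<lambda>x. (if s = 0 then 0 else w s x) - (if t = 0 then 0 else w t x)) e" if "s \<in> {0..T}" "\<bar>s - t\<bar> < d" for s
      using d(2) that True e Lp_bound_zero[of e p] by (cases "s = 0") auto
    then show ?thesis using d(1) by blast
  next
    case False
    then have t': "t \<in> {0<..T}" using t by simp
    obtain d where d: "0 < d" "\<And>s. s \<in> {0<..T} \<Longrightarrow> \<bar>s - t\<bar> < d \<Longrightarrow> Lp_bound p (\<lambda>x. w s x - w t x) e"
      using Lp_contE[OF w t' e] by blast
    have "Lp_bound p (\<lambda>x. (if s = 0 then 0 else w s x) - (if t = 0 then 0 else w t x)) e" if s: "s \<in> {0..T}" "\<bar>s - t\<bar> < min d t" for s
    proof -
      have "0 < s" using s(2) abs_ge_minus_self[of "s - t"] by linarith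
      then show ?thesis using d(2)[of s] s False by simp
    qed
    then show ?thesis using d(1) t' by (intro exI[of _ "min d t"]) auto
  qed
qed

lemma lin_small_subset: "lin_small u0 \<theta>0 \<alpha> \<tau> \<Longrightarrow> r \<le> \<tau> \<Longrightarrow> lin_small u0 \<theta>0 \<alpha> r"
  unfolding lin_small_def by auto

lemma heat_pos: "0 < t \<Longrightarrow> heat t f = conv (G t) f"
  by (simp add: fun_eq_iff heat_def conv_def)

section \<open>The fixed point lies in both solution spaces\<close>

context
  fixes u0 :: "real^3 \<Rightarrow> real^3" and \<theta>0 :: "real^3 \<Rightarrow> real" and A3 A1 E \<alpha> T :: real
    and u :: "real \<Rightarrow> real^3 \<Rightarrow> real^3" and \<theta> :: "real \<Rightarrow> real^3 \<Rightarrow> real"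
  assumes u0: "Lp_bound 3 u0 A3" and \<theta>0: "Lp_bound 1 \<theta>0 A1" and E: "E = 64 * A3 + 1"
    and T: "0 < T" and \<alpha>: "0 < \<alpha>" "small E \<alpha>" "lin_small u0 \<theta>0 \<alpha> T"
    and fx: "fixed_on u0 \<theta>0 T u \<theta>" and init: "u 0 = u0" "\<theta> 0 = \<theta>0"
    and good: "\<And>\<beta> \<tau>. \<tau> \<le> T \<Longrightarrow> small E \<beta> \<Longrightarrow> lin_small u0 \<theta>0 \<beta> \<tau> \<Longrightarrow> controlled E A1 \<beta> \<tau> u \<theta>"
begin

text \<open>A smaller \<beta> is paid for with a shorter interval on which the linear part is that
  small. All statements about time zero are drawn from this.\<close>

lemma controlled_arbitrarily_small:
  assumes e: "0 < e"
  shows "\<exists>\<beta> \<tau>. 0 < \<beta> \<and> \<beta> \<le> e \<and> small E \<beta> \<and> 0 < \<tau> \<and> \<tau> \<le> T \<and> controlled E A1 \<beta> \<tau> u \<theta>"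
proof -
  note sm = smallD[OF u0 \<theta>0 E]
  have E0: "0 \<le> E" using A_nonneg[OF u0 \<theta>0 E] by simp
  define \<beta> where "\<beta> = min e \<alpha>"
  have b: "0 < \<beta>" "\<beta> \<le> e" "\<beta> \<le> \<alpha>" using e \<alpha>(1) by (auto simp: \<beta>_def)
  have "\<beta> * (E + 1) \<le> \<alpha> * (E + 1)" using b(3) E0 by (intro mult_right_mono) auto
  then have s: "small E \<beta>" using \<alpha>(2) b(1) unfolding small_def[OF u0 \<theta>0 E] by simp
  obtain \<tau> where \<tau>: "0 < \<tau>" "lin_small u0 \<theta>0 \<beta> \<tau>" using lin_small_exists[OF u0 \<theta>0 b(1)] by blast
  have "controlled E A1 \<beta> (min \<tau> T) u \<theta>"
    by (rule good[OF _ s lin_small_subset[OF \<tau>(2)]]) auto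
  then show ?thesis using b s \<tau>(1) T by (intro exI[of _ \<beta>] exI[of _ "min \<tau> T"]) auto
qed

lemma controlled_T: "controlled E A1 \<alpha> T u \<theta>"
  by (rule good[OF order_refl \<alpha>(2,3)])

lemma solution_AE:
  assumes "t \<in> {0<..T}"
  shows "AE x in lborel. u t x = step_u u0 u \<theta> t x" "AE x in lborel. \<theta> t x = step_\<theta> \<theta>0 u \<theta> t x"
  using fx assms unfolding fixed_on_def by blast+

lemma solution_measurable:
  assumes "t \<in> {0..T}"
  shows "u t \<in> borel_measurable borel" "\<theta> t \<in> borel_measurable borel"
proof -
  note c = controlledD(1)[OF controlled_T]
  show "u t \<in> borel_measurable borel"
  proof (cases "t = 0")
    case True
    then show ?thesis using Lp_boundD(1)[OF u0] init by simp
  next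
    case False
    then have "t \<in> {0<..T}" using assms by simp
    then show ?thesis by (rule Lp_boundD(1)[OF crit_boundD(5)[OF c]])
  qed
  show "\<theta> t \<in> borel_measurable borel"
  proof (cases "t = 0")
    case True
    then show ?thesis using Lp_boundD(1)[OF \<theta>0] init by simp
  next
    case False
    then have "t \<in> {0<..T}" using assms by simp
    then show ?thesis by (rule Lp_boundD(1)[OF crit_boundD(6)[OF c]])
  qed
qed

text \<open>Buoyancy contributes \<open>2048 * \<beta>\<close>, and the quadratic convection term
  less than \<open>28 * \<beta>\<close> by smallness.\<close>

lemma velocity_forcing_bound:
  assumes c: "controlled E A1 \<beta> \<tau> u \<theta>" and s: "small E \<beta>" and t: "t \<in> {0<..\<tau>}"
  shows "Lp_bound 3 (\<lambda>x. buoyancy \<theta> t x - convection u t x) (3000 * \<beta>)"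
proof -
  note cb = controlledD(1)[OF c]
  have 1: "Lp_bound 3 (\<lambda>x. buoyancy \<theta> t x - convection u t x) (1024 * (2 * \<beta>) + 3072 * (30000 * \<beta> * (30000 * \<beta>)))"
    by (rule Lp_bound_diff[OF buoyancy_terms(3)[OF cb t] convection_bound(2)[OF cb t]]) simp
  show ?thesis by (rule Lp_bound_mono[OF 1]) (use smallD(1,5)[OF u0 \<theta>0 E s] in auto)
qed

lemma temperature_forcing_bound:
  assumes c: "controlled E A1 \<beta> \<tau> u \<theta>" and s: "small E \<beta>" and t: "t \<in> {0<..\<tau>}"
  shows "Lp_bound 1 (transport \<theta> u t) (3072 * (6000000 * (E + 1) * \<beta> * (2 * A1)))"
proof -
  have nn: "0 \<le> 6000000 * (E + 1) * \<beta>" "0 \<le> 2 * A1"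
    using A_nonneg[OF u0 \<theta>0 E] smallD(1)[OF u0 \<theta>0 E s] by auto
  show ?thesis
    by (rule transport_L1(1)[OF controlledD(1)[OF c] controlledD(4)[OF c] nn(2) controlledD(2)[OF c] nn(1) t])
qed

text \<open>The solution is the heat flow of the data plus a forcing that tends to zero in L^3,
  which gives continuity up to time zero. The weighted sup norm is at most a fixed multiple of every
  admissible \<beta> for short times, hence vanishes in the limit.\<close>

lemma solution_X:
  assumes div: "div_free u0"
  shows "u \<in> X_space T"
  unfolding X_space_iff[OF T] crit_space_def
proof (intro conjI ballI allI impI)
  note c = controlled_T
  note cb = controlledD(1)[OF c]
  have A0: "0 \<le> A3" "1 \<le> E" using A_nonneg[OF u0 \<theta>0 E] by auto
  show "div_free (u t)" if t: "t \<in> {0..T}" for t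
  proof (cases "t = 0")
    case True
    then show ?thesis using div init by simp
  next
    case False
    then have t': "t \<in> {0<..T}" "0 < t" using t by auto
    note k = kernel_bound_heat_kernel[OF t'(2)]
    have 1: "Lp_bound 3 (conv (G t) u0) (1 * A3)" by (rule Lp_bound_conv_same[OF k u0]) simp
    have d1: "div_free (conv (G t) u0)" by (rule div_free_conv[OF k u0 _ div]) simp
    note b2 = convection_bound(2)[OF cb t'(1)] and b3 = buoyancy_terms(3)[OF cb t'(1)]
    have 2: "Lp_bound 3 (\<lambda>x. conv (G t) u0 x - convection u t x) (1 * A3 + 3072 * (30000 * \<alpha> * (30000 * \<alpha>)))"
      by (rule Lp_bound_diff[OF 1 b2]) simp
    have d2: "div_free (\<lambda>x. conv (G t) u0 x - convection u t x)"
      by (rule div_free_diff[OF d1 convection_div_free[OF cb t'(1)] 1 b2]) simp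
    have 3: "Lp_bound 3 (\<lambda>x. conv (G t) u0 x - convection u t x + buoyancy \<theta> t x) (1 * A3 + 3072 * (30000 * \<alpha> * (30000 * \<alpha>)) + 1024 * (2 * \<alpha>))"
      by (rule Lp_bound_add[OF 2 b3]) simp
    have d3: "div_free (\<lambda>x. conv (G t) u0 x - convection u t x + buoyancy \<theta> t x)"
      by (rule div_free_add[OF d2 buoyancy_div_free[OF cb t'(1)] 2 b3]) simp
    show ?thesis
      by (rule div_free_cong_AE[OF d3]) (use Lp_boundD(1)[OF 3] solution_measurable(1)[OF t] solution_AE(1)[OF t'(1)] in \<open>simp_all add: step_u_def\<close>)
  qed
  have w: "Lp_cont 3 {0..T} (\<lambda>t x. if t = 0 then 0 else buoyancy \<theta> t x - convection u t x)"
  proof (rule Lp_cont_extend_zero)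
    show "Lp_cont 3 {0<..T} (\<lambda>t x. buoyancy \<theta> t x - convection u t x)"
      by (rule Lp_cont_diff[OF buoyancy_cont(2)[OF cb] convection_cont(2)[OF cb]]) simp
    fix e :: real assume e: "0 < e"
    then have "0 < e / 3000" by simp
    from controlled_arbitrarily_small[OF this] obtain \<beta> \<tau> where b: "\<beta> \<le> e / 3000" "small E \<beta>" "0 < \<tau>" "controlled E A1 \<beta> \<tau> u \<theta>"
      by blast
    have "Lp_bound 3 (\<lambda>x. buoyancy \<theta> t x - convection u t x) e" if "t \<in> {0<..\<tau>}" for t
      by (rule Lp_bound_mono[OF velocity_forcing_bound[OF b(4,2) that]]) (use b(1) in auto)
    then show "\<exists>d>0. \<forall>t\<in>{0<..T}. t < d \<longrightarrow> Lp_bound 3 (\<lambda>x. buoyancy \<theta> t x - convection u t x) e"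
      using b(3) by (intro exI[of _ \<tau>]) auto
  qed
  have h: "Lp_cont 3 {0..T} (\<lambda>t. heat t u0)"
    by (rule Lp_cont_subset[OF heat_Lp_cont[OF u0]]) auto
  have eq: "AE x in lborel. u t x = heat t u0 x + (if t = 0 then 0 else buoyancy \<theta> t x - convection u t x)" if t: "t \<in> {0..T}" for t
  proof (cases "t = 0")
    case True
    then show ?thesis by (simp add: init heat_def)
  next
    case False
    then have t': "t \<in> {0<..T}" "0 < t" using t by auto
    show ?thesis using solution_AE(1)[OF t'(1)]
      by eventually_elim (use t' in \<open>simp add: step_u_def heat_pos\<close>)
  qed
  show "Lp_cont 3 {0..T} u"
    by (rule Lp_cont_cong_AE[OF Lp_cont_add[OF h w] _ solution_measurable(1) eq]) auto
  have "Lp_bound 3 (u t) (A3 + 3000 * \<alpha>)" if t: "t \<in> {0..T}" for t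
  proof (cases "t = 0")
    case True
    have "A3 \<le> A3 + 3000 * \<alpha>" using \<alpha>(1) by simp
    from Lp_bound_mono[OF u0 this] show ?thesis using True by (simp add: init)
  next
    case False
    then have t': "t \<in> {0<..T}" "0 < t" using t by auto
    have 1: "Lp_bound 3 (conv (G t) u0) (1 * A3)"
      by (rule Lp_bound_conv_same[OF kernel_bound_heat_kernel[OF t'(2)] u0]) simp
    have 2: "Lp_bound 3 (\<lambda>x. conv (G t) u0 x + (buoyancy \<theta> t x - convection u t x)) (1 * A3 + 3000 * \<alpha>)"
      by (rule Lp_bound_add[OF 1 velocity_forcing_bound[OF c \<alpha>(2) t'(1)]]) simp
    have 3: "AE x in lborel. u t x = conv (G t) u0 x + (buoyancy \<theta> t x - convection u t x)"
      using eq[OF t] t'(2) by (simp add: heat_pos)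
    show ?thesis using Lp_bound_cong_AE[OF 2 solution_measurable(1)[OF t] 3] by simp
  qed
  then show "\<exists>A. \<forall>t\<in>{0..T}. Lp_bound 3 (u t) A" by blast
  show "\<exists>B\<ge>0. \<forall>t\<in>{0<..T}. AE x in lborel. norm (u t x) \<le> B * t powr (- (1/2))"
    by (rule exI[of _ "6000000 * (E + 1) * \<alpha>"]) (use controlledD(2)[OF c] A0 \<alpha>(1) in auto)
  fix e :: real assume e: "0 < e"
  define C where "C = 6000000 * (E + 1)"
  have C: "0 < C" using A0 by (simp add: C_def)
  have "0 < e / C" using C e by simp
  from controlled_arbitrarily_small[OF this] obtain \<beta> \<tau> where b: "\<beta> \<le> e / C" "0 < \<tau>" "controlled E A1 \<beta> \<tau> u \<theta>"
    by blast
  have Cb: "C * \<beta> \<le> e" using b(1) C by (simp add: field_simps)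
  have "AE x in lborel. norm (u t x) \<le> e * t powr (- (1/2))" if "t \<in> {0<..\<tau>}" for t
  proof -
    have "C * \<beta> * t powr (- (1/2)) \<le> e * t powr (- (1/2))" by (rule mult_right_mono[OF Cb]) simp
    moreover have "AE x in lborel. norm (u t x) \<le> C * \<beta> * t powr (- (1/2))"
      unfolding C_def by (rule controlledD(2)[OF b(3) that])
    ultimately show ?thesis by (auto elim: eventually_mono)
  qed
  then show "\<exists>d>0. \<forall>t\<in>{0<..T}. t < d \<longrightarrow> (AE x in lborel. norm (u t x) \<le> e * t powr (- (1/2)))"
    using b(2) by (intro exI[of _ \<tau>]) auto
qed

text \<open>As for the velocity, with the transport term as forcing. Its L^1 bound contains the
  fixed \<open>A1\<close> but also the factor \<beta>, hence it tends to zero with the time.\<close>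

lemma solution_Y: "\<theta> \<in> Y_space T"
  unfolding Y_space_iff[OF T] crit_space_def
proof (intro conjI ballI allI impI)
  note c = controlled_T
  note cb = controlledD(1)[OF c]
  have A0: "0 \<le> A1" "1 \<le> E" using A_nonneg[OF u0 \<theta>0 E] by auto
  have nn: "0 \<le> 6000000 * (E + 1) * \<alpha>" "0 \<le> 2 * A1" using A0 \<alpha>(1) by auto
  have w: "Lp_cont 1 {0..T} (\<lambda>t x. if t = 0 then 0 else transport \<theta> u t x)"
  proof (rule Lp_cont_extend_zero)
    show "Lp_cont 1 {0<..T} (transport \<theta> u)"
      by (rule transport_L1(2)[OF cb controlledD(4)[OF c] nn(2) controlledD(2)[OF c] nn(1)])
    fix e :: real assume e: "0 < e"
    define C where "C = 3072 * 6000000 * (E + 1) * 2 * A1"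
    have C: "0 \<le> C" using A0 by (simp add: C_def)
    have "0 < e / (C + 1)" using C e by simp
    from controlled_arbitrarily_small[OF this] obtain \<beta> \<tau> where b: "0 < \<beta>" "\<beta> \<le> e / (C + 1)" "small E \<beta>" "0 < \<tau>" "controlled E A1 \<beta> \<tau> u \<theta>"
      by blast
    have "C * \<beta> \<le> (C + 1) * \<beta>" using b(1) by simp
    also have "\<dots> \<le> e" using b(2) C by (simp add: field_simps)
    finally have le: "3072 * (6000000 * (E + 1) * \<beta> * (2 * A1)) \<le> e" by (simp add: C_def mult_ac)
    have "Lp_bound 1 (transport \<theta> u t) e" if "t \<in> {0<..\<tau>}" for t
      by (rule Lp_bound_mono[OF temperature_forcing_bound[OF b(5,3) that] le]) simp
    then show "\<exists>d>0. \<forall>t\<in>{0<..T}. t < d \<longrightarrow> Lp_bound 1 (transport \<theta> u t) e"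
      using b(4) by (intro exI[of _ \<tau>]) auto
  qed
  have h: "Lp_cont 1 {0..T} (\<lambda>t. heat t \<theta>0)"
    by (rule Lp_cont_subset[OF heat_Lp_cont[OF \<theta>0]]) auto
  have eq: "AE x in lborel. \<theta> t x = heat t \<theta>0 x - (if t = 0 then 0 else transport \<theta> u t x)" if t: "t \<in> {0..T}" for t
  proof (cases "t = 0")
    case True
    then show ?thesis by (simp add: init heat_def)
  next
    case False
    then have t': "t \<in> {0<..T}" "0 < t" using t by auto
    show ?thesis using solution_AE(2)[OF t'(1)]
      by eventually_elim (use t' in \<open>simp add: step_\<theta>_def heat_pos\<close>)
  qed
  show "Lp_cont 1 {0..T} \<theta>"
    by (rule Lp_cont_cong_AE[OF Lp_cont_diff[OF h w] _ solution_measurable(2) eq]) auto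
  have "Lp_bound 1 (\<theta> t) (2 * A1)" if t: "t \<in> {0..T}" for t
  proof (cases "t = 0")
    case True
    have "A1 \<le> 2 * A1" using A0 by simp
    from Lp_bound_mono[OF \<theta>0 this] show ?thesis using True by (simp add: init)
  next
    case False
    then show ?thesis using controlledD(4)[OF c] t by simp
  qed
  then show "\<exists>A. \<forall>t\<in>{0..T}. Lp_bound 1 (\<theta> t) A" by blast
  show "\<exists>B\<ge>0. \<forall>t\<in>{0<..T}. AE x in lborel. norm (\<theta> t x) \<le> B * t powr (- (3/2))"
    by (rule exI[of _ "2 * \<alpha>"]) (use controlledD(3)[OF c] \<alpha>(1) in auto)
  fix e :: real assume e: "0 < e"
  have "0 < e / 2" using e by simp
  from controlled_arbitrarily_small[OF this] obtain \<beta> \<tau> where b: "\<beta> \<le> e / 2" "0 < \<tau>" "controlled E A1 \<beta> \<tau> u \<theta>"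
    by blast
  have "AE x in lborel. norm (\<theta> t x) \<le> e * t powr (- (3/2))" if "t \<in> {0<..\<tau>}" for t
  proof -
    have "2 * \<beta> * t powr (- (3/2)) \<le> e * t powr (- (3/2))" by (rule mult_right_mono) (use b(1) in simp_all)
    with controlledD(3)[OF b(3) that] show ?thesis by (auto elim: eventually_mono)
  qed
  then show "\<exists>d>0. \<forall>t\<in>{0<..T}. t < d \<longrightarrow> (AE x in lborel. norm (\<theta> t x) \<le> e * t powr (- (3/2)))"
    using b(2) by (intro exI[of _ \<tau>]) auto
qed

end

theorem proposition1p1:
  fixes u0 :: "real^3 \<Rightarrow> real^3" and \<theta>0 :: "real^3 \<Rightarrow> real"
  assumes "u0 \<in> Lp_space 3" and "div_free u0" and "\<theta>0 \<in> Lp_space 1"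
  shows "\<exists>T>0. \<exists>u \<theta>.
    u \<in> X_space T \<and> \<theta> \<in> Y_space T \<and> mild_solution T u0 \<theta>0 u \<theta> \<and>
    (\<forall>v \<eta>. v \<in> X_space T \<and> \<eta> \<in> Y_space T \<and> mild_solution T u0 \<theta>0 v \<eta> \<longrightarrow>
      (\<forall>t\<in>{0..T}. (AE x in lborel. v t x = u t x) \<and> (AE x in lborel. \<eta> t x = \<theta> t x)))"
proof -
  obtain A3 where u0: "Lp_bound 3 u0 A3" using assms(1) Lp_space_iff[of 3 u0] by auto
  obtain A1 where \<theta>0: "Lp_bound 1 \<theta>0 A1" using assms(3) Lp_space_iff[of 1 \<theta>0] by auto
  define E where "E = 64 * A3 + 1"
  note ctx = u0 \<theta>0 E_def
  have E0: "1 \<le> E" using A_nonneg[OF ctx] by simp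
  \<comment> \<open>The largest value that \<open>small\<close> permits; the existence time is then
    chosen solely so that the linear part is below it.\<close>
  define \<alpha> where "\<alpha> = 1/100000000000 / (E + 1)"
  have \<alpha>: "0 < \<alpha>" "small E \<alpha>" using E0 by (simp_all add: \<alpha>_def small_def[OF ctx])
  obtain T where T: "0 < T" "lin_small u0 \<theta>0 \<alpha> T" using lin_small_exists[OF u0 \<theta>0 \<alpha>(1)] by blast
  obtain u \<theta> where sol: "fixed_on u0 \<theta>0 T u \<theta>" "u 0 = u0" "\<theta> 0 = \<theta>0"
    and good': "\<forall>\<beta> \<tau>. \<tau> \<le> T \<longrightarrow> small E \<beta> \<longrightarrow> lin_small u0 \<theta>0 \<beta> \<tau> \<longrightarrow> controlled E A1 \<beta> \<tau> u \<theta>"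
    using fixed_point_exists[OF ctx T(2) \<alpha>(2)] by (elim exE conjE) (rule that)
  note good = good'[rule_format]
  have u: "u \<in> X_space T" by (rule solution_X[OF ctx T(1) \<alpha> T(2) sol good assms(2)])
  have \<theta>: "\<theta> \<in> Y_space T" by (rule solution_Y[OF ctx T(1) \<alpha> T(2) sol good])
  have cb: "crit_bound T (30000 * \<alpha>) (2 * \<alpha>) u \<theta>"
    by (rule controlledD(1)[OF good[OF order_refl \<alpha>(2) T(2)]])
  have mild: "mild_solution T u0 \<theta>0 u \<theta>"
    unfolding mild_solution_iff_fixed_on[OF cb T(1)] using assms(2) sol by simp
  show ?thesis
    using T(1) u \<theta> mild mild_solution_unique[OF T(1) u \<theta> mild] by blast
qed

end
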